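(* Let $d\geq 1$ and $\gamma\geq 1/2$. There is a constant $D_{\gamma,d}>0$, depending only on $\gamma$ and $d$, such that for every complex-valued $V\in L^{\gamma+d/2}(\mathbb{R}^d)$ and every eigenvalue $E\in\mathbb{C}\setminus[0,\infty)$ of $-\Delta+V$ in $L^2(\mathbb{R}^d)$, $$ \delta(E)^{\gamma-1/2}\,|E|^{1/2} \leq D_{\gamma,d}\int_{\mathbb{R}^d}|V|^{\gamma+d/2}\,dx . $$
   Context: For $z\in\mathbb{C}$, $\delta(z):=\operatorname{dist}(z,[0,\infty))$. For a complex-valued potential $V\in L^{\gamma+d/2}(\mathbb{R}^d)$, the operator $-\Delta+V$ is the $m$-sectorial operator in $L^2(\mathbb{R}^d)$ associated with the closed sectorial quadratic form $u\mapsto\int|\nabla u|^2\,dx+\int V|u|^2\,dx$ on $H^1(\mathbb{R}^d)$. Its spectrum in $\mathbb{C}\setminus[0,\infty)$ consists of isolated eigenvalues of finite algebraic multiplicity. *)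

theory Defs
  imports "HOL-Analysis.Analysis"
begin

definition partial_ax :: "'n::finite \<Rightarrow> (real^'n \<Rightarrow> real) \<Rightarrow> real^'n \<Rightarrow> real" where
  "partial_ax j f x = deriv (\<lambda>t. f (x + t *\<^sub>R axis j 1)) 0"

definition smooth_fun :: "(real^'n::finite \<Rightarrow> real) \<Rightarrow> bool" where
  "smooth_fun f \<longleftrightarrow>
     (\<forall>js::'n list. continuous_on UNIV (foldr partial_ax js f) \<and>
        (\<forall>j x. (\<lambda>t. foldr partial_ax js f (x + t *\<^sub>R axis j 1)) differentiable (at 0)))"

definition test_fun :: "(real^'n::finite \<Rightarrow> real) \<Rightarrow> bool" where
  "test_fun \<phi> \<longleftrightarrow> smooth_fun \<phi> \<and> compact (closure {x. \<phi> x \<noteq> 0})"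

definition Lp :: "real \<Rightarrow> (real^'n::finite \<Rightarrow> complex) \<Rightarrow> bool" where
  "Lp p f \<longleftrightarrow> f \<in> borel_measurable lborel \<and> integrable lborel (\<lambda>x. norm (f x) powr p)"

definition weak_partial :: "(real^'n::finite \<Rightarrow> complex) \<Rightarrow> 'n \<Rightarrow> (real^'n \<Rightarrow> complex) \<Rightarrow> bool" where
  "weak_partial u j g \<longleftrightarrow>
     (\<forall>\<phi>. test_fun \<phi> \<longrightarrow>
        (\<integral>x. u x * complex_of_real (partial_ax j \<phi> x) \<partial>lborel)
          = - (\<integral>x. g x * complex_of_real (\<phi> x) \<partial>lborel))"

definition H1_grad :: "(real^'n::finite \<Rightarrow> complex) \<Rightarrow> ('n \<Rightarrow> real^'n \<Rightarrow> complex) \<Rightarrow> bool" where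
  "H1_grad u G \<longleftrightarrow> Lp 2 u \<and> (\<forall>j. weak_partial u j (G j) \<and> Lp 2 (G j))"

text \<open>E is an eigenvalue of the m-sectorial operator -Laplacian + V associated with the
  form a[u,v] = int grad u . conj(grad v) + int V u conj(v) on H^1: there is u \<noteq> 0 in H^1
  with a[u,v] = E <u,v> for all v in H^1.\<close>
definition is_eigenvalue :: "(real^'n::finite \<Rightarrow> complex) \<Rightarrow> complex \<Rightarrow> bool" where
  "is_eigenvalue V E \<longleftrightarrow>
     (\<exists>u G. H1_grad u G \<and> \<not> (AE x in lborel. u x = 0) \<and>
        (\<forall>v H. H1_grad v H \<longrightarrow>
           (\<Sum>j\<in>UNIV. \<integral>x. G j x * cnj (H j x) \<partial>lborel)
             + (\<integral>x. V x * u x * cnj (v x) \<partial>lborel)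
           = E * (\<integral>x. u x * cnj (v x) \<partial>lborel)))"

definition delta :: "complex \<Rightarrow> real" where
  "delta z = infdist z (complex_of_real ` {0..})"

end

theory Submission
  imports Defs "HOL-Probability.Probability" "HOL-Complex_Analysis.Complex_Analysis"
begin

text \<open>
  Write \<open>E = - k\<^sup>2\<close> with \<open>Re k > 0\<close>. By the Birman--Schwinger principle an eigenvalue \<open>E\<close> forces the operator
  \<open>\<bar>V\<bar>\<^sup>1\<^sup>/\<^sup>2 (-\<Delta> - E)\<^sup>-\<^sup>1 \<bar>V\<bar>\<^sup>1\<^sup>/\<^sup>2\<close> to have norm at least 1, so it suffices to bound this norm by a constant times
  \<open>(\<delta>(E) powr (1/2 - \<gamma>) \<bar>E\<bar> powr (-1/2) \<integral> \<bar>V\<bar> powr r) powr (1/r)\<close> with \<open>r = \<gamma> + d/2\<close>. The bound comes from Stein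
  interpolation in \<open>\<zeta>\<close> of the powers \<open>(k + \<bar>\<xi>\<bar>\<^sup>2 / k) powr (-\<zeta>)\<close>, which are averages of heat
  kernels at the complex times \<open>s / k\<close>: for small \<open>Re \<zeta>\<close> the multiplier is bounded by the distance of \<open>E\<close> to the half line, and
  for \<open>Re \<zeta> = (d + 1) / 2\<close> the kernel is a bounded function by an oscillatory integral estimate. All operators are
  replaced by bilinear forms on simple functions; the same estimate at \<open>E = -1\<close> shows that the potential energy
  is finite on \<open>H\<^sup>1\<close>.
\<close>

text \<open>The obstacle is uniformity as E approaches the half line, that is, as k approaches the
  imaginary axis. On the line Re \<zeta> = (d + 1)/2, bounding the kernel by the modulus of its
  integrand would cost (Re k)^(-1/2). The cancellation in the phase s + |w|^2/(4 s) yields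
  |k|^(-1/2) instead, so that \<open>delta E\<close> enters through the other line alone. Dividing
  the symbol |\<xi>|^2 - E by k moves it into the half-plane Re \<ge> Re k, where one principal
  branch serves all complex powers. The left line Re \<zeta> = s is not free: \<zeta> = 1 at \<eta>
  = 1/r forces s = (\<gamma> - 1/2)/(r - 1) for r > 1. This yields the power 1/2 - \<gamma> of
  \<open>delta E\<close>, and \<gamma> \<ge> 1/2 says that s is nonnegative. Losses such as exp(pi
  |Im \<zeta>|) are harmless, because exp(\<eta>^2) decays faster along vertical lines. A second
  difficulty: V u v need not be integrable a priori, and the Bochner integral of a nonintegrable
  function is 0. The eigenvalue equation therefore says something about V only once the potential
  energy is known to be finite.\<close>

section \<open>Holomorphic parameter integrals and a maximum principle on a strip\<close>

text \<open>Only \<open>F\<close> is dominated, not its derivative: Cauchy's inequality on discs of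
  radius \<open>e/2\<close> turns the local bound \<open>B\<close> into the bound
  \<open>2 B / e\<close> for the derivative, hence for the difference quotients, and dominated
  convergence differentiates under the integral sign.\<close>

lemma holomorphic_on_integral:
  fixes F :: "complex \<Rightarrow> 'a \<Rightarrow> complex"
  assumes S: "open S"
    and hol: "\<And>x. x \<in> space M \<Longrightarrow> (\<lambda>z. F z x) holomorphic_on S"
    and meas: "\<And>z. z \<in> S \<Longrightarrow> F z \<in> borel_measurable M"
    and bnd: "\<And>z. z \<in> S \<Longrightarrow> \<exists>e>0. \<exists>B. integrable M B \<and> cball z e \<subseteq> S \<and>
       (\<forall>w\<in>cball z e. \<forall>x\<in>space M. norm (F w x) \<le> B x)"
  shows "(\<lambda>z. \<integral>x. F z x \<partial>M) holomorphic_on S"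
  unfolding holomorphic_on_open[OF S]
proof (intro ballI)
  fix z assume z: "z \<in> S"
  obtain e B where e: "e > 0" and B: "integrable M B" and sub: "cball z e \<subseteq> S"
    and le: "\<And>w x. w \<in> cball z e \<Longrightarrow> x \<in> space M \<Longrightarrow> norm (F w x) \<le> B x"
    using bnd[OF z] by blast
  have Bnn: "0 \<le> B x" if "x \<in> space M" for x
    using le[of z x] that e by (meson centre_in_cball less_imp_le norm_ge_zero order_trans)
  have int: "integrable M (F w)" if "w \<in> cball z e" for w
    using that sub le by (intro Bochner_Integration.integrable_bound[OF B meas]) (auto intro!: AE_I2 simp: order_trans[OF le abs_ge_self])
  have der: "norm (deriv (\<lambda>z. F z x) w) \<le> B x / (e/2)" if "w \<in> ball z (e/2)" "x \<in> space M" for w x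
  proof -
    have sub': "cball w (e/2) \<subseteq> cball z e"
    proof
      fix y assume "y \<in> cball w (e/2)"
      then show "y \<in> cball z e" using that(1) dist_triangle[of z y w]
        by (simp add: dist_commute)
    qed
    have h: "(\<lambda>z. F z x) holomorphic_on cball w (e/2)"
      by (rule holomorphic_on_subset[OF hol]) (use that sub sub' in auto)
    \<comment> \<open>The point \<open>w\<close> lies within \<open>e/2\<close> of \<open>z\<close>,
      so the disc of radius \<open>e/2\<close> about \<open>w\<close> stays inside
      \<open>cball z e\<close>, where \<open>B\<close> dominates.\<close>
    have "norm ((deriv ^^ 1) (\<lambda>z. F z x) w) \<le> fact 1 * B x / (e/2)^1"
    proof (rule Cauchy_inequality)
      show "(\<lambda>z. F z x) holomorphic_on ball w (e/2)"
        using h by (rule holomorphic_on_subset) auto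
      show "continuous_on (cball w (e/2)) (\<lambda>z. F z x)"
        using h by (rule holomorphic_on_imp_continuous_on)
      show "norm (F y x) \<le> B x" if "norm (w - y) = e/2" for y
        using sub' that by (intro le \<open>x \<in> space M\<close>) (auto simp: dist_norm)
    qed (use e in auto)
    then show ?thesis by simp
  qed
  have quot: "norm ((F w x - F z x) / (w - z)) \<le> B x / (e/2)" if "w \<in> ball z (e/2)" "w \<noteq> z" "x \<in> space M" for w x
  proof -
    have "norm (F w x - F z x) \<le> B x / (e/2) * norm (w - z)"
    proof (rule field_differentiable_bound[of "ball z (e/2)"])
      fix y assume y: "y \<in> ball z (e/2)"
      then have "y \<in> S" using sub e by auto
      then show "((\<lambda>z. F z x) has_field_derivative deriv (\<lambda>z. F z x) y) (at y within ball z (e/2))"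
        using holomorphic_derivI[OF hol[OF that(3)] S] has_field_derivative_at_within by blast
      show "norm (deriv (\<lambda>z. F z x) y) \<le> B x / (e/2)" using der y that by blast
    qed (use that e in auto)
    then show ?thesis using that by (simp add: norm_divide field_simps)
  qed
  have lim: "((\<lambda>y. ((\<integral>x. F y x \<partial>M) - (\<integral>x. F z x \<partial>M)) / (y - z)) \<longlongrightarrow>
      (\<integral>x. deriv (\<lambda>z. F z x) z \<partial>M)) (at z)"
    unfolding tendsto_at_iff_sequentially comp_def
  proof (intro allI impI)
    fix X assume X: "\<forall>i. X i \<in> UNIV - {z}" "X \<longlonglongrightarrow> z"
    have "\<forall>\<^sub>F n in sequentially. X n \<in> ball z (e/2)"
      using X(2) e by (intro topological_tendstoD) auto
    then obtain N where N: "\<And>n. n \<ge> N \<Longrightarrow> X n \<in> ball z (e/2)"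
      unfolding eventually_sequentially by blast
    define Y where "Y n = X (n + N)" for n
    have Y: "Y n \<in> ball z (e/2)" "Y n \<noteq> z" for n using N X(1) by (auto simp: Y_def)
    then have YC: "Y n \<in> cball z e" for n using e by (smt (verit, best) mem_ball mem_cball field_sum_of_halves)
    have Ylim: "Y \<longlonglongrightarrow> z" unfolding Y_def using X(2) LIMSEQ_ignore_initial_segment by blast
    have [measurable]: "F (Y n) \<in> borel_measurable M" "F z \<in> borel_measurable M" for n
      using YC[of n] sub z by (auto intro: meas)
    have ptw: "(\<lambda>n. (F (Y n) x - F z x) / (Y n - z)) \<longlonglongrightarrow> deriv (\<lambda>z. F z x) z" if "x \<in> space M" for x
    proof -
      have "((\<lambda>z. F z x) has_field_derivative deriv (\<lambda>z. F z x) z) (at z)"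
        using holomorphic_derivI[OF hol[OF that] S z] .
      then show ?thesis
        unfolding has_field_derivative_iff tendsto_at_iff_sequentially comp_def
        using Y Ylim by auto
    qed
    have meas': "(\<lambda>x. deriv (\<lambda>z. F z x) z) \<in> borel_measurable M"
      by (rule borel_measurable_LIMSEQ_metric[OF _ ptw]) measurable
    have "(\<lambda>n. \<integral>x. (F (Y n) x - F z x) / (Y n - z) \<partial>M) \<longlonglongrightarrow> (\<integral>x. deriv (\<lambda>z. F z x) z \<partial>M)"
    proof (rule integral_dominated_convergence[where w="\<lambda>x. B x / (e/2)"])
      show "integrable M (\<lambda>x. B x / (e/2))" using B by simp
      show "AE x in M. (\<lambda>n. (F (Y n) x - F z x) / (Y n - z)) \<longlonglongrightarrow> deriv (\<lambda>z. F z x) z"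
        using ptw by auto
      show "AE x in M. norm ((F (Y n) x - F z x) / (Y n - z)) \<le> B x / (e/2)" for n
        using quot Y by auto
    qed (use meas' in auto)
    moreover have "(\<integral>x. (F (Y n) x - F z x) / (Y n - z) \<partial>M) = ((\<integral>x. F (Y n) x \<partial>M) - (\<integral>x. F z x \<partial>M)) / (Y n - z)" for n
      using int[OF YC] int[of z] e by simp
    ultimately have "(\<lambda>n. ((\<integral>x. F (Y n) x \<partial>M) - (\<integral>x. F z x \<partial>M)) / (Y n - z)) \<longlonglongrightarrow> (\<integral>x. deriv (\<lambda>z. F z x) z \<partial>M)"
      by (simp only:)
    then show "(\<lambda>n. ((\<integral>x. F (X n) x \<partial>M) - (\<integral>x. F z x \<partial>M)) / (X n - z)) \<longlonglongrightarrow> (\<integral>x. deriv (\<lambda>z. F z x) z \<partial>M)"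
      unfolding Y_def by (rule LIMSEQ_offset)
  qed
  show "\<exists>f'. ((\<lambda>z. \<integral>x. F z x \<partial>M) has_field_derivative f') (at z)"
    using lim has_field_derivative_iff[of "\<lambda>z. \<integral>x. F z x \<partial>M" _ z UNIV] by blast
qed

text \<open>A three lines theorem with one bound for both edges; normalising powers will make the
  two edge bounds equal. The decay makes the horizontal sides of a tall rectangle harmless, and
  \<open>A\<close> disappears from the conclusion, so that it may depend on any data.\<close>

lemma strip_maximum_principle:
  fixes F :: "complex \<Rightarrow> complex"
  assumes hol: "F holomorphic_on {z. 0 < Re z \<and> Re z < 1}"
    and cont: "continuous_on {z. 0 \<le> Re z \<and> Re z \<le> 1} F"
    and decay: "\<And>z. 0 \<le> Re z \<Longrightarrow> Re z \<le> 1 \<Longrightarrow> norm (F z) \<le> A * exp (- \<bar>Im z\<bar>)"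
    and left: "\<And>z. Re z = 0 \<Longrightarrow> norm (F z) \<le> B"
    and right: "\<And>z. Re z = 1 \<Longrightarrow> norm (F z) \<le> B"
    and z: "0 \<le> Re z" "Re z \<le> 1"
  shows "norm (F z) \<le> B"
proof (rule field_le_epsilon)
  fix e :: real assume e: "e > 0"
  have B0: "B \<ge> 0" using order_trans[OF norm_ge_zero left[of 0]] by simp
  have "((\<lambda>R. A * exp (- R)) \<longlongrightarrow> A * 0) at_top"
    by (intro tendsto_intros filterlim_compose[OF exp_at_bot] filterlim_uminus_at_bot_at_top)
  then have "\<forall>\<^sub>F R in at_top. A * exp (- R) < e"
    using e by (auto intro: order_tendstoD)
  then obtain R0 where R0: "\<And>R. R \<ge> R0 \<Longrightarrow> A * exp (- R) < e"
    unfolding eventually_at_top_linorder by blast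
  \<comment> \<open>Large enough for the horizontal sides to contribute less than \<open>e\<close>
    and for the rectangle to contain \<open>z\<close>.\<close>
  define R where "R = max (max R0 1) (\<bar>Im z\<bar>)"
  let ?S = "cbox (Complex 0 (-R)) (Complex 1 R)"
  have R: "R \<ge> R0" "R \<ge> 1" "\<bar>Im z\<bar> \<le> R" by (auto simp: R_def)
  have mem: "w \<in> ?S \<longleftrightarrow> 0 \<le> Re w \<and> Re w \<le> 1 \<and> \<bar>Im w\<bar> \<le> R" for w
    by (auto simp: in_cbox_complex_iff)
  have box: "w \<in> box (Complex 0 (-R)) (Complex 1 R) \<longleftrightarrow> 0 < Re w \<and> Re w < 1 \<and> \<bar>Im w\<bar> < R" for w
    by (auto simp: in_box_complex_iff)
  show "norm (F z) \<le> B + e"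
  proof (rule maximum_modulus_frontier[of F ?S])
    show "F holomorphic_on interior ?S"
      by (rule holomorphic_on_subset[OF hol]) (auto simp: box)
    show "continuous_on (closure ?S) F"
      by (rule continuous_on_subset[OF cont]) (auto simp: mem)
    show "bounded ?S" by simp
    show "z \<in> ?S" using z R by (simp add: mem)
    fix w assume "w \<in> frontier ?S"
    then have w: "w \<in> ?S" "w \<notin> box (Complex 0 (-R)) (Complex 1 R)"
      by (auto simp: frontier_def)
    then consider "Re w = 0" | "Re w = 1" | "\<bar>Im w\<bar> = R" unfolding mem box by linarith
    then show "norm (F w) \<le> B + e"
    proof cases
      case 1 then show ?thesis using left e by force
    next
      case 2 then show ?thesis using right e by force
    next
      case 3
      have "norm (F w) \<le> A * exp (- R)" using decay[of w] w 3 mem by auto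
      then show ?thesis using R0[OF R(1)] B0 by linarith
    qed
  qed
qed

section \<open>Square-integrable functions and the Cauchy-Schwarz inequality\<close>

definition L2 :: "('a::euclidean_space \<Rightarrow> complex) \<Rightarrow> bool" where
  "L2 f \<longleftrightarrow> f \<in> borel_measurable lborel \<and> integrable lborel (\<lambda>x. (cmod (f x))\<^sup>2)"

definition norm2 :: "('a::euclidean_space \<Rightarrow> complex) \<Rightarrow> real" where
  "norm2 f = sqrt (\<integral>x. (cmod (f x))\<^sup>2 \<partial>lborel)"

lemma L2_measurable [dest]: "L2 f \<Longrightarrow> f \<in> borel_measurable lborel"
  and L2_integrable [dest]: "L2 f \<Longrightarrow> integrable lborel (\<lambda>x. (cmod (f x))\<^sup>2)"
  by (auto simp: L2_def)

lemma norm2_nonneg [simp]: "0 \<le> norm2 f"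
  by (simp add: norm2_def)

lemma norm2_power2: "(norm2 f)\<^sup>2 = (\<integral>x. (cmod (f x))\<^sup>2 \<partial>lborel)"
  by (simp add: norm2_def)

lemma L2_mult:
  assumes f: "L2 f" and g: "L2 g"
  shows integrable_L2_mult: "integrable lborel (\<lambda>x. f x * g x)"
    and norm_integral_L2_le: "(\<integral>x. cmod (f x * g x) \<partial>lborel) \<le> norm2 f * norm2 g"
proof -
  have [measurable]: "f \<in> borel_measurable lborel" "g \<in> borel_measurable lborel"
    using f g by auto
  have sq: "cmod (f x * g x) \<le> (cmod (f x))\<^sup>2 + (cmod (g x))\<^sup>2" for x
    using sum_squares_bound[of "cmod (f x)" "cmod (g x)"] mult_nonneg_nonneg[OF norm_ge_zero norm_ge_zero, of "f x" "g x"]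
    unfolding norm_mult by linarith
  show int: "integrable lborel (\<lambda>x. f x * g x)"
    by (rule Bochner_Integration.integrable_bound[OF Bochner_Integration.integrable_add[OF L2_integrable[OF f] L2_integrable[OF g]]])
      (auto intro!: AE_I2 order_trans[OF sq])
  have "(\<integral>\<^sup>+x. ennreal (cmod (f x)) * ennreal (cmod (g x)) \<partial>lborel)\<^sup>2
      \<le> (\<integral>\<^sup>+x. ennreal (cmod (f x)) ^ 2 \<partial>lborel) * (\<integral>\<^sup>+x. ennreal (cmod (g x)) ^ 2 \<partial>lborel)"
    by (rule Cauchy_Schwarz_nn_integral) measurable
  also have "(\<integral>\<^sup>+x. ennreal (cmod (f x)) ^ 2 \<partial>lborel) = ennreal ((norm2 f)\<^sup>2)"
    unfolding norm2_power2 using f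
    by (subst nn_integral_eq_integral[symmetric]) (auto simp: ennreal_power)
  also have "(\<integral>\<^sup>+x. ennreal (cmod (g x)) ^ 2 \<partial>lborel) = ennreal ((norm2 g)\<^sup>2)"
    unfolding norm2_power2 using g
    by (subst nn_integral_eq_integral[symmetric]) (auto simp: ennreal_power)
  also have "(\<integral>\<^sup>+x. ennreal (cmod (f x)) * ennreal (cmod (g x)) \<partial>lborel) = ennreal (\<integral>x. cmod (f x * g x) \<partial>lborel)"
    using integrable_norm[OF int] by (subst nn_integral_eq_integral[symmetric]) (auto simp: ennreal_mult norm_mult)
  finally have "(\<integral>x. cmod (f x * g x) \<partial>lborel)\<^sup>2 \<le> (norm2 f * norm2 g)\<^sup>2"
    by (simp add: ennreal_power ennreal_mult[symmetric] power_mult_distrib)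
  then show "(\<integral>x. cmod (f x * g x) \<partial>lborel) \<le> norm2 f * norm2 g"
    by (rule power2_le_imp_le) simp
qed

lemma cmod_integral_L2_le:
  assumes f: "L2 f" and g: "L2 g"
  shows "cmod (\<integral>x. f x * g x \<partial>lborel) \<le> norm2 f * norm2 g"
  using integral_norm_bound norm_integral_L2_le[OF f g] by (rule order_trans)

lemma Lp_2_iff: "Lp 2 f \<longleftrightarrow> L2 f"
proof -
  have "cmod (f x) powr 2 = (cmod (f x))\<^sup>2" for x
    by simp
  then show ?thesis by (simp add: Lp_def L2_def)
qed

section \<open>Gaussian integrals and the heat kernel at complex times\<close>

lemma integrable_exp_square_1:
  fixes c :: real assumes "c > 0"
  shows "integrable lborel (\<lambda>x::real. exp (- (c * x\<^sup>2)))"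
proof -
  define \<sigma> where "\<sigma> = 1 / sqrt (2 * c)"
  have \<sigma>: "\<sigma> > 0" "\<sigma>\<^sup>2 = 1 / (2 * c)" using assms by (auto simp: \<sigma>_def power_divide)
  have "integrable lborel (\<lambda>x. sqrt (2 * pi * \<sigma>\<^sup>2) * normal_density 0 \<sigma> x)"
    using \<sigma> by simp
  moreover have "sqrt (2 * pi * \<sigma>\<^sup>2) * normal_density 0 \<sigma> x = exp (- (c * x\<^sup>2))" for x
    using \<sigma> assms by (simp add: normal_density_def)
  ultimately show ?thesis by simp
qed

text \<open>Up to normalisation this is the characteristic function of a centred normal law; the
  substitution by the factor \<open>1 / sqrt (2 * t)\<close> reduces it to the standard normal
  law.\<close>

lemma gaussian_integral_real_param:
  fixes t y :: real
  assumes t: "t > 0"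
  shows "(\<integral>x. exp (- (complex_of_real t * (of_real x)\<^sup>2)) * exp (\<i> * of_real (y * x)) \<partial>lborel)
    = of_real (sqrt pi) / csqrt (of_real t) * exp (- ((of_real y)\<^sup>2 / (4 * of_real t)))"
proof -
  define c where "c = 1 / sqrt (2 * t)"
  have c: "c > 0" "c\<^sup>2 = 1 / (2*t)" using t by (auto simp: c_def power_divide)
  have "char std_normal_distribution (y * c) = (\<integral>x. std_normal_density x *\<^sub>R exp (\<i> * of_real (y * c * x)) \<partial>lborel)"
    unfolding char_def by (subst integral_density) auto
  then have *: "(\<integral>x. std_normal_density x *\<^sub>R exp (\<i> * of_real (y * c * x)) \<partial>lborel) = of_real (exp (- ((y * c)\<^sup>2) / 2))"
    by (simp add: char_std_normal_distribution)
  have "(\<integral>x. exp (- (complex_of_real t * (of_real x)\<^sup>2)) * exp (\<i> * of_real (y * x)) \<partial>lborel)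
     = \<bar>c\<bar> *\<^sub>R (\<integral>x. exp (- (complex_of_real t * (of_real (0 + c * x))\<^sup>2)) * exp (\<i> * of_real (y * (0 + c * x))) \<partial>lborel)"
    using c by (intro lborel_integral_real_affine) auto
  also have "(\<lambda>x. exp (- (complex_of_real t * (of_real (0 + c * x))\<^sup>2)) * exp (\<i> * of_real (y * (0 + c * x))))
     = (\<lambda>x. sqrt (2 * pi) *\<^sub>R (std_normal_density x *\<^sub>R exp (\<i> * of_real (y * c * x))))"
  proof
    fix x
    have "t * (c * x)\<^sup>2 = x\<^sup>2 / 2" using c t by (simp add: power_mult_distrib)
    then have "- (complex_of_real t * (of_real (0 + c * x))\<^sup>2) = of_real (- x\<^sup>2 / 2)"
      by (metis add_0 of_real_minus of_real_mult of_real_power minus_divide_left)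
    then have "exp (- (complex_of_real t * (of_real (0 + c * x))\<^sup>2)) = of_real (exp (- x\<^sup>2 / 2))"
      by (simp only: exp_of_real)
    then show "exp (- (complex_of_real t * (of_real (0 + c * x))\<^sup>2)) * exp (\<i> * of_real (y * (0 + c * x)))
      = sqrt (2 * pi) *\<^sub>R (std_normal_density x *\<^sub>R exp (\<i> * of_real (y * c * x)))"
      by (simp add: std_normal_density_def scaleR_conv_of_real mult_ac)
  qed
  also have "\<bar>c\<bar> *\<^sub>R (\<integral>x. sqrt (2 * pi) *\<^sub>R (std_normal_density x *\<^sub>R exp (\<i> * of_real (y * c * x))) \<partial>lborel)
     = of_real (c * sqrt (2 * pi) * exp (- ((y * c)\<^sup>2) / 2))"
    using c by (simp only: integral_scaleR_right *) (simp add: scaleR_conv_of_real)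
  also have "c * sqrt (2 * pi) = sqrt pi / sqrt t"
    using t by (simp add: c_def real_sqrt_mult real_sqrt_divide)
  also have "- ((y * c)\<^sup>2) / 2 = - (y\<^sup>2 / (4 * t))"
    using c t by (simp add: power_mult_distrib)
  finally show ?thesis using t by (simp add: exp_of_real[symmetric] csqrt_of_real)
qed

lemma norm_exp_mult_square: "cmod (exp (- (t * (of_real x)\<^sup>2))) = exp (- (Re t * x\<^sup>2))"
  by (simp flip: of_real_power)

lemma norm_exp_i_times_of_real: "cmod (exp (\<i> * of_real x)) = 1"
  by simp

text \<open>The identity theorem, with 1 as an accumulation point of the positive reals. It carries
  both the Gaussian integral and the Gamma integral from real to complex parameters.\<close>

lemma halfplane_eqI:
  assumes f: "f holomorphic_on {z. Re z > 0}" and g: "g holomorphic_on {z. Re z > 0}"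
    and eq: "\<And>x. x > 0 \<Longrightarrow> f (complex_of_real x) = g (of_real x)"
    and z: "Re z > 0"
  shows "f z = g z"
proof -
  let ?S = "{z. Re z > 0}"
  have S: "open ?S" "connected ?S"
    by (auto intro: open_halfspace_Re_gt convex_connected convex_halfspace_Re_gt)
  have "(\<lambda>t. f t - g t) holomorphic_on ?S" using f g by (rule holomorphic_on_diff)
  then have "f z - g z = 0"
  proof (rule analytic_continuation[where U="of_real ` {0<..}" and \<xi>=1])
    show "(1::complex) islimpt of_real ` {0<..}"
      unfolding islimpt_sequential
    proof (intro exI[of _ "\<lambda>n. complex_of_real (1 + 1 / real (Suc n))"] conjI allI)
      have "(\<lambda>n. complex_of_real (1 + 1 / real (Suc n))) \<longlonglongrightarrow> of_real (1 + 0)"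
        by (intro tendsto_intros LIMSEQ_Suc[OF lim_1_over_n])
      then show "(\<lambda>n. complex_of_real (1 + 1 / real (Suc n))) \<longlonglongrightarrow> 1" by simp
      fix n
      have *: "1 + 1 / real (Suc n) > 0" "1 + 1 / real (Suc n) \<noteq> 1" by (auto intro: add_pos_pos)
      show "complex_of_real (1 + 1 / real (Suc n)) \<in> of_real ` {0<..} - {1}"
        using * by (metis Diff_iff empty_iff greaterThan_iff image_eqI insert_iff of_real_eq_1_iff)
    qed
    show "f z - g z = 0" if "z \<in> complex_of_real ` {0<..}" for z
      using that eq by auto
  qed (use S z in auto)
  then show ?thesis by simp
qed

text \<open>On the disc of radius \<open>Re z / 2\<close> about \<open>z\<close> the integrand is
  dominated by exp(-(Re z / 2) x^2), so the integral is holomorphic in \<open>t\<close> and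
  continues the real formula.\<close>

lemma gaussian_integral_1:
  fixes y :: real
  assumes t: "Re t > 0"
  shows "(\<integral>x. exp (- (t * (of_real x)\<^sup>2)) * exp (\<i> * of_real (y * x)) \<partial>lborel)
    = of_real (sqrt pi) / csqrt t * exp (- ((of_real y)\<^sup>2 / (4 * t)))"
proof -
  let ?S = "{t. Re t > 0}"
  let ?f = "\<lambda>t. (\<integral>x. exp (- (t * (of_real x)\<^sup>2)) * exp (\<i> * of_real (y * x)) \<partial>lborel)"
  let ?g = "\<lambda>t. of_real (sqrt pi) / csqrt t * exp (- ((of_real y)\<^sup>2 / (4 * t)))"
  have hf: "?f holomorphic_on ?S"
  proof (rule holomorphic_on_integral[OF open_halfspace_Re_gt])
    fix z assume z: "z \<in> ?S"
    show "\<exists>e>0. \<exists>B. integrable lborel B \<and> cball z e \<subseteq> ?S \<and>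
       (\<forall>w\<in>cball z e. \<forall>x\<in>space lborel. norm (exp (- (w * (of_real x)\<^sup>2)) * exp (\<i> * of_real (y * x))) \<le> B x)"
    proof (intro exI[of _ "Re z / 2"] exI[of _ "\<lambda>x. exp (- (Re z / 2 * x\<^sup>2))"] conjI ballI)
      show "0 < Re z / 2" using z by simp
      show "integrable lborel (\<lambda>x. exp (- (Re z / 2 * x\<^sup>2)))"
        using z by (intro integrable_exp_square_1) simp
      have Re: "Re z / 2 \<le> Re w" if "w \<in> cball z (Re z / 2)" for w
        using that abs_Re_le_cmod[of "z - w"] by (auto simp: dist_norm)
      show "cball z (Re z / 2) \<subseteq> ?S" using Re z by force
      show "norm (exp (- (w * (of_real x)\<^sup>2)) * exp (\<i> * of_real (y * x))) \<le> exp (- (Re z / 2 * x\<^sup>2))"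
        if "w \<in> cball z (Re z / 2)" for w x
        using mult_right_mono[OF Re[OF that], of "x\<^sup>2"] unfolding norm_mult norm_exp_mult_square norm_exp_i_times_of_real by simp
    qed
  qed (auto intro!: holomorphic_intros)
  have hg: "?g holomorphic_on ?S"
    by (intro holomorphic_intros) (auto simp: complex_nonpos_Reals_iff)
  show ?thesis by (rule halfplane_eqI[OF hf hg gaussian_integral_real_param t])
qed

lemma
  fixes f :: "'a::euclidean_space \<Rightarrow> real \<Rightarrow> complex"
  assumes f: "\<And>b. b \<in> Basis \<Longrightarrow> integrable lborel (f b)"
  shows integrable_prod_Basis: "integrable lborel (\<lambda>x::'a. \<Prod>b\<in>Basis. f b (x \<bullet> b))"
    and integral_prod_Basis: "(\<integral>x. (\<Prod>b\<in>Basis. f b (x \<bullet> b)) \<partial>(lborel::'a measure)) = (\<Prod>b\<in>Basis. \<integral>x. f b x \<partial>lborel)"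
proof -
  interpret product_sigma_finite "\<lambda>_::'a. lborel :: real measure"
    by standard
  have [measurable]: "b \<in> Basis \<Longrightarrow> f b \<in> borel_measurable borel" for b
    using f[of b] by auto
  let ?T = "\<lambda>g. \<Sum>b\<in>Basis. g b *\<^sub>R (b::'a)"
  have [measurable]: "?T \<in> (\<Pi>\<^sub>M b\<in>Basis. lborel) \<rightarrow>\<^sub>M borel" by measurable
  have eq: "(\<Prod>b\<in>Basis. f b (?T g \<bullet> b)) = (\<Prod>b\<in>Basis. f b (g b))" for g
    by (intro prod.cong) auto
  have m: "(\<lambda>x::'a. \<Prod>b\<in>Basis. f b (x \<bullet> b)) \<in> borel_measurable borel"
    by (intro borel_measurable_prod) auto
  show "integrable lborel (\<lambda>x::'a. \<Prod>b\<in>Basis. f b (x \<bullet> b))"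
    by (subst lborel_eq, subst integrable_distr_eq) (auto simp: eq m intro!: product_integrable_prod f)
  show "(\<integral>x. (\<Prod>b\<in>Basis. f b (x \<bullet> b)) \<partial>(lborel::'a measure)) = (\<Prod>b\<in>Basis. \<integral>x. f b x \<partial>lborel)"
    by (subst lborel_eq, subst integral_distr) (auto simp: eq m intro!: product_integral_prod f)
qed

lemma norm_power2_eq_sum_Basis: "(norm (x::'a::euclidean_space))\<^sup>2 = (\<Sum>b\<in>Basis. (x \<bullet> b)\<^sup>2)"
  unfolding power2_norm_eq_inner euclidean_inner[of x x] by (simp add: power2_eq_square)

text \<open>Both |\<xi>|^2 and the inner product with \<open>w\<close> are sums over
  \<open>Basis\<close>, so the integrand is a product of one-dimensional Gaussians.\<close>

lemma
  fixes w :: "'a::euclidean_space"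
  assumes t: "Re t > 0"
  shows integrable_gaussian: "integrable lborel (\<lambda>\<xi>::'a. exp (- (t * of_real ((norm \<xi>)\<^sup>2))) * exp (\<i> * of_real (w \<bullet> \<xi>)))"
    and gaussian_integral: "(\<integral>\<xi>. exp (- (t * of_real ((norm \<xi>)\<^sup>2))) * exp (\<i> * of_real (w \<bullet> \<xi>)) \<partial>(lborel::'a measure))
    = (of_real (sqrt pi) / csqrt t) ^ DIM('a) * exp (- (of_real ((norm w)\<^sup>2) / (4 * t)))"
proof -
  let ?f = "\<lambda>b x. exp (- (t * (of_real x)\<^sup>2)) * exp (\<i> * of_real ((w \<bullet> b) * x))"
  have eq: "exp (- (t * of_real ((norm \<xi>)\<^sup>2))) * exp (\<i> * of_real (w \<bullet> \<xi>)) = (\<Prod>b\<in>Basis. ?f b (\<xi> \<bullet> b))" for \<xi> :: 'a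
    by (simp add: norm_power2_eq_sum_Basis euclidean_inner[of w \<xi>] prod.distrib exp_sum[symmetric] sum_distrib_left sum_negf)
  have int: "integrable lborel (?f b)" for b
  proof (rule Bochner_Integration.integrable_bound[OF integrable_exp_square_1[OF t]])
    show "AE x in lborel. norm (?f b x) \<le> norm (exp (- (Re t * x\<^sup>2)))"
      unfolding norm_mult norm_exp_mult_square norm_exp_i_times_of_real by simp
  qed measurable
  show "integrable lborel (\<lambda>\<xi>::'a. exp (- (t * of_real ((norm \<xi>)\<^sup>2))) * exp (\<i> * of_real (w \<bullet> \<xi>)))"
    unfolding eq by (rule integrable_prod_Basis[OF int])
  have "(\<integral>\<xi>. exp (- (t * of_real ((norm \<xi>)\<^sup>2))) * exp (\<i> * of_real (w \<bullet> \<xi>)) \<partial>(lborel::'a measure)) = (\<Prod>b\<in>Basis. \<integral>x. ?f b x \<partial>lborel)"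
    unfolding eq by (rule integral_prod_Basis[OF int])
  also have "\<dots> = (\<Prod>b\<in>(Basis::'a set). of_real (sqrt pi) / csqrt t * exp (- ((of_real (w \<bullet> b))\<^sup>2 / (4 * t))))"
    by (intro prod.cong refl gaussian_integral_1 t)
  also have "\<dots> = (of_real (sqrt pi) / csqrt t) ^ DIM('a) * exp (- (of_real ((norm w)\<^sup>2) / (4 * t)))"
    unfolding prod.distrib by (simp add: exp_sum[symmetric] norm_power2_eq_sum_Basis sum_divide_distrib sum_negf)
  finally show "(\<integral>\<xi>. exp (- (t * of_real ((norm \<xi>)\<^sup>2))) * exp (\<i> * of_real (w \<bullet> \<xi>)) \<partial>(lborel::'a measure))
    = (of_real (sqrt pi) / csqrt t) ^ DIM('a) * exp (- (of_real ((norm w)\<^sup>2) / (4 * t)))" .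
qed

lemma integrable_exp_norm_square:
  fixes c :: real
  assumes c: "c > 0"
  shows "integrable lborel (\<lambda>x::'a::euclidean_space. exp (- (c * (norm x)\<^sup>2)))"
proof -
  have eq: "exp (- (complex_of_real c * of_real ((norm x)\<^sup>2))) * exp (\<i> * of_real (0 \<bullet> x)) = of_real (exp (- (c * (norm x)\<^sup>2)))" for x :: 'a
    by (simp flip: exp_of_real)
  have "Re (of_real c) > 0" using c by simp
  from integrable_gaussian[OF this, of "0::'a", unfolded eq] show ?thesis
    by (subst complex_of_real_integrable_eq[symmetric])
qed

lemma
  fixes f :: "'a::euclidean_space \<Rightarrow> 'b::{banach, second_countable_topology}" and c :: real
  assumes c: "c \<noteq> 0" and f [measurable]: "f \<in> borel_measurable borel"
  shows integral_affine: "(\<integral>x. f x \<partial>lborel) = \<bar>c\<bar> ^ DIM('a) *\<^sub>R (\<integral>x. f (t + c *\<^sub>R x) \<partial>lborel)"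
    and integrable_affine_iff: "integrable lborel (\<lambda>x. f (t + c *\<^sub>R x)) \<longleftrightarrow> integrable lborel f"
proof -
  have eq: "(lborel :: 'a measure) = density (distr lborel borel (\<lambda>x. t + c *\<^sub>R x)) (\<lambda>_. ennreal (\<bar>c\<bar> ^ DIM('a)))"
    using lborel_affine[OF c, of t] by (simp add: ennreal_power)
  have "(\<integral>x. f x \<partial>lborel) = (\<integral>x. f x \<partial>density (distr lborel borel (\<lambda>x. t + c *\<^sub>R x)) (\<lambda>_. ennreal (\<bar>c\<bar> ^ DIM('a))))"
    using eq by simp
  also have "\<dots> = \<bar>c\<bar> ^ DIM('a) *\<^sub>R (\<integral>x. f (t + c *\<^sub>R x) \<partial>lborel)"
    by (subst integral_density) (auto simp: integral_distr)
  finally show "(\<integral>x. f x \<partial>lborel) = \<bar>c\<bar> ^ DIM('a) *\<^sub>R (\<integral>x. f (t + c *\<^sub>R x) \<partial>lborel)" .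
  have "integrable lborel f \<longleftrightarrow> integrable (density (distr lborel borel (\<lambda>x. t + c *\<^sub>R x)) (\<lambda>_. ennreal (\<bar>c\<bar> ^ DIM('a)))) f"
    using eq by simp
  also have "\<dots> \<longleftrightarrow> integrable lborel (\<lambda>x. \<bar>c\<bar> ^ DIM('a) *\<^sub>R f (t + c *\<^sub>R x))"
    by (subst integrable_density) (simp_all add: integrable_distr_eq)
  also have "\<dots> \<longleftrightarrow> integrable lborel (\<lambda>x. f (t + c *\<^sub>R x))"
    using c integrable_scaleR_right[of "1 / \<bar>c\<bar> ^ DIM('a)" lborel "\<lambda>x. \<bar>c\<bar> ^ DIM('a) *\<^sub>R f (t + c *\<^sub>R x)"] by auto
  finally show "integrable lborel (\<lambda>x. f (t + c *\<^sub>R x)) \<longleftrightarrow> integrable lborel f" by simp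
qed

lemma
  fixes f :: "'a::euclidean_space \<Rightarrow> 'b::{banach, second_countable_topology}"
  assumes f [measurable]: "f \<in> borel_measurable borel"
  shows integral_translate: "(\<integral>x. f (x + t) \<partial>lborel) = (\<integral>x. f x \<partial>lborel)"
    and integrable_translate_iff: "integrable lborel (\<lambda>x. f (x + t)) \<longleftrightarrow> integrable lborel f"
    and integral_reflect: "(\<integral>x. f (t - x) \<partial>lborel) = (\<integral>x. f x \<partial>lborel)"
    and integrable_reflect_iff: "integrable lborel (\<lambda>x. f (t - x)) \<longleftrightarrow> integrable lborel f"
  using integral_affine[of 1 f t] integrable_affine_iff[of 1 f t]
    integral_affine[of "-1" f t] integrable_affine_iff[of "-1" f t]
  by (simp_all add: add.commute)

text \<open>The kernel (4 pi t)^(-d/2) exp(-|w|^2/(4 t)) of the heat semigroup at a complex time.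
  Writing the half-integer power as an integer power of \<open>1 / (2 * sqrt pi * csqrt t)\<close>
  fixes the branch in odd dimensions.\<close>

definition heat :: "complex \<Rightarrow> 'a::euclidean_space \<Rightarrow> complex" where
  "heat t w = (1 / (2 * of_real (sqrt pi) * csqrt t)) ^ DIM('a) * exp (- (of_real ((norm w)\<^sup>2) / (4 * t)))"

lemma heat_measurable [measurable]: "heat t \<in> borel_measurable borel"
  unfolding heat_def by measurable

lemma gaussian_integral_heat:
  fixes w :: "'a::euclidean_space"
  assumes t: "Re t > 0"
  shows "(\<integral>\<xi>. exp (- (t * of_real ((norm \<xi>)\<^sup>2))) * exp (\<i> * of_real (w \<bullet> \<xi>)) \<partial>(lborel::'a measure))
    = (2 * of_real pi) ^ DIM('a) * heat t w"
proof -
  have "complex_of_real pi = of_real (sqrt pi) * of_real (sqrt pi)"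
    by (simp flip: of_real_mult)
  then have "of_real (sqrt pi) / csqrt t = 2 * of_real pi * (1 / (2 * of_real (sqrt pi) * csqrt t))"
    by (simp add: field_simps)
  then show ?thesis
    unfolding gaussian_integral[OF t] heat_def by (simp only: power_mult_distrib mult.assoc)
qed

lemma norm_heat:
  fixes w :: "'a::euclidean_space"
  shows "cmod (heat t w) = (1 / (2 * sqrt (pi * cmod t))) ^ DIM('a) * exp (- (Re (1 / t) / 4 * (norm w)\<^sup>2))"
proof -
  have "Re (of_real ((norm w)\<^sup>2) / (4 * t)) = Re (of_real ((norm w)\<^sup>2 / 4) * (1 / t))"
    by simp
  also have "\<dots> = Re (1 / t) / 4 * (norm w)\<^sup>2"
    by (simp only: times_complex.sel Re_complex_of_real Im_complex_of_real) (simp del: Re_divide_numeral)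
  finally have "cmod (exp (- (of_real ((norm w)\<^sup>2) / (4 * t)))) = exp (- (Re (1 / t) / 4 * (norm w)\<^sup>2))"
    unfolding norm_exp_eq_Re by (simp del: Re_divide_numeral)
  then show ?thesis
    unfolding heat_def norm_mult norm_power norm_divide by (simp add: real_sqrt_mult mult.assoc)
qed

lemma Re_inverse_pos: "Re t > 0 \<Longrightarrow> Re (1 / t) > 0"
  by (auto simp: Re_divide intro!: divide_pos_pos add_pos_nonneg)

lemma integrable_heat: "Re t > 0 \<Longrightarrow> integrable lborel (heat t :: 'a::euclidean_space \<Rightarrow> complex)"
  by (rule Bochner_Integration.integrable_bound[of lborel "\<lambda>w. (1 / (2 * sqrt (pi * cmod t))) ^ DIM('a) * exp (- (Re (1 / t) / 4 * (norm w)\<^sup>2))"])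
    (auto simp: norm_heat intro!: integrable_exp_norm_square[of "Re (1 / t) / 4", simplified] Re_inverse_pos)

text \<open>The Gaussian integral at frequency 0 with parameter 1/(4 t). The actual work is to match
  the principal roots: \<open>csqrt (1 / (4 * t))\<close> equals \<open>1 / (2 * csqrt t)\<close>
  because the real part of the latter is positive.\<close>

lemma integral_heat:
  assumes t: "Re t > 0"
  shows "(\<integral>w. heat t (w::'a::euclidean_space) \<partial>lborel) = 1"
proof -
  let ?t = "1 / (4 * t)"
  have t': "Re ?t > 0" using Re_inverse_pos[of "4 * t"] t by simp
  have "csqrt ?t = 1 / (2 * csqrt t)"
  proof (rule csqrt_unique)
    show "(1 / (2 * csqrt t))\<^sup>2 = 1 / (4 * t)" by (simp add: power_divide power_mult_distrib)
    have "Re (csqrt t) \<ge> 0" "Re (csqrt t) \<noteq> 0"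
    proof -
      show "Re (csqrt t) \<ge> 0" by (rule Re_csqrt)
      show "Re (csqrt t) \<noteq> 0"
      proof
        assume "Re (csqrt t) = 0"
        then have "Re ((csqrt t)\<^sup>2) \<le> 0" by (simp add: power2_eq_square)
        then show False using t by simp
      qed
    qed
    then show "0 < Re (1 / (2 * csqrt t)) \<or> Re (1 / (2 * csqrt t)) = 0 \<and> 0 \<le> Im (1 / (2 * csqrt t))"
      using Re_inverse_pos[of "2 * csqrt t"] by simp
  qed
  moreover have "csqrt t \<noteq> 0" using t by auto
  ultimately have "of_real (sqrt pi) / csqrt ?t * (1 / (2 * of_real (sqrt pi) * csqrt t)) = 1"
    by simp
  then have one: "(1 / (2 * of_real (sqrt pi) * csqrt t)) ^ DIM('a) * (of_real (sqrt pi) / csqrt ?t) ^ DIM('a) = 1"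
    by (metis mult.commute power_mult_distrib power_one)
  have "(\<integral>w. heat t (w::'a::euclidean_space) \<partial>lborel) = (1 / (2 * of_real (sqrt pi) * csqrt t)) ^ DIM('a) *
     (\<integral>w. exp (- (?t * of_real ((norm w)\<^sup>2))) * exp (\<i> * of_real (0 \<bullet> w)) \<partial>(lborel::'a measure))"
    unfolding heat_def by (subst integral_mult_right_zero[symmetric]) simp
  also have "\<dots> = 1"
    unfolding gaussian_integral[OF t'] using one by simp
  finally show ?thesis .
qed

lemma heat_scale:
  fixes w :: "'a::euclidean_space"
  assumes s: "s > 0"
  shows "heat (of_real s * t) w = of_real (1 / sqrt s ^ DIM('a)) * heat t ((1 / sqrt s) *\<^sub>R w)"
proof -
  have "csqrt (of_real s * t) = of_real (sqrt s) * csqrt t"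
    by (rule csqrt_unique) (use s csqrt_principal[of t] in \<open>auto simp: power_mult_distrib simp flip: of_real_power\<close>)
  moreover have "of_real ((norm ((1 / sqrt s) *\<^sub>R w))\<^sup>2) / (4 * t) = of_real ((norm w)\<^sup>2) / (4 * (of_real s * t))"
    using s by (simp add: power_divide power_mult_distrib del: of_real_power)
  ultimately show ?thesis
    unfolding heat_def by (simp only:) (simp add: power_mult_distrib power_divide)
qed

lemma heat_approximate_identity:
  fixes c :: "'a::euclidean_space \<Rightarrow> complex"
  assumes t: "Re t > 0" and [measurable]: "c \<in> borel_measurable borel"
    and bnd: "\<And>w. cmod (c w) \<le> B" and cont: "isCont c 0"
  shows "((\<lambda>s. \<integral>w. heat (of_real s * t) w * c w \<partial>lborel) \<longlongrightarrow> c 0) (at_right 0)"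
  unfolding tendsto_at_iff_sequentially comp_def
proof (intro allI impI)
  fix X assume X: "\<forall>i. X i \<in> {0<..} - {0}" "X \<longlonglongrightarrow> (0::real)"
  have "(\<integral>w. heat (of_real (X n) * t) w * c w \<partial>lborel) = (\<integral>w. heat t w * c (sqrt (X n) *\<^sub>R w) \<partial>lborel)" for n
  proof -
    have pos: "X n > 0" using X(1) by auto
    have "(\<integral>w. heat (of_real (X n) * t) w * c w \<partial>lborel)
      = \<bar>sqrt (X n)\<bar> ^ DIM('a) *\<^sub>R (\<integral>w. heat (of_real (X n) * t) (0 + sqrt (X n) *\<^sub>R w) * c (0 + sqrt (X n) *\<^sub>R w) \<partial>lborel)"
      using pos by (intro integral_affine) auto
    also have "\<dots> = \<bar>sqrt (X n)\<bar> ^ DIM('a) *\<^sub>R (\<integral>w. of_real (1 / sqrt (X n) ^ DIM('a)) * (heat t w * c (sqrt (X n) *\<^sub>R w)) \<partial>lborel)"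
      using pos by (simp add: heat_scale mult.assoc)
    also have "\<dots> = (\<integral>w. heat t w * c (sqrt (X n) *\<^sub>R w) \<partial>lborel)"
      using pos by (subst integral_mult_right_zero) (simp add: scaleR_conv_of_real)
    finally show ?thesis .
  qed
  moreover have "(\<lambda>n. \<integral>w. heat t w * c (sqrt (X n) *\<^sub>R w) \<partial>lborel) \<longlonglongrightarrow> (\<integral>w. heat t w * c 0 \<partial>(lborel::'a measure))"
  proof (rule integral_dominated_convergence[where w="\<lambda>w::'a. cmod (heat t w) * B"])
    show "integrable lborel (\<lambda>w::'a. cmod (heat t w) * B)"
      using integrable_heat[OF t] by auto
    show "AE w in lborel. (\<lambda>n. heat t w * c (sqrt (X n) *\<^sub>R w)) \<longlonglongrightarrow> heat t w * c 0"
    proof (intro AE_I2 tendsto_intros isCont_tendsto_compose[OF cont])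
      fix w :: 'a
      have "(\<lambda>n. sqrt (X n) *\<^sub>R w) \<longlonglongrightarrow> sqrt 0 *\<^sub>R w" by (intro tendsto_intros X)
      then show "(\<lambda>n. sqrt (X n) *\<^sub>R w) \<longlonglongrightarrow> 0" by simp
    qed
    show "AE w in lborel. norm (heat t w * c (sqrt (X n) *\<^sub>R w)) \<le> cmod (heat t w) * B" for n
      by (auto simp: norm_mult intro!: mult_left_mono bnd)
  qed measurable
  ultimately show "(\<lambda>n. \<integral>w. heat (of_real (X n) * t) w * c w \<partial>lborel) \<longlonglongrightarrow> c 0"
    by (simp add: integral_heat[OF t])
qed

section \<open>Correlation, convolution and the Fourier transform\<close>

text \<open>Taken without conjugation, so that all forms stay bilinear and depend holomorphically on
  their entries. Pairing \<open>f\<close> with a convolution by \<open>K\<close> becomes the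
  integral of \<open>K\<close> against one function of the difference variable.\<close>

definition corr :: "('a::euclidean_space \<Rightarrow> complex) \<Rightarrow> ('a \<Rightarrow> complex) \<Rightarrow> 'a \<Rightarrow> complex" where
  "corr f g w = (\<integral>x. f x * g (x - w) \<partial>lborel)"

definition conv :: "('a::euclidean_space \<Rightarrow> complex) \<Rightarrow> ('a \<Rightarrow> complex) \<Rightarrow> 'a \<Rightarrow> complex" where
  "conv K g x = (\<integral>w. K w * g (x - w) \<partial>lborel)"

definition ft :: "('a::euclidean_space \<Rightarrow> complex) \<Rightarrow> 'a \<Rightarrow> complex" where
  "ft f \<xi> = (\<integral>x. exp (- (\<i> * of_real (x \<bullet> \<xi>))) * f x \<partial>lborel)"

lemma borel_measurable_cnj [measurable (raw)]:
  "f \<in> borel_measurable M \<Longrightarrow> (\<lambda>x. cnj (f x)) \<in> borel_measurable M"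
  by (rule measurable_compose[where N=borel]) (auto intro!: borel_measurable_continuous_onI continuous_intros)

lemma corr_measurable [measurable]:
  assumes [measurable]: "f \<in> borel_measurable borel" "g \<in> borel_measurable borel"
  shows "corr f g \<in> borel_measurable borel"
  unfolding corr_def[abs_def] by measurable

lemma conv_measurable [measurable]:
  assumes [measurable]: "f \<in> borel_measurable borel" "g \<in> borel_measurable borel"
  shows "conv f g \<in> borel_measurable borel"
  unfolding conv_def[abs_def] by measurable

lemma ft_measurable [measurable]:
  assumes [measurable]: "f \<in> borel_measurable borel"
  shows "ft f \<in> borel_measurable borel"
  unfolding ft_def[abs_def] by measurable

lemma
  fixes g :: "'a::euclidean_space \<Rightarrow> complex"
  assumes g: "L2 g"
  shows L2_translate: "L2 (\<lambda>x. g (x - w))" and norm2_translate: "norm2 (\<lambda>x. g (x - w)) = norm2 g"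
proof -
  have [measurable]: "g \<in> borel_measurable borel" using g by auto
  show "L2 (\<lambda>x. g (x - w))"
    using g integrable_translate_iff[of "\<lambda>x. (cmod (g x))\<^sup>2" "-w"] unfolding L2_def by simp
  show "norm2 (\<lambda>x. g (x - w)) = norm2 g"
    using integral_translate[of "\<lambda>x. (cmod (g x))\<^sup>2" "-w"] unfolding norm2_def by simp
qed

lemma cmod_corr_le:
  assumes "L2 f" "L2 g"
  shows "cmod (corr f g w) \<le> norm2 f * norm2 g"
  unfolding corr_def using cmod_integral_L2_le[OF assms(1) L2_translate[OF assms(2)]]
  by (simp add: norm2_translate[OF assms(2)])

text \<open>Fubini for K(w) f(x) g(x - w). By Cauchy-Schwarz and translation invariance the inner
  integral of the modulus is at most |K(w)| times the product of the two norms, which suffices even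
  if \<open>f\<close> and \<open>g\<close> are not integrable.\<close>

lemma
  fixes K f g :: "'a::euclidean_space \<Rightarrow> complex"
  assumes K: "integrable lborel K" and f: "L2 f" and g: "L2 g"
  shows integral_mult_conv: "(\<integral>x. f x * conv K g x \<partial>lborel) = (\<integral>w. K w * corr f g w \<partial>lborel)"
    and integrable_mult_corr: "integrable lborel (\<lambda>w. K w * corr f g w)"
proof -
  have [measurable]: "K \<in> borel_measurable borel" "f \<in> borel_measurable borel" "g \<in> borel_measurable borel"
    using K f g by auto
  let ?F = "\<lambda>w x. K w * (f x * g (x - w))"
  have int: "integrable lborel (?F w)" for w
    using integrable_L2_mult[OF f L2_translate[OF g]] by auto
  have "integrable (lborel \<Otimes>\<^sub>M lborel) (\<lambda>(w, x). ?F w x)"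
  proof (rule lborel_pair.Fubini_integrable)
    show "AE w in lborel. integrable lborel (\<lambda>x. case (w, x) of (w, x) \<Rightarrow> ?F w x)"
      using int by simp
    show "integrable lborel (\<lambda>w. \<integral>x. norm (case (w, x) of (w, x) \<Rightarrow> ?F w x) \<partial>lborel)"
    proof (rule Bochner_Integration.integrable_bound)
      show "integrable lborel (\<lambda>w. cmod (K w) * (norm2 f * norm2 g))"
        using K by auto
      show "AE w in lborel. norm (\<integral>x. norm (case (w, x) of (w, x) \<Rightarrow> ?F w x) \<partial>lborel) \<le> norm (cmod (K w) * (norm2 f * norm2 g))"
      proof (rule AE_I2)
        fix w :: 'a
        have "(\<integral>x. cmod (?F w x) \<partial>lborel) = cmod (K w) * (\<integral>x. cmod (f x * g (x - w)) \<partial>lborel)"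
          by (simp add: norm_mult)
        also have "\<dots> \<le> cmod (K w) * (norm2 f * norm2 g)"
          using norm_integral_L2_le[OF f L2_translate[OF g, of w]] by (intro mult_left_mono) (auto simp: norm2_translate[OF g])
        finally show "norm (\<integral>x. norm (case (w, x) of (w, x) \<Rightarrow> ?F w x) \<partial>lborel) \<le> norm (cmod (K w) * (norm2 f * norm2 g))"
          by (simp add: integral_nonneg_AE)
      qed
    qed measurable
  qed measurable
  note Fub = this
  have conv: "f x * conv K g x = (\<integral>w. ?F w x \<partial>lborel)" for x
    unfolding conv_def by (subst integral_mult_right_zero[symmetric]) (simp add: mult_ac)
  have corr: "K w * corr f g w = (\<integral>x. ?F w x \<partial>lborel)" for w
    unfolding corr_def by (subst integral_mult_right_zero[symmetric]) simp
  show "integrable lborel (\<lambda>w. K w * corr f g w)"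
    unfolding corr using lborel_pair.integrable_fst[OF Fub] .
  show "(\<integral>x. f x * conv K g x \<partial>lborel) = (\<integral>w. K w * corr f g w \<partial>lborel)"
    unfolding conv corr by (rule lborel_pair.Fubini_integral[OF Fub])
qed

lemma L2_of_bounded_integrable:
  assumes f: "integrable lborel f" and B: "\<And>x. cmod (f x) \<le> B"
  shows "L2 f"
  unfolding L2_def
proof
  show "f \<in> borel_measurable lborel" using f by auto
  show "integrable lborel (\<lambda>x. (cmod (f x))\<^sup>2)"
  proof (rule Bochner_Integration.integrable_bound)
    show "integrable lborel (\<lambda>x. B * cmod (f x))" using f by auto
    show "AE x in lborel. norm ((cmod (f x))\<^sup>2) \<le> norm (B * cmod (f x))"
    proof (rule AE_I2)
      fix x
      have "cmod (f x) * cmod (f x) \<le> B * cmod (f x)" using B by (rule mult_right_mono) simp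
      then show "norm ((cmod (f x))\<^sup>2) \<le> norm (B * cmod (f x))" by (simp add: power2_eq_square)
    qed
  qed (use f in auto)
qed

lemma integrable_pair_shift:
  fixes K g :: "'a::euclidean_space \<Rightarrow> complex"
  assumes K: "integrable lborel K" and g: "integrable lborel g"
  shows "integrable (lborel \<Otimes>\<^sub>M lborel) (\<lambda>(w, x). K w * g (x - w))"
proof -
  have [measurable]: "K \<in> borel_measurable borel" "g \<in> borel_measurable borel"
    using K g by auto
  show ?thesis
  proof (rule lborel_pair.Fubini_integrable)
    show "AE w in lborel. integrable lborel (\<lambda>x. case (w, x) of (w, x) \<Rightarrow> K w * g (x - w))"
      using integrable_translate_iff[of g] g by (auto simp: diff_conv_add_uminus simp del: add_uminus_conv_diff)
    have "(\<integral>x. norm (K w * g (x - w)) \<partial>lborel) = cmod (K w) * (\<integral>x. cmod (g x) \<partial>lborel)" for w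
      using integral_translate[of "\<lambda>x. cmod (g x)" "-w"] by (simp add: norm_mult)
    then show "integrable lborel (\<lambda>w. \<integral>x. norm (case (w, x) of (w, x) \<Rightarrow> K w * g (x - w)) \<partial>lborel)"
      using K by auto
  qed measurable
qed

text \<open>The convolution is integrable by Fubini and bounded by \<open>B\<close> times the L^1
  norm of \<open>K\<close>; bounded and integrable functions are square-integrable.\<close>

lemma L2_conv:
  fixes K g :: "'a::euclidean_space \<Rightarrow> complex"
  assumes K: "integrable lborel K" and g: "integrable lborel g" and B: "\<And>x. cmod (g x) \<le> B"
  shows "L2 (conv K g)"
proof -
  have [measurable]: "K \<in> borel_measurable borel" "g \<in> borel_measurable borel"
    using K g by auto
  have int: "integrable lborel (\<lambda>w. K w * g (x - w))" for x
  proof (rule Bochner_Integration.integrable_bound)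
    show "integrable lborel (\<lambda>w. B * cmod (K w))" using K by auto
    show "AE w in lborel. norm (K w * g (x - w)) \<le> norm (B * cmod (K w))"
      using B by (auto simp: norm_mult mult.commute[of B] abs_mult intro!: mult_left_mono order_trans[OF B])
  qed measurable
  show "L2 (conv K g)"
  proof (rule L2_of_bounded_integrable)
    show "integrable lborel (conv K g)"
      unfolding conv_def[abs_def] using lborel_pair.integrable_snd[OF integrable_pair_shift[OF K g]] .
    fix x
    have "cmod (conv K g x) \<le> (\<integral>w. B * cmod (K w) \<partial>lborel)"
      unfolding conv_def
    proof (rule order_trans[OF integral_norm_bound integral_mono])
      show "cmod (K w * g (x - w)) \<le> B * cmod (K w)" for w
        using B by (simp add: norm_mult mult.commute[of B] mult_left_mono)
      show "integrable lborel (\<lambda>w. cmod (K w * g (x - w)))" using int by (rule integrable_norm)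
    qed (use K in auto)
    then show "cmod (conv K g x) \<le> (\<integral>w. B * cmod (K w) \<partial>lborel)" .
  qed
qed

text \<open>Substituting x - w for w in the inner integral separates the two transforms. The sign of
  the exponent flips for \<open>g\<close>, which is why its transform appears at
  \<open>- \<xi>\<close>.\<close>

lemma
  fixes f g :: "'a::euclidean_space \<Rightarrow> complex"
  assumes f: "integrable lborel f" and g: "integrable lborel g"
  shows integrable_corr: "integrable lborel (corr f g)"
    and ft_corr: "ft (corr f g) \<xi> = ft f \<xi> * ft g (- \<xi>)"
proof -
  have [measurable]: "f \<in> borel_measurable borel" "g \<in> borel_measurable borel"
    using f g by auto
  let ?F = "\<lambda>\<xi> x w. exp (- (\<i> * of_real (w \<bullet> \<xi>))) * (f x * g (x - w))"
  have nF: "cmod (?F \<xi> x w) = cmod (f x) * cmod (g (x - w))" for \<xi> x w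
    by (simp add: norm_mult)
  have Fub: "integrable (lborel \<Otimes>\<^sub>M lborel) (\<lambda>(x, w). ?F \<xi> x w)" for \<xi>
  proof (rule lborel_pair.Fubini_integrable)
    have "integrable lborel (\<lambda>w. g (x - w))" for x
      using g by (simp add: integrable_reflect_iff)
    then have "integrable lborel (\<lambda>w. cmod (f x) * cmod (g (x - w)))" for x
      by auto
    then have "integrable lborel (?F \<xi> x)" for x
      by (rule Bochner_Integration.integrable_bound) (auto simp: nF)
    then show "AE x in lborel. integrable lborel (\<lambda>w. case (x, w) of (x, w) \<Rightarrow> ?F \<xi> x w)"
      by simp
    have "(\<integral>w. norm (?F \<xi> x w) \<partial>lborel) = cmod (f x) * (\<integral>x. cmod (g x) \<partial>lborel)" for x
      unfolding nF using integral_reflect[of "\<lambda>x. cmod (g x)" x] by simp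
    then show "integrable lborel (\<lambda>x. \<integral>w. norm (case (x, w) of (x, w) \<Rightarrow> ?F \<xi> x w) \<partial>lborel)"
      using f by auto
  qed measurable
  show "integrable lborel (corr f g)"
    unfolding corr_def[abs_def] using lborel_pair.integrable_snd[OF Fub[of 0]] by simp
  have "ft (corr f g) \<xi> = (\<integral>w. (\<integral>x. ?F \<xi> x w \<partial>lborel) \<partial>lborel)"
    unfolding ft_def corr_def by simp
  also have "\<dots> = (\<integral>x. (\<integral>w. ?F \<xi> x w \<partial>lborel) \<partial>lborel)"
    by (rule lborel_pair.Fubini_integral[OF Fub])
  also have "(\<lambda>x. \<integral>w. ?F \<xi> x w \<partial>lborel) = (\<lambda>x. exp (- (\<i> * of_real (x \<bullet> \<xi>))) * f x * ft g (- \<xi>))"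
  proof
    fix x
    have "(\<integral>w. ?F \<xi> x w \<partial>lborel) = (\<integral>w. ?F \<xi> x (x - w) \<partial>lborel)"
      by (rule integral_reflect[symmetric]) measurable
    also have "(\<lambda>w. ?F \<xi> x (x - w)) = (\<lambda>w. exp (- (\<i> * of_real (x \<bullet> \<xi>))) * f x * (exp (- (\<i> * of_real (w \<bullet> (- \<xi>)))) * g w))"
      by (rule ext) (simp add: inner_diff_left ring_distribs exp_add exp_minus exp_diff field_simps)
    finally show "(\<integral>w. ?F \<xi> x w \<partial>lborel) = exp (- (\<i> * of_real (x \<bullet> \<xi>))) * f x * ft g (- \<xi>)"
      unfolding ft_def by simp
  qed
  also have "(\<integral>x. exp (- (\<i> * of_real (x \<bullet> \<xi>))) * f x * ft g (- \<xi>) \<partial>lborel) = ft f \<xi> * ft g (- \<xi>)"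
    unfolding ft_def[of f] by simp
  finally show "ft (corr f g) \<xi> = ft f \<xi> * ft g (- \<xi>)" .
qed

lemma heat_minus [simp]: "heat t (- w) = heat t w"
  by (simp add: heat_def)

text \<open>Parseval's formula for the Gaussian multiplier, by Fubini. The transform
  \<open>ft\<close> carries no normalising factor, so powers of 2 pi are kept explicit here and in
  all later bounds.\<close>

lemma integral_heat_mult:
  fixes c :: "'a::euclidean_space \<Rightarrow> complex"
  assumes t: "Re t > 0" and c: "integrable lborel c"
  shows "(2 * of_real pi) ^ DIM('a) * (\<integral>w. heat t w * c w \<partial>lborel)
    = (\<integral>\<xi>. exp (- (t * of_real ((norm \<xi>)\<^sup>2))) * ft c \<xi> \<partial>lborel)"
proof -
  have [measurable]: "c \<in> borel_measurable borel" using c by auto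
  let ?F = "\<lambda>w \<xi>. c w * (exp (- (t * of_real ((norm \<xi>)\<^sup>2))) * exp (\<i> * of_real ((- w) \<bullet> \<xi>)))"
  have int: "integrable lborel (\<lambda>\<xi>::'a. exp (- (Re t * (norm \<xi>)\<^sup>2)))"
    by (rule integrable_exp_norm_square[OF t])
  have n: "norm (?F w \<xi>) = cmod (c w) * exp (- (Re t * (norm \<xi>)\<^sup>2))" for w \<xi>
    by (simp add: norm_mult flip: of_real_power)
  have Fub: "integrable (lborel \<Otimes>\<^sub>M lborel) (\<lambda>(w, \<xi>). ?F w \<xi>)"
  proof (rule lborel_pair.Fubini_integrable)
    show "AE w in lborel. integrable lborel (\<lambda>\<xi>. case (w, \<xi>) of (w, \<xi>) \<Rightarrow> ?F w \<xi>)"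
      unfolding prod.case by (intro AE_I2 integrable_mult_right integrable_gaussian t)
    show "integrable lborel (\<lambda>w. \<integral>\<xi>. norm (case (w, \<xi>) of (w, \<xi>) \<Rightarrow> ?F w \<xi>) \<partial>lborel)"
      unfolding prod.case n using c by auto
  qed measurable
  have "(2 * of_real pi) ^ DIM('a) * (\<integral>w. heat t w * c w \<partial>lborel) = (\<integral>w. c w * ((2 * of_real pi) ^ DIM('a) * heat t (- w)) \<partial>lborel)"
    by (subst integral_mult_right_zero[symmetric]) (simp add: mult_ac)
  also have "\<dots> = (\<integral>w. \<integral>\<xi>. ?F w \<xi> \<partial>lborel \<partial>lborel)"
    unfolding gaussian_integral_heat[OF t, symmetric] by simp
  also have "\<dots> = (\<integral>\<xi>. \<integral>w. ?F w \<xi> \<partial>lborel \<partial>lborel)"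
    by (rule lborel_pair.Fubini_integral[OF Fub, symmetric])
  also have "\<dots> = (\<integral>\<xi>. exp (- (t * of_real ((norm \<xi>)\<^sup>2))) * ft c \<xi> \<partial>lborel)"
    unfolding ft_def by (subst integral_mult_right_zero[symmetric]) (simp add: mult_ac)
  finally show ?thesis .
qed

lemma ft_cnj: "ft (\<lambda>x. cnj (f x)) (- \<xi>) = cnj (ft f \<xi>)"
proof -
  have "exp (- (\<i> * of_real (x \<bullet> - \<xi>))) * cnj (f x) = cnj (exp (- (\<i> * of_real (x \<bullet> \<xi>))) * f x)" for x
    by (simp add: exp_cnj)
  then show ?thesis unfolding ft_def by (simp only: Bochner_Integration.integral_cnj)
qed

text \<open>The inequality in Plancherel's theorem. The Gaussian-weighted integral of |ft f|^2
  equals, up to a power of 2 pi, the average of the autocorrelation of \<open>f\<close> against a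
  probability density, and Fatou's lemma removes the weight.\<close>

lemma
  fixes f :: "'a::euclidean_space \<Rightarrow> complex"
  assumes f: "integrable lborel f" "L2 f"
  shows L2_ft: "L2 (ft f)"
    and norm2_ft_le: "(norm2 (ft f))\<^sup>2 \<le> (2 * pi) ^ DIM('a) * (norm2 f)\<^sup>2"
proof -
  have [measurable]: "f \<in> borel_measurable borel" using f by auto
  let ?g = "\<lambda>x. cnj (f x)"
  have g: "integrable lborel ?g" "L2 ?g" "norm2 ?g = norm2 f"
    using f by (auto simp: L2_def norm2_def)
  \<comment> \<open>The autocorrelation of \<open>f\<close>: its transform is the nonnegative
    function |ft f|^2, and it is bounded by the squared norm of \<open>f\<close>.\<close>
  define c where "c = corr f ?g"
  have c: "integrable lborel c" "\<And>w. cmod (c w) \<le> (norm2 f)\<^sup>2" "\<And>\<xi>. ft c \<xi> = of_real ((cmod (ft f \<xi>))\<^sup>2)"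
    using integrable_corr[OF f(1) g(1)] cmod_corr_le[OF f(2) g(2)] ft_corr[OF f(1) g(1)]
    by (auto simp: c_def g(3) power2_eq_square ft_cnj simp flip: complex_norm_square)
  have [measurable]: "c \<in> borel_measurable borel" using c by auto
  define C where "C = (2 * pi) ^ DIM('a) * (norm2 f)\<^sup>2"
  have main: "(\<integral>\<^sup>+\<xi>. ennreal (exp (- (s * (norm \<xi>)\<^sup>2)) * (cmod (ft f \<xi>))\<^sup>2) \<partial>lborel) \<le> ennreal C" if s: "s > 0" for s
  proof -
    let ?h = "\<lambda>\<xi>::'a. exp (- (s * (norm \<xi>)\<^sup>2)) * (cmod (ft f \<xi>))\<^sup>2"
    have hc: "exp (- (of_real s * of_real ((norm \<xi>)\<^sup>2))) * ft c \<xi> = complex_of_real (?h \<xi>)" for \<xi>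
      unfolding c(3) by (simp flip: exp_of_real)
    have bf: "cmod (ft f \<xi>) \<le> (\<integral>x. cmod (f x) \<partial>lborel)" for \<xi>
      unfolding ft_def by (rule order_trans[OF integral_norm_bound]) (simp add: norm_mult)
    have inth: "integrable lborel ?h"
    proof (rule Bochner_Integration.integrable_bound)
      show "integrable lborel (\<lambda>\<xi>::'a. exp (- (s * (norm \<xi>)\<^sup>2)) * (\<integral>x. cmod (f x) \<partial>lborel)\<^sup>2)"
        using integrable_exp_norm_square[OF s] by auto
      show "AE \<xi> in lborel. norm (?h \<xi>) \<le> norm (exp (- (s * (norm \<xi>)\<^sup>2)) * (\<integral>x. cmod (f x) \<partial>lborel)\<^sup>2)"
        using bf by (auto intro!: mult_left_mono power_mono)
    qed measurable
    have "complex_of_real (\<integral>\<xi>. ?h \<xi> \<partial>lborel) = (2 * of_real pi) ^ DIM('a) * (\<integral>w. heat (of_real s) w * c w \<partial>lborel)"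
      using integral_heat_mult[of "of_real s" c] s c(1) unfolding hc integral_complex_of_real by simp
    then have "cmod (complex_of_real (\<integral>\<xi>. ?h \<xi> \<partial>lborel)) = cmod ((2 * of_real pi) ^ DIM('a) * (\<integral>w. heat (of_real s) w * c w \<partial>lborel))"
      by simp
    then have "\<bar>\<integral>\<xi>. ?h \<xi> \<partial>lborel\<bar> = (2 * pi) ^ DIM('a) * cmod (\<integral>w. heat (of_real s) w * c w \<partial>lborel)"
      by (simp add: norm_mult norm_power)
    also have "cmod (\<integral>w. heat (of_real s) w * c w \<partial>lborel) \<le> (\<integral>w. cmod (heat (of_real s) w) * (norm2 f)\<^sup>2 \<partial>(lborel::'a measure))"
    proof (rule order_trans[OF integral_norm_bound integral_mono])
      have h: "integrable lborel (\<lambda>w::'a. cmod (heat (of_real s) w))"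
        using integrable_heat[of "of_real s"] s by auto
      then show "integrable lborel (\<lambda>w::'a. cmod (heat (of_real s) w) * (norm2 f)\<^sup>2)" by auto
      show "norm (heat (of_real s) w * c w) \<le> cmod (heat (of_real s) w) * (norm2 f)\<^sup>2" for w
        by (simp add: norm_mult mult_left_mono c(2))
      show "integrable lborel (\<lambda>w. norm (heat (of_real s) w * c w))"
        by (rule Bochner_Integration.integrable_bound[OF \<open>integrable lborel (\<lambda>w::'a. cmod (heat (of_real s) w) * (norm2 f)\<^sup>2)\<close>])
          (auto simp: norm_mult intro!: mult_left_mono c(2))
    qed
    also have "(\<integral>w. cmod (heat (of_real s) w) * (norm2 f)\<^sup>2 \<partial>(lborel::'a measure)) = (norm2 f)\<^sup>2"
    proof -
      \<comment> \<open>At a real time the heat kernel is nonnegative, so its L^1 norm is its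
        integral, which is 1.\<close>
      have pos: "heat (of_real s) w = of_real (cmod (heat (of_real s) w))" for w :: 'a
        unfolding heat_def using s by (simp add: csqrt_of_real norm_mult norm_power norm_divide flip: exp_of_real)
      have "complex_of_real (\<integral>w. cmod (heat (of_real s) w) \<partial>(lborel::'a measure)) = (\<integral>w. heat (of_real s) w \<partial>(lborel::'a measure))"
        using pos by (simp flip: integral_complex_of_real)
      also have "\<dots> = 1" using s by (intro integral_heat) simp
      finally have "(\<integral>w. cmod (heat (of_real s) w) \<partial>(lborel::'a measure)) = 1" by (metis of_real_eq_1_iff)
      then show ?thesis by simp
    qed
    finally have "(\<integral>\<xi>. ?h \<xi> \<partial>lborel) \<le> C"
      unfolding C_def by (simp add: mult_left_mono)
    then show ?thesis
      using inth by (subst nn_integral_eq_integral) (auto simp: ennreal_leI)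
  qed
  \<comment> \<open>The weights with s = 1/(n + 1) tend to 1 pointwise, and Fatou's lemma preserves
    the uniform bound \<open>C\<close>.\<close>
  have "(\<integral>\<^sup>+\<xi>. ennreal ((cmod (ft f \<xi>))\<^sup>2) \<partial>lborel)
      = (\<integral>\<^sup>+\<xi>. liminf (\<lambda>n. ennreal (exp (- (1 / real (Suc n) * (norm \<xi>)\<^sup>2)) * (cmod (ft f \<xi>))\<^sup>2)) \<partial>lborel)"
  proof (intro nn_integral_cong lim_imp_Liminf[symmetric] tendsto_ennrealI)
    fix \<xi> :: 'a
    have "(\<lambda>n. exp (- (1 / real (Suc n) * (norm \<xi>)\<^sup>2)) * (cmod (ft f \<xi>))\<^sup>2) \<longlonglongrightarrow> exp (- (0 * (norm \<xi>)\<^sup>2)) * (cmod (ft f \<xi>))\<^sup>2"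
      by (intro tendsto_intros LIMSEQ_Suc[OF lim_1_over_n])
    then show "(\<lambda>n. exp (- (1 / real (Suc n) * (norm \<xi>)\<^sup>2)) * (cmod (ft f \<xi>))\<^sup>2) \<longlonglongrightarrow> (cmod (ft f \<xi>))\<^sup>2"
      by simp
  qed simp
  also have "\<dots> \<le> liminf (\<lambda>n. \<integral>\<^sup>+\<xi>. ennreal (exp (- (1 / real (Suc n) * (norm \<xi>)\<^sup>2)) * (cmod (ft f \<xi>))\<^sup>2) \<partial>lborel)"
    by (rule nn_integral_liminf) measurable
  also have "\<dots> \<le> limsup (\<lambda>n. \<integral>\<^sup>+\<xi>. ennreal (exp (- (1 / real (Suc n) * (norm \<xi>)\<^sup>2)) * (cmod (ft f \<xi>))\<^sup>2) \<partial>lborel)"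
    by (rule Liminf_le_Limsup) simp
  also have "\<dots> \<le> ennreal C"
    by (intro Limsup_bounded always_eventually allI main) simp
  finally have le: "(\<integral>\<^sup>+\<xi>. ennreal ((cmod (ft f \<xi>))\<^sup>2) \<partial>lborel) \<le> ennreal C" .
  have int: "integrable lborel (\<lambda>\<xi>. (cmod (ft f \<xi>))\<^sup>2)"
    by (rule integrableI_bounded) (use le le_less_trans in \<open>auto simp: less_top[symmetric] top_unique\<close>)
  then show "L2 (ft f)" unfolding L2_def by simp
  have "C \<ge> 0" by (simp add: C_def)
  then show "(norm2 (ft f))\<^sup>2 \<le> (2 * pi) ^ DIM('a) * (norm2 f)\<^sup>2"
    using le int unfolding norm2_power2[of "ft f"] C_def[symmetric]
    by (subst (asm) nn_integral_eq_integral) auto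
qed

lemma L2_reflect: "L2 f \<Longrightarrow> L2 (\<lambda>x. f (- x))"
  and norm2_reflect: "L2 f \<Longrightarrow> norm2 (\<lambda>x. f (- x)) = norm2 f"
  for f :: "'a::euclidean_space \<Rightarrow> complex"
  using integrable_reflect_iff[of "\<lambda>x. (cmod (f x))\<^sup>2" 0] integral_reflect[of "\<lambda>x. (cmod (f x))\<^sup>2" 0]
  by (auto simp: L2_def norm2_def)

text \<open>Cauchy-Schwarz on the Fourier side. Each transform costs the square root of (2 pi)^d,
  which together give the factor in the bound.\<close>

lemma
  fixes f g :: "'a::euclidean_space \<Rightarrow> complex"
  assumes f: "integrable lborel f" "L2 f" and g: "integrable lborel g" "L2 g"
    and m [measurable]: "m \<in> borel_measurable borel" and M: "\<And>\<xi>. cmod (m \<xi>) \<le> M"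
  shows integrable_multiplier: "integrable lborel (\<lambda>\<xi>. m \<xi> * (ft f \<xi> * ft g (- \<xi>)))"
    and multiplier_bound: "cmod (\<integral>\<xi>. m \<xi> * (ft f \<xi> * ft g (- \<xi>)) \<partial>lborel) \<le> M * (2 * pi) ^ DIM('a) * (norm2 f * norm2 g)"
proof -
  have [measurable]: "f \<in> borel_measurable borel" "g \<in> borel_measurable borel" using f g by auto
  note F = L2_ft[OF f] and G = L2_reflect[OF L2_ft[OF g]]
  have M0: "M \<ge> 0" using M[of 0] norm_ge_zero order_trans by blast
  let ?P = "\<lambda>\<xi>. M * cmod (ft f \<xi> * ft g (- \<xi>))"
  have P: "integrable lborel ?P"
    using integrable_L2_mult[OF F G] by auto
  have le: "cmod (m \<xi> * (ft f \<xi> * ft g (- \<xi>))) \<le> ?P \<xi>" for \<xi>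
    using M by (simp add: norm_mult mult_right_mono)
  show int: "integrable lborel (\<lambda>\<xi>. m \<xi> * (ft f \<xi> * ft g (- \<xi>)))"
  proof (rule Bochner_Integration.integrable_bound[OF P])
    show "AE \<xi> in lborel. norm (m \<xi> * (ft f \<xi> * ft g (- \<xi>))) \<le> norm (?P \<xi>)"
      unfolding real_norm_def by (intro AE_I2 order_trans[OF le abs_ge_self])
  qed measurable
  have pp: "0 \<le> (2 * pi) ^ DIM('a)" by simp
  have sq: "norm2 (ft h) \<le> sqrt ((2 * pi) ^ DIM('a)) * norm2 h" if "integrable lborel h" "L2 h" for h :: "'a \<Rightarrow> complex"
  proof (rule power2_le_imp_le)
    show "(norm2 (ft h))\<^sup>2 \<le> (sqrt ((2 * pi) ^ DIM('a)) * norm2 h)\<^sup>2"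
      using norm2_ft_le[OF that] by (simp only: power_mult_distrib[of "sqrt _"] real_sqrt_pow2[OF pp])
    show "0 \<le> sqrt ((2 * pi) ^ DIM('a)) * norm2 h"
      using pp by (intro mult_nonneg_nonneg real_sqrt_ge_zero) auto
  qed
  have "cmod (\<integral>\<xi>. m \<xi> * (ft f \<xi> * ft g (- \<xi>)) \<partial>lborel) \<le> (\<integral>\<xi>. ?P \<xi> \<partial>lborel)"
    by (rule order_trans[OF integral_norm_bound integral_mono[OF integrable_norm[OF int] P le]])
  also have "\<dots> \<le> M * (norm2 (ft f) * norm2 (ft g))"
    using norm_integral_L2_le[OF F G] M0 by (simp add: norm2_reflect[OF L2_ft[OF g]] mult_left_mono)
  also have "\<dots> \<le> M * ((sqrt ((2 * pi) ^ DIM('a)) * norm2 f) * (sqrt ((2 * pi) ^ DIM('a)) * norm2 g))"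
    using pp by (intro mult_left_mono mult_mono sq f g M0 mult_nonneg_nonneg real_sqrt_ge_zero norm2_nonneg)
  also have "\<dots> = M * (2 * pi) ^ DIM('a) * (norm2 f * norm2 g)"
    unfolding mult.assoc mult.left_commute[of "norm2 f"] mult.assoc[of "sqrt _" "sqrt _", symmetric] real_sqrt_mult_self
    using pp by simp
  finally show "cmod (\<integral>\<xi>. m \<xi> * (ft f \<xi> * ft g (- \<xi>)) \<partial>lborel) \<le> M * (2 * pi) ^ DIM('a) * (norm2 f * norm2 g)" .
qed

section \<open>Complex powers of positive reals and the Gamma integral\<close>

text \<open>The power s^z without the case distinction of \<open>powr\<close> at 0: one expression,
  entire in \<open>z\<close> and measurable in both arguments. Wherever it is used with s \<le> 0,
  an indicator or a case distinction discards the value.\<close>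

definition cpw :: "real \<Rightarrow> complex \<Rightarrow> complex" where
  "cpw s z = exp (z * of_real (ln s))"

lemma cpw_measurable [measurable (raw)]:
  "f \<in> borel_measurable M \<Longrightarrow> g \<in> borel_measurable M \<Longrightarrow> (\<lambda>x. cpw (f x) (g x)) \<in> borel_measurable M"
  unfolding cpw_def
  by (intro measurable_compose[OF _ borel_measurable_exp] borel_measurable_times
      measurable_compose[OF borel_measurable_ln borel_measurable_of_real])

lemma norm_cpw: "s > 0 \<Longrightarrow> cmod (cpw s z) = s powr Re z"
  by (simp add: cpw_def powr_def)

lemma powr_eq_cpw: "s > 0 \<Longrightarrow> of_real s powr z = cpw s z"
  by (simp add: cpw_def powr_def Ln_of_real)

lemma cpw_add: "cpw s (z + w) = cpw s z * cpw s w"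
  by (simp add: cpw_def ring_distribs exp_add)

lemma cpw_one: "s > 0 \<Longrightarrow> cpw s 1 = of_real s"
  by (simp add: cpw_def exp_of_real)

lemma cpw_of_real: "s > 0 \<Longrightarrow> cpw s (of_real x) = of_real (s powr x)"
  unfolding cpw_def powr_def of_real_mult[symmetric] exp_of_real by simp

lemma cpw_mult: "s > 0 \<Longrightarrow> t > 0 \<Longrightarrow> cpw (s * t) z = cpw s z * cpw t z"
  by (simp add: cpw_def ln_mult ring_distribs exp_add)

lemma holomorphic_on_cpw [holomorphic_intros]:
  "f holomorphic_on S \<Longrightarrow> (\<lambda>z. cpw s (f z)) holomorphic_on S"
  unfolding cpw_def by (intro holomorphic_intros)

lemma integrable_gamma_bound:
  fixes \<sigma> \<kappa> :: real
  assumes "\<sigma> > 0" "\<kappa> > 0"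
  shows "integrable lborel (\<lambda>s. indicator {0<..} s *\<^sub>R (s powr (\<sigma> - 1) * exp (- (\<kappa> * s))))"
proof -
  let ?f = "\<lambda>t. complex_of_real t powr (of_real \<sigma> - 1) / of_real (exp (\<kappa> * t))"
  let ?g = "\<lambda>s. indicator {0<..} s *\<^sub>R (s powr (\<sigma> - 1) * exp (- (\<kappa> * s)))"
  have "integrable lebesgue (\<lambda>x. indicator {0<..} x *\<^sub>R ?f x)"
    using absolutely_integrable_Gamma_integral[of "of_real \<sigma>" \<kappa>] assms by (simp add: set_integrable_def)
  then have "integrable lebesgue (\<lambda>x. norm (indicator {0<..} x *\<^sub>R ?f x))"
    by (rule integrable_norm)
  also have "(\<lambda>x. norm (indicator {0<..} x *\<^sub>R ?f x)) = ?g"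
  proof
    fix x
    show "norm (indicator {0<..} x *\<^sub>R ?f x) = ?g x"
      by (cases "x > 0") (auto simp: norm_divide norm_powr_real_powr exp_minus field_simps)
  qed
  finally have "integrable lebesgue ?g" .
  then show ?thesis
    by (subst (asm) integrable_completion) auto
qed

text \<open>The subordination formula: b^(-\<zeta>) is an average of exp(-s b). It is Euler's
  integral at b = 1, follows for b > 0 by scaling, and extends to the half-plane by analytic
  continuation in \<open>b\<close>.\<close>

lemma
  assumes \<zeta>: "Re \<zeta> > 0" and b: "Re b > 0"
  shows integrable_gamma: "integrable lborel (\<lambda>s. indicator {0<..} s *\<^sub>R (cpw s (\<zeta> - 1) * exp (- (of_real s * b))))"
    and gamma_integral: "(\<integral>s. indicator {0<..} s *\<^sub>R (cpw s (\<zeta> - 1) * exp (- (of_real s * b))) \<partial>lborel) = Gamma \<zeta> * b powr (- \<zeta>)"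
proof -
  let ?h = "\<lambda>b s. indicator {0<..} s *\<^sub>R (cpw s (\<zeta> - 1) * exp (- (of_real s * b)))"
  have n: "norm (?h b s) = indicator {0<..} s *\<^sub>R (s powr (Re \<zeta> - 1) * exp (- (Re b * s)))" for b s
    by (auto simp: indicator_def norm_mult norm_cpw mult.commute)
  have int: "integrable lborel (?h b)" if "Re b > 0" for b
    by (rule Bochner_Integration.integrable_bound[OF integrable_gamma_bound[OF \<zeta> that]])
      (measurable, simp only: n real_norm_def abs_ge_self AE_I2)
  show "integrable lborel (?h b)" using int b .
  have one: "(\<integral>s. ?h 1 s \<partial>lborel) = Gamma \<zeta>"
  proof -
    have eq: "?h 1 = (\<lambda>s. indicator {0<..} s *\<^sub>R (of_real s powr (\<zeta> - 1) / of_real (exp s)))"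
      by (rule ext) (auto simp: indicator_def powr_eq_cpw exp_minus exp_of_real field_simps)
    have "(\<integral>s. ?h 1 s \<partial>lborel) = (\<integral>s. ?h 1 s \<partial>lebesgue)"
      by (rule integral_completion[symmetric]) measurable
    also have "\<dots> = integral {0<..} (\<lambda>s. of_real s powr (\<zeta> - 1) / of_real (exp s))"
      unfolding eq using set_lebesgue_integral_eq_integral(2)[OF absolutely_integrable_Gamma_integral'[OF \<zeta>]]
      by (simp add: set_lebesgue_integral_def)
    also have "\<dots> = Gamma \<zeta>" using Gamma_integral_complex'[OF \<zeta>] by (simp add: has_integral_iff)
    finally show ?thesis .
  qed
  show "(\<integral>s. ?h b s \<partial>lborel) = Gamma \<zeta> * b powr (- \<zeta>)"
  proof (rule halfplane_eqI[OF _ _ _ b])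
    show "(\<lambda>b. \<integral>s. ?h b s \<partial>lborel) holomorphic_on {z. Re z > 0}"
    proof (rule holomorphic_on_integral[OF open_halfspace_Re_gt])
      fix z assume z: "z \<in> {z. Re z > 0}"
      show "\<exists>e>0. \<exists>B. integrable lborel B \<and> cball z e \<subseteq> {z. Re z > 0} \<and>
        (\<forall>w\<in>cball z e. \<forall>x\<in>space lborel. norm (?h w x) \<le> B x)"
      proof (intro exI[of _ "Re z / 2"] exI[of _ "\<lambda>s. indicator {0<..} s *\<^sub>R (s powr (Re \<zeta> - 1) * exp (- (Re z / 2 * s)))"] conjI ballI)
        show "0 < Re z / 2" using z by simp
        show "integrable lborel (\<lambda>s. indicator {0<..} s *\<^sub>R (s powr (Re \<zeta> - 1) * exp (- (Re z / 2 * s))))"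
          using z \<zeta> by (intro integrable_gamma_bound) auto
        have Re: "Re z / 2 \<le> Re w" if "w \<in> cball z (Re z / 2)" for w
          using that abs_Re_le_cmod[of "z - w"] by (auto simp: dist_norm)
        show "cball z (Re z / 2) \<subseteq> {z. Re z > 0}" using Re z by force
        show "norm (?h w s) \<le> indicator {0<..} s *\<^sub>R (s powr (Re \<zeta> - 1) * exp (- (Re z / 2 * s)))"
          if "w \<in> cball z (Re z / 2)" for w s
          unfolding n using Re[OF that] by (auto simp: indicator_def intro!: mult_left_mono mult_right_mono)
      qed
    qed (auto intro!: holomorphic_intros)
    show "(\<lambda>b. Gamma \<zeta> * b powr - \<zeta>) holomorphic_on {z. 0 < Re z}"
      by (intro holomorphic_intros) (auto simp: complex_nonpos_Reals_iff)
    fix x :: real assume x: "x > 0"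
    have "(\<integral>s. ?h (of_real x) s \<partial>lborel) = \<bar>1/x\<bar> *\<^sub>R (\<integral>s. ?h (of_real x) (0 + 1/x * s) \<partial>lborel)"
      using x by (intro lborel_integral_real_affine) auto
    also have "(\<lambda>s. ?h (of_real x) (0 + 1/x * s)) = (\<lambda>s. cpw (1/x) (\<zeta> - 1) * ?h 1 s)"
    proof
      fix s
      show "?h (of_real x) (0 + 1/x * s) = cpw (1/x) (\<zeta> - 1) * ?h 1 s"
        using x cpw_mult[of "1/x" s "\<zeta> - 1"] by (cases "s > 0") (auto simp: indicator_def zero_less_divide_iff)
    qed
    also have "(\<integral>s. cpw (1/x) (\<zeta> - 1) * ?h 1 s \<partial>lborel) = cpw (1/x) (\<zeta> - 1) * Gamma \<zeta>"
      using one by (simp only: integral_mult_right_zero)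
    also have "\<bar>1/x\<bar> *\<^sub>R (cpw (1/x) (\<zeta> - 1) * Gamma \<zeta>) = Gamma \<zeta> * of_real x powr (- \<zeta>)"
    proof -
      have "complex_of_real (1/x) * cpw (1/x) (\<zeta> - 1) = cpw (1/x) \<zeta>"
        using x cpw_one[of "1/x"] cpw_add[of "1/x" 1 "\<zeta> - 1"] by simp
      also have "\<dots> = of_real x powr (- \<zeta>)"
        using x by (simp add: powr_eq_cpw) (simp add: cpw_def ln_div)
      finally have "complex_of_real (1/x) * cpw (1/x) (\<zeta> - 1) = of_real x powr (- \<zeta>)" .
      moreover have "\<bar>1/x\<bar> *\<^sub>R (cpw (1/x) (\<zeta> - 1) * Gamma \<zeta>) = Gamma \<zeta> * (complex_of_real (1/x) * cpw (1/x) (\<zeta> - 1))"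
        using x by (simp add: scaleR_conv_of_real)
      ultimately show ?thesis by (simp only:)
    qed
    finally show "(\<integral>s. ?h (of_real x) s \<partial>lborel) = Gamma \<zeta> * of_real x powr (- \<zeta>)" .
  qed
qed

text \<open>The modulus of s^(\<zeta> - 1) depends on Re \<zeta> only, so Euler's integral bounds
  \<open>Gamma\<close> on a whole vertical line by its value on the real axis.\<close>

lemma norm_Gamma_le:
  assumes "Re \<zeta> > 0"
  shows "cmod (Gamma \<zeta>) \<le> Gamma (Re \<zeta>)"
proof -
  have pos: "Re (complex_of_real (Re \<zeta>)) > 0" using assms by simp
  have "cmod (Gamma \<zeta>) = cmod (\<integral>s. indicator {0<..} s *\<^sub>R (cpw s (\<zeta> - 1) * exp (- (of_real s * 1))) \<partial>lborel)"
    using gamma_integral[OF assms, of 1] by simp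
  also have "\<dots> \<le> (\<integral>s. norm (indicator {0<..} s *\<^sub>R (cpw s (\<zeta> - 1) * exp (- (of_real s * 1)))) \<partial>lborel)"
    by (rule integral_norm_bound)
  also have "\<dots> = (\<integral>s. norm (indicator {0<..} s *\<^sub>R (cpw s (of_real (Re \<zeta>) - 1) * exp (- (of_real s * 1)))) \<partial>lborel)"
    by (intro Bochner_Integration.integral_cong) (auto simp: indicator_def norm_mult norm_cpw)
  finally have le: "cmod (Gamma \<zeta>) \<le> (\<integral>s. norm (indicator {0<..} s *\<^sub>R (cpw s (of_real (Re \<zeta>) - 1) * exp (- (of_real s * 1)))) \<partial>lborel)" .
  have "complex_of_real (\<integral>s. norm (indicator {0<..} s *\<^sub>R (cpw s (of_real (Re \<zeta>) - 1) * exp (- (of_real s * 1)))) \<partial>lborel)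
    = (\<integral>s. indicator {0<..} s *\<^sub>R (cpw s (of_real (Re \<zeta>) - 1) * exp (- (of_real s * 1))) \<partial>lborel)"
    unfolding integral_complex_of_real[symmetric]
  proof (intro Bochner_Integration.integral_cong refl)
    fix s :: real
    have "cpw s (of_real (Re \<zeta>) - 1) = of_real (s powr (Re \<zeta> - 1))" if "s > 0"
      using cpw_of_real[OF that, of "Re \<zeta> - 1"] by simp
    then show "complex_of_real (norm (indicator {0<..} s *\<^sub>R (cpw s (of_real (Re \<zeta>) - 1) * exp (- (of_real s * 1)))))
      = indicator {0<..} s *\<^sub>R (cpw s (of_real (Re \<zeta>) - 1) * exp (- (of_real s * 1)))"
      by (auto simp: indicator_def norm_mult exp_of_real[symmetric] simp flip: of_real_minus)
  qed
  also have "\<dots> = of_real (Gamma (Re \<zeta>))"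
    using gamma_integral[OF pos, of 1] by (simp add: Gamma_complex_of_real)
  finally show ?thesis using le by (metis of_real_eq_iff)
qed

section \<open>An oscillatory integral over the half line\<close>

text \<open>Integration by parts without a second integral: \<open>F\<close> is an approximate
  primitive of \<open>f\<close>, and the increment of \<psi> bounds the accumulated error. The mean
  value inequality is applied to the primitive of \<open>f\<close> minus \<open>F\<close>.\<close>

lemma norm_integral_comparison:
  fixes f F F' :: "real \<Rightarrow> complex" and \<psi> \<psi>' :: "real \<Rightarrow> real"
  assumes xy: "x < y" and f: "continuous_on {x..y} f"
    and F: "\<And>s. s \<in> {x..y} \<Longrightarrow> (F has_vector_derivative F' s) (at s)"
    and \<psi>: "\<And>s. s \<in> {x..y} \<Longrightarrow> (\<psi> has_real_derivative \<psi>' s) (at s)"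
    and le: "\<And>s. s \<in> {x..y} \<Longrightarrow> norm (f s - F' s) \<le> \<psi>' s"
  shows "norm (integral {x..y} f) \<le> norm (F y) + norm (F x) + (\<psi> y - \<psi> x)"
proof -
  let ?\<Phi> = "\<lambda>u. integral {x..u} f"
  have \<Phi>: "(?\<Phi> has_vector_derivative f s) (at s within {x..y})" if "s \<in> {x..y}" for s
    using integral_has_vector_derivative[OF f that] .
  have cont: "continuous_on {x..y} F" "continuous_on {x..y} \<psi>" "continuous_on {x..y} ?\<Phi>"
    using F \<psi> \<Phi> by (meson continuous_at_imp_continuous_on has_vector_derivative_continuous DERIV_isCont
        continuous_on_eq_continuous_within)+
  have "norm ((?\<Phi> y - F y) - (?\<Phi> x - F x)) \<le> \<psi> y - \<psi> x"
  proof (rule differentiable_bound_general[OF xy])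
    show "continuous_on {x..y} (\<lambda>u. ?\<Phi> u - F u)" "continuous_on {x..y} \<psi>"
      using cont by (auto intro: continuous_intros)
    fix s assume s: "x < s" "s < y"
    show "((\<lambda>u. ?\<Phi> u - F u) has_vector_derivative (f s - F' s)) (at s)"
      using \<Phi>[of s] F[of s] s by (intro has_vector_derivative_diff) (auto simp: at_within_Icc_at)
    show "(\<psi> has_vector_derivative \<psi>' s) (at s)"
      using \<psi>[of s] s by (simp add: has_real_derivative_iff_has_vector_derivative)
    show "norm (f s - F' s) \<le> \<psi>' s" using le s by simp
  qed
  then show ?thesis
    using norm_triangle_ineq4[of "?\<Phi> y - F y + F x" "F x - F y"]
      norm_triangle_ineq4[of "F x" "F y"] by (simp add: algebra_simps)
qed

text \<open>Dominated convergence along [1/(n + 1), n]. It reduces the Lebesgue integral to bounds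
  on compact intervals that are uniform in the endpoints, where \<open>f\<close> is continuous and
  calculus applies.\<close>

lemma norm_integral_pos_le:
  fixes f :: "real \<Rightarrow> complex"
  assumes f: "integrable lborel (\<lambda>s. indicator {0<..} s *\<^sub>R f s)" and cont: "continuous_on {0<..} f" and pl: "0 < pl"
    and le: "\<And>p q. 0 < p \<Longrightarrow> p < pl \<Longrightarrow> qr < q \<Longrightarrow> norm (integral {p..q} f) \<le> C"
  shows "norm (\<integral>s. indicator {0<..} s *\<^sub>R f s \<partial>lborel) \<le> C"
proof -
  let ?g = "\<lambda>s. indicator {0<..} s *\<^sub>R f s"
  have [measurable]: "?g \<in> borel_measurable borel" using f by auto
  define p where "p n = 1 / real (Suc n)" for n
  define q where "q n = real n" for n
  have lim: "(\<lambda>n. \<integral>s. indicator {p n..q n} s *\<^sub>R ?g s \<partial>lborel) \<longlonglongrightarrow> (\<integral>s. ?g s \<partial>lborel)"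
  proof (rule integral_dominated_convergence[where w="\<lambda>s. norm (?g s)"])
    show "AE s in lborel. (\<lambda>n. indicator {p n..q n} s *\<^sub>R ?g s) \<longlonglongrightarrow> ?g s"
    proof (rule AE_I2)
      fix s :: real
      show "(\<lambda>n. indicator {p n..q n} s *\<^sub>R ?g s) \<longlonglongrightarrow> ?g s"
      proof (cases "s > 0")
        case True
        have "\<forall>\<^sub>F n in sequentially. p n < s"
          using LIMSEQ_Suc[OF lim_1_over_n[where 'a=real]] True unfolding p_def by (auto intro: order_tendstoD)
        moreover have "\<forall>\<^sub>F n in sequentially. s \<le> q n"
          unfolding q_def by (rule eventually_sequentiallyI[of "nat \<lceil>s\<rceil>"]) linarith
        ultimately have "\<forall>\<^sub>F n in sequentially. indicator {p n..q n} s *\<^sub>R ?g s = ?g s"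
          by eventually_elim auto
        then show ?thesis by (rule tendsto_eventually)
      qed auto
    qed
    show "AE s in lborel. norm (indicator {p n..q n} s *\<^sub>R ?g s) \<le> norm (?g s)" for n
      by (auto simp: indicator_def)
    show "integrable lborel (\<lambda>s. norm (?g s))" using f by (rule integrable_norm)
  qed measurable
  have ev: "\<forall>\<^sub>F n in sequentially. norm (\<integral>s. indicator {p n..q n} s *\<^sub>R ?g s \<partial>lborel) \<le> C"
  proof -
    have "\<forall>\<^sub>F n in sequentially. p n < pl"
      using LIMSEQ_Suc[OF lim_1_over_n[where 'a=real]] pl unfolding p_def by (auto intro: order_tendstoD)
    moreover have "\<forall>\<^sub>F n in sequentially. qr < q n"
      unfolding q_def by (rule eventually_sequentiallyI[of "nat (\<lceil>qr\<rceil> + 1)"]) linarith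
    ultimately show ?thesis
    proof eventually_elim
      case (elim n)
      have pos: "p n > 0" by (simp add: p_def)
      have "(\<integral>s. indicator {p n..q n} s *\<^sub>R ?g s \<partial>lborel) = (LINT s:{p n..q n}|lborel. f s)"
        unfolding set_lebesgue_integral_def
        using pos by (intro Bochner_Integration.integral_cong) (auto simp: indicator_def)
      also have "\<dots> = integral {p n..q n} f"
        using pos by (intro set_borel_integral_eq_integral borel_integrable_atLeastAtMost' continuous_on_subset[OF cont]) auto
      finally show ?case using le[OF pos elim] by simp
    qed
  qed
  show ?thesis
    by (rule tendsto_upperbound[OF tendsto_norm[OF lim] ev]) simp
qed

lemma has_vector_derivative_cpw:
  assumes "s > 0"
  shows "((\<lambda>s. cpw s c) has_vector_derivative (c / of_real s * cpw s c)) (at s)"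
proof -
  have "((\<lambda>s. complex_of_real (ln s)) has_vector_derivative of_real (1 / s)) (at s)"
    using DERIV_ln_divide[OF assms] by (intro has_vector_derivative_of_real) (simp add: has_real_derivative_iff_has_vector_derivative)
  then have "((\<lambda>s. c * complex_of_real (ln s)) has_vector_derivative c * of_real (1 / s)) (at s)"
    by (rule has_vector_derivative_mult_right)
  from field_vector_diff_chain_at[OF this DERIV_exp] show ?thesis
    by (simp add: o_def cpw_def mult_ac)
qed

lemma has_vector_derivative_exp_phase:
  fixes k :: complex and a :: real
  assumes "s > 0"
  shows "((\<lambda>s. exp (- (k * of_real (s + a / s)))) has_vector_derivative
    (- (k * of_real (1 - a / s\<^sup>2)) * exp (- (k * of_real (s + a / s))))) (at s)"
proof -
  have "((\<lambda>s. s + a / s) has_real_derivative (1 - a / s\<^sup>2)) (at s)"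
    using assms by (auto intro!: derivative_eq_intros simp: power2_eq_square)
  then have "((\<lambda>s. complex_of_real (s + a / s)) has_vector_derivative of_real (1 - a / s\<^sup>2)) (at s)"
    by (intro has_vector_derivative_of_real) (simp add: has_real_derivative_iff_has_vector_derivative)
  then have "((\<lambda>s. - k * complex_of_real (s + a / s)) has_vector_derivative - k * of_real (1 - a / s\<^sup>2)) (at s)"
    by (rule has_vector_derivative_mult_right)
  from field_vector_diff_chain_at[OF this DERIV_exp] show ?thesis
    by (simp add: o_def mult_ac)
qed

text \<open>The phase is \<open>s + b\<^sup>2 / s = w\<^sup>2 + 2 b\<close> with \<open>w = sqrt s - b / sqrt s\<close>. The integral is estimated trivially
  where \<open>\<bar>w\<bar> \<le> \<rho> = \<bar>k\<bar> powr (-1/2)\<close> and by parts elsewhere; \<open>-1/w\<close> is monotone and dominates the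
  total variation of the amplitude.\<close>

lemma oscillatory_integral_bound:
  fixes k :: complex and b \<tau> :: real
  assumes k: "Re k > 0" and b: "b > 0"
    and int: "integrable lborel (\<lambda>s. indicator {0<..} s *\<^sub>R (cpw s (Complex (-1/2) \<tau>) * exp (- (k * of_real (s + b\<^sup>2 / s)))))"
  shows "norm (\<integral>s. indicator {0<..} s *\<^sub>R (cpw s (Complex (-1/2) \<tau>) * exp (- (k * of_real (s + b\<^sup>2 / s)))) \<partial>lborel)
    \<le> (20 + 4 * \<bar>\<tau>\<bar>) / sqrt (cmod k)"
proof -
  \<comment> \<open>The approximate primitive \<open>F\<close> is the amplitude over the derivative
    of the exponent: s^(-1/2 + i \<tau>) / (1 - b^2/s^2) = s^(3/2 + i \<tau>) / (s^2 - b^2), whence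
    the exponent 3/2. The derivative of this quotient leaves the error \<open>e\<close>, so F' = f -
    e.\<close>
  define c where "c = Complex (3/2) \<tau>"
  define f where "f s = cpw s (Complex (-1/2) \<tau>) * exp (- (k * of_real (s + b\<^sup>2 / s)))" for s
  define h where "h s = exp (- (k * complex_of_real (s + b\<^sup>2 / s)))" for s
  define F where "F s = - (1 / k) * (cpw s c * (of_real (1 / (s\<^sup>2 - b\<^sup>2)) * h s))" for s
  define e where "e s = 1 / k * ((c / of_real s * cpw s c) * of_real (1 / (s\<^sup>2 - b\<^sup>2)) + cpw s c * of_real (- (2 * s) / (s\<^sup>2 - b\<^sup>2)\<^sup>2)) * h s" for s
  define \<psi> where "\<psi> s = (7 + 2 * \<bar>\<tau>\<bar>) / cmod k * (- (sqrt s / (s - b)))" for s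
  define \<psi>' where "\<psi>' s = (7 + 2 * \<bar>\<tau>\<bar>) / cmod k * ((s + b) / (2 * sqrt s * (s - b)\<^sup>2))" for s
  have k0: "k \<noteq> 0" "cmod k > 0" using k by auto
  have contf: "continuous_on {0<..} f"
    unfolding f_def cpw_def by (intro continuous_intros) auto
  have h1: "cmod (h s) \<le> 1" if "s > 0" for s
  proof -
    have "0 \<le> Re k * (s + b\<^sup>2 / s)" using k that by simp
    then show ?thesis unfolding h_def by simp
  qed
  have cp: "cmod (cpw s c) = s * sqrt s" if "s > 0" for s
  proof -
    have "s powr (3/2) = s powr (1 + 1/2)" by simp
    also have "\<dots> = s * sqrt s" using that by (subst powr_add) (simp add: powr_half_sqrt)
    finally show ?thesis using that by (simp add: norm_cpw c_def)
  qed
  have alg: "- (1 / k) * (P * (X * (- (k * Z) * H) + Y * H) + Q * (X * H)) = P * (X * Z) * H - 1 / k * (Q * X + P * Y) * H" for P X Y Z Q H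
    using k0 by (simp add: field_simps)
  have dF: "(F has_vector_derivative (f s - e s)) (at s)" if s: "s > 0" "s \<noteq> b" for s
  proof -
    have sb: "s\<^sup>2 - b\<^sup>2 \<noteq> 0" using s b by (simp add: power2_eq_iff)
    have "((\<lambda>s. 1 / (s\<^sup>2 - b\<^sup>2)) has_real_derivative (- (2 * s) / (s\<^sup>2 - b\<^sup>2)\<^sup>2)) (at s)"
      using sb by (auto intro!: derivative_eq_intros simp: power2_eq_square)
    then have dR: "((\<lambda>s. complex_of_real (1 / (s\<^sup>2 - b\<^sup>2))) has_vector_derivative of_real (- (2 * s) / (s\<^sup>2 - b\<^sup>2)\<^sup>2)) (at s)"
      by (intro has_vector_derivative_of_real) (simp add: has_real_derivative_iff_has_vector_derivative)
    have dh: "(h has_vector_derivative (- (k * of_real (1 - b\<^sup>2 / s\<^sup>2)) * h s)) (at s)"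
      unfolding h_def[abs_def] by (rule has_vector_derivative_exp_phase[OF s(1)])
    have "(F has_vector_derivative - (1 / k) * (cpw s c * (of_real (1 / (s\<^sup>2 - b\<^sup>2)) * (- (k * of_real (1 - b\<^sup>2 / s\<^sup>2)) * h s)
        + of_real (- (2 * s) / (s\<^sup>2 - b\<^sup>2)\<^sup>2) * h s) + c / of_real s * cpw s c * (of_real (1 / (s\<^sup>2 - b\<^sup>2)) * h s))) (at s)"
      unfolding F_def[abs_def]
      by (intro has_vector_derivative_mult_right has_vector_derivative_mult has_vector_derivative_cpw s dR dh)
    moreover have "- (1 / k) * (cpw s c * (of_real (1 / (s\<^sup>2 - b\<^sup>2)) * (- (k * of_real (1 - b\<^sup>2 / s\<^sup>2)) * h s)
        + of_real (- (2 * s) / (s\<^sup>2 - b\<^sup>2)\<^sup>2) * h s) + c / of_real s * cpw s c * (of_real (1 / (s\<^sup>2 - b\<^sup>2)) * h s))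
       = cpw s c * of_real (1 / (s\<^sup>2 - b\<^sup>2) * (1 - b\<^sup>2 / s\<^sup>2)) * h s - e s"
      unfolding e_def of_real_mult by (rule alg)
    moreover have "1 / (s\<^sup>2 - b\<^sup>2) * (1 - b\<^sup>2 / s\<^sup>2) = 1 / s\<^sup>2"
      using sb s by (simp add: field_simps)
    moreover have "cpw s c * of_real (1 / s\<^sup>2) = cpw s (Complex (-1/2) \<tau>)"
    proof -
      have "c = Complex (-1/2) \<tau> + (1 + 1)" by (simp add: c_def complex_eq_iff)
      then have "cpw s c = cpw s (Complex (-1/2) \<tau>) * (of_real s * of_real s)"
        using s by (simp only: cpw_add cpw_one)
      then show ?thesis using s by (simp add: power2_eq_square)
    qed
    ultimately show ?thesis unfolding f_def h_def[symmetric] by (simp only:)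
  qed
  have d\<psi>: "(\<psi> has_real_derivative \<psi>' s) (at s)" if s: "s > 0" "s \<noteq> b" for s
  proof -
    have "((\<lambda>s. - (sqrt s / (s - b))) has_real_derivative ((s + b) / (2 * sqrt s * (s - b)\<^sup>2))) (at s)"
    proof -
      have d: "((\<lambda>s. - (sqrt s / (s - b))) has_real_derivative (- ((inverse (sqrt s) / 2 * (s - b) - sqrt s * 1) / ((s - b) * (s - b))))) (at s)"
        using s by (intro derivative_intros DERIV_real_sqrt DERIV_diff[OF DERIV_ident DERIV_const, simplified]) auto
      have y: "sqrt s > 0" "sqrt s * sqrt s = s" using s by auto
      have "inverse (sqrt s) / 2 * (s - b) - sqrt s * 1 = ((s - b) - 2 * (sqrt s * sqrt s)) / (2 * sqrt s)"
        using y(1) by (simp add: field_simps del: real_sqrt_mult_self)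
      also have "\<dots> = - (s + b) / (2 * sqrt s)" unfolding y(2) by simp
      finally have "- ((inverse (sqrt s) / 2 * (s - b) - sqrt s * 1) / ((s - b) * (s - b))) = (s + b) / (2 * sqrt s * (s - b)\<^sup>2)"
        by (simp add: power2_eq_square minus_divide_left)
      with d show ?thesis by (simp only:)
    qed
    then show ?thesis unfolding \<psi>_def[abs_def] \<psi>'_def by (rule DERIV_cmult)
  qed
  have e\<psi>: "cmod (e s) \<le> \<psi>' s" if s: "s > 0" "s \<noteq> b" for s
  proof -
    define x where "x = sqrt s"
    have x: "x > 0" "x\<^sup>2 = s" using s by (auto simp: x_def)
    define D where "D = \<bar>s - b\<bar>"
    have D: "D > 0" "D\<^sup>2 = (s - b)\<^sup>2" using s by (auto simp: D_def)
    have prod: "\<bar>s\<^sup>2 - b\<^sup>2\<bar> = D * (s + b)" using s b by (simp add: D_def power2_eq_square square_diff_square_factored abs_mult)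
    have nc: "cmod c \<le> 3/2 + \<bar>\<tau>\<bar>" using cmod_le[of c] by (simp add: c_def)
    have "cmod ((c / of_real s * cpw s c) * of_real (1 / (s\<^sup>2 - b\<^sup>2)) + cpw s c * of_real (- (2 * s) / (s\<^sup>2 - b\<^sup>2)\<^sup>2))
       \<le> cmod ((c / of_real s * cpw s c) * of_real (1 / (s\<^sup>2 - b\<^sup>2))) + cmod (cpw s c * of_real (- (2 * s) / (s\<^sup>2 - b\<^sup>2)\<^sup>2))"
      by (rule norm_triangle_ineq)
    also have "\<dots> = cmod c * (x / (D * (s + b))) + 2 * s * s * x / (D * (s + b))\<^sup>2"
      using s cp[OF s(1)] unfolding norm_mult norm_divide norm_of_real prod[symmetric] x_def
      by (simp add: power2_eq_square abs_mult)
    \<comment> \<open>The first term comes from differentiating the power, the second from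
      differentiating 1/(s^2 - b^2). Since 2 (3/2 + |\<tau>|) + 4 = 7 + 2 |\<tau>|, this is the
      constant in the definition of \<open>\<psi>\<close>.\<close>
    also have "\<dots> \<le> (3/2 + \<bar>\<tau>\<bar>) * (2 * ((s + b) / (2 * x * D\<^sup>2))) + 4 * ((s + b) / (2 * x * D\<^sup>2))"
    proof (rule add_mono)
      have S: "s + b > 0" using s b by simp
      have gen: "T * T / (x * D\<^sup>2 * T) = 2 * (T / (2 * x * D\<^sup>2))"
          "2 * (T * T * T) / (x * D\<^sup>2 * T\<^sup>2) = 4 * (T / (2 * x * D\<^sup>2))" if "T > 0" for T
        using that by (simp_all add: power2_eq_square)
      have sD: "s * D \<le> (s + b) * (s + b)" using s b by (intro mult_mono) (auto simp: D_def)
      have "x / (D * (s + b)) = s * D / (x * D\<^sup>2 * (s + b))"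
        using x(1) D(1) S by (simp add: power2_eq_square flip: x(2))
      also have "\<dots> \<le> (s + b) * (s + b) / (x * D\<^sup>2 * (s + b))"
        using sD x D S by (intro divide_right_mono) auto
      also have "\<dots> = 2 * ((s + b) / (2 * x * D\<^sup>2))" using gen(1)[OF S] .
      finally have "x / (D * (s + b)) \<le> 2 * ((s + b) / (2 * x * D\<^sup>2))" .
      then show "cmod c * (x / (D * (s + b))) \<le> (3/2 + \<bar>\<tau>\<bar>) * (2 * ((s + b) / (2 * x * D\<^sup>2)))"
        using nc x D s b by (intro mult_mono) auto
      have s3: "s * s * s \<le> (s + b) * (s + b) * (s + b)" using s b by (intro mult_mono) auto
      have "2 * s * s * x / (D * (s + b))\<^sup>2 = 2 * (s * s * s) / (x * D\<^sup>2 * (s + b)\<^sup>2)"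
        using x(1) D(1) S by (simp add: power2_eq_square mult_ac flip: x(2))
      also have "\<dots> \<le> 2 * ((s + b) * (s + b) * (s + b)) / (x * D\<^sup>2 * (s + b)\<^sup>2)"
        using s3 x D S by (intro divide_right_mono) auto
      also have "\<dots> = 4 * ((s + b) / (2 * x * D\<^sup>2))" using gen(2)[OF S] .
      finally show "2 * s * s * x / (D * (s + b))\<^sup>2 \<le> 4 * ((s + b) / (2 * x * D\<^sup>2))" .
    qed
    also have "\<dots> = (7 + 2 * \<bar>\<tau>\<bar>) * ((s + b) / (2 * sqrt s * (s - b)\<^sup>2))"
      by (simp add: D(2) x_def[symmetric] algebra_simps add_divide_distrib)
    finally have main: "cmod ((c / of_real s * cpw s c) * of_real (1 / (s\<^sup>2 - b\<^sup>2)) + cpw s c * of_real (- (2 * s) / (s\<^sup>2 - b\<^sup>2)\<^sup>2))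
       \<le> (7 + 2 * \<bar>\<tau>\<bar>) * ((s + b) / (2 * sqrt s * (s - b)\<^sup>2))" .
    have "cmod (e s) = 1 / cmod k * cmod ((c / of_real s * cpw s c) * of_real (1 / (s\<^sup>2 - b\<^sup>2)) + cpw s c * of_real (- (2 * s) / (s\<^sup>2 - b\<^sup>2)\<^sup>2)) * cmod (h s)"
      unfolding e_def by (simp only: norm_mult norm_divide norm_one)
    also have "\<dots> \<le> 1 / cmod k * ((7 + 2 * \<bar>\<tau>\<bar>) * ((s + b) / (2 * sqrt s * (s - b)\<^sup>2))) * 1"
      using main h1[OF s(1)] s b by (intro mult_mono) auto
    also have "\<dots> = \<psi>' s" unfolding \<psi>'_def by simp
    finally show ?thesis .
  qed
  have Fle: "cmod (F s) \<le> 1 / cmod k * (sqrt s / \<bar>s - b\<bar>)" if s: "s > 0" "s \<noteq> b" for s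
  proof -
    have prod: "\<bar>s\<^sup>2 - b\<^sup>2\<bar> = \<bar>s - b\<bar> * (s + b)" using s b by (simp add: power2_eq_square square_diff_square_factored abs_mult)
    have "cmod (F s) = 1 / cmod k * (s * sqrt s / \<bar>s\<^sup>2 - b\<^sup>2\<bar> * cmod (h s))"
      unfolding F_def norm_mult norm_of_real norm_minus_cancel norm_divide using cp[OF s(1)] by simp
    also have "\<dots> \<le> 1 / cmod k * (s * sqrt s / \<bar>s\<^sup>2 - b\<^sup>2\<bar> * 1)"
      using h1[OF s(1)] s by (intro mult_left_mono) auto
    also have "\<dots> \<le> 1 / cmod k * (sqrt s / \<bar>s - b\<bar>)"
    proof (rule mult_left_mono)
      have "s * sqrt s / \<bar>s\<^sup>2 - b\<^sup>2\<bar> * 1 = s / (s + b) * (sqrt s / \<bar>s - b\<bar>)"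
        unfolding prod by simp
      also have "\<dots> \<le> 1 * (sqrt s / \<bar>s - b\<bar>)"
        using s b by (intro mult_right_mono) auto
      finally show "s * sqrt s / \<bar>s\<^sup>2 - b\<^sup>2\<bar> * 1 \<le> sqrt s / \<bar>s - b\<bar>" by simp
    qed simp
    finally show ?thesis .
  qed
  define \<rho> where "\<rho> = 1 / sqrt (cmod k)"
  have \<rho>: "\<rho> > 0" using k0 by (simp add: \<rho>_def)
  \<comment> \<open>In the variable y = sqrt s, the equations y - b/y = \<rho> and y - b/y = -\<rho>
    have the positive roots \<open>x2\<close> and \<open>x1 = x2 - \<rho>\<close>, with product
    \<open>b\<close>. The region |w| \<le> \<rho> is therefore the interval from \<open>x1\<close>
    squared to \<open>x2\<close> squared.\<close>
  define x2 where "x2 = (\<rho> + sqrt (\<rho>\<^sup>2 + 4 * b)) / 2"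
  define x1 where "x1 = x2 - \<rho>"
  have sq: "\<rho> < sqrt (\<rho>\<^sup>2 + 4 * b)" using \<rho> b by (intro real_less_rsqrt) auto
  have "x1 > 0" using sq by (simp add: x1_def x2_def)
  then have x: "x1 > 0" "x2 > x1" "x2 = x1 + \<rho>" using \<rho> by (auto simp: x1_def)
  have "x2\<^sup>2 = \<rho> * x2 + b"
  proof -
    have "(sqrt (\<rho>\<^sup>2 + 4 * b))\<^sup>2 = \<rho>\<^sup>2 + 4 * b" using b by (intro real_sqrt_pow2) auto
    then show ?thesis unfolding x2_def by (simp add: power2_eq_square field_simps)
  qed
  then have x12: "x1 * x2 = b" by (simp add: x1_def power2_eq_square algebra_simps)
  have right: "s - b \<ge> \<rho> * sqrt s" "s > b" if "s \<ge> x2\<^sup>2" for s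
  proof -
    have s0: "s \<ge> 0" using that zero_le_power2 order_trans by blast
    have y: "sqrt s \<ge> x2" using that x by (intro real_le_rsqrt) auto
    have "x2 * x1 \<le> sqrt s * (sqrt s - \<rho>)" using y x \<rho> s0 by (intro mult_mono) auto
    then show *: "s - b \<ge> \<rho> * sqrt s" using x12 s0 by (simp add: algebra_simps)
    have "sqrt s > 0" using y x \<rho> by linarith
    then have "\<rho> * sqrt s > 0" using \<rho> by (intro mult_pos_pos)
    with * show "s > b" by linarith
  qed
  have left: "b - s \<ge> \<rho> * sqrt s" "s < b" if "0 < s" "s \<le> x1\<^sup>2" for s
  proof -
    have y: "sqrt s \<le> x1" using that x by (intro real_le_lsqrt) auto
    have "sqrt s * (sqrt s + \<rho>) \<le> x1 * x2" using y x \<rho> that by (intro mult_mono) auto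
    then show *: "b - s \<ge> \<rho> * sqrt s" using x12 that by (simp add: algebra_simps)
    have "\<rho> * sqrt s > 0" using \<rho> that by (intro mult_pos_pos) auto
    with * show "s < b" by linarith
  qed
  have w: "sqrt s / \<bar>s - b\<bar> \<le> 1 / \<rho>" if "s > 0" "s \<ge> x2\<^sup>2 \<or> s \<le> x1\<^sup>2" for s
    using that(2)
  proof
    assume "s \<ge> x2\<^sup>2"
    from right[OF this] have *: "\<bar>s - b\<bar> > 0" "sqrt s * \<rho> \<le> \<bar>s - b\<bar>" by (auto simp: mult.commute)
    then show ?thesis using \<rho> by (simp add: divide_simps)
  next
    assume "s \<le> x1\<^sup>2"
    from left[OF that(1) this] have *: "\<bar>s - b\<bar> > 0" "sqrt s * \<rho> \<le> \<bar>s - b\<bar>" by (auto simp: mult.commute)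
    then show ?thesis using \<rho> by (simp add: divide_simps)
  qed
  let ?M = "1 / (cmod k * \<rho>)"
  have tail: "cmod (integral {p..q} f) \<le> (9 + 2 * \<bar>\<tau>\<bar>) * ?M"
    if pq: "0 < p" "p < q" "q \<le> x1\<^sup>2 \<or> x2\<^sup>2 \<le> p" for p q
  proof -
    have s: "s > 0" "s \<ge> x2\<^sup>2 \<or> s \<le> x1\<^sup>2" "s \<noteq> b" if "s \<in> {p..q}" for s
      using that pq left[of s] right[of s] by force+
    have "cmod (integral {p..q} f) \<le> cmod (F q) + cmod (F p) + (\<psi> q - \<psi> p)"
    proof (rule norm_integral_comparison[OF pq(2)])
      show "continuous_on {p..q} f" using pq by (intro continuous_on_subset[OF contf]) auto
      show "\<And>s. s \<in> {p..q} \<Longrightarrow> (F has_vector_derivative (f s - e s)) (at s)" using dF s by blast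
      show "\<And>s. s \<in> {p..q} \<Longrightarrow> (\<psi> has_real_derivative \<psi>' s) (at s)" using d\<psi> s by blast
      show "\<And>s. s \<in> {p..q} \<Longrightarrow> norm (f s - (f s - e s)) \<le> \<psi>' s" using e\<psi> s by simp
    qed
    moreover have FM: "cmod (F u) \<le> ?M" if "u \<in> {p..q}" for u
    proof -
      have "1 / cmod k * (sqrt u / \<bar>u - b\<bar>) \<le> 1 / cmod k * (1 / \<rho>)"
        using s[OF that] by (intro mult_left_mono w) auto
      then show ?thesis using Fle[of u] s[OF that] by simp
    qed
    moreover have "\<psi> q - \<psi> p \<le> (7 + 2 * \<bar>\<tau>\<bar>) / cmod k * (1 / \<rho>)"
    proof -
      \<comment> \<open>Only one term counts: the first is at most 0 to the right of
        \<open>b\<close>, the second at most 0 to the left of it.\<close>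
      have "- (sqrt q / (q - b)) + sqrt p / (p - b) \<le> 1 / \<rho>"
      proof (cases "x2\<^sup>2 \<le> p")
        case True
        have "sqrt p / (p - b) \<le> 1 / \<rho>" using w[of p] True right(2)[OF True] pq by simp
        moreover have "sqrt q / (q - b) \<ge> 0" using right(2)[of q] True pq by simp
        ultimately show ?thesis by linarith
      next
        case False
        then have q: "q \<le> x1\<^sup>2" using pq by auto
        have "- (sqrt q / (q - b)) \<le> 1 / \<rho>" using w[of q] left(2)[of q] q pq
          by (simp add: abs_if minus_divide_right)
        moreover have "sqrt p / (p - b) \<le> 0" using left(2)[of p] q pq by (intro divide_nonneg_neg) auto
        ultimately show ?thesis by linarith
      qed
      then show ?thesis
        unfolding \<psi>_def right_diff_distrib[symmetric] using k0 by (intro mult_left_mono) auto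
    qed
    \<comment> \<open>Two boundary terms of size \<open>?M\<close> and the variation of
      \<open>\<psi>\<close> add up to 2 + 7 + 2 |\<tau>|.\<close>
    moreover have "(9 + 2 * \<bar>\<tau>\<bar>) * ?M = ?M + ?M + (7 + 2 * \<bar>\<tau>\<bar>) / cmod k * (1 / \<rho>)"
      by (simp add: algebra_simps add_divide_distrib)
    ultimately show ?thesis using FM[of p] FM[of q] pq(2) by (smt (verit) atLeastAtMost_iff)
  qed
  have mid: "cmod (integral {x1\<^sup>2..x2\<^sup>2} f) \<le> 2 * \<rho>"
  proof -
    \<comment> \<open>No oscillation is used here: the amplitude s^(-1/2) has the primitive 2 sqrt
      s, which increases by 2 (x2 - x1) = 2 \<rho>.\<close>
    have "cmod (integral {x1\<^sup>2..x2\<^sup>2} f) \<le> cmod 0 + cmod 0 + (2 * sqrt (x2\<^sup>2) - 2 * sqrt (x1\<^sup>2))"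
    proof (rule norm_integral_comparison[where F="\<lambda>_. 0" and F'="\<lambda>_. 0" and \<psi>'="\<lambda>s. 1 / sqrt s"])
      show "x1\<^sup>2 < x2\<^sup>2" using x by (intro power_strict_mono) auto
      have posI: "s > 0" if "s \<in> {x1\<^sup>2..x2\<^sup>2}" for s
        using zero_less_power[OF x(1), of 2] that by (meson atLeastAtMost_iff less_le_trans)
      then show "continuous_on {x1\<^sup>2..x2\<^sup>2} f" by (intro continuous_on_subset[OF contf]) auto
      fix s assume s: "s \<in> {x1\<^sup>2..x2\<^sup>2}"
      then have pos: "s > 0" by (rule posI)
      show "((\<lambda>s. 2 * sqrt s) has_real_derivative 1 / sqrt s) (at s)"
        using pos by (auto intro!: derivative_eq_intros simp: field_simps)
      have "s powr (- 1 / 2) = 1 / sqrt s" using pos by (metis powr_minus powr_half_sqrt less_imp_le inverse_eq_divide minus_divide_left)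
      then have "cmod (f s) = 1 / sqrt s * cmod (h s)"
        unfolding f_def h_def[symmetric] norm_mult norm_cpw[OF pos] by simp
      also have "\<dots> \<le> 1 / sqrt s * 1" using h1[OF pos] pos by (intro mult_left_mono) auto
      finally show "norm (f s - 0) \<le> 1 / sqrt s" by simp
    qed auto
    then show ?thesis using x by simp
  qed
  have "norm (\<integral>s. indicator {0<..} s *\<^sub>R f s \<partial>lborel) \<le> 2 * \<rho> + 2 * ((9 + 2 * \<bar>\<tau>\<bar>) * ?M)"
  proof (rule norm_integral_pos_le[where pl="x1\<^sup>2" and qr="x2\<^sup>2"])
    show "integrable lborel (\<lambda>s. indicator {0<..} s *\<^sub>R f s)" using int unfolding f_def .
    show "continuous_on {0<..} f" by (rule contf)
    show "0 < x1\<^sup>2" using x by simp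
    fix p q :: real assume p: "0 < p" "p < x1\<^sup>2" and q: "x2\<^sup>2 < q"
    have x12': "x1\<^sup>2 < x2\<^sup>2" using x by (intro power_strict_mono) auto
    have io: "f integrable_on {p'..q'}" if "p' > 0" for p' q'
      using that by (intro integrable_continuous_interval continuous_on_subset[OF contf]) auto
    have "integral {p..q} f = integral {p..x1\<^sup>2} f + integral {x1\<^sup>2..q} f"
      using p q x12' io[OF p(1)] by (intro Henstock_Kurzweil_Integration.integral_combine[symmetric]) auto
    also have "integral {x1\<^sup>2..q} f = integral {x1\<^sup>2..x2\<^sup>2} f + integral {x2\<^sup>2..q} f"
      using p q x12' io[OF zero_less_power[OF x(1)], of 2] by (intro Henstock_Kurzweil_Integration.integral_combine[symmetric]) auto
    finally have "cmod (integral {p..q} f) \<le> cmod (integral {p..x1\<^sup>2} f) + (cmod (integral {x1\<^sup>2..x2\<^sup>2} f) + cmod (integral {x2\<^sup>2..q} f))"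
      by (smt (verit) norm_triangle_ineq)
    then show "cmod (integral {p..q} f) \<le> 2 * \<rho> + 2 * ((9 + 2 * \<bar>\<tau>\<bar>) * ?M)"
    proof -
      have "0 < x2\<^sup>2" using x by simp
      have gen: "u \<le> R + 2 * T" if "u \<le> a + (m + b)" "a \<le> T" "m \<le> R" "b \<le> T" for u a m b R T :: real
        using that by linarith
      show ?thesis
        by (rule gen[OF \<open>cmod (integral {p..q} f) \<le> _\<close> tail[OF p(1,2) disjI1[OF order_refl]] mid
              tail[OF \<open>0 < x2\<^sup>2\<close> q disjI2[OF order_refl]]])
    qed
  qed
  \<comment> \<open>Because \<rho> squared is 1/|k|, the tails have the same size as the middle
    piece; this is the reason for the choice of \<open>\<rho>\<close>. The total is (2 + 2 (9 + 2
    |\<tau>|)) \<rho>.\<close>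
  also have "?M = \<rho>"
    using k0 by (simp add: \<rho>_def real_div_sqrt)
  also have "2 * \<rho> + 2 * ((9 + 2 * \<bar>\<tau>\<bar>) * \<rho>) = (20 + 4 * \<bar>\<tau>\<bar>) / sqrt (cmod k)"
    unfolding \<rho>_def by (simp add: add_divide_distrib algebra_simps)
  finally show ?thesis unfolding f_def .
qed

section \<open>Complex powers of the resolvent symbol and their kernels\<close>

lemma integrable_pair_mult:
  fixes f :: "'a::euclidean_space \<Rightarrow> real" and g :: "'b::euclidean_space \<Rightarrow> real"
  assumes f: "integrable lborel f" and g: "integrable lborel g"
  shows "integrable (lborel \<Otimes>\<^sub>M lborel) (\<lambda>(x, y). f x * g y)"
proof -
  have [measurable]: "f \<in> borel_measurable borel" "g \<in> borel_measurable borel"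
    using f g by auto
  show ?thesis
  proof (rule lborel_pair.Fubini_integrable)
    show "AE x in lborel. integrable lborel (\<lambda>y. case (x, y) of (x, y) \<Rightarrow> f x * g y)"
      using g by auto
    show "integrable lborel (\<lambda>x. \<integral>y. norm (case (x, y) of (x, y) \<Rightarrow> f x * g y) \<partial>lborel)"
      using f by (simp add: abs_mult)
  qed measurable
qed

text \<open>With E = -k^2 this is (|\<xi>|^2 - E)/k. Both summands have nonnegative real part when
  Re k > 0, so the values avoid the branch cut of the logarithm.\<close>

definition bsym :: "complex \<Rightarrow> 'a::euclidean_space \<Rightarrow> complex" where
  "bsym k \<xi> = k + of_real ((norm \<xi>)\<^sup>2) / k"

lemma bsym_measurable [measurable]: "bsym k \<in> borel_measurable borel"
  unfolding bsym_def[abs_def] by measurable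

lemma Re_bsym_ge:
  assumes "Re k > 0" shows "Re (bsym k \<xi>) \<ge> Re k"
proof -
  have "of_real ((norm \<xi>)\<^sup>2) / k = of_real ((norm \<xi>)\<^sup>2) * (1 / k)" by simp
  then have "Re (of_real ((norm \<xi>)\<^sup>2) / k) = (norm \<xi>)\<^sup>2 * Re (1 / k)"
    by (simp only: times_complex.sel Re_complex_of_real Im_complex_of_real mult_zero_left diff_zero)
  also have "\<dots> \<ge> 0" using Re_inverse_pos[OF assms] by simp
  finally show ?thesis by (simp add: bsym_def)
qed

lemma bsym_nonzero: "Re k > 0 \<Longrightarrow> bsym k \<xi> \<noteq> 0"
  using Re_bsym_ge[of k \<xi>] by auto

lemma powr_bsym_eq: "Re k > 0 \<Longrightarrow> bsym k \<xi> powr z = exp (z * Ln (bsym k \<xi>))"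
  using bsym_nonzero by (simp add: powr_def)

lemma Ln_bsym_measurable [measurable]:
  assumes "Re k > 0" shows "(\<lambda>\<xi>::'a::euclidean_space. Ln (bsym k \<xi>)) \<in> borel_measurable borel"
proof (rule borel_measurable_continuous_onI)
  have "bsym k \<xi> \<notin> \<real>\<^sub>\<le>\<^sub>0" for \<xi> :: 'a
    using Re_bsym_ge[OF assms, of \<xi>] assms by (auto simp: complex_nonpos_Reals_iff)
  then show "continuous_on UNIV (\<lambda>\<xi>::'a. Ln (bsym k \<xi>))"
    unfolding bsym_def using assms by (intro continuous_intros) auto
qed

lemma powr_bsym_measurable [measurable]:
  assumes "Re k > 0" shows "(\<lambda>\<xi>::'a::euclidean_space. bsym k \<xi> powr z) \<in> borel_measurable borel"
proof -
  have [measurable]: "(\<lambda>\<xi>::'a. Ln (bsym k \<xi>)) \<in> borel_measurable borel"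
    by (rule Ln_bsym_measurable[OF assms])
  show ?thesis unfolding powr_bsym_eq[OF assms] by measurable
qed

text \<open>The modulus of b^(-z) is |b|^(-Re z) exp(Im z arg b), and the argument is at most pi in
  modulus. The lower bound \<open>m\<close> is left free: \<open>delta E / |k|\<close> gives the
  sharp estimate, \<open>Re k\<close> a crude one.\<close>

lemma norm_powr_bsym_le:
  fixes \<xi> :: "'a::euclidean_space"
  assumes k: "Re k > 0" and m: "0 < m" "m \<le> cmod (bsym k \<xi>)" and z: "Re z \<ge> 0"
  shows "cmod (bsym k \<xi> powr (- z)) \<le> m powr (- Re z) * exp (pi * \<bar>Im z\<bar>)"
proof -
  have b: "bsym k \<xi> \<noteq> 0" by (rule bsym_nonzero[OF k])
  have "cmod (bsym k \<xi> powr (- z)) = exp (- Re z * ln (cmod (bsym k \<xi>)) + Im z * Im (Ln (bsym k \<xi>)))"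
    unfolding powr_bsym_eq[OF k] norm_exp_eq_Re using b by (simp add: algebra_simps)
  also have "\<dots> \<le> exp (- Re z * ln m + pi * \<bar>Im z\<bar>)"
  proof (subst exp_le_cancel_iff, rule add_mono)
    have "ln m \<le> ln (cmod (bsym k \<xi>))" using m by (subst ln_le_cancel_iff) auto
    then show "- Re z * ln (cmod (bsym k \<xi>)) \<le> - Re z * ln m" using z by (simp add: mult_left_mono)
    have "\<bar>Im (Ln (bsym k \<xi>))\<bar> \<le> pi" using mpi_less_Im_Ln[OF b] Im_Ln_le_pi[OF b] by auto
    then have "\<bar>Im z * Im (Ln (bsym k \<xi>))\<bar> \<le> \<bar>Im z\<bar> * pi" by (simp add: abs_mult mult_left_mono)
    then show "Im z * Im (Ln (bsym k \<xi>)) \<le> pi * \<bar>Im z\<bar>" by (simp add: mult.commute)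
  qed
  also have "\<dots> = m powr (- Re z) * exp (pi * \<bar>Im z\<bar>)" using m by (simp add: powr_def exp_add[symmetric])
  finally show ?thesis .
qed

text \<open>The crude choice m = Re k. The estimate degenerates near the imaginary axis, so it
  serves only for integrability, holomorphy, continuity and the growth bound, none of which enter
  the final constant.\<close>

lemma norm_powr_bsym_le_exp:
  fixes \<xi> :: "'a::euclidean_space"
  assumes k: "Re k > 0" and z: "Re z \<ge> 0"
  shows "cmod (bsym k \<xi> powr (- z)) \<le> exp (cmod z * (\<bar>ln (Re k)\<bar> + pi))"
proof -
  have "Re k \<le> cmod (bsym k \<xi>)" using Re_bsym_ge[OF k, of \<xi>] complex_Re_le_cmod order_trans by blast
  from norm_powr_bsym_le[OF k k this z]
  have "cmod (bsym k \<xi> powr (- z)) \<le> Re k powr (- Re z) * exp (pi * \<bar>Im z\<bar>)" .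
  also have "\<dots> = exp (Re z * (- ln (Re k)) + \<bar>Im z\<bar> * pi)"
    using k by (simp add: powr_def exp_add[symmetric] mult.commute)
  also have "\<dots> \<le> exp (cmod z * \<bar>ln (Re k)\<bar> + cmod z * pi)"
  proof (subst exp_le_cancel_iff, rule add_mono)
    have "Re z * (- ln (Re k)) \<le> Re z * \<bar>ln (Re k)\<bar>" using z by (intro mult_left_mono) auto
    also have "\<dots> \<le> cmod z * \<bar>ln (Re k)\<bar>" using complex_Re_le_cmod by (intro mult_right_mono) auto
    finally show "Re z * (- ln (Re k)) \<le> cmod z * \<bar>ln (Re k)\<bar>" .
    show "\<bar>Im z\<bar> * pi \<le> cmod z * pi" using abs_Im_le_cmod by (intro mult_right_mono) auto
  qed
  finally show ?thesis by (simp add: ring_distribs)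
qed

text \<open>For \<open>h\<close> a product of two transforms this is, up to a power of 2 pi, the
  bilinear form of the operator with symbol \<open>bsym k\<close> to the power -z.\<close>

definition bint :: "complex \<Rightarrow> ('a::euclidean_space \<Rightarrow> complex) \<Rightarrow> complex \<Rightarrow> complex" where
  "bint k h z = (\<integral>\<xi>. bsym k \<xi> powr (- z) * h \<xi> \<partial>lborel)"

lemma integrable_bint:
  fixes h :: "'a::euclidean_space \<Rightarrow> complex"
  assumes k: "Re k > 0" and h: "integrable lborel h" and z: "Re z \<ge> 0"
  shows "integrable lborel (\<lambda>\<xi>. bsym k \<xi> powr (- z) * h \<xi>)"
proof (rule Bochner_Integration.integrable_bound)
  have [measurable]: "(\<lambda>\<xi>::'a. bsym k \<xi> powr (- z)) \<in> borel_measurable borel" "h \<in> borel_measurable borel"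
    using powr_bsym_measurable[OF k] h by auto
  show "integrable lborel (\<lambda>\<xi>. exp (cmod z * (\<bar>ln (Re k)\<bar> + pi)) * cmod (h \<xi>))"
    using h by auto
  show "AE \<xi> in lborel. norm (bsym k \<xi> powr (- z) * h \<xi>) \<le> norm (exp (cmod z * (\<bar>ln (Re k)\<bar> + pi)) * cmod (h \<xi>))"
    by (intro AE_I2) (simp add: norm_mult mult_right_mono norm_powr_bsym_le_exp[OF k z])
  show "(\<lambda>\<xi>. bsym k \<xi> powr (- z) * h \<xi>) \<in> borel_measurable lborel" by measurable
qed

lemma bint_holomorphic:
  fixes h :: "'a::euclidean_space \<Rightarrow> complex"
  assumes k: "Re k > 0" and h: "integrable lborel h"
  shows "bint k h holomorphic_on {z. Re z > 0}"
  unfolding bint_def[abs_def]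
proof (rule holomorphic_on_integral[OF open_halfspace_Re_gt])
  have [measurable]: "(\<lambda>\<xi>::'a. bsym k \<xi> powr (- z)) \<in> borel_measurable borel" "h \<in> borel_measurable borel" for z
    using powr_bsym_measurable[OF k] h by auto
  show "(\<lambda>\<xi>. bsym k \<xi> powr (- z) * h \<xi>) \<in> borel_measurable lborel" for z by measurable
  show "(\<lambda>z. bsym k \<xi> powr (- z) * h \<xi>) holomorphic_on {z. Re z > 0}" for \<xi>
    by (intro holomorphic_intros)
  fix z assume z: "z \<in> {z. Re z > 0}"
  show "\<exists>e>0. \<exists>B. integrable lborel B \<and> cball z e \<subseteq> {z. 0 < Re z} \<and>
       (\<forall>w\<in>cball z e. \<forall>\<xi>\<in>space lborel. cmod (bsym k \<xi> powr - w * h \<xi>) \<le> B \<xi>)"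
  proof (intro exI[of _ "Re z / 2"] exI[of _ "\<lambda>\<xi>. exp ((cmod z + Re z / 2) * (\<bar>ln (Re k)\<bar> + pi)) * cmod (h \<xi>)"] conjI ballI)
    show "0 < Re z / 2" using z by simp
    show "integrable lborel (\<lambda>\<xi>. exp ((cmod z + Re z / 2) * (\<bar>ln (Re k)\<bar> + pi)) * cmod (h \<xi>))"
      using h by auto
    have Re: "Re z / 2 \<le> Re w" if "w \<in> cball z (Re z / 2)" for w
      using that abs_Re_le_cmod[of "z - w"] by (auto simp: dist_norm)
    show "cball z (Re z / 2) \<subseteq> {z. Re z > 0}" using Re z by force
    fix w and \<xi> :: 'a assume w: "w \<in> cball z (Re z / 2)"
    have "cmod w \<le> cmod z + Re z / 2"
      using w norm_triangle_ineq4[of z "z - w"] by (auto simp: dist_norm)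
    moreover have "Re w \<ge> 0" using Re[OF w] z by auto
    ultimately have "cmod (bsym k \<xi> powr (- w)) \<le> exp ((cmod z + Re z / 2) * (\<bar>ln (Re k)\<bar> + pi))"
      by (intro order_trans[OF norm_powr_bsym_le_exp[OF k]]) (auto intro!: mult_right_mono)
    then show "cmod (bsym k \<xi> powr - w * h \<xi>) \<le> exp ((cmod z + Re z / 2) * (\<bar>ln (Re k)\<bar> + pi)) * cmod (h \<xi>)"
      by (simp add: norm_mult mult_right_mono)
  qed
qed

text \<open>The closed half-plane matters: for \<gamma> = 1/2 the left edge of the interpolation
  strip lies on Re z = 0.\<close>

lemma bint_continuous:
  fixes h :: "'a::euclidean_space \<Rightarrow> complex"
  assumes k: "Re k > 0" and h: "integrable lborel h"
  shows "continuous_on {z. Re z \<ge> 0} (bint k h)"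
  unfolding continuous_on_sequentially bint_def comp_def
proof (intro allI impI ballI, elim conjE)
  have [measurable]: "(\<lambda>\<xi>::'a. bsym k \<xi> powr (- z)) \<in> borel_measurable borel" "h \<in> borel_measurable borel" for z
    using powr_bsym_measurable[OF k] h by auto
  fix x a assume a: "a \<in> {z. Re z \<ge> 0}" and x: "\<forall>n. x n \<in> {z. Re z \<ge> 0}" "x \<longlonglongrightarrow> a"
  obtain R where R: "\<And>n. cmod (x n) \<le> R"
    using convergent_imp_bounded[OF x(2)] by (auto simp: bounded_iff)
  show "(\<lambda>n. \<integral>\<xi>. bsym k \<xi> powr (- x n) * h \<xi> \<partial>lborel) \<longlonglongrightarrow> (\<integral>\<xi>. bsym k \<xi> powr (- a) * h \<xi> \<partial>lborel)"
  proof (rule integral_dominated_convergence[where w="\<lambda>\<xi>. exp (R * (\<bar>ln (Re k)\<bar> + pi)) * cmod (h \<xi>)"])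
    show "integrable lborel (\<lambda>\<xi>. exp (R * (\<bar>ln (Re k)\<bar> + pi)) * cmod (h \<xi>))" using h by auto
    show "AE \<xi> in lborel. (\<lambda>n. bsym k \<xi> powr (- x n) * h \<xi>) \<longlonglongrightarrow> bsym k \<xi> powr (- a) * h \<xi>"
      unfolding powr_bsym_eq[OF k] by (intro AE_I2 tendsto_intros x(2))
    fix n
    have "cmod (bsym k \<xi> powr (- x n)) \<le> exp (R * (\<bar>ln (Re k)\<bar> + pi))" for \<xi> :: 'a
      using x(1) R[of n] by (intro order_trans[OF norm_powr_bsym_le_exp[OF k]]) (auto intro!: mult_right_mono)
    then show "AE \<xi> in lborel. norm (bsym k \<xi> powr (- x n) * h \<xi>) \<le> exp (R * (\<bar>ln (Re k)\<bar> + pi)) * cmod (h \<xi>)"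
      by (intro AE_I2) (simp add: norm_mult mult_right_mono)
  qed measurable
qed

text \<open>Subordination under the integral: exp(-s bsym) splits into exp(-s k) and the heat
  multiplier exp(-(s/k) |\<xi>|^2). Fubini is justified by Re bsym \<ge> Re k, and Parseval's
  formula returns each time slice to position space.\<close>

lemma Gamma_bint_eq:
  fixes c :: "'a::euclidean_space \<Rightarrow> complex"
  assumes k: "Re k > 0" and z: "Re z > 0" and c: "integrable lborel c" and fc: "integrable lborel (ft c)"
  shows "Gamma z * bint k (ft c) z = (2 * of_real pi) ^ DIM('a) *
    (\<integral>s. indicator {0<..} s *\<^sub>R (cpw s (z - 1) * exp (- (of_real s * k)) * (\<integral>w. heat (of_real s * (1 / k)) w * c w \<partial>lborel)) \<partial>lborel)"
proof -
  have [measurable]: "c \<in> borel_measurable borel" "ft c \<in> borel_measurable borel" using c fc by auto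
  let ?F = "\<lambda>s \<xi>. indicator {0<..} s *\<^sub>R (cpw s (z - 1) * exp (- (of_real s * bsym k \<xi>))) * ft c \<xi>"
  have Fub: "integrable (lborel \<Otimes>\<^sub>M lborel) (\<lambda>(s, \<xi>). ?F s \<xi>)"
  proof (rule Bochner_Integration.integrable_bound[OF integrable_pair_mult[OF integrable_gamma_bound[OF z k] integrable_norm[OF fc]]])
    have "norm (?F s \<xi>) \<le> norm (indicator {0<..} s *\<^sub>R (s powr (Re z - 1) * exp (- (Re k * s))) * norm (ft c \<xi>))" for s \<xi>
      using Re_bsym_ge[OF k, of \<xi>]
      by (auto simp: indicator_def norm_mult norm_cpw mult.commute[of "Re _"] intro!: mult_right_mono mult_left_mono)
    then show "AE x in lborel \<Otimes>\<^sub>M lborel. norm (case x of (s, \<xi>) \<Rightarrow> ?F s \<xi>)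
      \<le> norm (case x of (s, \<xi>) \<Rightarrow> indicator {0<..} s *\<^sub>R (s powr (Re z - 1) * exp (- (Re k * s))) * norm (ft c \<xi>))"
      by (auto simp del: norm_mult)
  qed measurable
  have "Gamma z * bint k (ft c) z = (\<integral>\<xi>. Gamma z * bsym k \<xi> powr (- z) * ft c \<xi> \<partial>lborel)"
    unfolding bint_def by (subst integral_mult_right_zero[symmetric]) (simp add: mult.assoc)
  also have "\<dots> = (\<integral>\<xi>. \<integral>s. ?F s \<xi> \<partial>lborel \<partial>lborel)"
  proof (intro Bochner_Integration.integral_cong refl)
    fix \<xi> :: 'a
    have "Re (bsym k \<xi>) > 0" using Re_bsym_ge[OF k, of \<xi>] k by linarith
    from gamma_integral[OF z this] show "Gamma z * bsym k \<xi> powr (- z) * ft c \<xi> = (\<integral>s. ?F s \<xi> \<partial>lborel)"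
      by (simp only: integral_mult_left_zero)
  qed
  also have "\<dots> = (\<integral>s. \<integral>\<xi>. ?F s \<xi> \<partial>lborel \<partial>lborel)"
    by (rule lborel_pair.Fubini_integral[OF Fub])
  also have "\<dots> = (\<integral>s. (2 * of_real pi) ^ DIM('a) * (indicator {0<..} s *\<^sub>R (cpw s (z - 1) * exp (- (of_real s * k)) * (\<integral>w. heat (of_real s * (1 / k)) w * c w \<partial>lborel))) \<partial>lborel)"
  proof (intro Bochner_Integration.integral_cong refl)
    fix s :: real
    show "(\<integral>\<xi>. ?F s \<xi> \<partial>lborel) = (2 * of_real pi) ^ DIM('a) * (indicator {0<..} s *\<^sub>R (cpw s (z - 1) * exp (- (of_real s * k)) * (\<integral>w. heat (of_real s * (1 / k)) w * c w \<partial>lborel)))"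
    proof (cases "s > 0")
      case s: True
      have t: "Re (of_real s * (1 / k)) > 0"
        using s Re_inverse_pos[OF k] by (simp only: times_complex.sel Re_complex_of_real Im_complex_of_real) simp
      have "?F s \<xi> = (cpw s (z - 1) * exp (- (of_real s * k))) * (exp (- (of_real s * (1 / k) * of_real ((norm \<xi>)\<^sup>2))) * ft c \<xi>)" for \<xi>
        using s by (simp add: bsym_def ring_distribs exp_add exp_diff exp_minus field_simps)
      then have "(\<integral>\<xi>. ?F s \<xi> \<partial>lborel) = (cpw s (z - 1) * exp (- (of_real s * k))) * (\<integral>\<xi>. exp (- (of_real s * (1 / k) * of_real ((norm \<xi>)\<^sup>2))) * ft c \<xi> \<partial>lborel)"
        by simp
      then show ?thesis unfolding integral_heat_mult[OF t c, symmetric] using s by simp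
    qed simp
  qed
  also have "\<dots> = (2 * of_real pi) ^ DIM('a) *
    (\<integral>s. indicator {0<..} s *\<^sub>R (cpw s (z - 1) * exp (- (of_real s * k)) * (\<integral>w. heat (of_real s * (1 / k)) w * c w \<partial>lborel)) \<partial>lborel)"
    by (rule integral_mult_right_zero)
  finally show ?thesis .
qed

text \<open>Exposes the time dependence as s^(-d/2) exp(-k b^2/s) with b = |w|/2; together with
  exp(-s k) this is the phase s + b^2/s of the oscillatory integral.\<close>

lemma heat_kernel_scaled:
  fixes w :: "'a::euclidean_space"
  assumes s: "s > 0" and k: "k \<noteq> 0"
  shows "heat (of_real s * (1 / k)) w = (1 / (2 * of_real (sqrt pi) * csqrt (1 / k))) ^ DIM('a) * cpw s (of_real (- (DIM('a) / 2)))
     * exp (- (k * of_real ((norm w / 2)\<^sup>2 / s)))"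
proof -
  have "heat (of_real s * (1 / k)) w = of_real (1 / sqrt s ^ DIM('a)) * heat (1 / k) ((1 / sqrt s) *\<^sub>R w)"
    by (rule heat_scale[OF s])
  moreover have "1 / sqrt s ^ DIM('a) = s powr (- (DIM('a) / 2))"
  proof -
    have "sqrt s ^ DIM('a) = s powr (DIM('a) / 2)"
      using s by (simp add: powr_half_sqrt[symmetric] powr_power)
    then show ?thesis by (simp add: powr_minus_divide)
  qed
  moreover have "of_real ((norm ((1 / sqrt s) *\<^sub>R w))\<^sup>2) / (4 * (1 / k)) = k * of_real ((norm w / 2)\<^sup>2 / s)"
    using s k by (simp add: power_divide power_mult_distrib field_simps del: of_real_power)
  ultimately show ?thesis
    unfolding heat_def cpw_of_real[OF s] by (simp only: mult_ac)
qed

text \<open>After exchanging the integrals, the kernel at each w \<noteq> 0 is an oscillatory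
  integral with b = |w|/2 and \<tau> = Im z. Its bound does not depend on w, so only the L^1 norm of
  \<open>c\<close> is left.\<close>

lemma kernel_line_bound:
  fixes c :: "'a::euclidean_space \<Rightarrow> complex"
  assumes k: "Re k > 0" and z: "Re z = (real DIM('a) + 1) / 2" and c: "integrable lborel c" and fc: "integrable lborel (ft c)"
  shows "cmod (Gamma z * bint k (ft c) z) \<le> (2 * pi) ^ DIM('a) * ((sqrt (cmod k) / (2 * sqrt pi)) ^ DIM('a) *
     ((20 + 4 * \<bar>Im z\<bar>) / sqrt (cmod k))) * (\<integral>w. cmod (c w) \<partial>lborel)"
proof -
  have [measurable]: "c \<in> borel_measurable borel" using c by auto
  have z0: "Re z > 0" using z by simp
  have k0: "k \<noteq> 0" using k by auto
  define H where "H = (1 / (2 * of_real (sqrt pi) * csqrt (1 / k))) ^ DIM('a)"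
  have nH: "cmod H = (sqrt (cmod k) / (2 * sqrt pi)) ^ DIM('a)"
    unfolding H_def by (simp add: norm_power norm_divide norm_mult real_sqrt_divide)
  define G where "G = (\<lambda>w s. indicator {0<..} s *\<^sub>R (cpw s (Complex (-1/2) (Im z)) * exp (- (k * of_real (s + (norm (w::'a) / 2)\<^sup>2 / s)))))"
  have [measurable]: "(\<lambda>(s, w). G w s) \<in> borel_measurable (lborel \<Otimes>\<^sub>M lborel)"
    "\<And>w. G w \<in> borel_measurable borel"
    unfolding G_def by measurable
  have Gle: "cmod (G w s) \<le> indicator {0<..} s *\<^sub>R (s powr (1/2 - 1) * exp (- (Re k * s)))" for w s
  proof (cases "s > 0")
    case s: True
    have "Re k * (s + (norm w / 2)\<^sup>2 / s) \<ge> Re k * s" using k s by (intro mult_left_mono) auto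
    then have "exp (- (Re k * (s + (norm w / 2)\<^sup>2 / s))) \<le> exp (- (Re k * s))" by simp
    then show ?thesis using s by (simp add: G_def norm_mult norm_cpw mult_left_mono)
  qed (simp add: G_def)
  have bnd: "integrable lborel (\<lambda>s. indicator {0<..} s *\<^sub>R (s powr (1/2 - 1) * exp (- (Re k * s))))"
    using k by (intro integrable_gamma_bound) auto
  have intG: "integrable lborel (G w)" for w
    by (rule Bochner_Integration.integrable_bound[OF bnd]) (auto intro!: AE_I2 order_trans[OF Gle])
  have eq: "indicator {0<..} s *\<^sub>R (cpw s (z - 1) * exp (- (of_real s * k)) * (\<integral>w. heat (of_real s * (1 / k)) w * c w \<partial>lborel))
     = (\<integral>w. H * (G w s * c w) \<partial>lborel)" for s
  proof (cases "s > 0")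
    case s: True
    \<comment> \<open>This fixes the choice of the line: on Re z = (d + 1)/2 the powers s^(z - 1)
      and s^(-d/2) combine to s^(-1/2 + i Im z).\<close>
    have ce: "z - 1 + of_real (- (DIM('a) / 2)) = Complex (-1/2) (Im z)"
      using z by (simp add: complex_eq_iff field_simps)
    have "(cpw s (z - 1) * exp (- (of_real s * k))) * (heat (of_real s * (1 / k)) w * c w) = H * (G w s * c w)" for w
    proof -
      have e: "exp (- (of_real s * k)) * exp (- (k * of_real ((norm w / 2)\<^sup>2 / s))) = exp (- (k * of_real (s + (norm w / 2)\<^sup>2 / s)))"
        by (simp add: exp_add[symmetric] ring_distribs mult.commute)
      have cc: "cpw s (z - 1) * cpw s (of_real (- (DIM('a) / 2))) = cpw s (Complex (-1/2) (Im z))"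
        unfolding ce[symmetric] by (rule cpw_add[symmetric])
      have "(cpw s (z - 1) * exp (- (of_real s * k))) * (heat (of_real s * (1 / k)) w * c w)
        = H * ((cpw s (z - 1) * cpw s (of_real (- (DIM('a) / 2)))) * (exp (- (of_real s * k)) * exp (- (k * of_real ((norm w / 2)\<^sup>2 / s)))) * c w)"
        unfolding heat_kernel_scaled[OF s k0] H_def[symmetric] by (simp only: mult_ac)
      then show ?thesis unfolding e cc using s by (simp add: G_def)
    qed
    then have "(\<integral>w. H * (G w s * c w) \<partial>lborel) = (\<integral>w. (cpw s (z - 1) * exp (- (of_real s * k))) * (heat (of_real s * (1 / k)) w * c w) \<partial>lborel)"
      by (simp only:)
    then show ?thesis using s by (simp only: integral_mult_right_zero) simp
  qed (simp add: G_def)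
  have Fub: "integrable (lborel \<Otimes>\<^sub>M lborel) (\<lambda>(s, w). H * (G w s * c w))"
  proof (rule Bochner_Integration.integrable_bound[OF integrable_pair_mult[OF bnd, of "\<lambda>w. cmod H * cmod (c w)"]])
    show "integrable lborel (\<lambda>w. cmod H * cmod (c w))" using c by auto
    have "norm (H * (G w s * c w)) \<le> (indicator {0<..} s *\<^sub>R (s powr (1/2 - 1) * exp (- (Re k * s)))) * (cmod H * cmod (c w))" for s w
    proof -
      have "norm (H * (G w s * c w)) = cmod (G w s) * (cmod H * cmod (c w))" by (simp add: norm_mult)
      also have "\<dots> \<le> (indicator {0<..} s *\<^sub>R (s powr (1/2 - 1) * exp (- (Re k * s)))) * (cmod H * cmod (c w))"
        by (intro mult_right_mono Gle) auto
      finally show ?thesis .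
    qed
    then show "AE x in lborel \<Otimes>\<^sub>M lborel. norm (case x of (s, w) \<Rightarrow> H * (G w s * c w))
        \<le> norm (case x of (s, w) \<Rightarrow> (indicator {0<..} s *\<^sub>R (s powr (1/2 - 1) * exp (- (Re k * s)))) * (cmod H * cmod (c w)))"
      unfolding real_norm_def by (auto simp del: norm_mult real_scaleR_def intro!: AE_I2 order_trans[OF _ abs_ge_self])
  qed measurable
  have "Gamma z * bint k (ft c) z = (2 * of_real pi) ^ DIM('a) * (\<integral>s. \<integral>w. H * (G w s * c w) \<partial>lborel \<partial>lborel)"
    unfolding Gamma_bint_eq[OF k z0 c fc] eq ..
  also have "(\<integral>s. \<integral>w. H * (G w s * c w) \<partial>lborel \<partial>lborel) = (\<integral>w. \<integral>s. H * (G w s * c w) \<partial>lborel \<partial>lborel)"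
    by (rule lborel_pair.Fubini_integral[OF Fub, symmetric])
  also have "\<dots> = (\<integral>w. H * ((\<integral>s. G w s \<partial>lborel) * c w) \<partial>lborel)"
    by simp
  finally have "cmod (Gamma z * bint k (ft c) z) = (2 * pi) ^ DIM('a) * cmod (\<integral>w. H * ((\<integral>s. G w s \<partial>lborel) * c w) \<partial>lborel)"
    by (simp add: norm_mult norm_power)
  also have "cmod (\<integral>w. H * ((\<integral>s. G w s \<partial>lborel) * c w) \<partial>lborel) \<le> (\<integral>w. (cmod H * ((20 + 4 * \<bar>Im z\<bar>) / sqrt (cmod k))) * cmod (c w) \<partial>lborel)"
  proof (rule order_trans[OF integral_norm_bound integral_mono_AE])
    have "integrable lborel (\<lambda>w. \<integral>s. H * (G w s * c w) \<partial>lborel)"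
      using lborel_pair.integrable_snd[OF Fub] .
    then show "integrable lborel (\<lambda>w. norm (H * ((\<integral>s. G w s \<partial>lborel) * c w)))"
      using integrable_norm by fastforce
    show "integrable lborel (\<lambda>w. (cmod H * ((20 + 4 * \<bar>Im z\<bar>) / sqrt (cmod k))) * cmod (c w))"
      using c by auto
    \<comment> \<open>The oscillatory bound requires b > 0, so the origin is discarded as a null
      set.\<close>
    have "AE w in lborel. w \<noteq> (0::'a)" by (rule AE_lborel_singleton)
    then show "AE w in lborel. norm (H * ((\<integral>s. G w s \<partial>lborel) * c w)) \<le> (cmod H * ((20 + 4 * \<bar>Im z\<bar>) / sqrt (cmod k))) * cmod (c w)"
    proof eventually_elim
      case (elim w)
      have "cmod (\<integral>s. G w s \<partial>lborel) \<le> (20 + 4 * \<bar>Im z\<bar>) / sqrt (cmod k)"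
        using oscillatory_integral_bound[OF k, of "norm w / 2" "Im z"] elim intG[of w] by (simp add: G_def)
      then show ?case by (simp only: norm_mult mult.assoc) (intro mult_left_mono mult_right_mono, auto)
    qed
  qed
  also have "(\<integral>w. (cmod H * ((20 + 4 * \<bar>Im z\<bar>) / sqrt (cmod k))) * cmod (c w) \<partial>lborel) = (cmod H * ((20 + 4 * \<bar>Im z\<bar>) / sqrt (cmod k))) * (\<integral>w. cmod (c w) \<partial>lborel)"
    by simp
  finally show ?thesis unfolding nH by (simp add: mult_left_mono mult.assoc)
qed

section \<open>Analytic families of weighted simple functions\<close>

text \<open>The analytic family W^(r \<eta>) a of Stein interpolation: its modulus is at most |a| on
  Re \<eta> = 0, it equals W a at \<eta> = 1/r, and on Re \<eta> = 1 it is controlled in L^1. Where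
  W vanishes it is set to 0, so that it stays holomorphic in \<eta>.\<close>

definition wt :: "real \<Rightarrow> ('a::euclidean_space \<Rightarrow> real) \<Rightarrow> ('a \<Rightarrow> complex) \<Rightarrow> complex \<Rightarrow> 'a \<Rightarrow> complex" where
  "wt r W a \<eta> x = (if W x = 0 then 0 else cpw (W x) (of_real r * \<eta>) * a x)"

lemma simple_function_lborel_bounded:
  fixes f :: "'a::euclidean_space \<Rightarrow> 'b::real_normed_vector"
  assumes "simple_function lborel f"
  obtains B where "B \<ge> 0" "\<And>x. norm (f x) \<le> B"
proof -
  have "finite (range f)" using assms by (simp add: simple_function_def)
  then have "bounded (range f)" by (rule finite_imp_bounded)
  then obtain B where "\<And>x. norm (f x) \<le> B" by (auto simp: bounded_iff)
  moreover from this have "B \<ge> 0" using norm_ge_zero order_trans by blast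
  ultimately show ?thesis using that by blast
qed

lemma wt_measurable [measurable]:
  assumes [measurable]: "W \<in> borel_measurable borel" "a \<in> borel_measurable borel"
  shows "wt r W a \<eta> \<in> borel_measurable borel"
  unfolding wt_def[abs_def] by measurable

lemma norm_wt: "W x \<ge> 0 \<Longrightarrow> cmod (wt r W a \<eta> x) = (if W x = 0 then 0 else W x powr (r * Re \<eta>) * cmod (a x))"
  by (auto simp: wt_def norm_mult norm_cpw)

lemma powr_strip_le:
  fixes t x :: real
  assumes "t > 0" "0 \<le> x" "x \<le> 1" shows "t powr x \<le> 1 + t"
proof (cases "t \<ge> 1")
  case True
  then have "t powr x \<le> t powr 1" using assms by (intro powr_mono) auto
  then show ?thesis using assms by simp
next
  case False
  then have "t powr x \<le> t powr 0" using assms by (intro powr_mono') auto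
  then show ?thesis using assms by simp
qed

lemma wt_one: "r \<noteq> 0 \<Longrightarrow> W x \<ge> 0 \<Longrightarrow> wt r W a (of_real (1 / r)) x = of_real (W x) * a x"
  using cpw_one[of "W x"] by (auto simp: wt_def simp flip: of_real_mult)

text \<open>Simple \<open>W\<close> and \<open>a\<close> take finitely many values, so the family is
  a finite sum of fixed indicators whose coefficients are entire in \<eta>. Integrability of
  \<open>a\<close> gives the level sets finite measure where \<open>a\<close> is nonzero.\<close>

locale weighted =
  fixes r :: real and W :: "'a::euclidean_space \<Rightarrow> real" and a :: "'a \<Rightarrow> complex"
  assumes r: "r > 0" and W: "simple_function lborel W" "\<And>x. W x \<ge> 0"
    and a: "simple_function lborel a" "integrable lborel a"
begin

lemma W_meas [measurable]: "W \<in> borel_measurable borel"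
  using borel_measurable_simple_function[OF W(1)] by simp

lemma a_meas [measurable]: "a \<in> borel_measurable borel"
  using borel_measurable_simple_function[OF a(1)] by simp

lemma L2_a: "L2 a"
proof -
  obtain B where "\<And>x. norm (a x) \<le> B" using simple_function_lborel_bounded[OF a(1)] by blast
  then show ?thesis by (rule L2_of_bounded_integrable[OF a(2)])
qed

text \<open>An intermediate power of \<open>W powr r\<close> is at most 1 plus that number, and
  \<open>W\<close> is bounded. The constant depends on \<open>W\<close> and enters only the growth
  estimate on the strip.\<close>

lemma wt_bound:
  obtains B where "B \<ge> 0" "\<And>x \<eta>. 0 \<le> Re \<eta> \<Longrightarrow> Re \<eta> \<le> 1 \<Longrightarrow> cmod (wt r W a \<eta> x) \<le> B * cmod (a x)"
proof -
  obtain B where B: "B \<ge> 0" "\<And>x. norm (W x) \<le> B" using simple_function_lborel_bounded[OF W(1)] by blast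
  have "cmod (wt r W a \<eta> x) \<le> (1 + B powr r) * cmod (a x)" if "0 \<le> Re \<eta>" "Re \<eta> \<le> 1" for x \<eta>
  proof (cases "W x = 0")
    case False
    then have pos: "W x > 0" using W(2)[of x] by auto
    have "W x powr (r * Re \<eta>) = (W x powr r) powr Re \<eta>" by (simp add: powr_powr)
    also have "\<dots> \<le> 1 + W x powr r" using pos that by (intro powr_strip_le) auto
    also have "\<dots> \<le> 1 + B powr r" using pos B(2)[of x] r by (auto intro!: powr_mono2)
    finally show ?thesis using pos by (simp add: norm_wt mult_right_mono)
  qed (simp add: wt_def)
  then show ?thesis using that[of "1 + B powr r"] by simp
qed

lemma
  assumes "0 \<le> Re \<eta>" "Re \<eta> \<le> 1"
  shows integrable_wt: "integrable lborel (wt r W a \<eta>)"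
    and L2_wt: "L2 (wt r W a \<eta>)"
proof -
  obtain B where B: "\<And>x. cmod (wt r W a \<eta> x) \<le> B * cmod (a x)" "B \<ge> 0" using wt_bound assms by metis
  obtain A where A: "\<And>x. norm (a x) \<le> A" using simple_function_lborel_bounded[OF a(1)] by blast
  show i: "integrable lborel (wt r W a \<eta>)"
    by (rule Bochner_Integration.integrable_bound[of lborel "\<lambda>x. B * cmod (a x)"])
      (use a(2) B in \<open>auto simp: abs_mult intro!: AE_I2\<close>)
  have "cmod (wt r W a \<eta> x) \<le> B * A" for x
    using order_trans[OF B(1) mult_left_mono[OF A B(2)]] .
  then show "L2 (wt r W a \<eta>)" by (rule L2_of_bounded_integrable[OF i])
qed

lemma norm2_wt_bound:
  obtains B where "B \<ge> 0" "\<And>\<eta>. 0 \<le> Re \<eta> \<Longrightarrow> Re \<eta> \<le> 1 \<Longrightarrow> norm2 (wt r W a \<eta>) \<le> B"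
proof -
  obtain B where B: "B \<ge> 0" "\<And>x \<eta>. 0 \<le> Re \<eta> \<Longrightarrow> Re \<eta> \<le> 1 \<Longrightarrow> cmod (wt r W a \<eta> x) \<le> B * cmod (a x)"
    using wt_bound by blast
  have "norm2 (wt r W a \<eta>) \<le> sqrt (\<integral>x. B\<^sup>2 * (cmod (a x))\<^sup>2 \<partial>lborel)" if "0 \<le> Re \<eta>" "Re \<eta> \<le> 1" for \<eta>
    unfolding norm2_def
  proof (intro real_sqrt_le_mono integral_mono)
    show "integrable lborel (\<lambda>x. (cmod (wt r W a \<eta> x))\<^sup>2)" using L2_wt[OF that] by auto
    show "integrable lborel (\<lambda>x. B\<^sup>2 * (cmod (a x))\<^sup>2)" using L2_a by auto
    show "(cmod (wt r W a \<eta> x))\<^sup>2 \<le> B\<^sup>2 * (cmod (a x))\<^sup>2" for x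
      unfolding power_mult_distrib[symmetric] by (intro power_mono B that) auto
  qed
  then show ?thesis using that[of "sqrt (\<integral>x. B\<^sup>2 * (cmod (a x))\<^sup>2 \<partial>lborel)"] by auto
qed

lemma norm2_wt_left: "Re \<eta> = 0 \<Longrightarrow> norm2 (wt r W a \<eta>) \<le> norm2 a"
  unfolding norm2_def
proof (intro real_sqrt_le_mono integral_mono)
  assume \<eta>: "Re \<eta> = 0"
  show "integrable lborel (\<lambda>x. (cmod (wt r W a \<eta> x))\<^sup>2)" using L2_wt[of \<eta>] \<eta> by auto
  show "integrable lborel (\<lambda>x. (cmod (a x))\<^sup>2)" using L2_a by auto
  show "(cmod (wt r W a \<eta> x))\<^sup>2 \<le> (cmod (a x))\<^sup>2" for x
    using W(2)[of x] \<eta> by (intro power_mono) (auto simp: norm_wt)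
qed

text \<open>Cauchy-Schwarz for W^r times \<open>a\<close>: the square of W^r is W^(2 r), which for W
  \<le> sqrt |V| is at most |V|^r. Here the integral of the potential enters.\<close>

lemma norm1_wt_right:
  assumes \<eta>: "Re \<eta> = 1" and X: "integrable lborel (\<lambda>x. W x powr (2 * r))" "(\<integral>x. W x powr (2 * r) \<partial>lborel) \<le> X"
  shows "(\<integral>x. cmod (wt r W a \<eta> x) \<partial>lborel) \<le> sqrt X * norm2 a"
proof -
  let ?w = "\<lambda>x. complex_of_real (W x powr r)"
  have sq: "(cmod (?w x))\<^sup>2 = W x powr (2 * r)" for x
    using W(2)[of x] by (simp add: power2_eq_square powr_add[symmetric])
  have w: "L2 ?w" using X unfolding L2_def sq by simp
  have "norm2 ?w \<le> sqrt X" unfolding norm2_def sq using X by simp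
  have eq: "cmod (wt r W a \<eta> x) = cmod (?w x * a x)" for x
    using W(2)[of x] \<eta> by (auto simp: norm_wt norm_mult)
  have "(\<integral>x. cmod (?w x * a x) \<partial>lborel) \<le> norm2 ?w * norm2 a"
    by (rule norm_integral_L2_le[OF w L2_a])
  also have "\<dots> \<le> sqrt X * norm2 a" using \<open>norm2 ?w \<le> sqrt X\<close> by (intro mult_right_mono) auto
  finally show ?thesis unfolding eq .
qed

text \<open>The value pairs of (W, a) that contribute. Dropping those with a zero component leaves
  level sets of finite measure and positive bases for \<open>cpw\<close>.\<close>

definition P where "P = {p \<in> range (\<lambda>x. (W x, a x)). fst p \<noteq> 0 \<and> snd p \<noteq> 0}"

definition ind where "ind p x = complex_of_real (indicator {x. W x = fst p \<and> a x = snd p} x)"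

lemma finite_P: "finite P"
proof -
  have "simple_function lborel (\<lambda>x. (W x, a x))" using W(1) a(1) by (rule simple_function_Pair)
  then show ?thesis by (simp add: P_def simple_function_def)
qed

lemma ind_measurable [measurable]: "ind p \<in> borel_measurable borel"
  unfolding ind_def by measurable

lemma integrable_ind:
  assumes "p \<in> P" shows "integrable lborel (ind p)"
proof (rule Bochner_Integration.integrable_bound[of lborel "\<lambda>x. cmod (a x) / cmod (snd p)"])
  show "integrable lborel (\<lambda>x. cmod (a x) / cmod (snd p))" using a(2) by auto
  show "AE x in lborel. norm (ind p x) \<le> norm (cmod (a x) / cmod (snd p))"
    using assms by (auto simp: ind_def indicator_def P_def)
qed measurable

lemma L2_ind: "p \<in> P \<Longrightarrow> L2 (ind p)"
  by (rule L2_of_bounded_integrable[OF integrable_ind, of _ 1]) (auto simp: ind_def indicator_def)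

text \<open>Separates the dependence on \<eta>, which sits in scalar coefficients, from the
  dependence on x, which sits in finitely many indicators.\<close>

lemma wt_eq_sum: "wt r W a \<eta> x = (\<Sum>p\<in>P. (cpw (fst p) (of_real r * \<eta>) * snd p) * ind p x)"
proof (cases "W x = 0 \<or> a x = 0")
  case True
  then have "(cpw (fst p) (of_real r * \<eta>) * snd p) * ind p x = 0" if "p \<in> P" for p
    using that by (auto simp: P_def ind_def)
  then have "(\<Sum>p\<in>P. (cpw (fst p) (of_real r * \<eta>) * snd p) * ind p x) = 0"
    by (rule sum.neutral[rule_format])
  then show ?thesis using True by (auto simp: wt_def)
next
  case False
  then have "(W x, a x) \<in> P" by (auto simp: P_def)
  then have "(\<Sum>p\<in>P. (cpw (fst p) (of_real r * \<eta>) * snd p) * ind p x)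
      = (\<Sum>p\<in>{(W x, a x)}. (cpw (fst p) (of_real r * \<eta>) * snd p) * ind p x)"
    by (intro sum.mono_neutral_right finite_P) (auto simp: ind_def indicator_def)
  then show ?thesis using False by (simp add: wt_def ind_def)
qed

lemma ft_wt: "ft (wt r W a \<eta>) \<xi> = (\<Sum>p\<in>P. (cpw (fst p) (of_real r * \<eta>) * snd p) * ft (ind p) \<xi>)"
proof -
  have int: "integrable lborel (\<lambda>x. exp (- (\<i> * of_real (x \<bullet> \<xi>))) * ind p x)" if "p \<in> P" for p
    by (rule Bochner_Integration.integrable_bound[OF integrable_norm[OF integrable_ind[OF that]]])
      (auto simp: norm_mult)
  have "ft (wt r W a \<eta>) \<xi> = (\<integral>x. (\<Sum>p\<in>P. (cpw (fst p) (of_real r * \<eta>) * snd p) * (exp (- (\<i> * of_real (x \<bullet> \<xi>))) * ind p x)) \<partial>lborel)"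
    unfolding ft_def wt_eq_sum sum_distrib_left by (simp add: mult_ac)
  also have "\<dots> = (\<Sum>p\<in>P. (cpw (fst p) (of_real r * \<eta>) * snd p) * ft (ind p) \<xi>)"
    using int by (subst Bochner_Integration.integral_sum) (auto simp: ft_def)
  finally show ?thesis .
qed

end

section \<open>Stein interpolation for bilinear forms\<close>

text \<open>The Fourier transform of the correlation of \<open>f\<close> and \<open>g\<close>; the
  reflected argument reflects the absence of a conjugation.\<close>

definition pairing where
  "pairing f g \<xi> = ft f \<xi> * ft g (- \<xi>)"

lemma integrable_pairing:
  assumes "integrable lborel f" "L2 f" "integrable lborel g" "L2 g"
  shows "integrable lborel (pairing f g)"
  unfolding pairing_def[abs_def] using integrable_multiplier[OF assms, of "\<lambda>_. 1" 1] by simp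

text \<open>In the interpolated function \<eta> enters both through the power of the symbol and
  through the weights. The expansion leaves \<open>bint\<close> with fixed densities, to which the
  holomorphy and continuity lemmas apply.\<close>

lemma bint_wt_eq_sum:
  assumes 1: "weighted r W a" and 2: "weighted r W' b" and k: "Re k > 0" and z: "Re z \<ge> 0"
  shows "bint k (pairing (wt r W a \<eta>) (wt r W' b \<eta>)) z =
    (\<Sum>p\<in>weighted.P W a. \<Sum>q\<in>weighted.P W' b. (cpw (fst p) (of_real r * \<eta>) * snd p) * (cpw (fst q) (of_real r * \<eta>) * snd q) *
      bint k (pairing (weighted.ind W a p) (weighted.ind W' b q)) z)"
proof -
  interpret A: weighted r W a by (rule 1)
  interpret B: weighted r W' b by (rule 2)
  have int: "integrable lborel (\<lambda>\<xi>. bsym k \<xi> powr (- z) * pairing (A.ind p) (B.ind q) \<xi>)" if "p \<in> A.P" "q \<in> B.P" for p q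
    using that A.integrable_ind A.L2_ind B.integrable_ind B.L2_ind by (intro integrable_bint k z integrable_pairing) auto
  have "bsym k \<xi> powr (- z) * pairing (wt r W a \<eta>) (wt r W' b \<eta>) \<xi> =
     (\<Sum>p\<in>A.P. \<Sum>q\<in>B.P. (cpw (fst p) (of_real r * \<eta>) * snd p) * (cpw (fst q) (of_real r * \<eta>) * snd q) *
       (bsym k \<xi> powr (- z) * pairing (A.ind p) (B.ind q) \<xi>))" for \<xi>
    unfolding pairing_def A.ft_wt B.ft_wt sum_product unfolding sum_distrib_left by (intro sum.cong refl) (simp add: mult_ac)
  then have "bint k (pairing (wt r W a \<eta>) (wt r W' b \<eta>)) z = (\<integral>\<xi>. (\<Sum>p\<in>A.P. \<Sum>q\<in>B.P. (cpw (fst p) (of_real r * \<eta>) * snd p) * (cpw (fst q) (of_real r * \<eta>) * snd q) *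
       (bsym k \<xi> powr (- z) * pairing (A.ind p) (B.ind q) \<xi>)) \<partial>lborel)"
    unfolding bint_def by simp
  also have "\<dots> = (\<Sum>p\<in>A.P. \<Sum>q\<in>B.P. (cpw (fst p) (of_real r * \<eta>) * snd p) * (cpw (fst q) (of_real r * \<eta>) * snd q) *
       bint k (pairing (A.ind p) (B.ind q)) z)"
    using int by (simp add: bint_def Bochner_Integration.integral_sum)
  finally show ?thesis .
qed

lemma pairing_eq_ft_corr:
  assumes "integrable lborel f" "integrable lborel g"
  shows "pairing f g = ft (corr f g)"
  using ft_corr[OF assms] by (auto simp: pairing_def)

lemma bint_multiplier_bound:
  fixes f g :: "'a::euclidean_space \<Rightarrow> complex"
  assumes k: "Re k > 0" and f: "integrable lborel f" "L2 f" and g: "integrable lborel g" "L2 g"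
    and M: "\<And>\<xi>::'a. cmod (bsym k \<xi> powr (- z)) \<le> M"
  shows "cmod (bint k (pairing f g) z) \<le> M * (2 * pi) ^ DIM('a) * (norm2 f * norm2 g)"
  unfolding bint_def pairing_def by (rule multiplier_bound[OF f g powr_bsym_measurable[OF k] M])

text \<open>Young's inequality in the case L^1 times L^1, by Fubini; it feeds the weights on Re
  \<eta> = 1 into the kernel bound.\<close>

lemma integral_norm_corr_le:
  fixes f g :: "'a::euclidean_space \<Rightarrow> complex"
  assumes f: "integrable lborel f" and g: "integrable lborel g"
  shows "(\<integral>w. cmod (corr f g w) \<partial>lborel) \<le> (\<integral>x. cmod (f x) \<partial>lborel) * (\<integral>x. cmod (g x) \<partial>lborel)"
proof -
  have [measurable]: "f \<in> borel_measurable borel" "g \<in> borel_measurable borel"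
    using f g by auto
  let ?F = "\<lambda>x w. cmod (f x) * cmod (g (x - w))"
  have ig: "integrable lborel (\<lambda>w. cmod (g (x - w)))" for x
    using g integrable_reflect_iff[of "\<lambda>w. cmod (g w)" x] by simp
  have ev: "(\<integral>w. ?F x w \<partial>lborel) = cmod (f x) * (\<integral>x. cmod (g x) \<partial>lborel)" for x
    using integral_reflect[of "\<lambda>x. cmod (g x)" x] by simp
  have Fub: "integrable (lborel \<Otimes>\<^sub>M lborel) (\<lambda>(x, w). ?F x w)"
  proof (rule lborel_pair.Fubini_integrable)
    show "AE x in lborel. integrable lborel (\<lambda>w. case (x, w) of (x, w) \<Rightarrow> ?F x w)" using ig by auto
    show "integrable lborel (\<lambda>x. \<integral>w. norm (case (x, w) of (x, w) \<Rightarrow> ?F x w) \<partial>lborel)"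
      unfolding prod.case real_norm_def abs_mult abs_norm_cancel ev using f by auto
  qed measurable
  have "(\<integral>w. cmod (corr f g w) \<partial>lborel) \<le> (\<integral>w. (\<integral>x. ?F x w \<partial>lborel) \<partial>lborel)"
  proof (rule integral_mono)
    show "integrable lborel (\<lambda>w. cmod (corr f g w))" using integrable_corr[OF f g] by auto
    show "integrable lborel (\<lambda>w. \<integral>x. ?F x w \<partial>lborel)" using lborel_pair.integrable_snd[OF Fub] .
    show "cmod (corr f g w) \<le> (\<integral>x. ?F x w \<partial>lborel)" for w
      unfolding corr_def by (rule order_trans[OF integral_norm_bound]) (simp add: norm_mult)
  qed
  also have "\<dots> = (\<integral>x. (\<integral>w. ?F x w \<partial>lborel) \<partial>lborel)"
    by (rule lborel_pair.Fubini_integral[OF Fub])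
  also have "\<dots> = (\<integral>x. cmod (f x) \<partial>lborel) * (\<integral>x. cmod (g x) \<partial>lborel)"
    unfolding ev by simp
  finally show ?thesis .
qed

text \<open>Completing the square. The factor exp(\<eta>^2) supplies the negative square that
  absorbs every exponential loss along vertical lines.\<close>

lemma exp_linear_minus_square_le: "exp (t * \<bar>u\<bar> - u\<^sup>2) \<le> exp (t\<^sup>2 / 4)" for t u :: real
proof -
  have "0 \<le> (t / 2 - \<bar>u\<bar>)\<^sup>2" by simp
  then have "t * \<bar>u\<bar> - u\<^sup>2 \<le> t\<^sup>2 / 4" by (simp add: power2_diff power_divide)
  then show ?thesis by simp
qed

lemma norm_exp_square: "cmod (exp (\<eta>\<^sup>2)) = exp ((Re \<eta>)\<^sup>2 - (Im \<eta>)\<^sup>2)"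
  by (simp add: norm_exp_eq_Re Re_power2)

text \<open>Stein interpolation on the strip: \<open>\<zeta>\<close> runs from \<open>Re \<zeta> = s\<close>, where the multiplier is bounded, to
  \<open>Re \<zeta> = (d + 1) / 2\<close>, where the kernel is bounded, and passes through 1 at \<open>\<eta> = 1 / r\<close>. The factor
  \<open>Gamma (1 + \<zeta>)\<close> removes the pole at 0 of the \<open>Gamma \<zeta>\<close> produced by the subordination formula.\<close>

lemma stein_interpolation_bound:
  fixes W W' :: "'a::euclidean_space \<Rightarrow> real" and a b :: "'a \<Rightarrow> complex"
  defines "d \<equiv> real DIM('a)"
  assumes r: "r \<ge> 1" and s: "0 \<le> s" "s \<le> 1" and s1: "s * (1 - 1 / r) + (d + 1) / (2 * r) = 1"
    and k: "Re k > 0" and m: "m > 0" "\<And>\<xi>::'a. m \<le> cmod (bsym k \<xi>)"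
    and A: "weighted r W a" and B: "weighted r W' b" and X0: "X > 0"
    and X: "integrable lborel (\<lambda>x. W x powr (2 * r))" "(\<integral>x. W x powr (2 * r) \<partial>lborel) \<le> X"
    and X': "integrable lborel (\<lambda>x. W' x powr (2 * r))" "(\<integral>x. W' x powr (2 * r) \<partial>lborel) \<le> X"
    and N: "norm2 a * norm2 b \<le> N" "N > 0"
  shows "cmod (bint k (pairing (\<lambda>x. of_real (W x) * a x) (\<lambda>x. of_real (W' x) * b x)) 1)
    \<le> (Gamma (1 + s) * exp ((pi * (d + 1) / 2)\<^sup>2 / 4) + (20 + 4 * (d + 1))\<^sup>2 * exp 2)
      * ((2 * pi) ^ DIM('a) * N * m powr (- s * (1 - 1 / r)) * (cmod k powr ((d - 1) / 2) * X) powr (1 / r))"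
proof -
  interpret A: weighted r W a by (rule A)
  interpret B: weighted r W' b by (rule B)
  have r0: "r > 0" and d1: "d \<ge> 1" using r by (auto simp: d_def DIM_positive Suc_leI)
  \<comment> \<open>The width of the strip in the variable \<zeta>: its real part runs from s to s +
    e = (d + 1)/2.\<close>
  define e where "e = (d + 1) / 2 - s"
  have "(d + 1) / 2 \<ge> 1" using d1 by simp
  then have "0 \<le> e" using s unfolding e_def by linarith
  moreover have "e \<le> (d + 1) / 2" using s unfolding e_def by linarith
  ultimately have e: "0 \<le> e" "e \<le> (d + 1) / 2" by blast+
  define \<zeta> where "\<zeta> \<eta> = of_real s + \<eta> * of_real e" for \<eta> :: complex
  have Re\<zeta>: "Re (\<zeta> \<eta>) = s + Re \<eta> * e" and Im\<zeta>: "Im (\<zeta> \<eta>) = Im \<eta> * e" for \<eta> by (auto simp: \<zeta>_def)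
  have k0: "cmod k > 0" using k by auto
  \<comment> \<open>\<open>M0\<close> and \<open>M1\<close> are the sizes of the form on the left
    and on the right edge. The factors M0^(\<eta> - 1) and M1^(-\<eta>) in \<open>F\<close> divide
    them out, so that one constant \<open>C\<close> bounds both edges.\<close>
  define M0 where "M0 = m powr (- s) * (2 * pi) ^ DIM('a) * N"
  define M1 where "M1 = (2 * pi) ^ DIM('a) * (cmod k powr ((d - 1) / 2)) * X * N"
  have M: "M0 > 0" "M1 > 0" using m k0 X0 N by (auto simp: M0_def M1_def)
  define h where "h \<eta> = pairing (wt r W a \<eta>) (wt r W' b \<eta>)" for \<eta>
  define \<Psi> where "\<Psi> \<eta> = Gamma (1 + \<zeta> \<eta>) * bint k (h \<eta>) (\<zeta> \<eta>)" for \<eta>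
  define F where "F \<eta> = exp (\<eta>\<^sup>2) * \<Psi> \<eta> * cpw M0 (\<eta> - 1) * cpw M1 (- \<eta>)" for \<eta>
  define C where "C = Gamma (1 + s) * exp ((pi * (d + 1) / 2)\<^sup>2 / 4) + (20 + 4 * (d + 1))\<^sup>2 * exp 2"
  have G0: "Gamma (1 + s) > 0" using s by (intro Gamma_real_pos) auto
  have nF: "cmod (F \<eta>) = exp ((Re \<eta>)\<^sup>2 - (Im \<eta>)\<^sup>2) * cmod (\<Psi> \<eta>) * M0 powr (Re \<eta> - 1) * M1 powr (- Re \<eta>)" for \<eta>
    unfolding F_def norm_mult norm_exp_square norm_cpw[OF M(1)] norm_cpw[OF M(2)] by simp
  let ?O = "{z. 0 < Re z \<and> Re z < 1}" and ?C = "{z. 0 \<le> Re z \<and> Re z \<le> 1}"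
  have \<zeta>pos: "Re (\<zeta> \<eta>) > 0" if "Re \<eta> > 0" for \<eta>
  proof (cases "s = 0")
    case True
    then have "e > 0" using d1 by (simp add: e_def)
    then show ?thesis using that True by (simp add: Re\<zeta>)
  next
    case False
    then show ?thesis using that s e by (simp add: Re\<zeta> add_pos_nonneg)
  qed
  have \<zeta>nn: "Re (\<zeta> \<eta>) \<ge> 0" if "Re \<eta> \<ge> 0" for \<eta> using that s e by (simp add: Re\<zeta>)
  have notint: "1 + \<zeta> \<eta> \<notin> \<int>\<^sub>\<le>\<^sub>0" if "Re \<eta> \<ge> 0" for \<eta>
  proof
    assume "1 + \<zeta> \<eta> \<in> \<int>\<^sub>\<le>\<^sub>0"
    then obtain n where "1 + \<zeta> \<eta> = of_int n" "n \<le> 0" by (elim nonpos_Ints_cases)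
    then have "Re (1 + \<zeta> \<eta>) \<le> 0" by (simp only: complex_Re_of_int)
    then show False using \<zeta>nn[OF that] by simp
  qed
  \<comment> \<open>The density \<open>h \<eta>\<close> varies with \<eta>; holomorphy and
    continuity of \<open>F\<close> are read off from this finite sum.\<close>
  have sumrep: "bint k (h \<eta>) (\<zeta> \<eta>) = (\<Sum>p\<in>A.P. \<Sum>q\<in>B.P. (cpw (fst p) (of_real r * \<eta>) * snd p) * (cpw (fst q) (of_real r * \<eta>) * snd q) *
      bint k (pairing (A.ind p) (B.ind q)) (\<zeta> \<eta>))" if "Re \<eta> \<ge> 0" for \<eta>
    unfolding h_def by (rule bint_wt_eq_sum[OF A B k \<zeta>nn[OF that]])
  have intind: "integrable lborel (pairing (A.ind p) (B.ind q))" if "p \<in> A.P" "q \<in> B.P" for p q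
    using that by (intro integrable_pairing A.integrable_ind A.L2_ind B.integrable_ind B.L2_ind)
  have hol: "F holomorphic_on ?O"
  proof -
    have "(\<lambda>\<eta>. bint k (pairing (A.ind p) (B.ind q)) (\<zeta> \<eta>)) holomorphic_on ?O" if "p \<in> A.P" "q \<in> B.P" for p q
    proof -
      have "bint k (pairing (A.ind p) (B.ind q)) \<circ> \<zeta> holomorphic_on ?O"
        unfolding \<zeta>_def[abs_def]
        by (rule holomorphic_on_compose_gen[OF _ bint_holomorphic[OF k intind[OF that]]])
          (use \<zeta>pos in \<open>auto intro!: holomorphic_intros simp: \<zeta>_def\<close>)
      then show ?thesis by (simp add: o_def)
    qed
    then have "(\<lambda>\<eta>. \<Sum>p\<in>A.P. \<Sum>q\<in>B.P. (cpw (fst p) (of_real r * \<eta>) * snd p) * (cpw (fst q) (of_real r * \<eta>) * snd q) *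
      bint k (pairing (A.ind p) (B.ind q)) (\<zeta> \<eta>)) holomorphic_on ?O"
      by (intro holomorphic_intros) auto
    then have "(\<lambda>\<eta>. bint k (h \<eta>) (\<zeta> \<eta>)) holomorphic_on ?O"
      by (rule holomorphic_transform) (simp add: sumrep)
    moreover have "(\<lambda>\<eta>. Gamma (1 + \<zeta> \<eta>)) holomorphic_on ?O"
      using notint unfolding \<zeta>_def by (intro holomorphic_intros) auto
    moreover have "(\<lambda>\<eta>. exp (\<eta>\<^sup>2)) holomorphic_on ?O" "(\<lambda>\<eta>. cpw M0 (\<eta> - 1)) holomorphic_on ?O" "(\<lambda>\<eta>. cpw M1 (- \<eta>)) holomorphic_on ?O"
      by (intro holomorphic_intros)+
    ultimately show ?thesis
      unfolding F_def[abs_def] \<Psi>_def by (intro holomorphic_on_mult)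
  qed
  have cont: "continuous_on ?C F"
  proof -
    have c\<zeta>: "continuous_on ?C \<zeta>" unfolding \<zeta>_def by (intro continuous_intros)
    have "continuous_on ?C (\<lambda>\<eta>. bint k (pairing (A.ind p) (B.ind q)) (\<zeta> \<eta>))" if "p \<in> A.P" "q \<in> B.P" for p q
      by (rule continuous_on_compose2[OF bint_continuous[OF k intind[OF that]] c\<zeta>]) (use \<zeta>nn in auto)
    moreover have "continuous_on ?C (\<lambda>\<eta>. cpw x (of_real r * \<eta>))" for x
      unfolding cpw_def by (intro continuous_intros)
    ultimately have "continuous_on ?C (\<lambda>\<eta>. \<Sum>p\<in>A.P. \<Sum>q\<in>B.P. (cpw (fst p) (of_real r * \<eta>) * snd p) * (cpw (fst q) (of_real r * \<eta>) * snd q) *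
      bint k (pairing (A.ind p) (B.ind q)) (\<zeta> \<eta>))"
      by (intro continuous_intros) auto
    then have "continuous_on ?C (\<lambda>\<eta>. bint k (h \<eta>) (\<zeta> \<eta>))"
      by (subst continuous_on_cong[OF refl sumrep]) auto
    moreover have "continuous_on ?C (\<lambda>\<eta>. Gamma (1 + \<zeta> \<eta>))"
    proof (rule continuous_on_compose2[OF holomorphic_on_imp_continuous_on[OF holomorphic_Gamma[of "- \<int>\<^sub>\<le>\<^sub>0"]]])
      show "continuous_on ?C (\<lambda>\<eta>. 1 + \<zeta> \<eta>)" using c\<zeta> by (intro continuous_intros)
      show "(\<lambda>\<eta>. 1 + \<zeta> \<eta>) ` ?C \<subseteq> - \<int>\<^sub>\<le>\<^sub>0" using notint by auto
    qed auto
    moreover have "continuous_on ?C (\<lambda>\<eta>. exp (\<eta>\<^sup>2))" "continuous_on ?C (\<lambda>\<eta>. cpw M0 (\<eta> - 1))" "continuous_on ?C (\<lambda>\<eta>. cpw M1 (- \<eta>))"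
      unfolding cpw_def by (intro continuous_intros)+
    ultimately show ?thesis
      unfolding F_def[abs_def] \<Psi>_def by (intro continuous_on_mult)
  qed
  obtain NA where NA: "NA \<ge> 0" "\<And>\<eta>. 0 \<le> Re \<eta> \<Longrightarrow> Re \<eta> \<le> 1 \<Longrightarrow> norm2 (wt r W a \<eta>) \<le> NA"
    using A.norm2_wt_bound by blast
  obtain NB where NB: "NB \<ge> 0" "\<And>\<eta>. 0 \<le> Re \<eta> \<Longrightarrow> Re \<eta> \<le> 1 \<Longrightarrow> norm2 (wt r W' b \<eta>) \<le> NB"
    using B.norm2_wt_bound by blast
  \<comment> \<open>On the closed strip the real part of 1 + \<zeta> stays in [1, 1 + s + e], a
    compact interval away from the poles of \<open>Gamma\<close>.\<close>
  obtain GB where GB: "\<And>x. 1 \<le> x \<Longrightarrow> x \<le> 1 + s + e \<Longrightarrow> \<bar>Gamma x\<bar> \<le> GB"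
  proof -
    have "continuous_on {1..1 + s + e} (Gamma :: real \<Rightarrow> real)"
      by (intro continuous_on_Gamma) (auto elim!: nonpos_Ints_cases)
    then have "bounded (Gamma ` {1..1 + s + e})" by (intro compact_imp_bounded compact_continuous_image) auto
    then obtain y where "\<And>x. x \<in> Gamma ` {1..1 + s + e} \<Longrightarrow> norm x \<le> y" unfolding bounded_iff by blast
    then show ?thesis by (intro that[of y]) (simp only: real_norm_def[symmetric] imageI atLeastAtMost_iff)
  qed
  define L where "L = (s + e) * (\<bar>ln (Re k)\<bar> + pi)"
  define L' where "L' = e * (\<bar>ln (Re k)\<bar> + pi)"
  define Q where "Q = GB * (exp L * (2 * pi) ^ DIM('a) * (NA * NB)) * (1 + 1 / M0) * (1 + 1 / M1)"
  have GB0: "GB \<ge> 0" using GB[of 1] s e by force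
  \<comment> \<open>A qualitative bound only: its constant involves ln (Re k) and the sizes of the
    weights, and the maximum principle makes it disappear.\<close>
  have decay: "cmod (F \<eta>) \<le> (exp (1 + (L' + 1)\<^sup>2 / 4) * Q) * exp (- \<bar>Im \<eta>\<bar>)" if \<eta>: "0 \<le> Re \<eta>" "Re \<eta> \<le> 1" for \<eta>
  proof -
    have G: "cmod (Gamma (1 + \<zeta> \<eta>)) \<le> GB"
    proof -
      have "Re (1 + \<zeta> \<eta>) > 0" using \<zeta>nn[OF \<eta>(1)] by simp
      from norm_Gamma_le[OF this] have "cmod (Gamma (1 + \<zeta> \<eta>)) \<le> \<bar>Gamma (1 + (s + Re \<eta> * e))\<bar>" by (simp add: Re\<zeta>)
      also have "\<dots> \<le> GB" using \<eta> s e mult_right_mono[OF \<eta>(2) e(1)] by (intro GB) auto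
      finally show ?thesis .
    qed
    have z: "cmod (\<zeta> \<eta>) \<le> (s + e) + e * \<bar>Im \<eta>\<bar>"
    proof -
      have "cmod (\<zeta> \<eta>) \<le> \<bar>Re (\<zeta> \<eta>)\<bar> + \<bar>Im (\<zeta> \<eta>)\<bar>" by (rule cmod_le)
      also have "\<dots> \<le> (s + e) + e * \<bar>Im \<eta>\<bar>"
        using \<eta> s e mult_right_mono[OF \<eta>(2) e(1)] by (simp add: Re\<zeta> Im\<zeta> abs_mult mult.commute)
      finally show ?thesis .
    qed
    have "cmod (bint k (h \<eta>) (\<zeta> \<eta>)) \<le> exp (cmod (\<zeta> \<eta>) * (\<bar>ln (Re k)\<bar> + pi)) * (2 * pi) ^ DIM('a) * (norm2 (wt r W a \<eta>) * norm2 (wt r W' b \<eta>))"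
      unfolding h_def using \<eta>
      by (intro bint_multiplier_bound k A.integrable_wt A.L2_wt B.integrable_wt B.L2_wt norm_powr_bsym_le_exp \<zeta>nn)
    also have "\<dots> \<le> exp (L + L' * \<bar>Im \<eta>\<bar>) * (2 * pi) ^ DIM('a) * (NA * NB)"
    proof (intro mult_mono)
      have "cmod (\<zeta> \<eta>) * (\<bar>ln (Re k)\<bar> + pi) \<le> ((s + e) + e * \<bar>Im \<eta>\<bar>) * (\<bar>ln (Re k)\<bar> + pi)"
        by (intro mult_right_mono z) auto
      then show "exp (cmod (\<zeta> \<eta>) * (\<bar>ln (Re k)\<bar> + pi)) \<le> exp (L + L' * \<bar>Im \<eta>\<bar>)"
        unfolding L_def L'_def by (simp add: algebra_simps)
    qed (use NA NB \<eta> in auto)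
    finally have b: "cmod (bint k (h \<eta>) (\<zeta> \<eta>)) \<le> exp (L' * \<bar>Im \<eta>\<bar>) * (exp L * (2 * pi) ^ DIM('a) * (NA * NB))"
      by (simp add: exp_add mult_ac)
    have "cmod (\<Psi> \<eta>) \<le> GB * (exp (L' * \<bar>Im \<eta>\<bar>) * (exp L * (2 * pi) ^ DIM('a) * (NA * NB)))"
      unfolding \<Psi>_def norm_mult using GB0 by (intro mult_mono G b) auto
    moreover have "M0 powr (Re \<eta> - 1) \<le> 1 + 1 / M0"
    proof -
      have "M0 powr (Re \<eta> - 1) = (1 / M0) powr (1 - Re \<eta>)"
        using M by (simp add: powr_divide powr_diff powr_minus_divide)
      also have "\<dots> \<le> 1 + 1 / M0" using M \<eta> by (intro powr_strip_le) auto
      finally show ?thesis .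
    qed
    moreover have "M1 powr (- Re \<eta>) \<le> 1 + 1 / M1"
    proof -
      have "M1 powr (- Re \<eta>) = (1 / M1) powr (Re \<eta>)"
        using M by (simp add: powr_divide powr_minus_divide)
      also have "\<dots> \<le> 1 + 1 / M1" using M \<eta> by (intro powr_strip_le) auto
      finally show ?thesis .
    qed
    moreover have "exp ((Re \<eta>)\<^sup>2 - (Im \<eta>)\<^sup>2) \<le> exp (1 - (Im \<eta>)\<^sup>2)"
      using \<eta> power_le_one[of "Re \<eta>" 2] by simp
    ultimately have "cmod (F \<eta>) \<le> exp (1 - (Im \<eta>)\<^sup>2) * (GB * (exp (L' * \<bar>Im \<eta>\<bar>) * (exp L * (2 * pi) ^ DIM('a) * (NA * NB)))) * (1 + 1 / M0) * (1 + 1 / M1)"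
      unfolding nF using GB0 NA NB M by (intro mult_mono) auto
    also have "\<dots> = (exp (1 - (Im \<eta>)\<^sup>2) * exp (L' * \<bar>Im \<eta>\<bar>)) * Q"
      unfolding Q_def by (simp only: mult_ac)
    also have "exp (1 - (Im \<eta>)\<^sup>2) * exp (L' * \<bar>Im \<eta>\<bar>) = exp 1 * exp ((L' + 1) * \<bar>Im \<eta>\<bar> - (Im \<eta>)\<^sup>2) * exp (- \<bar>Im \<eta>\<bar>)"
      unfolding exp_add[symmetric] by (simp add: algebra_simps)
    also have "\<dots> * Q \<le> (exp 1 * exp ((L' + 1)\<^sup>2 / 4) * exp (- \<bar>Im \<eta>\<bar>)) * Q"
    proof (rule mult_right_mono)
      show "Q \<ge> 0" unfolding Q_def using GB0 NA NB M by (intro mult_nonneg_nonneg) auto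
      show "exp 1 * exp ((L' + 1) * \<bar>Im \<eta>\<bar> - (Im \<eta>)\<^sup>2) * exp (- \<bar>Im \<eta>\<bar>) \<le> exp 1 * exp ((L' + 1)\<^sup>2 / 4) * exp (- \<bar>Im \<eta>\<bar>)"
        by (intro mult_right_mono mult_left_mono exp_linear_minus_square_le) auto
    qed
    finally show ?thesis by (simp add: exp_add mult_ac)
  qed
  have left: "cmod (F \<eta>) \<le> C" if \<eta>: "Re \<eta> = 0" for \<eta>
  proof -
    \<comment> \<open>On the left edge the distance to the half line enters through m^(-s); the
      weights there have modulus 1 or 0.\<close>
    have "cmod (bint k (h \<eta>) (\<zeta> \<eta>)) \<le> (m powr (- s) * exp (pi * (e * \<bar>Im \<eta>\<bar>))) * (2 * pi) ^ DIM('a) * (norm2 (wt r W a \<eta>) * norm2 (wt r W' b \<eta>))"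
      unfolding h_def using \<eta> norm_powr_bsym_le[OF k m, where z="\<zeta> \<eta>"] \<zeta>nn[of \<eta>]
      by (intro bint_multiplier_bound k A.integrable_wt A.L2_wt B.integrable_wt B.L2_wt) (auto simp: Re\<zeta> Im\<zeta> abs_mult e mult_ac)
    also have "\<dots> \<le> (m powr (- s) * exp (pi * (e * \<bar>Im \<eta>\<bar>))) * (2 * pi) ^ DIM('a) * N"
    proof (rule mult_left_mono)
      have "norm2 (wt r W a \<eta>) * norm2 (wt r W' b \<eta>) \<le> norm2 a * norm2 b"
        using \<eta> by (intro mult_mono A.norm2_wt_left B.norm2_wt_left) auto
      then show "norm2 (wt r W a \<eta>) * norm2 (wt r W' b \<eta>) \<le> N" using N by linarith
    qed auto
    also have "\<dots> = exp (pi * (e * \<bar>Im \<eta>\<bar>)) * M0" by (simp add: M0_def)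
    finally have b: "cmod (bint k (h \<eta>) (\<zeta> \<eta>)) \<le> exp (pi * (e * \<bar>Im \<eta>\<bar>)) * M0" .
    have G: "cmod (Gamma (1 + \<zeta> \<eta>)) \<le> Gamma (1 + s)"
      using norm_Gamma_le[of "1 + \<zeta> \<eta>"] \<eta> s by (simp add: Re\<zeta>)
    have "cmod (\<Psi> \<eta>) \<le> Gamma (1 + s) * (exp (pi * (e * \<bar>Im \<eta>\<bar>)) * M0)"
      unfolding \<Psi>_def norm_mult using G0 by (intro mult_mono G b) auto
    then have "exp (- (Im \<eta>)\<^sup>2) * cmod (\<Psi> \<eta>) * (1 / M0) \<le> exp (- (Im \<eta>)\<^sup>2) * (Gamma (1 + s) * (exp (pi * (e * \<bar>Im \<eta>\<bar>)) * M0)) * (1 / M0)"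
      using M by (intro mult_right_mono mult_left_mono) auto
    moreover have "cmod (F \<eta>) = exp (- (Im \<eta>)\<^sup>2) * cmod (\<Psi> \<eta>) * (1 / M0)"
      unfolding nF \<eta> using M by (simp add: powr_minus_divide)
    ultimately have "cmod (F \<eta>) \<le> Gamma (1 + s) * (exp (- (Im \<eta>)\<^sup>2) * exp (pi * (e * \<bar>Im \<eta>\<bar>)))"
      using M by (simp add: mult_ac)
    also have "exp (- (Im \<eta>)\<^sup>2) * exp (pi * (e * \<bar>Im \<eta>\<bar>)) \<le> exp ((pi * (d + 1) / 2)\<^sup>2 / 4)"
    proof -
      have "exp (- (Im \<eta>)\<^sup>2) * exp (pi * (e * \<bar>Im \<eta>\<bar>)) = exp ((pi * e) * \<bar>Im \<eta>\<bar> - (Im \<eta>)\<^sup>2)"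
        unfolding exp_add[symmetric] by (simp add: algebra_simps)
      also have "\<dots> \<le> exp ((pi * e)\<^sup>2 / 4)" by (rule exp_linear_minus_square_le)
      also have "\<dots> \<le> exp ((pi * (d + 1) / 2)\<^sup>2 / 4)"
      proof -
        have "pi * e \<le> pi * ((d + 1) / 2)" using e by (intro mult_left_mono) auto
        then have "(pi * e)\<^sup>2 \<le> (pi * ((d + 1) / 2))\<^sup>2" using e by (intro power_mono) auto
        then show ?thesis by simp
      qed
      finally show ?thesis .
    qed
    finally have "cmod (F \<eta>) \<le> Gamma (1 + s) * exp ((pi * (d + 1) / 2)\<^sup>2 / 4)" using G0 by simp
    moreover have "0 \<le> (20 + 4 * (d + 1))\<^sup>2 * exp 2" by simp
    ultimately show ?thesis unfolding C_def by linarith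
  qed
  have right: "cmod (F \<eta>) \<le> C" if \<eta>: "Re \<eta> = 1" for \<eta>
  proof -
    have Rez: "Re (\<zeta> \<eta>) = (real DIM('a) + 1) / 2" using \<eta> by (simp add: Re\<zeta> e_def d_def)
    have z0: "\<zeta> \<eta> \<notin> \<int>\<^sub>\<le>\<^sub>0"
    proof
      assume "\<zeta> \<eta> \<in> \<int>\<^sub>\<le>\<^sub>0"
      then obtain n where "\<zeta> \<eta> = of_int n" "n \<le> 0" by (elim nonpos_Ints_cases)
      then have "Re (\<zeta> \<eta>) \<le> 0" by (simp only: complex_Re_of_int)
      then show False using Rez by simp
    qed
    note iA = A.integrable_wt[of \<eta>] A.L2_wt[of \<eta>] and iB = B.integrable_wt[of \<eta>] B.L2_wt[of \<eta>]
    have iA: "integrable lborel (wt r W a \<eta>)" "L2 (wt r W a \<eta>)" and iB: "integrable lborel (wt r W' b \<eta>)" "L2 (wt r W' b \<eta>)"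
      using iA iB \<eta> by auto
    have hh: "h \<eta> = ft (corr (wt r W a \<eta>) (wt r W' b \<eta>))"
      unfolding h_def by (rule pairing_eq_ft_corr[OF iA(1) iB(1)])
    have ih: "integrable lborel (ft (corr (wt r W a \<eta>) (wt r W' b \<eta>)))"
      unfolding hh[symmetric] h_def by (rule integrable_pairing[OF iA iB])
    have "(\<integral>w. cmod (corr (wt r W a \<eta>) (wt r W' b \<eta>) w) \<partial>lborel) \<le> (\<integral>x. cmod (wt r W a \<eta> x) \<partial>lborel) * (\<integral>x. cmod (wt r W' b \<eta> x) \<partial>lborel)"
      by (rule integral_norm_corr_le[OF iA(1) iB(1)])
    also have "\<dots> \<le> (sqrt X * norm2 a) * (sqrt X * norm2 b)"
      using X0 by (intro mult_mono A.norm1_wt_right[OF \<eta> X] B.norm1_wt_right[OF \<eta> X'] mult_nonneg_nonneg) auto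
    also have "\<dots> = X * (norm2 a * norm2 b)" using X0 by (simp add: mult_ac)
    also have "\<dots> \<le> X * N" using N X0 by (intro mult_left_mono) auto
    finally have c1: "(\<integral>w. cmod (corr (wt r W a \<eta>) (wt r W' b \<eta>) w) \<partial>lborel) \<le> X * N" .
    \<comment> \<open>The prefactor of the heat kernel contributes |k|^(d/2) and the oscillatory
      integral |k|^(-1/2). The factor 1/(2 sqrt pi) is less than 1 and is dropped.\<close>
    have kk: "(sqrt (cmod k) / (2 * sqrt pi)) ^ DIM('a) / sqrt (cmod k) \<le> cmod k powr ((d - 1) / 2)"
    proof -
      have p1: "1 \<le> 2 * sqrt pi" using pi_ge_two real_sqrt_ge_one[of pi] by linarith
      have "sqrt (cmod k) / (2 * sqrt pi) \<le> sqrt (cmod k) / 1" using p1 k0 by (intro divide_left_mono) auto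
      then have "(sqrt (cmod k) / (2 * sqrt pi)) ^ DIM('a) \<le> sqrt (cmod k) ^ DIM('a)" by (intro power_mono) auto
      then have "(sqrt (cmod k) / (2 * sqrt pi)) ^ DIM('a) / sqrt (cmod k) \<le> sqrt (cmod k) ^ DIM('a) / sqrt (cmod k)"
        by (intro divide_right_mono) auto
      also have "\<dots> = cmod k powr (d / 2) / cmod k powr (1 / 2)"
        using k0 by (simp add: powr_half_sqrt[symmetric] powr_power d_def)
      also have "\<dots> = cmod k powr ((d - 1) / 2)" by (simp add: powr_diff[symmetric] diff_divide_distrib)
      finally show ?thesis .
    qed
    have "cmod (Gamma (\<zeta> \<eta>) * bint k (h \<eta>) (\<zeta> \<eta>)) \<le> (2 * pi) ^ DIM('a) * ((sqrt (cmod k) / (2 * sqrt pi)) ^ DIM('a) *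
       ((20 + 4 * \<bar>Im (\<zeta> \<eta>)\<bar>) / sqrt (cmod k))) * (\<integral>w. cmod (corr (wt r W a \<eta>) (wt r W' b \<eta>) w) \<partial>lborel)"
      unfolding hh by (rule kernel_line_bound[OF k Rez integrable_corr[OF iA(1) iB(1)] ih])
    also have "\<dots> \<le> (2 * pi) ^ DIM('a) * ((sqrt (cmod k) / (2 * sqrt pi)) ^ DIM('a) *
       ((20 + 4 * \<bar>Im (\<zeta> \<eta>)\<bar>) / sqrt (cmod k))) * (X * N)"
      by (intro mult_left_mono c1) auto
    also have "\<dots> = ((2 * pi) ^ DIM('a) * (20 + 4 * \<bar>Im (\<zeta> \<eta>)\<bar>) * (X * N)) * ((sqrt (cmod k) / (2 * sqrt pi)) ^ DIM('a) / sqrt (cmod k))"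
      by simp
    also have "\<dots> \<le> ((2 * pi) ^ DIM('a) * (20 + 4 * \<bar>Im (\<zeta> \<eta>)\<bar>) * (X * N)) * (cmod k powr ((d - 1) / 2))"
      using X0 N by (intro mult_left_mono kk) auto
    also have "\<dots> = (20 + 4 * \<bar>Im (\<zeta> \<eta>)\<bar>) * M1" by (simp add: M1_def mult_ac)
    finally have b: "cmod (Gamma (\<zeta> \<eta>) * bint k (h \<eta>) (\<zeta> \<eta>)) \<le> (20 + 4 * \<bar>Im (\<zeta> \<eta>)\<bar>) * M1" .
    \<comment> \<open>One constant for both growing quantities on this edge: |\<zeta>| and 20 + 4
      |Im \<zeta>| are each at most D exp |Im \<eta>|. This is the origin of the square and of exp(2
      |Im \<eta>|).\<close>
    define D where "D = 20 + 4 * (d + 1)"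
    have D0: "D > 0" using d1 by (simp add: D_def)
    have Imle: "\<bar>Im (\<zeta> \<eta>)\<bar> \<le> (d + 1) / 2 * \<bar>Im \<eta>\<bar>"
    proof -
      have "\<bar>Im (\<zeta> \<eta>)\<bar> = e * \<bar>Im \<eta>\<bar>" using e by (simp add: Im\<zeta> abs_mult)
      also have "\<dots> \<le> (d + 1) / 2 * \<bar>Im \<eta>\<bar>" by (intro mult_right_mono e) auto
      finally show ?thesis .
    qed
    have z1: "cmod (\<zeta> \<eta>) \<le> D * exp \<bar>Im \<eta>\<bar>" and z2: "20 + 4 * \<bar>Im (\<zeta> \<eta>)\<bar> \<le> D * exp \<bar>Im \<eta>\<bar>"
    proof -
      have ex: "1 + \<bar>Im \<eta>\<bar> \<le> exp \<bar>Im \<eta>\<bar>" by (rule exp_ge_add_one_self)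
      have "20 + 4 * \<bar>Im (\<zeta> \<eta>)\<bar> \<le> 20 + 4 * ((d + 1) / 2 * \<bar>Im \<eta>\<bar>)"
        by (intro add_left_mono mult_left_mono Imle) auto
      also have "\<dots> \<le> D * (1 + \<bar>Im \<eta>\<bar>)" using d1 by (simp add: D_def algebra_simps)
      also have "\<dots> \<le> D * exp \<bar>Im \<eta>\<bar>" using ex D0 by (intro mult_left_mono) auto
      finally show "20 + 4 * \<bar>Im (\<zeta> \<eta>)\<bar> \<le> D * exp \<bar>Im \<eta>\<bar>" .
      have "cmod (\<zeta> \<eta>) \<le> \<bar>Re (\<zeta> \<eta>)\<bar> + \<bar>Im (\<zeta> \<eta>)\<bar>" by (rule cmod_le)
      also have "\<bar>Re (\<zeta> \<eta>)\<bar> = (d + 1) / 2" unfolding Rez using d1 by (simp add: d_def)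
      also have "(d + 1) / 2 + \<bar>Im (\<zeta> \<eta>)\<bar> \<le> (d + 1) / 2 + (d + 1) / 2 * \<bar>Im \<eta>\<bar>" by (intro add_left_mono Imle)
      also have "\<dots> = (d + 1) / 2 * (1 + \<bar>Im \<eta>\<bar>)" by (simp only: distrib_left mult_1_right)
      also have "\<dots> \<le> D * (1 + \<bar>Im \<eta>\<bar>)" using d1 by (intro mult_right_mono) (auto simp: D_def)
      also have "\<dots> \<le> D * exp \<bar>Im \<eta>\<bar>" using ex D0 by (intro mult_left_mono) auto
      finally show "cmod (\<zeta> \<eta>) \<le> D * exp \<bar>Im \<eta>\<bar>" .
    qed
    \<comment> \<open>The kernel bound controls the form multiplied by \<open>Gamma \<zeta>\<close>;
      passing to \<open>Gamma (1 + \<zeta>)\<close> costs one factor |\<zeta>|.\<close>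
    have "Gamma (1 + \<zeta> \<eta>) = \<zeta> \<eta> * Gamma (\<zeta> \<eta>)"
      using Gamma_plus1[OF z0] by (simp add: add.commute)
    then have "cmod (\<Psi> \<eta>) = cmod (\<zeta> \<eta>) * cmod (Gamma (\<zeta> \<eta>) * bint k (h \<eta>) (\<zeta> \<eta>))"
      unfolding \<Psi>_def by (simp add: norm_mult)
    also have "\<dots> \<le> (D * exp \<bar>Im \<eta>\<bar>) * ((D * exp \<bar>Im \<eta>\<bar>) * M1)"
    proof (rule mult_mono[OF z1])
      show "cmod (Gamma (\<zeta> \<eta>) * bint k (h \<eta>) (\<zeta> \<eta>)) \<le> (D * exp \<bar>Im \<eta>\<bar>) * M1"
        using b mult_right_mono[OF z2, of M1] M by linarith
    qed (use D0 in auto)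
    also have "\<dots> = D\<^sup>2 * exp (2 * \<bar>Im \<eta>\<bar>) * M1" 
    proof -
      have "exp (2 * \<bar>Im \<eta>\<bar>) = exp \<bar>Im \<eta>\<bar> * exp \<bar>Im \<eta>\<bar>" by (simp add: exp_add[symmetric])
      then show ?thesis by (simp only: power2_eq_square mult_ac)
    qed
    finally have p: "cmod (\<Psi> \<eta>) \<le> D\<^sup>2 * exp (2 * \<bar>Im \<eta>\<bar>) * M1" .
    have "cmod (F \<eta>) = exp (1 - (Im \<eta>)\<^sup>2) * cmod (\<Psi> \<eta>) * (1 / M1)"
      unfolding nF \<eta> using M by (simp add: powr_minus_divide)
    also have "\<dots> \<le> exp (1 - (Im \<eta>)\<^sup>2) * (D\<^sup>2 * exp (2 * \<bar>Im \<eta>\<bar>) * M1) * (1 / M1)"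
      using M p by (intro mult_right_mono mult_left_mono) auto
    also have "\<dots> = D\<^sup>2 * (exp 1 * exp (2 * \<bar>Im \<eta>\<bar> - (Im \<eta>)\<^sup>2))"
      using M by (simp add: exp_diff mult_ac)
    also have "\<dots> \<le> D\<^sup>2 * (exp 1 * exp (2\<^sup>2 / 4))"
      by (intro mult_left_mono exp_linear_minus_square_le) auto
    also have "\<dots> = D\<^sup>2 * exp 2" by (simp add: exp_add[symmetric])
    finally have "cmod (F \<eta>) \<le> D\<^sup>2 * exp 2" .
    moreover have "Gamma (1 + s) * exp ((pi * (d + 1) / 2)\<^sup>2 / 4) \<ge> 0" using G0 by simp
    ultimately show ?thesis unfolding C_def D_def by linarith
  qed
  define \<theta> where "\<theta> = 1 / r"
  have \<theta>: "0 < \<theta>" "\<theta> \<le> 1" using r by (auto simp: \<theta>_def)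
  have FC: "cmod (F (of_real \<theta>)) \<le> C"
    by (rule strip_maximum_principle[OF hol cont decay left right]) (use \<theta> in auto)
  have z1: "\<zeta> (of_real \<theta>) = 1"
  proof -
    have "s + \<theta> * e = s * (1 - 1 / r) + (d + 1) / (2 * r)" using r0 by (simp add: \<theta>_def e_def field_simps)
    then have "s + \<theta> * e = 1" using s1 by simp
    then show ?thesis by (simp add: \<zeta>_def flip: of_real_mult of_real_add)
  qed
  have \<Psi>1: "\<Psi> (of_real \<theta>) = bint k (pairing (\<lambda>x. of_real (W x) * a x) (\<lambda>x. of_real (W' x) * b x)) 1"
  proof -
    have "wt r W a (of_real \<theta>) = (\<lambda>x. of_real (W x) * a x)" "wt r W' b (of_real \<theta>) = (\<lambda>x. of_real (W' x) * b x)"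
      unfolding \<theta>_def using r0 A.W(2) B.W(2) by (auto intro!: ext wt_one simp del: of_real_divide)
    moreover have "Gamma (1 + 1 :: complex) = 1" using Gamma_plus1[of "1::complex"] by simp
    ultimately show ?thesis by (simp add: \<Psi>_def h_def z1)
  qed
  \<comment> \<open>At the real point \<theta> the factor exp(\<theta>^2) of \<open>F\<close> is at
    least 1 and can be discarded.\<close>
  have "cmod (\<Psi> (of_real \<theta>)) * (M0 powr (\<theta> - 1) * M1 powr (- \<theta>)) \<le> exp (\<theta>\<^sup>2) * (cmod (\<Psi> (of_real \<theta>)) * (M0 powr (\<theta> - 1) * M1 powr (- \<theta>)))"
  proof -
    have "1 * y \<le> exp (\<theta>\<^sup>2) * y" if "y \<ge> 0" for y :: real using that by (intro mult_right_mono) auto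
    from this[of "cmod (\<Psi> (of_real \<theta>)) * (M0 powr (\<theta> - 1) * M1 powr (- \<theta>))"] show ?thesis by simp
  qed
  also have "\<dots> \<le> C" using FC unfolding nF by (simp add: mult_ac)
  finally have "cmod (\<Psi> (of_real \<theta>)) * (M0 powr (\<theta> - 1) * M1 powr (- \<theta>)) \<le> C" .
  then have "cmod (\<Psi> (of_real \<theta>)) * (M0 powr (\<theta> - 1) * M1 powr (- \<theta>)) * (M0 powr (1 - \<theta>) * M1 powr \<theta>) \<le> C * (M0 powr (1 - \<theta>) * M1 powr \<theta>)"
    by (intro mult_right_mono) auto
  moreover have "(M0 powr (\<theta> - 1) * M1 powr (- \<theta>)) * (M0 powr (1 - \<theta>) * M1 powr \<theta>) = 1"
  proof -
    have "(M0 powr (\<theta> - 1) * M0 powr (1 - \<theta>)) * (M1 powr (- \<theta>) * M1 powr \<theta>) = 1"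
      unfolding powr_add[symmetric] using M by simp
    then show ?thesis by (simp only: mult_ac)
  qed
  ultimately have "cmod (\<Psi> (of_real \<theta>)) \<le> C * (M0 powr (1 - \<theta>) * M1 powr \<theta>)"
    by (simp only: mult.assoc mult_1_right)
  also have "M0 powr (1 - \<theta>) * M1 powr \<theta> = (2 * pi) ^ DIM('a) * N * m powr (- s * (1 - 1 / r)) * (cmod k powr ((d - 1) / 2) * X) powr (1 / r)"
  proof -
    define T where "T = (2 * pi) ^ DIM('a) * N"
    have T: "T > 0" using N by (simp add: T_def)
    have "M0 = m powr (- s) * T" "M1 = (cmod k powr ((d - 1) / 2) * X) * T" by (simp_all add: M0_def M1_def T_def)
    then have "M0 powr (1 - \<theta>) * M1 powr \<theta> = (m powr (- s)) powr (1 - \<theta>) * T powr (1 - \<theta>) * ((cmod k powr ((d - 1) / 2) * X) powr \<theta> * T powr \<theta>)"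
      using T X0 by (simp add: powr_mult)
    also have "\<dots> = (T powr (1 - \<theta>) * T powr \<theta>) * m powr (- s * (1 - \<theta>)) * (cmod k powr ((d - 1) / 2) * X) powr \<theta>"
      unfolding powr_powr by (simp only: mult_ac)
    also have "T powr (1 - \<theta>) * T powr \<theta> = T" using T by (simp add: powr_add[symmetric])
    finally show ?thesis unfolding T_def \<theta>_def .
  qed
  finally show ?thesis unfolding \<Psi>1 C_def .
qed

section \<open>Smooth cutoffs, and weak derivatives tested against products\<close>

text \<open>The standard flat function exp(-1/y) divided by powers of y. The family over all
  \<open>m\<close> has derivatives in its own linear span, which gives smoothness of every order at
  once.\<close>

definition bump :: "nat \<Rightarrow> real \<Rightarrow> real" where
  "bump m y = (if y > 0 then exp (- (1 / y)) / y ^ m else 0)"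

lemma bump_quotient_tendsto_0: "((\<lambda>h. exp (- (1 / h)) / h ^ m) \<longlongrightarrow> 0) (at_right (0::real))"
proof -
  have "((\<lambda>u. u ^ m / exp u) \<longlongrightarrow> 0) (at_top :: real filter)" by (rule tendsto_power_div_exp_0)
  from filterlim_compose[OF this filterlim_inverse_at_top_right]
  have "((\<lambda>h::real. inverse h ^ m / exp (inverse h)) \<longlongrightarrow> 0) (at_right 0)" .
  moreover have "inverse h ^ m / exp (inverse h) = exp (- (1 / h)) / h ^ m" for h :: real
    by (simp add: exp_minus divide_simps power_inverse)
  ultimately show ?thesis by simp
qed

text \<open>The delicate point is y = 0, where the right difference quotient is exp(-1/h)/h^(m + 1)
  and tends to 0 because the exponential beats every power.\<close>

lemma bump_deriv: "(bump m has_real_derivative (bump (m + 2) y - real m * bump (m + 1) y)) (at y)"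
proof -
  consider "y > 0" | "y < 0" | "y = 0" by linarith
  then show ?thesis
  proof cases
    case 1
    have "((\<lambda>y. exp (- (1 / y)) / y ^ m) has_real_derivative (bump (m + 2) y - real m * bump (m + 1) y)) (at y)"
    proof -
      have "((\<lambda>y. exp (- (1 / y)) * inverse (y ^ m)) has_real_derivative
         (exp (- (1 / y)) * (1 / y\<^sup>2)) * inverse (y ^ m) + (- (inverse (y ^ m) * (real m * y ^ (m - 1)) * inverse (y ^ m))) * exp (- (1 / y))) (at y)"
        using 1 by (auto intro!: derivative_eq_intros simp: power2_eq_square)
      moreover have "inverse (y ^ m) * (real m * y ^ (m - 1)) * inverse (y ^ m) = real m / y ^ (m + 1)"
        using 1 by (cases m) (auto simp: field_simps)
      ultimately have "((\<lambda>y. exp (- (1 / y)) * inverse (y ^ m)) has_real_derivative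
         (exp (- (1 / y)) * (1 / y\<^sup>2)) * inverse (y ^ m) + (- (real m / y ^ (m + 1))) * exp (- (1 / y))) (at y)"
        by (simp only:)
      moreover have "(exp (- (1 / y)) * (1 / y\<^sup>2)) * inverse (y ^ m) + (- (real m / y ^ (m + 1))) * exp (- (1 / y))
         = bump (m + 2) y - real m * bump (m + 1) y"
        using 1 by (simp add: bump_def field_simps power_add power2_eq_square)
      ultimately show ?thesis by (simp only: divide_inverse)
    qed
    moreover have "\<forall>\<^sub>F x in nhds y. exp (- (1 / x)) / x ^ m = bump m x"
    proof -
      have "\<forall>\<^sub>F x in nhds y. x > 0" using 1 by (intro eventually_nhds_in_open[of "{0<..}", simplified]) auto
      then show ?thesis by eventually_elim (simp add: bump_def)
    qed
    ultimately show ?thesis by (rule DERIV_cong_ev[OF refl _ refl, THEN iffD1, rotated])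
  next
    case 2
    have "((\<lambda>_. 0) has_real_derivative 0) (at y)" by simp
    moreover have "\<forall>\<^sub>F x in nhds y. 0 = bump m x"
    proof -
      have "\<forall>\<^sub>F x in nhds y. x < 0" using 2 by (intro eventually_nhds_in_open[of "{..<0}", simplified]) auto
      then show ?thesis by eventually_elim (simp add: bump_def)
    qed
    moreover have "bump (m + 2) y - real m * bump (m + 1) y = 0" using 2 by (simp add: bump_def)
    ultimately show ?thesis using DERIV_cong_ev[OF refl, of "\<lambda>_. 0" "bump m" y 0 0] by simp
  next
    case 3
    have "((\<lambda>h. (bump m (0 + h) - bump m 0) / h) \<longlongrightarrow> 0) (at 0)"
    proof (rule filterlim_split_at)
      show "((\<lambda>h. (bump m (0 + h) - bump m 0) / h) \<longlongrightarrow> 0) (at_left 0)"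
        by (rule tendsto_eventually) (auto simp: bump_def eventually_at_left_field intro!: exI[of _ "-1"])
      have "\<forall>\<^sub>F h in at_right 0. exp (- (1 / h)) / h ^ (m + 1) = (bump m (0 + h) - bump m 0) / h"
        by (auto simp: bump_def eventually_at_right_field intro!: exI[of _ 1])
      then show "((\<lambda>h. (bump m (0 + h) - bump m 0) / h) \<longlongrightarrow> 0) (at_right 0)"
        using bump_quotient_tendsto_0[of "m + 1"] by (rule Lim_transform_eventually[rotated])
    qed
    then show ?thesis using 3 by (simp add: DERIV_def bump_def)
  qed
qed

text \<open>An algebra closed under differentiation that contains polynomials, complex Gaussians and
  cutoffs. Closure replaces the verification of higher derivatives one by one, which
  \<open>smooth_fun\<close> would otherwise demand.\<close>

inductive_set smooth_alg :: "(real \<Rightarrow> complex) set" where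
  const: "(\<lambda>_. c) \<in> smooth_alg"
| ident: "(\<lambda>x. of_real x) \<in> smooth_alg"
| gauss: "(\<lambda>x. exp (c * (of_real (x - q))\<^sup>2)) \<in> smooth_alg"
| bump: "(\<lambda>x. of_real (bump m (p * x + q))) \<in> smooth_alg"
| add: "f \<in> smooth_alg \<Longrightarrow> g \<in> smooth_alg \<Longrightarrow> (\<lambda>x. f x + g x) \<in> smooth_alg"
| mult: "f \<in> smooth_alg \<Longrightarrow> g \<in> smooth_alg \<Longrightarrow> (\<lambda>x. f x * g x) \<in> smooth_alg"

lemma smooth_alg_deriv:
  "f \<in> smooth_alg \<Longrightarrow> \<exists>f'\<in>smooth_alg. \<forall>x. (f has_vector_derivative f' x) (at x)"
proof (induction rule: smooth_alg.induct)
  case (const c)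
  show ?case by (intro bexI[of _ "\<lambda>_. 0"] smooth_alg.const) (auto intro: derivative_intros)
next
  case ident
  have "((\<lambda>x. complex_of_real x) has_vector_derivative of_real 1) (at x)" for x
    by (intro has_vector_derivative_of_real) (auto intro: derivative_intros)
  then show ?case by (intro bexI[of _ "\<lambda>_. 1"] smooth_alg.const) auto
next
  case (gauss c q)
  have "((\<lambda>x. exp (c * (of_real (x - q))\<^sup>2)) has_vector_derivative (c * (2 * (of_real x + - of_real q))) * exp (c * (of_real (x - q))\<^sup>2)) (at x)" for x
  proof -
    have "((\<lambda>z. exp (c * (z - of_real q)\<^sup>2)) has_field_derivative (c * (2 * (of_real x + - of_real q))) * exp (c * (of_real (x - q))\<^sup>2)) (at (of_real x))"
      by (auto intro!: derivative_eq_intros simp: field_simps)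
    from has_vector_derivative_real_field[OF this] show ?thesis by simp
  qed
  note der = this
  have "(\<lambda>x. (c * (2 * (of_real x + - of_real q))) * exp (c * (of_real (x - q))\<^sup>2)) \<in> smooth_alg"
    by (intro smooth_alg.intros)
  then show ?case by (rule bexI[rotated]) (intro allI der)
next
  case (bump m p q)
  have "((\<lambda>x. complex_of_real (bump m (p * x + q))) has_vector_derivative
     of_real p * (of_real (bump (m + 2) (p * x + q)) + of_real (- real m) * of_real (bump (m + 1) (p * x + q)))) (at x)" for x
  proof -
    have "((\<lambda>x. bump m (p * x + q)) has_real_derivative (bump (m + 2) (p * x + q) - real m * bump (m + 1) (p * x + q)) * p) (at x)"
      by (rule DERIV_chain2[OF bump_deriv]) (auto intro!: derivative_eq_intros)
    then have "((\<lambda>x. complex_of_real (bump m (p * x + q))) has_vector_derivative of_real ((bump (m + 2) (p * x + q) - real m * bump (m + 1) (p * x + q)) * p)) (at x)"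
      by (intro has_vector_derivative_of_real) (simp add: has_real_derivative_iff_has_vector_derivative)
    then show ?thesis by (simp add: mult.commute)
  qed
  note der = this
  have "(\<lambda>x. of_real p * (of_real (bump (m + 2) (p * x + q)) + of_real (- real m) * of_real (bump (m + 1) (p * x + q)))) \<in> smooth_alg"
    by (intro smooth_alg.intros)
  then show ?case by (rule bexI[rotated]) (intro allI der)
next
  case (add f g)
  then obtain f' g' where "f' \<in> smooth_alg" "g' \<in> smooth_alg" "\<And>x. (f has_vector_derivative f' x) (at x)" "\<And>x. (g has_vector_derivative g' x) (at x)"
    by blast
  then show ?case by (intro bexI[of _ "\<lambda>x. f' x + g' x"] allI has_vector_derivative_add smooth_alg.add)
next
  case (mult f g)
  then obtain f' g' where "f' \<in> smooth_alg" "g' \<in> smooth_alg" "\<And>x. (f has_vector_derivative f' x) (at x)" "\<And>x. (g has_vector_derivative g' x) (at x)"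
    by blast
  then show ?case using mult.hyps
    by (intro bexI[of _ "\<lambda>x. f x * g' x + f' x * g x"] allI has_vector_derivative_mult smooth_alg.add smooth_alg.mult)
qed

lemma smooth_alg_continuous: "f \<in> smooth_alg \<Longrightarrow> continuous_on UNIV f"
  using smooth_alg_deriv[of f] has_vector_derivative_continuous
  by (metis continuous_at_imp_continuous_on)

text \<open>Tensor products of one-variable functions. A partial derivative replaces a single
  factor, so multivariable calculus reduces to a function update; Gaussian kernels and
  coordinatewise cutoffs both have this form.\<close>

definition cprod :: "('n::finite \<Rightarrow> real \<Rightarrow> complex) \<Rightarrow> real^'n \<Rightarrow> complex" where
  "cprod A x = (\<Prod>i\<in>UNIV. A i (x $ i))"

lemma cprod_update: "cprod (A(j := a)) x = a (x $ j) * (\<Prod>i\<in>UNIV - {j}. A i (x $ i))"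
proof -
  have "cprod (A(j := a)) x = (A(j := a)) j (x $ j) * (\<Prod>i\<in>UNIV - {j}. (A(j := a)) i (x $ i))"
    unfolding cprod_def by (rule prod.remove) auto
  also have "(\<Prod>i\<in>UNIV - {j}. (A(j := a)) i (x $ i)) = (\<Prod>i\<in>UNIV - {j}. A i (x $ i))"
    by (rule prod.cong) auto
  finally show ?thesis by (simp only: fun_upd_same)
qed

lemma cprod_line_deriv:
  assumes "\<And>s. (A j has_vector_derivative a' s) (at s)"
  shows "((\<lambda>t. cprod A (x + t *\<^sub>R axis j 1)) has_vector_derivative cprod (A(j := a')) (x + t *\<^sub>R axis j 1)) (at t)"
proof -
  let ?R = "\<Prod>i\<in>UNIV - {j}. A i (x $ i)"
  have comp: "(x + t *\<^sub>R axis j 1) $ j = x $ j + t" for t by (simp add: axis_def)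
  have rest: "(\<Prod>i\<in>UNIV - {j}. A i ((x + t *\<^sub>R axis j 1) $ i)) = ?R" for t
    by (rule prod.cong) (auto simp: axis_def)
  have eq: "cprod A (x + t *\<^sub>R axis j 1) = A j (x $ j + t) * ?R" for t
    using cprod_update[of A j "A j" "x + t *\<^sub>R axis j 1"] unfolding rest comp by simp
  have "((\<lambda>t. A j (x $ j + t)) has_vector_derivative a' (x $ j + t)) (at t)"
  proof -
    have "((\<lambda>t. x $ j + t) has_vector_derivative 1) (at t)" by (auto intro!: derivative_eq_intros)
    from vector_diff_chain_at[OF this assms[of "x $ j + t"]] show ?thesis by (simp add: o_def)
  qed
  then have "((\<lambda>t. A j (x $ j + t) * ?R) has_vector_derivative a' (x $ j + t) * ?R) (at t)"
    by (rule has_vector_derivative_mult_left)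
  moreover have "cprod (A(j := a')) (x + t *\<^sub>R axis j 1) = a' (x $ j + t) * ?R"
    unfolding cprod_update rest comp ..
  ultimately show ?thesis by (simp only: eq)
qed

lemma has_real_derivative_Re:
  assumes "(f has_vector_derivative f') (at x)"
  shows "((\<lambda>t. Re (f t)) has_real_derivative Re f') (at x)"
  using bounded_linear.has_vector_derivative[OF bounded_linear_Re assms]
  by (simp add: has_real_derivative_iff_has_vector_derivative)

lemma partial_ax_Re_cprod:
  assumes "\<And>s. (A j has_vector_derivative a' s) (at s)"
  shows "partial_ax j (\<lambda>x. Re (cprod A x)) = (\<lambda>x. Re (cprod (A(j := a')) x))"
proof
  fix x
  have "((\<lambda>t. Re (cprod A (x + t *\<^sub>R axis j 1))) has_real_derivative Re (cprod (A(j := a')) (x + 0 *\<^sub>R axis j 1))) (at 0)"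
    by (rule has_real_derivative_Re[OF cprod_line_deriv[where A=A and j=j and a'=a', OF assms]])
  then show "partial_ax j (\<lambda>x. Re (cprod A x)) x = Re (cprod (A(j := a')) x)"
    unfolding partial_ax_def by (simp add: DERIV_imp_deriv)
qed

lemma cprod_continuous:
  assumes "\<And>i. A i \<in> smooth_alg" shows "continuous_on UNIV (cprod A)"
  unfolding cprod_def
  by (intro continuous_intros continuous_on_compose2[OF smooth_alg_continuous[OF assms]]) auto

text \<open>The set of real parts of such products is invariant under every
  \<open>partial_ax j\<close>, so an induction on the list of derivatives stays inside it.\<close>

lemma smooth_Re_cprod:
  fixes A :: "'n::finite \<Rightarrow> real \<Rightarrow> complex"
  assumes "\<And>i. A i \<in> smooth_alg"
  shows "smooth_fun (\<lambda>x. Re (cprod A x))"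
proof -
  let ?S = "{\<lambda>x. Re (cprod A x) |A. \<forall>i. A i \<in> smooth_alg} :: (real^'n \<Rightarrow> real) set"
  have step: "partial_ax j f \<in> ?S" "(\<lambda>t. f (x + t *\<^sub>R axis j 1)) differentiable (at 0)" "continuous_on UNIV f"
    if f: "f \<in> ?S" for f j x
  proof -
    obtain A where A: "f = (\<lambda>x. Re (cprod A x))" "\<And>i. A i \<in> smooth_alg" using f by blast
    obtain a' where a': "a' \<in> smooth_alg" "\<And>s. (A j has_vector_derivative a' s) (at s)"
      using smooth_alg_deriv[OF A(2)] by blast
    show "partial_ax j f \<in> ?S"
      unfolding A(1) partial_ax_Re_cprod[where A=A and j=j and a'=a', OF a'(2)] using A(2) a'(1) by (auto intro!: exI[of _ "A(j := a')"])
    show "(\<lambda>t. f (x + t *\<^sub>R axis j 1)) differentiable (at 0)"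
      using has_real_derivative_Re[OF cprod_line_deriv[of A j a' x 0, OF a'(2)]] unfolding A(1)
      real_differentiable_def by blast
    show "continuous_on UNIV f" unfolding A(1) by (intro continuous_intros cprod_continuous A(2))
  qed
  have "foldr partial_ax js (\<lambda>x. Re (cprod A x)) \<in> ?S" for js
    by (induction js) (use assms step in auto)
  then show ?thesis unfolding smooth_fun_def using step by blast
qed

lemma test_Re_cprod:
  fixes A :: "'n::finite \<Rightarrow> real \<Rightarrow> complex"
  assumes A: "\<And>i. A i \<in> smooth_alg" and supp: "\<And>i s. \<bar>s\<bar> > R \<Longrightarrow> A i s = 0"
  shows "test_fun (\<lambda>x. Re (cprod A x))"
  unfolding test_fun_def
proof
  show "smooth_fun (\<lambda>x. Re (cprod A x))" by (rule smooth_Re_cprod[OF A])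
  have "\<bar>x $ i\<bar> \<le> R" if "Re (cprod A x) \<noteq> 0" for x :: "real^'n" and i
  proof (rule ccontr)
    assume "\<not> \<bar>x $ i\<bar> \<le> R"
    then have "A i (x $ i) = 0" by (intro supp) auto
    then have "cprod A x = 0" unfolding cprod_def by (intro prod_zero) auto
    with that show False by simp
  qed
  then have "{x. Re (cprod A x) \<noteq> 0} \<subseteq> cbox (\<chi> i. - R) (\<chi> i. R)"
    by (auto simp: mem_box_cart abs_le_iff minus_le_iff)
  then have "bounded {x. Re (cprod A x) \<noteq> 0}" by (rule bounded_subset[OF bounded_cbox])
  then show "compact (closure {x. Re (cprod A x) \<noteq> 0})" by (simp add: compact_closure)
qed

lemma Basis_vec_axis: "(Basis :: (real^'n::finite) set) = (\<lambda>i. axis i 1) ` UNIV"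
  by (auto simp: Basis_vec_def)

lemma prod_Basis_vec:
  fixes A :: "'n::finite \<Rightarrow> real \<Rightarrow> complex"
  shows "(\<Prod>b\<in>Basis. A (inv (\<lambda>i. axis i (1::real)) b) (x \<bullet> b)) = cprod A x"
proof -
  have inj: "inj (\<lambda>i::'n. axis i (1::real))" by (auto simp: inj_on_def axis_eq_axis)
  show ?thesis unfolding Basis_vec_axis cprod_def
    by (subst prod.reindex[OF inj]) (simp add: inv_f_f[OF inj] inner_axis)
qed

lemma integrable_cprod:
  fixes A :: "'n::finite \<Rightarrow> real \<Rightarrow> complex"
  assumes "\<And>i. integrable lborel (A i)"
  shows "integrable lborel (cprod A)"
  using integrable_prod_Basis[of "\<lambda>b. A (inv (\<lambda>i. axis i (1::real)) b)"] assms by (simp add: prod_Basis_vec)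

lemma L2_cprod:
  fixes A :: "'n::finite \<Rightarrow> real \<Rightarrow> complex"
  assumes "\<And>i. L2 (A i)"
  shows "L2 (cprod A)"
  unfolding L2_def
proof
  have [measurable]: "A i \<in> borel_measurable borel" for i using L2_measurable[OF assms[of i]] by simp
  show "cprod A \<in> borel_measurable lborel"
    unfolding cprod_def[abs_def] by measurable
  have "integrable lborel (cprod (\<lambda>i s. complex_of_real ((cmod (A i s))\<^sup>2)))"
    by (intro integrable_cprod iffD2[OF complex_of_real_integrable_eq] L2_integrable assms)
  moreover have "cprod (\<lambda>i s. complex_of_real ((cmod (A i s))\<^sup>2)) = (\<lambda>x. of_real ((cmod (cprod A x))\<^sup>2))"
    by (rule ext) (simp add: cprod_def prod_norm[symmetric] prod_power_distrib)
  ultimately show "integrable lborel (\<lambda>x. (cmod (cprod A x))\<^sup>2)"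
    by (simp only: complex_of_real_integrable_eq)
qed

text \<open>A cutoff vanishing outside [-R, R]. The factor exp 2 normalises the value at 0 to 1;
  away from 0 the function is not constant, but it tends to 1 pointwise as R grows.\<close>

definition cut :: "real \<Rightarrow> real \<Rightarrow> complex" where
  "cut R x = of_real (exp 2) * (of_real (bump 0 ((- 1 / R) * x + 1)) * of_real (bump 0 ((1 / R) * x + 1)))"

definition cut' :: "real \<Rightarrow> real \<Rightarrow> complex" where
  "cut' R x = of_real (exp 2) * (of_real (bump 0 ((- 1 / R) * x + 1)) * of_real (bump 2 ((1 / R) * x + 1) * (1 / R))
     + of_real (bump 2 ((- 1 / R) * x + 1) * (- 1 / R)) * of_real (bump 0 ((1 / R) * x + 1)))"

lemma cut_smooth: "cut R \<in> smooth_alg"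
  unfolding cut_def[abs_def] by (intro smooth_alg.intros)

lemma cut_deriv: "(cut R has_vector_derivative cut' R x) (at x)"
proof -
  have b: "((\<lambda>x. complex_of_real (bump 0 (p * x + 1))) has_vector_derivative of_real (bump 2 (p * x + 1) * p)) (at x)" for p
  proof -
    have "((\<lambda>x. bump 0 (p * x + 1)) has_real_derivative (bump (0 + 2) (p * x + 1) - real 0 * bump (0 + 1) (p * x + 1)) * p) (at x)"
      by (rule DERIV_chain2[OF bump_deriv]) (auto intro!: derivative_eq_intros)
    then show ?thesis
      by (intro has_vector_derivative_of_real) (simp add: has_real_derivative_iff_has_vector_derivative numeral_2_eq_2)
  qed
  show ?thesis unfolding cut_def[abs_def] cut'_def
    by (intro has_vector_derivative_mult_right has_vector_derivative_mult b)
qed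

lemma bump_0_bounds: "0 \<le> bump 0 y" "bump 0 y \<le> 1"
  by (auto simp: bump_def)

text \<open>The constant 2 comes from the quadratic Taylor bound exp u \<ge> u^2/2 at u = 1/y. The
  function \<open>bump 2\<close> is the derivative of \<open>bump 0\<close>, so this controls the
  slope of the cutoff.\<close>

lemma bump_2_bounds: "0 \<le> bump 2 y" "bump 2 y \<le> 2"
proof -
  show "0 \<le> bump 2 y" by (auto simp: bump_def)
  show "bump 2 y \<le> 2"
  proof (cases "y > 0")
    case True
    have "(1 / y)\<^sup>2 / 2 \<le> 1 + 1 / y + (1 / y)\<^sup>2 / 2" using True by simp
    also have "\<dots> \<le> exp (1 / y)" using True by (intro exp_lower_Taylor_quadratic) simp
    finally have "(1 / y)\<^sup>2 \<le> 2 * exp (1 / y)" by linarith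
    then have "(1 / y)\<^sup>2 * exp (- (1 / y)) \<le> 2 * exp (1 / y) * exp (- (1 / y))"
      by (intro mult_right_mono) auto
    also have "\<dots> = 2" by (simp add: exp_minus)
    finally show ?thesis using True by (simp add: bump_def power_divide)
  qed (simp add: bump_def)
qed

lemma cut_zero: "R > 0 \<Longrightarrow> \<bar>x\<bar> > R \<Longrightarrow> cut R x = 0"
  by (auto simp: cut_def bump_def field_simps abs_if split: if_splits)

lemma cut_bound: "cmod (cut R x) \<le> exp 2"
proof -
  have "bump 0 ((- 1 / R) * x + 1) * bump 0 ((1 / R) * x + 1) \<le> 1 * 1"
    by (intro mult_mono bump_0_bounds) auto
  then show ?thesis
    using bump_0_bounds by (simp add: cut_def norm_mult)
qed

lemma cut'_bound:
  assumes "R > 0" shows "cmod (cut' R x) \<le> 4 * exp 2 / R"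
proof -
  let ?p = "bump 0 ((- 1 / R) * x + 1)" and ?q = "bump 2 ((1 / R) * x + 1)" and ?r = "bump 2 ((- 1 / R) * x + 1)" and ?s = "bump 0 ((1 / R) * x + 1)"
  have "cmod (cut' R x) = exp 2 * cmod (of_real (?p * (?q * (1 / R)) + ?r * (- 1 / R) * ?s))"
    unfolding cut'_def by (simp add: norm_mult flip: of_real_mult of_real_add)
  also have "\<dots> = exp 2 * \<bar>?p * (?q * (1 / R)) + ?r * (- 1 / R) * ?s\<bar>" by (simp only: norm_of_real)
  also have "\<dots> \<le> exp 2 * (\<bar>?p * (?q * (1 / R))\<bar> + \<bar>?r * (- 1 / R) * ?s\<bar>)"
    by (intro mult_left_mono abs_triangle_ineq) auto
  also have "\<bar>?p * (?q * (1 / R))\<bar> \<le> 1 * (2 * (1 / R))"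
    using bump_0_bounds bump_2_bounds assms by (simp only: abs_mult) (intro mult_mono, auto)
  also have "\<bar>?r * (- 1 / R) * ?s\<bar> \<le> 2 * (1 / R) * 1"
    using bump_0_bounds bump_2_bounds assms by (simp only: abs_mult) (intro mult_mono, auto)
  finally show ?thesis by (simp add: mult.commute)
qed

lemma cut_tendsto: "(\<lambda>n. cut (real (Suc n)) x) \<longlonglongrightarrow> 1"
proof -
  have lim: "(\<lambda>n. bump 0 (c / real (Suc n) * x + 1)) \<longlonglongrightarrow> bump 0 1" for c
  proof -
    have "isCont (bump 0) 1" using bump_deriv DERIV_isCont by blast
    moreover have "(\<lambda>n. c * (1 / real (Suc n)) * x + 1) \<longlonglongrightarrow> c * 0 * x + 1"
      by (intro tendsto_intros LIMSEQ_Suc[OF lim_1_over_n])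
    ultimately show ?thesis by (auto intro!: isCont_tendsto_compose[of 1 "bump 0"])
  qed
  have "(\<lambda>n. cut (real (Suc n)) x) \<longlonglongrightarrow> of_real (exp 2) * (of_real (bump 0 1) * of_real (bump 0 1))"
    unfolding cut_def by (intro tendsto_intros lim)
  also have "of_real (exp 2) * (of_real (bump 0 1) * of_real (bump 0 1)) = complex_of_real (exp 2 * (bump 0 1 * bump 0 1))"
    by simp
  also have "exp 2 * (bump 0 1 * bump 0 (1::real)) = (1::real)" by (simp add: bump_def exp_add[symmetric])
  finally show ?thesis by simp
qed

lemma L2_of_compact_support:
  fixes f :: "real \<Rightarrow> complex"
  assumes f: "continuous_on UNIV f" and supp: "\<And>s. \<bar>s\<bar> > R \<Longrightarrow> f s = 0"
  shows "L2 f"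
proof -
  have [measurable]: "f \<in> borel_measurable borel" by (rule borel_measurable_continuous_onI[OF f])
  have "bounded (f ` {-R..R})" by (intro compact_imp_bounded compact_continuous_image continuous_on_subset[OF f]) auto
  then obtain B where "\<And>y. y \<in> f ` {-R..R} \<Longrightarrow> cmod y \<le> B" unfolding bounded_iff by blast
  then have B: "\<And>s. s \<in> {-R..R} \<Longrightarrow> cmod (f s) \<le> B" by blast
  have ind: "integrable lborel (indicat_real {-R..R})" by (intro integrable_real_indicator) (auto simp: emeasure_lborel_Icc_eq)
  have le: "cmod (f s) \<le> max B 0 * indicator {-R..R} s" for s
    using B[of s] supp[of s] by (cases "s \<in> {-R..R}") (auto simp: abs_if split: if_splits)
  have int: "integrable lborel f"
    by (rule Bochner_Integration.integrable_bound[of lborel "\<lambda>s. max B 0 * indicator {-R..R} s"])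
      (use ind in \<open>auto intro!: AE_I2 order_trans[OF le]\<close>)
  show ?thesis
    by (rule L2_of_bounded_integrable[OF int, of "max B 0"]) (rule order_trans[OF le], auto simp: indicator_def)
qed

text \<open>\<open>weak_partial\<close> tests against real functions only. A complex product is
  recovered from the real parts of its multiples by 1 and by -i.\<close>

lemma weak_partial_cprod_compact:
  fixes u g :: "real^'n::finite \<Rightarrow> complex" and B :: "'n \<Rightarrow> real \<Rightarrow> complex"
  assumes wk: "weak_partial u j g" and u: "L2 u" and g: "L2 g"
    and B: "\<And>i. B i \<in> smooth_alg" and supp: "\<And>i s. \<bar>s\<bar> > R \<Longrightarrow> B i s = 0"
    and b': "\<And>s. (B j has_vector_derivative b' s) (at s)"
  shows "(\<integral>x. u x * cprod (B(j := b')) x \<partial>lborel) = - (\<integral>x. g x * cprod B x \<partial>lborel)"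
proof -
  obtain b'' where b'': "b'' \<in> smooth_alg" "\<And>s. (B j has_vector_derivative b'' s) (at s)"
    using smooth_alg_deriv[OF B] by blast
  \<comment> \<open>Uniqueness of the derivative identifies the given \<open>b'\<close> with a
    member of \<open>smooth_alg\<close>.\<close>
  have "b'' = b'" using vector_derivative_unique_at[OF b''(2) b'] by auto
  then have b's: "b' \<in> smooth_alg" using b'' by simp
  have supp': "b' s = 0" if "\<bar>s\<bar> > R" for s
  proof -
    have "((\<lambda>_. 0) has_vector_derivative b' s) (at s)"
    proof (rule has_vector_derivative_transform_within_open[OF b'])
      show "open {x. \<bar>x\<bar> > R}" by (intro open_Collect_less continuous_intros)
      show "s \<in> {x. \<bar>x\<bar> > R}" using that by simp
      show "B j x = 0" if "x \<in> {x. \<bar>x\<bar> > R}" for x using that supp by simp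
    qed
    then show ?thesis using vector_derivative_unique_at[OF _ has_vector_derivative_const] by blast
  qed
  have Lb: "L2 (cprod B)" by (intro L2_cprod L2_of_compact_support[of _ R] smooth_alg_continuous B supp)
  have Lb': "L2 (cprod (B(j := b')))"
    by (intro L2_cprod L2_of_compact_support[of _ R] smooth_alg_continuous) (use B b's supp supp' in auto)
  have *: "(\<integral>x. u x * of_real (Re (c * cprod (B(j := b')) x)) \<partial>lborel) = - (\<integral>x. g x * of_real (Re (c * cprod B x)) \<partial>lborel)" for c
  proof -
    \<comment> \<open>The scalar \<open>c\<close> is put into the factor \<open>j\<close>, so that
      \<open>c\<close> times the product is again a product of admissible factors.\<close>
    let ?C = "B(j := (\<lambda>s. c * B j s))"
    have C: "?C i \<in> smooth_alg" for i using B by (auto intro: smooth_alg.intros)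
    have Cs: "?C i s = 0" if "\<bar>s\<bar> > R" for i s using supp[OF that] by auto
    have Cd: "(?C j has_vector_derivative c * b' s) (at s)" for s
      using has_vector_derivative_mult_right[OF b'] by simp
    have eq: "cprod ?C x = c * cprod B x" "cprod (?C(j := (\<lambda>s. c * b' s))) x = c * cprod (B(j := b')) x" for x
      using cprod_update[of B j "B j" x] by (simp_all add: cprod_update fun_upd_upd)
    have "test_fun (\<lambda>x. Re (cprod ?C x))" by (rule test_Re_cprod[OF C Cs])
    with wk have "(\<integral>x. u x * complex_of_real (partial_ax j (\<lambda>x. Re (cprod ?C x)) x) \<partial>lborel) = - (\<integral>x. g x * complex_of_real (Re (cprod ?C x)) \<partial>lborel)"
      unfolding weak_partial_def by blast
    then show ?thesis
      unfolding partial_ax_Re_cprod[where A="?C" and j=j and a'="\<lambda>s. c * b' s", OF Cd] unfolding eq .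
  qed
  \<comment> \<open>Here p = Re p + i Re(-i p), because Re(-i p) is the imaginary part of p.\<close>
  have dec: "(\<integral>x. v x * p x \<partial>lborel) = (\<integral>x. v x * of_real (Re (1 * p x)) \<partial>lborel) + \<i> * (\<integral>x. v x * of_real (Re (- \<i> * p x)) \<partial>lborel)"
    if v: "L2 v" and p: "L2 p" for v p :: "real^'n \<Rightarrow> complex"
  proof -
    have [measurable]: "p \<in> borel_measurable borel" using p by auto
    have "L2 (\<lambda>x. complex_of_real (Re (1 * p x)))" "L2 (\<lambda>x. complex_of_real (Re (- \<i> * p x)))"
      unfolding L2_def
      by (auto intro!: Bochner_Integration.integrable_bound[OF L2_integrable[OF p]] AE_I2
          simp: abs_le_square_iff[symmetric] abs_Re_le_cmod abs_Im_le_cmod)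
    note i = integrable_L2_mult[OF v this(1)] integrable_L2_mult[OF v this(2)]
    have "(\<integral>x. v x * p x \<partial>lborel) = (\<integral>x. v x * of_real (Re (1 * p x)) + \<i> * (v x * of_real (Re (- \<i> * p x))) \<partial>lborel)"
      by (intro Bochner_Integration.integral_cong refl) (simp add: complex_eq_iff algebra_simps)
    also have "\<dots> = (\<integral>x. v x * of_real (Re (1 * p x)) \<partial>lborel) + (\<integral>x. \<i> * (v x * of_real (Re (- \<i> * p x))) \<partial>lborel)"
      using i by (intro Bochner_Integration.integral_add) auto
    finally show ?thesis by simp
  qed
  show ?thesis
    unfolding dec[OF u Lb'] dec[OF g Lb] * by (simp add: algebra_simps)
qed

text \<open>Gaussians are not compactly supported. Every factor is multiplied by a cutoff at radius
  n + 1; the derivative of the cutoff is O(1/n), and dominated convergence removes the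
  cutoff.\<close>

lemma weak_partial_cprod:
  fixes u g :: "real^'n::finite \<Rightarrow> complex" and A :: "'n \<Rightarrow> real \<Rightarrow> complex"
  assumes wk: "weak_partial u j g" and u: "L2 u" and g: "L2 g"
    and A: "\<And>i. A i \<in> smooth_alg" and LA: "\<And>i. L2 (A i)"
    and a': "\<And>s. (A j has_vector_derivative a' s) (at s)" and La': "L2 a'"
  shows "(\<integral>x. u x * cprod (A(j := a')) x \<partial>lborel) = - (\<integral>x. g x * cprod A x \<partial>lborel)"
proof -
  have [measurable]: "u \<in> borel_measurable borel" "g \<in> borel_measurable borel" using u g by auto
  define B where "B n i s = A i s * cut (real (Suc n)) s" for n i s
  define b' where "b' n s = A j s * cut' (real (Suc n)) s + a' s * cut (real (Suc n)) s" for n s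
  have LA': "L2 (cprod A)" "L2 (cprod (A(j := a')))" using LA La' by (auto intro!: L2_cprod)
  have [measurable]: "cprod A \<in> borel_measurable borel" "cprod (A(j := a')) \<in> borel_measurable borel"
    using LA' by auto
  have meas: "cprod F \<in> borel_measurable borel" if "\<And>i. F i \<in> borel_measurable borel" for F :: "'n \<Rightarrow> real \<Rightarrow> complex"
    unfolding cprod_def[abs_def] using that by measurable
  have mA [measurable]: "A i \<in> borel_measurable borel" "a' \<in> borel_measurable borel" for i
    using L2_measurable[OF LA[of i]] L2_measurable[OF La'] by simp_all
  have mc [measurable]: "cut R \<in> borel_measurable borel" for R
    by (rule borel_measurable_continuous_onI[OF smooth_alg_continuous[OF cut_smooth]])
  have mb [measurable]: "bump m \<in> borel_measurable borel" for m
    unfolding bump_def[abs_def] by measurable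
  have mc' [measurable]: "cut' R \<in> borel_measurable borel" for R
    unfolding cut'_def[abs_def] by measurable
  have [measurable]: "cprod (B n) \<in> borel_measurable borel" "cprod ((B n)(j := b' n)) \<in> borel_measurable borel" for n
    by (auto intro!: meas simp: B_def[abs_def] b'_def[abs_def] split: if_splits)
  \<comment> \<open>A common bound for a cutoff (at most exp 2) and for its derivative (at most 4
    exp 2 / R with R \<ge> 1).\<close>
  define K where "K = 4 * exp (2::real)"
  have "exp (2::real) \<ge> 1" by simp
  then have K: "K \<ge> 1" "exp 2 \<le> K" unfolding K_def by linarith+
  have Bd: "cmod (B n i s) \<le> K * cmod (A i s)" for n i s
  proof -
    have "cmod (B n i s) \<le> cmod (A i s) * exp 2" unfolding B_def norm_mult by (intro mult_left_mono cut_bound) auto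
    also have "\<dots> \<le> cmod (A i s) * K" by (intro mult_left_mono K) auto
    finally show ?thesis by (simp add: mult.commute)
  qed
  have b'd: "cmod (b' n s) \<le> K * (cmod (A j s) + cmod (a' s))" for n s
  proof -
    have "cmod (b' n s) \<le> cmod (A j s) * cmod (cut' (real (Suc n)) s) + cmod (a' s) * cmod (cut (real (Suc n)) s)"
      unfolding b'_def using norm_triangle_ineq by (metis norm_mult)
    also have "\<dots> \<le> cmod (A j s) * K + cmod (a' s) * K"
    proof (intro add_mono mult_left_mono)
      have "4 * exp 2 / real (Suc n) \<le> 4 * exp 2 / 1" by (intro divide_left_mono) auto
      then show "cmod (cut' (real (Suc n)) s) \<le> K" using cut'_bound[of "real (Suc n)" s] by (simp add: K_def)
      show "cmod (cut (real (Suc n)) s) \<le> K" using cut_bound[of "real (Suc n)" s] K by linarith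
    qed auto
    finally show ?thesis by (simp add: algebra_simps)
  qed
  have d1: "cmod (cprod (B n) x) \<le> K ^ CARD('n) * cmod (cprod A x)" for n x
  proof -
    have "cmod (cprod (B n) x) \<le> (\<Prod>i\<in>UNIV. K * cmod (A i (x $ i)))"
      unfolding cprod_def prod_norm[symmetric] by (intro prod_mono conjI Bd) auto
    then show ?thesis by (simp add: prod.distrib cprod_def prod_norm)
  qed
  have d2: "cmod (cprod ((B n)(j := b' n)) x) \<le> K ^ CARD('n) * (cmod (cprod A x) + cmod (cprod (A(j := a')) x))" for n x
  proof -
    let ?P = "\<Prod>i\<in>UNIV - {j}. cmod (A i (x $ i))"
    have "cmod (cprod ((B n)(j := b' n)) x) = cmod (b' n (x $ j)) * (\<Prod>i\<in>UNIV - {j}. cmod (B n i (x $ i)))"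
      unfolding cprod_update norm_mult prod_norm ..
    also have "\<dots> \<le> (K * (cmod (A j (x $ j)) + cmod (a' (x $ j)))) * (\<Prod>i\<in>UNIV - {j}. K * cmod (A i (x $ i)))"
      using K by (intro mult_mono b'd prod_mono conjI Bd prod_nonneg) auto
    also have "\<dots> = (K * K ^ card (UNIV - {j})) * (cmod (A j (x $ j)) * ?P + cmod (a' (x $ j)) * ?P)"
      by (simp add: prod.distrib algebra_simps)
    also have "K * K ^ card (UNIV - {j} :: 'n set) = K ^ CARD('n)"
      by (subst power_Suc[symmetric]) (simp add: card_Suc_Diff1)
    also have "cmod (A j (x $ j)) * ?P = cmod (cprod A x)"
      using cprod_update[of A j "A j" x] by (simp add: norm_mult prod_norm)
    also have "cmod (a' (x $ j)) * ?P = cmod (cprod (A(j := a')) x)"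
      unfolding cprod_update norm_mult prod_norm ..
    finally show ?thesis .
  qed
  have c: "(\<integral>x. u x * cprod ((B n)(j := b' n)) x \<partial>lborel) = - (\<integral>x. g x * cprod (B n) x \<partial>lborel)" for n
  proof (rule weak_partial_cprod_compact[OF wk u g])
    show "B n i \<in> smooth_alg" for i
      unfolding B_def[abs_def] by (intro smooth_alg.mult A cut_smooth)
    show "B n i s = 0" if "\<bar>s\<bar> > real (Suc n)" for i s
      unfolding B_def using that cut_zero[of "real (Suc n)" s] by simp
    show "(B n j has_vector_derivative b' n s) (at s)" for s
      unfolding B_def b'_def by (intro has_vector_derivative_mult a' cut_deriv)
  qed
  have l1: "(\<lambda>n. \<integral>x. g x * cprod (B n) x \<partial>lborel) \<longlonglongrightarrow> (\<integral>x. g x * cprod A x \<partial>lborel)"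
  proof (rule integral_dominated_convergence[where w="\<lambda>x. K ^ CARD('n) * cmod (g x * cprod A x)"])
    show "integrable lborel (\<lambda>x. K ^ CARD('n) * cmod (g x * cprod A x))"
      using integrable_norm[OF integrable_L2_mult[OF g LA'(1)]] by (rule integrable_mult_right)
    show "AE x in lborel. (\<lambda>n. g x * cprod (B n) x) \<longlonglongrightarrow> g x * cprod A x"
    proof (intro AE_I2 tendsto_intros)
      fix x :: "real^'n"
      have "(\<lambda>n. cprod (B n) x) \<longlonglongrightarrow> (\<Prod>i\<in>UNIV. A i (x $ i) * 1)"
        unfolding cprod_def B_def by (intro tendsto_intros cut_tendsto)
      then show "(\<lambda>n. cprod (B n) x) \<longlonglongrightarrow> cprod A x" by (simp add: cprod_def)
    qed
    show "AE x in lborel. norm (g x * cprod (B n) x) \<le> K ^ CARD('n) * cmod (g x * cprod A x)" for n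
    proof (rule AE_I2)
      fix x :: "real^'n"
      have "cmod (g x) * cmod (cprod (B n) x) \<le> cmod (g x) * (K ^ CARD('n) * cmod (cprod A x))" by (intro mult_left_mono d1) auto
      then show "norm (g x * cprod (B n) x) \<le> K ^ CARD('n) * cmod (g x * cprod A x)" by (simp add: norm_mult mult_ac)
    qed
  qed measurable
  have l2: "(\<lambda>n. \<integral>x. u x * cprod ((B n)(j := b' n)) x \<partial>lborel) \<longlonglongrightarrow> (\<integral>x. u x * cprod (A(j := a')) x \<partial>lborel)"
  proof (rule integral_dominated_convergence[where w="\<lambda>x. K ^ CARD('n) * (cmod (u x * cprod A x) + cmod (u x * cprod (A(j := a')) x))"])
    show "integrable lborel (\<lambda>x. K ^ CARD('n) * (cmod (u x * cprod A x) + cmod (u x * cprod (A(j := a')) x)))"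
      by (intro integrable_mult_right Bochner_Integration.integrable_add integrable_norm integrable_L2_mult u LA')
    show "AE x in lborel. (\<lambda>n. u x * cprod ((B n)(j := b' n)) x) \<longlonglongrightarrow> u x * cprod (A(j := a')) x"
    proof (intro AE_I2 tendsto_intros)
      fix x :: "real^'n"
      have c': "(\<lambda>n. cut' (real (Suc n)) s) \<longlonglongrightarrow> 0" for s
      proof (rule Lim_null_comparison)
        show "\<forall>\<^sub>F n in sequentially. norm (cut' (real (Suc n)) s) \<le> 4 * exp 2 * (1 / real (Suc n))"
        proof (intro always_eventually allI)
          show "norm (cut' (real (Suc n)) s) \<le> 4 * exp 2 * (1 / real (Suc n))" for n
            using cut'_bound[of "real (Suc n)" s] by simp
        qed
        have "(\<lambda>n. 4 * exp 2 * (1 / real (Suc n))) \<longlonglongrightarrow> 4 * exp 2 * 0"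
          by (intro tendsto_intros LIMSEQ_Suc[OF lim_1_over_n])
        then show "(\<lambda>n. 4 * exp 2 * (1 / real (Suc n))) \<longlonglongrightarrow> 0" by simp
      qed
      have "(\<lambda>n. cprod ((B n)(j := b' n)) x) \<longlonglongrightarrow> (A j (x $ j) * 0 + a' (x $ j) * 1) * (\<Prod>i\<in>UNIV - {j}. A i (x $ i) * 1)"
        unfolding cprod_update B_def b'_def by (intro tendsto_intros cut_tendsto c')
      then show "(\<lambda>n. cprod ((B n)(j := b' n)) x) \<longlonglongrightarrow> cprod (A(j := a')) x" by (simp add: cprod_update)
    qed
    show "AE x in lborel. norm (u x * cprod ((B n)(j := b' n)) x) \<le> K ^ CARD('n) * (cmod (u x * cprod A x) + cmod (u x * cprod (A(j := a')) x))" for n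
    proof (rule AE_I2)
      fix x :: "real^'n"
      have "cmod (u x) * cmod (cprod ((B n)(j := b' n)) x) \<le> cmod (u x) * (K ^ CARD('n) * (cmod (cprod A x) + cmod (cprod (A(j := a')) x)))"
        by (intro mult_left_mono d2) auto
      then show "norm (u x * cprod ((B n)(j := b' n)) x) \<le> K ^ CARD('n) * (cmod (u x * cprod A x) + cmod (u x * cprod (A(j := a')) x))"
        by (simp add: norm_mult algebra_simps)
    qed
  qed measurable
  show ?thesis
    using LIMSEQ_unique[OF l2 tendsto_minus[OF l1, folded c]] .
qed

section \<open>Moving weak derivatives onto the heat kernel\<close>

text \<open>The first and second derivatives of the kernel in direction \<open>j\<close> are given
  as polynomial multiples of \<open>heat\<close>, so that measurability, integrability and scaling
  reduce to those of \<open>heat\<close>.\<close>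

definition dheat :: "'n::finite \<Rightarrow> complex \<Rightarrow> real^'n \<Rightarrow> complex" where
  "dheat j t w = - (of_real (w $ j) / (2 * t)) * heat t w"

definition d2heat :: "'n::finite \<Rightarrow> complex \<Rightarrow> real^'n \<Rightarrow> complex" where
  "d2heat j t w = ((of_real (w $ j))\<^sup>2 / (4 * t\<^sup>2) - 1 / (2 * t)) * heat t w"

text \<open>Lets half of a Gaussian exponent absorb a quadratic prefactor.\<close>

lemma abs_le_exp_square:
  fixes y \<epsilon> :: real assumes "\<epsilon> > 0"
  shows "1 + \<bar>y\<bar> + y\<^sup>2 \<le> (2 + 2 / \<epsilon>) * exp (\<epsilon> * y\<^sup>2)"
proof -
  have "\<epsilon> * y\<^sup>2 \<le> exp (\<epsilon> * y\<^sup>2)" using exp_ge_add_one_self[of "\<epsilon> * y\<^sup>2"] by linarith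
  then have 1: "y\<^sup>2 \<le> exp (\<epsilon> * y\<^sup>2) / \<epsilon>" using assms by (simp add: field_simps)
  have 2: "1 \<le> exp (\<epsilon> * y\<^sup>2)" using assms by simp
  have "0 \<le> (1 - \<bar>y\<bar>)\<^sup>2" by simp
  then have "\<bar>y\<bar> \<le> 1 + y\<^sup>2" by (simp add: power2_diff)
  then have "1 + \<bar>y\<bar> + y\<^sup>2 \<le> 2 + 2 * y\<^sup>2" by linarith
  also have "\<dots> \<le> 2 * exp (\<epsilon> * y\<^sup>2) + 2 * (exp (\<epsilon> * y\<^sup>2) / \<epsilon>)" using 1 2 by linarith
  finally show ?thesis by (simp add: algebra_simps)
qed

lemma L2_poly_gauss_1:
  fixes c :: complex and q K :: real
  assumes c: "Re c < 0" and [measurable]: "P \<in> borel_measurable borel"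
    and P: "\<And>s. cmod (P s) \<le> K * (1 + \<bar>s - q\<bar> + (s - q)\<^sup>2)" and K: "K \<ge> 0"
  shows "L2 (\<lambda>s. P s * exp (c * (of_real (s - q))\<^sup>2))"
  unfolding L2_def
proof
  show "(\<lambda>s. P s * exp (c * (of_real (s - q))\<^sup>2)) \<in> borel_measurable lborel" by measurable
  define \<epsilon> where "\<epsilon> = - Re c / 2"
  have \<epsilon>: "\<epsilon> > 0" using c by (simp add: \<epsilon>_def)
  define K' where "K' = K * (2 + 2 / \<epsilon>)"
  have "integrable lborel (\<lambda>s. K'\<^sup>2 * exp (- ((2 * \<epsilon>) * (s - q)\<^sup>2)))"
    using integrable_exp_square_1[of "2 * \<epsilon>"] \<epsilon>
      integrable_translate_iff[of "\<lambda>s. exp (- ((2 * \<epsilon>) * s\<^sup>2))" "- q"] by auto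
  then show "integrable lborel (\<lambda>s. (cmod (P s * exp (c * (of_real (s - q))\<^sup>2)))\<^sup>2)"
  proof (rule Bochner_Integration.integrable_bound)
    show "AE s in lborel. norm ((cmod (P s * exp (c * (of_real (s - q))\<^sup>2)))\<^sup>2) \<le> norm (K'\<^sup>2 * exp (- ((2 * \<epsilon>) * (s - q)\<^sup>2)))"
    proof (rule AE_I2)
      fix s :: real
      have "cmod (P s) \<le> K * ((2 + 2 / \<epsilon>) * exp (\<epsilon> * (s - q)\<^sup>2))"
        using P[of s] mult_left_mono[OF abs_le_exp_square[OF \<epsilon>, of "s - q"] K] by linarith
      then have p: "cmod (P s) \<le> K' * exp (\<epsilon> * (s - q)\<^sup>2)" by (simp add: K'_def)
      have e: "cmod (exp (c * (of_real (s - q))\<^sup>2)) = exp (- (2 * \<epsilon>) * (s - q)\<^sup>2)"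
        using norm_exp_mult_square[of "- c" "s - q"] by (simp add: \<epsilon>_def)
      have "cmod (P s * exp (c * (of_real (s - q))\<^sup>2)) \<le> (K' * exp (\<epsilon> * (s - q)\<^sup>2)) * exp (- (2 * \<epsilon>) * (s - q)\<^sup>2)"
        unfolding norm_mult e by (intro mult_right_mono p) auto
      also have "\<dots> = K' * exp (- \<epsilon> * (s - q)\<^sup>2)" by (simp add: mult_exp_exp algebra_simps)
      finally have "(cmod (P s * exp (c * (of_real (s - q))\<^sup>2)))\<^sup>2 \<le> (K' * exp (- \<epsilon> * (s - q)\<^sup>2))\<^sup>2"
        by (intro power_mono) auto
      also have "\<dots> = K'\<^sup>2 * exp (- ((2 * \<epsilon>) * (s - q)\<^sup>2))"
        by (simp add: power_mult_distrib power2_eq_square[of "exp _"] mult_exp_exp algebra_simps)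
      finally show "norm ((cmod (P s * exp (c * (of_real (s - q))\<^sup>2)))\<^sup>2) \<le> norm (K'\<^sup>2 * exp (- ((2 * \<epsilon>) * (s - q)\<^sup>2)))"
        by simp
    qed
  qed measurable
qed

lemma norm_vec_power2: "(norm (x :: real^'n::finite))\<^sup>2 = (\<Sum>i\<in>UNIV. (x $ i)\<^sup>2)"
  by (simp add: norm_vec_def L2_set_def sum_nonneg)

text \<open>As a function of x, \<open>dheat j t (x - y)\<close> is a product of centred Gaussians
  with an additional linear factor in coordinate \<open>j\<close>, so it is an admissible test
  function after removal of the compact support.\<close>

lemma weak_partial_heat:
  fixes u g :: "real^'n::finite \<Rightarrow> complex"
  assumes wk: "weak_partial u j g" and u: "L2 u" and g: "L2 g" and t: "Re t > 0"
  shows "(\<integral>x. u x * d2heat j t (x - y) \<partial>lborel) = - (\<integral>x. g x * dheat j t (x - y) \<partial>lborel)"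
proof -
  define C where "C = 1 / (2 * of_real (sqrt pi) * csqrt t)"
  define c where "c = - (1 / (4 * t))"
  have c: "Re c < 0" using Re_inverse_pos[of "4 * t"] t by (simp add: c_def)
  define E where "E q s = C * exp (c * (of_real (s - q))\<^sup>2)" for q s :: real
  define A where "A i s = (if i = j then (- 1 / (2 * t)) * (of_real s + of_real (- (y $ j))) * E (y $ j) s else E (y $ i) s)" for i s
  define a' where "a' s = ((of_real (s - y $ j))\<^sup>2 / (4 * t\<^sup>2) - 1 / (2 * t)) * E (y $ j) s" for s
  have t0: "t \<noteq> 0" using t by auto
  have Es: "E q \<in> smooth_alg" for q unfolding E_def[abs_def] by (intro smooth_alg.intros)
  have As: "A i \<in> smooth_alg" for i
  proof (cases "i = j")
    case True
    have "(\<lambda>s. (- 1 / (2 * t)) * (of_real s + of_real (- (y $ j))) * E (y $ j) s) \<in> smooth_alg"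
      by (intro smooth_alg.intros Es)
    then show ?thesis unfolding A_def using True by simp
  next
    case False
    then show ?thesis unfolding A_def[abs_def] using Es by simp
  qed
  have LE: "L2 (E q)" for q
    unfolding E_def[abs_def] by (rule L2_poly_gauss_1[OF c, of _ "cmod C"]) (auto simp: algebra_simps)
  have LAj: "L2 (\<lambda>s. ((- 1 / (2 * t)) * (of_real s + of_real (- (y $ j))) * C) * exp (c * (of_real (s - y $ j))\<^sup>2))"
  proof (rule L2_poly_gauss_1[OF c, of _ "cmod (C / (2 * t))"])
    fix s
    have "cmod ((- 1 / (2 * t)) * (of_real s + of_real (- (y $ j))) * C) = cmod (C / (2 * t)) * cmod (of_real (s - y $ j))"
      by (simp add: norm_mult norm_divide)
    also have "\<dots> \<le> cmod (C / (2 * t)) * (1 + \<bar>s - y $ j\<bar> + (s - y $ j)\<^sup>2)"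
      unfolding norm_of_real by (intro mult_left_mono) auto
    finally show "cmod ((- 1 / (2 * t)) * (of_real s + of_real (- (y $ j))) * C) \<le> cmod (C / (2 * t)) * (1 + \<bar>s - y $ j\<bar> + (s - y $ j)\<^sup>2)" .
    show "(\<lambda>s. (- 1 / (2 * t)) * (of_real s + of_real (- (y $ j))) * C) \<in> borel_measurable borel" by measurable
    show "0 \<le> cmod (C / (2 * t))" by simp
  qed
  have LA: "L2 (A i)" for i
  proof (cases "i = j")
    case True
    then show ?thesis using LAj unfolding A_def E_def by (simp add: mult_ac)
  next
    case False
    then show ?thesis using LE unfolding A_def by simp
  qed
  define K where "K = cmod C * (cmod (1 / (4 * t\<^sup>2)) + cmod (1 / (2 * t)))"
  have La: "L2 (\<lambda>s. (((of_real (s - y $ j))\<^sup>2 / (4 * t\<^sup>2) - 1 / (2 * t)) * C) * exp (c * (of_real (s - y $ j))\<^sup>2))"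
  proof (rule L2_poly_gauss_1[OF c, of _ K])
    fix s
    let ?z = "s - y $ j"
    have gen: "T * p + T * q = (p + q) * T" for T p q :: real by (simp add: algebra_simps)
    have "cmod ((of_real ?z)\<^sup>2 / (4 * t\<^sup>2) - 1 / (2 * t)) \<le> cmod ((of_real ?z)\<^sup>2 / (4 * t\<^sup>2)) + cmod (1 / (2 * t))"
      by (rule norm_triangle_ineq4)
    also have "\<dots> = ?z\<^sup>2 * cmod (1 / (4 * t\<^sup>2)) + 1 * cmod (1 / (2 * t))"
      by (simp add: norm_divide norm_mult norm_power del: of_real_diff)
    also have "\<dots> \<le> (1 + \<bar>?z\<bar> + ?z\<^sup>2) * cmod (1 / (4 * t\<^sup>2)) + (1 + \<bar>?z\<bar> + ?z\<^sup>2) * cmod (1 / (2 * t))"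
      by (intro add_mono mult_right_mono) auto
    finally have "cmod ((of_real ?z)\<^sup>2 / (4 * t\<^sup>2) - 1 / (2 * t)) \<le> (cmod (1 / (4 * t\<^sup>2)) + cmod (1 / (2 * t))) * (1 + \<bar>?z\<bar> + ?z\<^sup>2)"
      unfolding gen .
    from mult_right_mono[OF this, of "cmod C"]
    show "cmod (((of_real ?z)\<^sup>2 / (4 * t\<^sup>2) - 1 / (2 * t)) * C) \<le> K * (1 + \<bar>?z\<bar> + ?z\<^sup>2)"
      unfolding K_def norm_mult by (simp only: norm_ge_zero mult_ac simp_thms)
    show "0 \<le> K" by (simp add: K_def)
  qed measurable
  have La': "L2 a'" using La unfolding a'_def E_def by (simp add: mult_ac)
  have Aj: "A j = (\<lambda>s. (- 1 / (2 * t)) * (of_real s + of_real (- (y $ j))) * E (y $ j) s)"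
    by (auto simp: A_def)
  have dA: "(A j has_vector_derivative a' s) (at s)" for s
  proof -
    have d1: "((\<lambda>z. (- 1 / (2 * t)) * (z + of_real (- (y $ j)))) has_field_derivative (- 1 / (2 * t))) (at (of_real s))"
      using DERIV_cmult[OF DERIV_add[OF DERIV_ident DERIV_const], of "- 1 / (2 * t)" "of_real (- (y $ j))"] by (simp only: add_0_right mult_1_right)
    have d2: "((\<lambda>z. C * exp (c * (z - of_real (y $ j))\<^sup>2)) has_field_derivative
       C * (exp (c * (of_real s - of_real (y $ j))\<^sup>2) * (c * (2 * (of_real s - of_real (y $ j)))))) (at (of_real s))"
      by (rule derivative_eq_intros refl | simp)+
    have "((\<lambda>z. (- 1 / (2 * t)) * (z + of_real (- (y $ j))) * (C * exp (c * (z - of_real (y $ j))\<^sup>2))) has_field_derivative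
       (- 1 / (2 * t)) * (C * exp (c * (of_real s - of_real (y $ j))\<^sup>2)) + (C * (exp (c * (of_real s - of_real (y $ j))\<^sup>2) * (c * (2 * (of_real s - of_real (y $ j)))))) * ((- 1 / (2 * t)) * (of_real s + of_real (- (y $ j))))) (at (of_real s))"
      by (rule DERIV_mult[OF d1 d2])
    moreover have "(- 1 / (2 * t)) * (C * exp (c * (of_real s - of_real (y $ j))\<^sup>2)) + (C * (exp (c * (of_real s - of_real (y $ j))\<^sup>2) * (c * (2 * (of_real s - of_real (y $ j)))))) * ((- 1 / (2 * t)) * (of_real s + of_real (- (y $ j)))) = a' s"
    proof -
      have alg: "(- 1 / (2 * t)) * (C * e) + (C * (e * (c * (2 * z)))) * ((- 1 / (2 * t)) * z) = (z\<^sup>2 / (4 * t\<^sup>2) - 1 / (2 * t)) * (C * e)" for e z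
        unfolding c_def using t0 by (simp add: field_simps power2_eq_square)
      have "complex_of_real s + of_real (- (y $ j)) = of_real (s - y $ j)" "complex_of_real s - of_real (y $ j) = of_real (s - y $ j)" by simp_all
      then show ?thesis unfolding a'_def E_def by (simp only: alg)
    qed
    ultimately have "((\<lambda>z. (- 1 / (2 * t)) * (z + of_real (- (y $ j))) * (C * exp (c * (z - of_real (y $ j))\<^sup>2))) has_field_derivative a' s) (at (of_real s))"
      by (simp only:)
    from has_vector_derivative_real_field[OF this] show ?thesis
      unfolding Aj E_def of_real_diff .
  qed
  have prodE: "(\<Prod>i\<in>UNIV. E (y $ i) (x $ i)) = heat t (x - y)" for x
  proof -
    have "(\<Prod>i\<in>UNIV. E (y $ i) (x $ i)) = C ^ CARD('n) * exp (\<Sum>i\<in>UNIV. c * (of_real (x $ i - y $ i))\<^sup>2)"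
      unfolding E_def prod.distrib by (simp add: exp_sum)
    also have "(\<Sum>i\<in>UNIV. c * (of_real (x $ i - y $ i))\<^sup>2) = c * of_real ((norm (x - y))\<^sup>2)"
      unfolding norm_vec_power2 by (simp add: sum_distrib_left)
    finally show ?thesis unfolding heat_def C_def[symmetric] c_def by simp
  qed
  have split: "(\<Prod>i\<in>UNIV. E (y $ i) (x $ i)) = E (y $ j) (x $ j) * (\<Prod>i\<in>UNIV - {j}. E (y $ i) (x $ i))" for x
    by (rule prod.remove) auto
  have rest: "(\<Prod>i\<in>UNIV - {j}. A i (x $ i)) = (\<Prod>i\<in>UNIV - {j}. E (y $ i) (x $ i))" for x
    by (rule prod.cong) (auto simp: A_def)
  have e1: "cprod A x = dheat j t (x - y)" for x
  proof -
    have "cprod A x = A j (x $ j) * (\<Prod>i\<in>UNIV - {j}. A i (x $ i))"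
      using cprod_update[of A j "A j" x] by (simp only: fun_upd_triv)
    then show ?thesis unfolding rest dheat_def prodE[symmetric] split by (simp add: Aj mult.assoc)
  qed
  have e2: "cprod (A(j := a')) x = d2heat j t (x - y)" for x
    unfolding cprod_update rest d2heat_def prodE[symmetric] split a'_def by simp
  show ?thesis
    using weak_partial_cprod[where A=A and a'=a', OF wk u g As LA dA La'] unfolding e1 e2 .
qed

lemma smooth_fun_line_deriv:
  fixes \<phi> :: "real^'n::finite \<Rightarrow> real"
  assumes "smooth_fun \<phi>"
  shows "((\<lambda>t. \<phi> (x + t *\<^sub>R axis j 1)) has_real_derivative partial_ax j \<phi> (x + t *\<^sub>R axis j 1)) (at t)"
proof -
  have diff: "(\<lambda>s. \<phi> (y + s *\<^sub>R axis j 1)) differentiable (at 0)" for y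
    using assms[unfolded smooth_fun_def, rule_format, of "[]"] by auto
  have "((\<lambda>s. \<phi> ((x + t *\<^sub>R axis j 1) + s *\<^sub>R axis j 1)) has_real_derivative partial_ax j \<phi> (x + t *\<^sub>R axis j 1)) (at 0)"
    using diff[of "x + t *\<^sub>R axis j 1"] unfolding partial_ax_def
    by (metis DERIV_imp_deriv real_differentiable_def)
  then have "((\<lambda>s. \<phi> ((x + t *\<^sub>R axis j 1) + s *\<^sub>R axis j 1)) has_real_derivative partial_ax j \<phi> (x + t *\<^sub>R axis j 1)) (at (t - t))"
    by simp
  then have "((\<lambda>s. \<phi> ((x + t *\<^sub>R axis j 1) + (s - t) *\<^sub>R axis j 1)) has_real_derivative partial_ax j \<phi> (x + t *\<^sub>R axis j 1) * 1) (at t)"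
    by (rule DERIV_chain2) (auto intro!: derivative_eq_intros)
  then show ?thesis by (simp add: algebra_simps)
qed

lemma integrable_indicator_cball: "integrable lborel (indicat_real (cball (c::'a::euclidean_space) r))"
  by (intro integrable_real_indicator emeasure_lborel_cball_finite) auto

text \<open>By translation invariance every difference quotient of \<open>f\<close> integrates to 0.
  The quotients are bounded and live on a fixed ball, so dominated convergence passes to the
  derivative.\<close>

lemma integral_axis_derivative_zero:
  fixes f f' :: "real^'n::finite \<Rightarrow> real"
  assumes f: "continuous_on UNIV f" and f': "continuous_on UNIV f'"
    and supp: "\<And>x. norm x > R \<Longrightarrow> f x = 0"
    and der: "\<And>x t. ((\<lambda>t. f (x + t *\<^sub>R axis j 1)) has_real_derivative f' (x + t *\<^sub>R axis j 1)) (at t)"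
  shows "(\<integral>x. f' x \<partial>lborel) = 0"
proof -
  have [measurable]: "f \<in> borel_measurable borel" "f' \<in> borel_measurable borel"
    using f f' by (auto intro: borel_measurable_continuous_onI)
  define e where "e = (axis j 1 :: real^'n)"
  have ne: "norm e = 1" by (simp add: e_def norm_axis_1)
  have "bounded (f' ` cball 0 (R + 2))"
    by (intro compact_imp_bounded compact_continuous_image continuous_on_subset[OF f']) auto
  then obtain B0 where "\<And>y. y \<in> f' ` cball 0 (R + 2) \<Longrightarrow> norm y \<le> B0" unfolding bounded_iff by blast
  then have B0: "\<bar>f' x\<bar> \<le> B0" if "norm x \<le> R + 2" for x using that by fastforce
  define B where "B = max B0 0"
  have B: "\<bar>f' x\<bar> \<le> B" if "norm x \<le> R + 2" for x using B0[OF that] by (simp add: B_def)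
  define q where "q n x = (f (x + (1 / real (Suc n)) *\<^sub>R e) - f x) / (1 / real (Suc n))" for n x
  have qle: "\<bar>q n x\<bar> \<le> B * indicator (cball 0 (R + 1)) x" for n x
  proof (cases "norm x \<le> R + 1")
    case True
    have h: "1 / real (Suc n) \<le> 1" "1 / real (Suc n) > 0" by auto
    have "\<bar>f (x + (1 / real (Suc n)) *\<^sub>R e) - f (x + 0 *\<^sub>R e)\<bar> \<le> B * (1 / real (Suc n)) - B * 0"
      unfolding real_norm_def[symmetric]
    proof (rule differentiable_bound_general[where f="\<lambda>t. f (x + t *\<^sub>R e)" and \<phi>="\<lambda>t. B * t" and f'="\<lambda>t. f' (x + t *\<^sub>R e)" and \<phi>'="\<lambda>_. B"])
      show "0 < 1 / real (Suc n)" by simp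
      show "continuous_on {0..1 / real (Suc n)} (\<lambda>t. f (x + t *\<^sub>R e))"
        by (intro continuous_on_compose2[OF f] continuous_intros) auto
      show "continuous_on {0..1 / real (Suc n)} (\<lambda>t. B * t)" by (intro continuous_intros)
      fix t assume t: "0 < t" "t < 1 / real (Suc n)"
      show "((\<lambda>t. f (x + t *\<^sub>R e)) has_vector_derivative f' (x + t *\<^sub>R e)) (at t)"
        using der[of x t] by (simp add: e_def has_real_derivative_iff_has_vector_derivative)
      show "((\<lambda>t. B * t) has_vector_derivative B) (at t)" by (auto intro!: derivative_eq_intros)
      have "norm (x + t *\<^sub>R e) \<le> norm x + norm (t *\<^sub>R e)" by (rule norm_triangle_ineq)
      also have "norm (t *\<^sub>R e) = t" using t by (simp add: ne)
      finally have "norm (x + t *\<^sub>R e) \<le> R + 2" using True t h by linarith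
      then show "norm (f' (x + t *\<^sub>R e)) \<le> B" using B by simp
    qed
    then have "\<bar>f (x + (1 / real (Suc n)) *\<^sub>R e) - f x\<bar> \<le> B * (1 / real (Suc n))" by simp
    then have "\<bar>f (x + (1 / real (Suc n)) *\<^sub>R e) - f x\<bar> / (1 / real (Suc n)) \<le> B"
      by (subst pos_divide_le_eq[OF h(2)])
    then have "\<bar>q n x\<bar> \<le> B" unfolding q_def by (simp add: abs_mult)
    then show ?thesis using True by simp
  next
    case False
    have "norm x \<le> norm (x + (1 / real (Suc n)) *\<^sub>R e) + norm ((1 / real (Suc n)) *\<^sub>R e)"
      using norm_triangle_ineq4[of "x + (1 / real (Suc n)) *\<^sub>R e" "(1 / real (Suc n)) *\<^sub>R e"] by simp
    moreover have "norm ((1 / real (Suc n)) *\<^sub>R e) \<le> 1" by (simp add: ne)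
    ultimately have "norm (x + (1 / real (Suc n)) *\<^sub>R e) > R" "norm x > R" using False by linarith+
    then have "f (x + (1 / real (Suc n)) *\<^sub>R e) = 0" "f x = 0" by (auto intro!: supp)
    then show ?thesis using False by (simp add: q_def)
  qed
  have int: "integrable lborel (\<lambda>x::real^'n. B * indicator (cball 0 (R + 1)) x)"
    by (intro integrable_mult_right integrable_indicator_cball)
  have [measurable]: "q n \<in> borel_measurable borel" for n unfolding q_def[abs_def] by measurable
  have lim: "(\<lambda>n. \<integral>x. q n x \<partial>lborel) \<longlonglongrightarrow> (\<integral>x. f' x \<partial>lborel)"
  proof (rule integral_dominated_convergence[where w="\<lambda>x. B * indicator (cball 0 (R + 1)) x"])
    show "AE x in lborel. (\<lambda>n. q n x) \<longlonglongrightarrow> f' x"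
    proof (rule AE_I2)
      fix x
      have "((\<lambda>h. (f (x + (0 + h) *\<^sub>R e) - f (x + 0 *\<^sub>R e)) / h) \<longlongrightarrow> f' (x + 0 *\<^sub>R e)) (at 0)"
        using der[of x 0] unfolding e_def DERIV_def .
      moreover have "filterlim (\<lambda>n. 1 / real (Suc n)) (at 0) sequentially"
        unfolding filterlim_at using LIMSEQ_Suc[OF lim_1_over_n[where 'a=real]] by simp
      ultimately have "(\<lambda>n. (f (x + (0 + 1 / real (Suc n)) *\<^sub>R e) - f (x + 0 *\<^sub>R e)) / (1 / real (Suc n))) \<longlonglongrightarrow> f' (x + 0 *\<^sub>R e)"
        by (rule filterlim_compose)
      then show "(\<lambda>n. q n x) \<longlonglongrightarrow> f' x" by (simp add: q_def)
    qed
    show "AE x in lborel. norm (q n x) \<le> B * indicator (cball 0 (R + 1)) x" for n using qle by auto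
  qed (use int in measurable)
  have "integrable lborel f"
  proof -
    have "bounded (f ` cball 0 R)" by (intro compact_imp_bounded compact_continuous_image continuous_on_subset[OF f]) auto
    then obtain C where C: "\<And>y. y \<in> f ` cball 0 R \<Longrightarrow> norm y \<le> C" unfolding bounded_iff by blast
    have "norm (f x) \<le> norm (C * indicator (cball 0 R) x)" for x
      using C[of "f x"] supp[of x] by (cases "x \<in> cball 0 R") auto
    then show ?thesis
      by (rule Bochner_Integration.integrable_bound[OF integrable_mult_right[OF integrable_indicator_cball, of C 0 R] _ AE_I2, rotated]) measurable
  qed
  then have "(\<integral>x. q n x \<partial>lborel) = 0" for n
    using integral_translate[of f "(1 / real (Suc n)) *\<^sub>R e"] integrable_translate_iff[of f "(1 / real (Suc n)) *\<^sub>R e"]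
    unfolding q_def by simp
  with lim show ?thesis by (simp add: LIMSEQ_const_iff)
qed

lemma test_fun_support:
  assumes "test_fun \<phi>"
  obtains R where "\<And>x. norm x > R \<Longrightarrow> \<phi> x = 0" "\<And>x. norm x > R \<Longrightarrow> partial_ax j \<phi> x = 0"
proof -
  have "bounded (closure {x. \<phi> x \<noteq> 0})" using assms by (auto simp: test_fun_def compact_imp_bounded)
  then have "bounded {x. \<phi> x \<noteq> 0}" using bounded_subset closure_subset by blast
  then obtain R where R: "\<And>x. \<phi> x \<noteq> 0 \<Longrightarrow> norm x \<le> R" by (auto simp: bounded_iff)
  have z: "\<phi> x = 0" if "norm x > R" for x using R[of x] that by auto
  have "partial_ax j \<phi> x = 0" if x: "norm x > R" for x
  proof -
    have "((\<lambda>t. \<phi> (x + t *\<^sub>R axis j 1)) has_real_derivative partial_ax j \<phi> (x + 0 *\<^sub>R axis j 1)) (at 0)"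
      using assms by (intro smooth_fun_line_deriv) (simp add: test_fun_def)
    moreover have "\<forall>\<^sub>F t in nhds 0. \<phi> (x + t *\<^sub>R axis j 1) = 0"
    proof -
      have "open {t. norm (x + t *\<^sub>R axis j 1) > R}" by (intro open_Collect_less continuous_intros)
      then have "\<forall>\<^sub>F t in nhds 0. t \<in> {t. norm (x + t *\<^sub>R axis j 1) > R}" using x by (intro eventually_nhds_in_open) auto
      then show ?thesis by eventually_elim (auto intro: z)
    qed
    ultimately have "((\<lambda>t. 0) has_real_derivative partial_ax j \<phi> x) (at 0)"
      using DERIV_cong_ev[OF refl, of "\<lambda>t. \<phi> (x + t *\<^sub>R axis j 1)" "\<lambda>_. 0" 0] by simp
    then show ?thesis using DERIV_unique[OF _ DERIV_const] by blast
  qed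
  then show ?thesis using that z by blast
qed

lemma L2_of_continuous_compact_support:
  fixes f :: "real^'n::finite \<Rightarrow> real"
  assumes f: "continuous_on UNIV f" and supp: "\<And>x. norm x > R \<Longrightarrow> f x = 0"
  shows "L2 (\<lambda>x. complex_of_real (f x))"
proof -
  have [measurable]: "f \<in> borel_measurable borel" by (rule borel_measurable_continuous_onI[OF f])
  have "bounded (f ` cball 0 R)" by (intro compact_imp_bounded compact_continuous_image continuous_on_subset[OF f]) auto
  then obtain C where C: "\<And>y. y \<in> f ` cball 0 R \<Longrightarrow> norm y \<le> C" unfolding bounded_iff by blast
  have le: "\<bar>f x\<bar> \<le> max C 0 * indicator (cball 0 R) x" for x
    using C[of "f x"] supp[of x] by (cases "x \<in> cball 0 R") auto
  have int: "integrable lborel (\<lambda>x. complex_of_real (f x))"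
    by (rule Bochner_Integration.integrable_bound[OF integrable_mult_right[OF integrable_indicator_cball, of "max C 0" 0 R]])
      (auto intro!: AE_I2 order_trans[OF le])
  show ?thesis
  proof (rule L2_of_bounded_integrable[OF int, of "max C 0"])
    show "cmod (complex_of_real (f x)) \<le> max C 0" for x
      unfolding norm_of_real by (rule order_trans[OF le]) (simp add: indicator_def)
  qed
qed

text \<open>Integration by parts for two test functions. With a test function in the role of the
  Sobolev function, the heat kernel identities also show that the resolvent maps into H^1.\<close>

lemma
  fixes \<phi> :: "real^'n::finite \<Rightarrow> real"
  assumes \<phi>: "test_fun \<phi>"
  shows weak_partial_test_fun: "weak_partial (\<lambda>x. of_real (\<phi> x)) j (\<lambda>x. of_real (partial_ax j \<phi> x))"
    and L2_test_fun: "L2 (\<lambda>x. complex_of_real (\<phi> x))"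
    and L2_partial_test_fun: "L2 (\<lambda>x. complex_of_real (partial_ax j \<phi> x))"
proof -
  have cont: "continuous_on UNIV \<psi>" "continuous_on UNIV (partial_ax j \<psi>)" if "test_fun \<psi>" for \<psi> :: "real^'n \<Rightarrow> real"
    using that[unfolded test_fun_def smooth_fun_def, THEN conjunct1, rule_format, of "[]"]
      that[unfolded test_fun_def smooth_fun_def, THEN conjunct1, rule_format, of "[j]"] by auto
  have L: "L2 (\<lambda>x. complex_of_real (\<psi> x))" "L2 (\<lambda>x. complex_of_real (partial_ax j \<psi> x))" if \<psi>: "test_fun \<psi>" for \<psi> :: "real^'n \<Rightarrow> real"
  proof -
    obtain R where R: "\<And>x. norm x > R \<Longrightarrow> \<psi> x = 0" "\<And>x. norm x > R \<Longrightarrow> partial_ax j \<psi> x = 0"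
      using test_fun_support[OF \<psi>] by blast
    show "L2 (\<lambda>x. complex_of_real (\<psi> x))" by (rule L2_of_continuous_compact_support[OF cont(1)[OF \<psi>] R(1)])
    show "L2 (\<lambda>x. complex_of_real (partial_ax j \<psi> x))" by (rule L2_of_continuous_compact_support[OF cont(2)[OF \<psi>] R(2)])
  qed
  show "L2 (\<lambda>x. complex_of_real (\<phi> x))" "L2 (\<lambda>x. complex_of_real (partial_ax j \<phi> x))" using L[OF \<phi>] by auto
  show "weak_partial (\<lambda>x. of_real (\<phi> x)) j (\<lambda>x. of_real (partial_ax j \<phi> x))"
    unfolding weak_partial_def
  proof (intro allI impI)
    fix \<psi> :: "real^'n \<Rightarrow> real" assume \<psi>: "test_fun \<psi>"
    obtain R where R: "\<And>x. norm x > R \<Longrightarrow> \<psi> x = 0" using test_fun_support[OF \<psi>] by blast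
    have "(\<integral>x. \<phi> x * partial_ax j \<psi> x + partial_ax j \<phi> x * \<psi> x \<partial>lborel) = 0"
    proof (rule integral_axis_derivative_zero[where f="\<lambda>x. \<phi> x * \<psi> x" and j=j and R=R])
      show "continuous_on UNIV (\<lambda>x. \<phi> x * \<psi> x)" "continuous_on UNIV (\<lambda>x. \<phi> x * partial_ax j \<psi> x + partial_ax j \<phi> x * \<psi> x)"
        by (intro continuous_intros cont \<phi> \<psi>)+
      show "\<phi> x * \<psi> x = 0" if "norm x > R" for x using R[OF that] by simp
      fix x t
      show "((\<lambda>t. \<phi> (x + t *\<^sub>R axis j 1) * \<psi> (x + t *\<^sub>R axis j 1)) has_real_derivative
        \<phi> (x + t *\<^sub>R axis j 1) * partial_ax j \<psi> (x + t *\<^sub>R axis j 1) + partial_ax j \<phi> (x + t *\<^sub>R axis j 1) * \<psi> (x + t *\<^sub>R axis j 1)) (at t)"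
        using DERIV_mult[OF smooth_fun_line_deriv[of \<phi> x j t] smooth_fun_line_deriv[of \<psi> x j t]] \<phi> \<psi>
        by (simp add: test_fun_def algebra_simps)
    qed
    then have "(\<integral>x. complex_of_real (\<phi> x * partial_ax j \<psi> x + partial_ax j \<phi> x * \<psi> x) \<partial>lborel) = 0"
      unfolding integral_complex_of_real by simp
    then have "(\<integral>x. complex_of_real (\<phi> x) * of_real (partial_ax j \<psi> x) + of_real (partial_ax j \<phi> x) * of_real (\<psi> x) \<partial>lborel) = 0"
      by simp
    then show "(\<integral>x. complex_of_real (\<phi> x) * of_real (partial_ax j \<psi> x) \<partial>lborel) = - (\<integral>x. of_real (partial_ax j \<phi> x) * of_real (\<psi> x) \<partial>lborel)"
      using integrable_L2_mult[OF L(1)[OF \<phi>] L(2)[OF \<psi>]] integrable_L2_mult[OF L(2)[OF \<phi>] L(1)[OF \<psi>]]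
      by (subst (asm) Bochner_Integration.integral_add) (auto simp: add_eq_0_iff2)
  qed
qed

text \<open>The same argument one order lower, with the Gaussian itself as the test
  function.\<close>

lemma weak_partial_heat_first:
  fixes u g :: "real^'n::finite \<Rightarrow> complex"
  assumes wk: "weak_partial u j g" and u: "L2 u" and g: "L2 g" and t: "Re t > 0"
  shows "(\<integral>x. u x * dheat j t (x - y) \<partial>lborel) = - (\<integral>x. g x * heat t (x - y) \<partial>lborel)"
proof -
  define C where "C = 1 / (2 * of_real (sqrt pi) * csqrt t)"
  define c where "c = - (1 / (4 * t))"
  have c: "Re c < 0" using Re_inverse_pos[of "4 * t"] t by (simp add: c_def)
  define E where "E q s = C * exp (c * (of_real (s - q))\<^sup>2)" for q s :: real
  define A where "A i = E (y $ i)" for i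
  define a' where "a' s = - (of_real (s - y $ j) / (2 * t)) * E (y $ j) s" for s
  have t0: "t \<noteq> 0" using t by auto
  have As: "A i \<in> smooth_alg" for i unfolding A_def E_def[abs_def] by (intro smooth_alg.intros)
  have LA: "L2 (A i)" for i
    unfolding A_def E_def[abs_def] by (rule L2_poly_gauss_1[OF c, of _ "cmod C"]) (auto simp: algebra_simps)
  have La: "L2 (\<lambda>s. (- (of_real (s - y $ j) / (2 * t)) * C) * exp (c * (of_real (s - y $ j))\<^sup>2))"
  proof (rule L2_poly_gauss_1[OF c, of _ "cmod (C / (2 * t))"])
    fix s
    have "cmod (- (of_real (s - y $ j) / (2 * t)) * C) = cmod (C / (2 * t)) * cmod (of_real (s - y $ j))"
      by (simp add: norm_mult norm_divide)
    also have "\<dots> \<le> cmod (C / (2 * t)) * (1 + \<bar>s - y $ j\<bar> + (s - y $ j)\<^sup>2)"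
      unfolding norm_of_real by (intro mult_left_mono) auto
    finally show "cmod (- (of_real (s - y $ j) / (2 * t)) * C) \<le> cmod (C / (2 * t)) * (1 + \<bar>s - y $ j\<bar> + (s - y $ j)\<^sup>2)" .
    show "(\<lambda>s. - (of_real (s - y $ j) / (2 * t)) * C) \<in> borel_measurable borel" by measurable
    show "0 \<le> cmod (C / (2 * t))" by simp
  qed
  have La': "L2 a'" using La unfolding a'_def E_def by (simp add: mult_ac)
  have dA: "(A j has_vector_derivative a' s) (at s)" for s
  proof -
    have "((\<lambda>z. C * exp (c * (z - of_real (y $ j))\<^sup>2)) has_field_derivative
        C * (exp (c * (of_real s - of_real (y $ j))\<^sup>2) * (c * (2 * (of_real s - of_real (y $ j)))))) (at (of_real s))"
      by (rule derivative_eq_intros refl | simp)+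
    moreover have "C * (exp (c * (of_real s - of_real (y $ j))\<^sup>2) * (c * (2 * (of_real s - of_real (y $ j))))) = a' s"
    proof -
      have alg: "C * (e * (c * (2 * z))) = - (z / (2 * t)) * (C * e)" for e z
        unfolding c_def using t0 by (simp add: field_simps)
      show ?thesis unfolding a'_def E_def of_real_diff by (rule alg)
    qed
    ultimately have "((\<lambda>z. C * exp (c * (z - of_real (y $ j))\<^sup>2)) has_field_derivative a' s) (at (of_real s))"
      by (simp only:)
    from has_vector_derivative_real_field[OF this] show ?thesis
      unfolding A_def E_def of_real_diff .
  qed
  have prodE: "cprod A x = heat t (x - y)" for x
  proof -
    have "cprod A x = C ^ CARD('n) * exp (\<Sum>i\<in>UNIV. c * (of_real (x $ i - y $ i))\<^sup>2)"
      unfolding cprod_def A_def E_def prod.distrib by (simp add: exp_sum)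
    also have "(\<Sum>i\<in>UNIV. c * (of_real (x $ i - y $ i))\<^sup>2) = c * of_real ((norm (x - y))\<^sup>2)"
      unfolding norm_vec_power2 by (simp add: sum_distrib_left)
    finally show ?thesis unfolding heat_def C_def[symmetric] c_def by simp
  qed
  have e2: "cprod (A(j := a')) x = dheat j t (x - y)" for x
  proof -
    have "cprod A x = A j (x $ j) * (\<Prod>i\<in>UNIV - {j}. A i (x $ i))"
      using cprod_update[of A j "A j" x] by (simp only: fun_upd_triv)
    then show ?thesis unfolding cprod_update dheat_def prodE[symmetric] a'_def by (simp add: A_def mult.assoc)
  qed
  show ?thesis
    using weak_partial_cprod[where A=A and a'=a', OF wk u g As LA dA La'] unfolding prodE e2 .
qed

lemma heat_scale_1: "s > 0 \<Longrightarrow> heat (of_real s * t) w = of_real (1 / sqrt s ^ CARD('n)) * heat t ((1 / sqrt s) *\<^sub>R w)"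
  for w :: "real^'n::finite"
  using heat_scale[of s t w] by simp

text \<open>Each derivative costs a factor s^(-1/2). One such factor is integrable at time 0, two
  are not; hence \<open>d2heat\<close> is integrated in time only over compact intervals of positive
  times.\<close>

lemma dheat_scale:
  fixes w :: "real^'n::finite"
  assumes s: "s > 0"
  shows "dheat j (of_real s * t) w = of_real (1 / sqrt s) * (of_real (1 / sqrt s ^ CARD('n)) * dheat j t ((1 / sqrt s) *\<^sub>R w))"
proof -
  have "of_real (w $ j) / (2 * (of_real s * t)) = complex_of_real (1 / sqrt s) * (of_real (((1 / sqrt s) *\<^sub>R w) $ j) / (2 * t))"
    using s by (simp flip: of_real_mult)
  then show ?thesis unfolding dheat_def heat_scale_1[OF s] by (simp only: mult_minus_left mult_minus_right mult.assoc mult.left_commute)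
qed

lemma d2heat_scale:
  fixes w :: "real^'n::finite"
  assumes s: "s > 0"
  shows "d2heat j (of_real s * t) w = of_real (1 / s) * (of_real (1 / sqrt s ^ CARD('n)) * d2heat j t ((1 / sqrt s) *\<^sub>R w))"
proof -
  have "(complex_of_real (w $ j))\<^sup>2 / (4 * (of_real s * t)\<^sup>2) - 1 / (2 * (of_real s * t))
     = of_real (1 / s) * ((of_real (((1 / sqrt s) *\<^sub>R w) $ j))\<^sup>2 / (4 * t\<^sup>2) - 1 / (2 * t))"
  proof -
    have "(complex_of_real (((1 / sqrt s) *\<^sub>R w) $ j))\<^sup>2 = of_real ((((1 / sqrt s) *\<^sub>R w) $ j)\<^sup>2)" by simp
    also have "(((1 / sqrt s) *\<^sub>R w) $ j)\<^sup>2 = (w $ j)\<^sup>2 / s" using s by (simp add: power_divide)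
    finally have "(complex_of_real (((1 / sqrt s) *\<^sub>R w) $ j))\<^sup>2 = (complex_of_real (w $ j))\<^sup>2 / of_real s" by simp
    then show ?thesis using s by (simp only: power_mult_distrib) (simp add: right_diff_distrib power2_eq_square mult_ac)
  qed
  then show ?thesis unfolding d2heat_def heat_scale_1[OF s] by (simp only: mult.assoc mult.left_commute)
qed

lemma dheat_measurable [measurable]: "dheat j t \<in> borel_measurable borel"
  unfolding dheat_def[abs_def] by measurable

lemma d2heat_measurable [measurable]: "d2heat j t \<in> borel_measurable borel"
  unfolding d2heat_def[abs_def] by measurable

lemma heat_measurable_2 [measurable]: "(\<lambda>(s, w). heat (of_real s * t) w) \<in> borel_measurable (borel \<Otimes>\<^sub>M (borel :: (real^'n::finite) measure))"
proof -
  have csq: "csqrt \<in> borel_measurable borel"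
  proof -
    \<comment> \<open>The principal root jumps across the negative axis, so joint measurability is
      read off from its real and imaginary parts.\<close>
    have "csqrt = (\<lambda>z. Complex (sqrt ((cmod z + Re z) / 2)) ((if Im z = 0 then 1 else sgn (Im z)) * sqrt ((cmod z - Re z) / 2)))"
      by (rule ext) (simp add: complex_eq_iff csqrt.sel)
    moreover have "(\<lambda>z. Complex (sqrt ((cmod z + Re z) / 2)) ((if Im z = 0 then 1 else sgn (Im z)) * sqrt ((cmod z - Re z) / 2))) \<in> borel_measurable borel"
      unfolding Complex_eq by measurable
    ultimately show ?thesis by simp
  qed
  note [measurable] = measurable_compose[OF _ csq]
  show ?thesis unfolding heat_def[abs_def] case_prod_beta' by measurable
qed

lemma dheat_measurable_2 [measurable]: "(\<lambda>(s, w). dheat j (of_real s * t) w) \<in> borel_measurable (borel \<Otimes>\<^sub>M (borel :: (real^'n::finite) measure))"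
proof -
  have [measurable]: "(\<lambda>x. heat (of_real (fst x) * t) (snd x)) \<in> borel_measurable (borel \<Otimes>\<^sub>M (borel :: (real^'n::finite) measure))"
    using heat_measurable_2[of t] by (simp add: case_prod_beta')
  have [measurable]: "(\<lambda>x :: real \<times> (real^'n). snd x $ j) \<in> borel_measurable (borel \<Otimes>\<^sub>M borel)"
    by (rule measurable_compose[OF measurable_snd]) (intro borel_measurable_continuous_onI continuous_intros)
  show ?thesis unfolding dheat_def[abs_def] case_prod_beta' by measurable
qed

lemma d2heat_measurable_2 [measurable]: "(\<lambda>(s, w). d2heat j (of_real s * t) w) \<in> borel_measurable (borel \<Otimes>\<^sub>M (borel :: (real^'n::finite) measure))"
proof -
  have [measurable]: "(\<lambda>x. heat (of_real (fst x) * t) (snd x)) \<in> borel_measurable (borel \<Otimes>\<^sub>M (borel :: (real^'n::finite) measure))"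
    using heat_measurable_2[of t] by (simp add: case_prod_beta')
  have [measurable]: "(\<lambda>x :: real \<times> (real^'n). snd x $ j) \<in> borel_measurable (borel \<Otimes>\<^sub>M borel)"
    by (rule measurable_compose[OF measurable_snd]) (intro borel_measurable_continuous_onI continuous_intros)
  show ?thesis unfolding d2heat_def[abs_def] case_prod_beta' by measurable
qed

lemma integrable_poly_heat:
  fixes P :: "real^'n::finite \<Rightarrow> complex"
  assumes t: "Re t > 0" and [measurable]: "P \<in> borel_measurable borel"
    and P: "\<And>w. cmod (P w) \<le> K * (1 + \<bar>norm w\<bar> + (norm w)\<^sup>2)" and K: "K \<ge> 0"
  shows "integrable lborel (\<lambda>w. P w * heat t w)"
proof -
  define c where "c = Re (1 / t) / 4"
  have c: "c > 0" using Re_inverse_pos[OF t] by (simp add: c_def)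
  define H where "H = (1 / (2 * sqrt (pi * cmod t))) ^ CARD('n)"
  have H: "H \<ge> 0" by (simp add: H_def)
  define K' where "K' = K * (2 + 2 / (c / 2)) * H"
  have "integrable lborel (\<lambda>w::real^'n. K' * exp (- (c / 2 * (norm w)\<^sup>2)))"
    using integrable_exp_norm_square[of "c / 2"] c by auto
  then show ?thesis
  proof (rule Bochner_Integration.integrable_bound)
    show "AE w in lborel. norm (P w * heat t w) \<le> norm (K' * exp (- (c / 2 * (norm w)\<^sup>2)))"
    proof (rule AE_I2)
      fix w :: "real^'n"
      have "cmod (P w) \<le> K * ((2 + 2 / (c / 2)) * exp (c / 2 * (norm w)\<^sup>2))"
        using P[of w] mult_left_mono[OF abs_le_exp_square[of "c / 2" "norm w"] K] c by linarith
      moreover have "cmod (heat t w) = H * exp (- (c * (norm w)\<^sup>2))"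
        unfolding norm_heat c_def H_def by simp
      ultimately have "cmod (P w * heat t w) \<le> (K * ((2 + 2 / (c / 2)) * exp (c / 2 * (norm w)\<^sup>2))) * (H * exp (- (c * (norm w)\<^sup>2)))"
        unfolding norm_mult by (intro mult_mono) (use H K c in auto)
      also have "\<dots> = K' * (exp (c / 2 * (norm w)\<^sup>2) * exp (- (c * (norm w)\<^sup>2)))"
        unfolding K'_def by (simp only: mult_ac)
      also have "exp (c / 2 * (norm w)\<^sup>2) * exp (- (c * (norm w)\<^sup>2)) = exp (- (c / 2 * (norm w)\<^sup>2))"
        unfolding exp_add[symmetric] by simp
      finally show "norm (P w * heat t w) \<le> norm (K' * exp (- (c / 2 * (norm w)\<^sup>2)))" by simp
    qed
  qed measurable
qed

lemma integrable_dheat: "Re t > 0 \<Longrightarrow> integrable lborel (dheat j t :: real^'n::finite \<Rightarrow> complex)"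
  unfolding dheat_def[abs_def]
proof (rule integrable_poly_heat[where K="cmod (1 / (2 * t))"])
  fix w :: "real^'n"
  have "cmod (- (of_real (w $ j) / (2 * t))) = cmod (1 / (2 * t)) * \<bar>w $ j\<bar>" by (simp add: norm_divide)
  also have "\<dots> \<le> cmod (1 / (2 * t)) * (1 + \<bar>norm w\<bar> + (norm w)\<^sup>2)"
    using component_le_norm_cart[of w j] by (intro mult_left_mono) (auto intro: add_increasing2)
  finally show "cmod (- (of_real (w $ j) / (2 * t))) \<le> cmod (1 / (2 * t)) * (1 + \<bar>norm w\<bar> + (norm w)\<^sup>2)" .
qed auto

lemma integrable_d2heat: "Re t > 0 \<Longrightarrow> integrable lborel (d2heat j t :: real^'n::finite \<Rightarrow> complex)"
  unfolding d2heat_def[abs_def]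
proof (rule integrable_poly_heat[where K="cmod (1 / (4 * t\<^sup>2)) + cmod (1 / (2 * t))"])
  fix w :: "real^'n"
  let ?T = "1 + \<bar>norm w\<bar> + (norm w)\<^sup>2"
  have "cmod ((of_real (w $ j))\<^sup>2 / (4 * t\<^sup>2) - 1 / (2 * t)) \<le> cmod ((of_real (w $ j))\<^sup>2 / (4 * t\<^sup>2)) + cmod (1 / (2 * t))"
    by (rule norm_triangle_ineq4)
  also have "\<dots> = cmod (1 / (4 * t\<^sup>2)) * (w $ j)\<^sup>2 + cmod (1 / (2 * t)) * 1"
    by (simp add: norm_divide norm_mult norm_power)
  also have "\<dots> \<le> cmod (1 / (4 * t\<^sup>2)) * ?T + cmod (1 / (2 * t)) * ?T"
  proof (intro add_mono mult_left_mono)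
    have "(w $ j)\<^sup>2 \<le> (norm w)\<^sup>2" using component_le_norm_cart[of w j] by (simp add: abs_le_square_iff[symmetric])
    then show "(w $ j)\<^sup>2 \<le> ?T" using norm_ge_zero[of w] by linarith
  qed auto
  finally show "cmod ((of_real (w $ j))\<^sup>2 / (4 * t\<^sup>2) - 1 / (2 * t)) \<le> (cmod (1 / (4 * t\<^sup>2)) + cmod (1 / (2 * t))) * ?T"
    by (simp only: distrib_right)
qed auto

lemma integral_norm_scaled:
  fixes \<psi> :: "real^'n::finite \<Rightarrow> complex"
  assumes s: "s > 0" and [measurable]: "\<psi> \<in> borel_measurable borel"
  shows "(\<integral>w. cmod (of_real (1 / sqrt s ^ CARD('n)) * \<psi> ((1 / sqrt s) *\<^sub>R w)) \<partial>lborel) = (\<integral>w. cmod (\<psi> w) \<partial>lborel)"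
proof -
  have "(\<integral>w. cmod (\<psi> w) \<partial>lborel) = \<bar>1 / sqrt s\<bar> ^ CARD('n) *\<^sub>R (\<integral>w. cmod (\<psi> (0 + (1 / sqrt s) *\<^sub>R w)) \<partial>lborel)"
    using integral_affine[of "1 / sqrt s" "\<lambda>w. cmod (\<psi> w)" 0] s by simp
  also have "\<dots> = (\<integral>w. (1 / sqrt s ^ CARD('n)) * cmod (\<psi> ((1 / sqrt s) *\<^sub>R w)) \<partial>lborel)"
    using s by (simp add: power_one_over)
  also have "\<dots> = (\<integral>w. cmod (of_real (1 / sqrt s ^ CARD('n)) * \<psi> ((1 / sqrt s) *\<^sub>R w)) \<partial>lborel)"
    using s by (simp add: norm_mult norm_divide norm_power)
  finally show ?thesis by simp
qed

lemma integrable_scaled: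
  fixes \<psi> :: "real^'n::finite \<Rightarrow> complex"
  assumes s: "s > 0" and \<psi>: "integrable lborel \<psi>"
  shows "integrable lborel (\<lambda>w. of_real (1 / sqrt s ^ CARD('n)) * \<psi> ((1 / sqrt s) *\<^sub>R w))"
proof -
  have [measurable]: "\<psi> \<in> borel_measurable borel" using \<psi> by auto
  show ?thesis using integrable_affine_iff[of "1 / sqrt s" \<psi> 0] s \<psi> by (intro integrable_mult_right) simp
qed

text \<open>Parabolic scaling makes the \<open>L\<^sup>1\<close> norm of a kernel profile independent of the time variable.\<close>

lemma integrable_pair_scaled:
  fixes F :: "real \<Rightarrow> real^'n::finite \<Rightarrow> complex"
  assumes \<rho>: "integrable lborel \<rho>" "\<And>s. s \<le> 0 \<Longrightarrow> \<rho> s = 0" and \<psi>: "integrable lborel \<psi>"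
    and F [measurable]: "(\<lambda>(s, w). F s w) \<in> borel_measurable (lborel \<Otimes>\<^sub>M lborel)"
    and eq: "\<And>s w. s > 0 \<Longrightarrow> F s w = \<rho> s * (of_real (1 / sqrt s ^ CARD('n)) * \<psi> ((1 / sqrt s) *\<^sub>R w))"
    and zero: "\<And>s w. s \<le> 0 \<Longrightarrow> F s w = 0"
  shows "integrable (lborel \<Otimes>\<^sub>M lborel) (\<lambda>(s, w). F s w)"
proof (rule lborel_pair.Fubini_integrable[OF F])
  have [measurable]: "\<psi> \<in> borel_measurable borel" using \<psi> by auto
  have int: "integrable lborel (F s)" for s
  proof (cases "s > 0")
    case True
    have "F s = (\<lambda>w. \<rho> s * (of_real (1 / sqrt s ^ CARD('n)) * \<psi> ((1 / sqrt s) *\<^sub>R w)))" using eq[OF True] by auto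
    then show ?thesis using integrable_scaled[OF True \<psi>] by (simp only: integrable_mult_right)
  next
    case False
    then have "F s = (\<lambda>w. 0)" using zero by auto
    then show ?thesis by simp
  qed
  then show "AE s in lborel. integrable lborel (\<lambda>w. case (s, w) of (s, w) \<Rightarrow> F s w)" by simp
  have "(\<integral>w. cmod (F s w) \<partial>lborel) = cmod (\<rho> s) * (\<integral>w. cmod (\<psi> w) \<partial>lborel)" for s
  proof (cases "s > 0")
    case True
    have "(\<integral>w. cmod (F s w) \<partial>lborel) = (\<integral>w. cmod (\<rho> s) * cmod (of_real (1 / sqrt s ^ CARD('n)) * \<psi> ((1 / sqrt s) *\<^sub>R w)) \<partial>lborel)"
      unfolding eq[OF True] norm_mult[of "\<rho> s"] ..
    then show ?thesis using integral_norm_scaled[OF True, of \<psi>] by simp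
  next
    case False
    then show ?thesis using zero \<rho>(2) by simp
  qed
  then show "integrable lborel (\<lambda>s. \<integral>w. norm (case (s, w) of (s, w) \<Rightarrow> F s w) \<partial>lborel)"
    using integrable_norm[OF \<rho>(1)] by simp
qed

lemma integrable_pair_bounded_mult:
  fixes F :: "real \<Rightarrow> real^'n::finite \<Rightarrow> complex"
  assumes F: "integrable (lborel \<Otimes>\<^sub>M lborel) (\<lambda>(s, w). F s w)"
    and [measurable]: "c \<in> borel_measurable borel" and c: "\<And>w. cmod (c w) \<le> B"
  shows "integrable (lborel \<Otimes>\<^sub>M lborel) (\<lambda>(s, w). F s w * c w)"
proof -
  have [measurable]: "(\<lambda>x. F (fst x) (snd x)) \<in> borel_measurable (lborel \<Otimes>\<^sub>M lborel)"
    using borel_measurable_integrable[OF F] by (simp add: case_prod_beta')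
  have B: "B \<ge> 0" using c[of 0] norm_ge_zero order_trans by blast
  show ?thesis
  proof (rule Bochner_Integration.integrable_bound[OF integrable_mult_right[OF integrable_norm[OF F], of B]])
    show "(\<lambda>(s, w). F s w * c w) \<in> borel_measurable (lborel \<Otimes>\<^sub>M lborel)" unfolding case_prod_beta' by measurable
    show "AE x in lborel \<Otimes>\<^sub>M lborel. norm (case x of (s, w) \<Rightarrow> F s w * c w) \<le> norm (B * norm (case x of (s, w) \<Rightarrow> F s w))"
      using B c by (auto simp: norm_mult case_prod_beta' mult.commute[of B] intro!: mult_left_mono)
  qed
qed

section \<open>The resolvent kernel and its gradient\<close>

text \<open>The time weight of the subordination formula at \<zeta> = 1, where the power of s is
  trivial and \<open>Gamma\<close> equals 1.\<close>

definition rho :: "complex \<Rightarrow> real \<Rightarrow> complex" where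
  "rho k s = indicator {0<..} s *\<^sub>R exp (- (of_real s * k))"

lemma rho_measurable [measurable]: "rho k \<in> borel_measurable borel"
  unfolding rho_def[abs_def] by measurable

lemma
  assumes k: "Re k > 0"
  shows integrable_rho: "integrable lborel (rho k)"
    and integrable_rho_sqrt: "integrable lborel (\<lambda>s. rho k s * of_real (1 / sqrt s))"
proof -
  have "integrable lborel (\<lambda>s. indicator {0<..} s *\<^sub>R (cpw s (1 - 1) * exp (- (of_real s * k))))"
    using k by (intro integrable_gamma) auto
  then show "integrable lborel (rho k)" by (simp add: rho_def[abs_def] cpw_def)
  show "integrable lborel (\<lambda>s. rho k s * of_real (1 / sqrt s))"
  proof (rule Bochner_Integration.integrable_bound[OF integrable_gamma_bound[OF _ k, of "1/2"]])
    show "AE s in lborel. norm (rho k s * of_real (1 / sqrt s)) \<le> norm (indicator {0<..} s *\<^sub>R (s powr (1 / 2 - 1) * exp (- (Re k * s))))"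
    proof (rule AE_I2)
      fix s :: real
      show "norm (rho k s * of_real (1 / sqrt s)) \<le> norm (indicator {0<..} s *\<^sub>R (s powr (1 / 2 - 1) * exp (- (Re k * s))))"
      proof (cases "s > 0")
        case True
        have "s powr (- (1 / 2)) = 1 / sqrt s"
          using True by (simp only: powr_minus powr_half_sqrt less_imp_le inverse_eq_divide)
        moreover have "1 / 2 - 1 = - (1 / 2 :: real)" by simp
        ultimately have "s powr (1 / 2 - 1) = 1 / sqrt s" by (simp only:)
        then show ?thesis using True by (simp add: rho_def norm_mult norm_divide mult.commute)
      qed (simp add: rho_def)
    qed
  qed (simp, measurable)
qed

text \<open>The kernel of the resolvent of the Laplacian at -k^2: the Laplace transform of the heat
  semigroup, rotated to the complex times s/k, which explains the factor 1/k. Where the time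
  integral diverges, as at w = 0 for d \<ge> 2, the value is 0 by convention; this concerns a null
  set.\<close>

definition rk :: "complex \<Rightarrow> real^'n::finite \<Rightarrow> complex" where
  "rk k w = 1 / k * (\<integral>s. rho k s * heat (of_real s * (1 / k)) w \<partial>lborel)"

definition rkd :: "complex \<Rightarrow> 'n::finite \<Rightarrow> real^'n \<Rightarrow> complex" where
  "rkd k j w = 1 / k * (\<integral>s. rho k s * dheat j (of_real s * (1 / k)) w \<partial>lborel)"

lemma pair_rk:
  assumes k: "Re k > 0"
  shows "integrable (lborel \<Otimes>\<^sub>M lborel) (\<lambda>(s, w). rho k s * heat (of_real s * (1 / k)) (w :: real^'n::finite))"
proof (rule integrable_pair_scaled[OF integrable_rho[OF k] _ integrable_heat[OF Re_inverse_pos[OF k]]])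
  show "(\<lambda>(s, w). rho k s * heat (of_real s * (1 / k)) (w :: real^'n)) \<in> borel_measurable (lborel \<Otimes>\<^sub>M lborel)"
    using heat_measurable_2[of "1 / k"] unfolding case_prod_beta' by measurable
qed (simp_all only: heat_scale_1 rho_def indicator_simps greaterThan_iff not_less[symmetric] scaleR_zero_left mult_zero_left not_False_eq_True)

lemma pair_rkd:
  assumes k: "Re k > 0"
  shows "integrable (lborel \<Otimes>\<^sub>M lborel) (\<lambda>(s, w). rho k s * dheat j (of_real s * (1 / k)) (w :: real^'n::finite))"
proof (rule integrable_pair_scaled[OF integrable_rho_sqrt[OF k] _ integrable_dheat[OF Re_inverse_pos[OF k], of j]])
  show "(\<lambda>(s, w). rho k s * dheat j (of_real s * (1 / k)) (w :: real^'n)) \<in> borel_measurable (lborel \<Otimes>\<^sub>M lborel)"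
    using dheat_measurable_2[of j "1 / k"] unfolding case_prod_beta' by measurable
qed (simp_all only: dheat_scale mult.assoc rho_def indicator_simps greaterThan_iff not_less[symmetric] scaleR_zero_left mult_zero_left not_False_eq_True)

text \<open>Common to \<open>rk\<close> and \<open>rkd\<close>: Fubini exchanges the time integral
  with pairing against a bounded function, so identities for the resolvent follow from identities at
  each fixed time.\<close>

lemma
  fixes F :: "real \<Rightarrow> real^'n::finite \<Rightarrow> complex"
  assumes F: "integrable (lborel \<Otimes>\<^sub>M lborel) (\<lambda>(s, w). rho k s * F s w)"
  shows integrable_time_integral: "integrable lborel (\<lambda>w. 1 / k * (\<integral>s. rho k s * F s w \<partial>lborel))"
    and integrable_time_pairing: "c \<in> borel_measurable borel \<Longrightarrow> (\<And>w. cmod (c w) \<le> B) \<Longrightarrow> integrable lborel (\<lambda>s. rho k s * (\<integral>w. F s w * c w \<partial>lborel))"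
    and time_integral_pairing: "c \<in> borel_measurable borel \<Longrightarrow> (\<And>w. cmod (c w) \<le> B) \<Longrightarrow>
      (\<integral>w. 1 / k * (\<integral>s. rho k s * F s w \<partial>lborel) * c w \<partial>lborel) = 1 / k * (\<integral>s. rho k s * (\<integral>w. F s w * c w \<partial>lborel) \<partial>lborel)"
proof -
  show "integrable lborel (\<lambda>w. 1 / k * (\<integral>s. rho k s * F s w \<partial>lborel))"
    by (intro integrable_mult_right lborel_pair.integrable_snd[OF F])
  assume c: "c \<in> borel_measurable borel" "\<And>w. cmod (c w) \<le> B"
  note Fc = integrable_pair_bounded_mult[OF F c]
  have eq: "(\<integral>w. rho k s * F s w * c w \<partial>lborel) = rho k s * (\<integral>w. F s w * c w \<partial>lborel)" for s
    by (subst integral_mult_right_zero[symmetric]) (simp add: mult.assoc)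
  show "integrable lborel (\<lambda>s. rho k s * (\<integral>w. F s w * c w \<partial>lborel))"
    using lborel_pair.integrable_fst[OF Fc] unfolding eq .
  have "(\<integral>w. 1 / k * (\<integral>s. rho k s * F s w \<partial>lborel) * c w \<partial>lborel) = (\<integral>w. 1 / k * (\<integral>s. rho k s * F s w * c w \<partial>lborel) \<partial>lborel)"
    unfolding mult.assoc[of "1 / k"] integral_mult_left_zero ..
  also have "\<dots> = 1 / k * (\<integral>w. \<integral>s. rho k s * F s w * c w \<partial>lborel \<partial>lborel)" by (rule integral_mult_right_zero)
  also have "(\<integral>w. \<integral>s. rho k s * F s w * c w \<partial>lborel \<partial>lborel) = (\<integral>s. \<integral>w. rho k s * F s w * c w \<partial>lborel \<partial>lborel)"
    by (rule lborel_pair.Fubini_integral[OF Fc])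
  finally show "(\<integral>w. 1 / k * (\<integral>s. rho k s * F s w \<partial>lborel) * c w \<partial>lborel) = 1 / k * (\<integral>s. rho k s * (\<integral>w. F s w * c w \<partial>lborel) \<partial>lborel)"
    unfolding eq .
qed

lemmas integrable_rk = integrable_time_integral[OF pair_rk, folded rk_def]
lemmas integrable_rkd = integrable_time_integral[OF pair_rkd, folded rkd_def]
lemmas integral_rk_mult = time_integral_pairing[OF pair_rk, folded rk_def]
lemmas integral_rkd_mult = time_integral_pairing[OF pair_rkd, folded rkd_def]

lemma integral_mult_corr_swap:
  fixes \<psi> f g :: "real^'n::finite \<Rightarrow> complex"
  assumes \<psi>: "integrable lborel \<psi>" and f: "L2 f" and g: "L2 g"
  shows "(\<integral>w. \<psi> w * corr f g w \<partial>lborel) = (\<integral>y. g y * (\<integral>x. f x * \<psi> (x - y) \<partial>lborel) \<partial>lborel)"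
proof -
  have [measurable]: "\<psi> \<in> borel_measurable borel" "f \<in> borel_measurable borel" "g \<in> borel_measurable borel" using \<psi> f g by auto
  have cc: "corr g f (0 - w) = corr f g w" for w
  proof -
    have "corr f g w = (\<integral>x. f (x + w) * g (x + w - w) \<partial>lborel)"
      unfolding corr_def by (rule integral_translate[symmetric]) measurable
    then show ?thesis by (simp add: corr_def mult.commute)
  qed
  let ?\<psi> = "\<lambda>w. \<psi> (- w)"
  have \<psi>': "integrable lborel ?\<psi>" using integrable_reflect_iff[of \<psi> 0] \<psi> by simp
  have "conv ?\<psi> f y = (\<integral>x. f x * \<psi> (x - y) \<partial>lborel)" for y
  proof -
    have "conv ?\<psi> f y = (\<integral>x. ?\<psi> (y - x) * f (y - (y - x)) \<partial>lborel)"
      unfolding conv_def by (rule integral_reflect[symmetric]) measurable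
    then show ?thesis by (simp add: mult.commute)
  qed
  then have "(\<integral>y. g y * (\<integral>x. f x * \<psi> (x - y) \<partial>lborel) \<partial>lborel) = (\<integral>y. g y * conv ?\<psi> f y \<partial>lborel)" by simp
  also have "\<dots> = (\<integral>w. ?\<psi> w * corr g f w \<partial>lborel)" by (rule integral_mult_conv[OF \<psi>' g f])
  also have "\<dots> = (\<integral>w. ?\<psi> (0 - w) * corr g f (0 - w) \<partial>lborel)"
    by (rule integral_reflect[symmetric]) measurable
  finally show ?thesis unfolding cc by simp
qed

text \<open>A weak derivative on the first entry of a correlation moves to the kernel with a minus
  sign. Written as iterated integrals, the inner one is the tested weak derivative at the centre
  y.\<close>

lemma heat_corr_weak:
  fixes u v g :: "real^'n::finite \<Rightarrow> complex"
  assumes wk: "weak_partial u j v" and u: "L2 u" and v: "L2 v" and g: "L2 g" and t: "Re t > 0"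
  shows "(\<integral>w. dheat j t w * corr v g w \<partial>lborel) = - (\<integral>w. d2heat j t w * corr u g w \<partial>lborel)"
    and "(\<integral>w. heat t w * corr v g w \<partial>lborel) = - (\<integral>w. dheat j t w * corr u g w \<partial>lborel)"
proof -
  show "(\<integral>w. dheat j t w * corr v g w \<partial>lborel) = - (\<integral>w. d2heat j t w * corr u g w \<partial>lborel)"
    unfolding integral_mult_corr_swap[OF integrable_dheat[OF t] v g] integral_mult_corr_swap[OF integrable_d2heat[OF t] u g]
      weak_partial_heat[OF wk u v t] by simp
  show "(\<integral>w. heat t w * corr v g w \<partial>lborel) = - (\<integral>w. dheat j t w * corr u g w \<partial>lborel)"
    unfolding integral_mult_corr_swap[OF integrable_heat[OF t] v g] integral_mult_corr_swap[OF integrable_dheat[OF t] u g]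
      weak_partial_heat_first[OF wk u v t] by simp
qed

lemma Re_scaled_pos: "s > 0 \<Longrightarrow> Re k > 0 \<Longrightarrow> Re (of_real s * (1 / k)) > 0"
  using Re_inverse_pos[of k] by (simp only: times_complex.sel Re_complex_of_real Im_complex_of_real) simp

text \<open>The conjugates are there because the form of \<open>is_eigenvalue\<close> conjugates its
  test function, while all resolvent pairings are bilinear. The weak derivative is found by moving
  the derivative from the test function to the heat kernel at each time.\<close>

lemma H1_grad_resolvent:
  fixes g :: "real^'n::finite \<Rightarrow> complex"
  assumes k: "Re k > 0" and g: "integrable lborel g" "\<And>x. cmod (g x) \<le> B"
  shows "H1_grad (\<lambda>x. cnj (conv (rk k) g x)) (\<lambda>j x. cnj (conv (rkd k j) g x))"
proof -
  have Lg: "L2 g" by (rule L2_of_bounded_integrable[OF g])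
  have [measurable]: "g \<in> borel_measurable borel" using g by auto
  have L: "L2 (conv (rk k) g)" "L2 (conv (rkd k j) g)" for j
    by (rule L2_conv[OF integrable_rk[OF k] g], rule L2_conv[OF integrable_rkd[OF k] g])
  have Lc: "L2 f \<Longrightarrow> L2 (\<lambda>x. cnj (f x))" for f :: "real^'n \<Rightarrow> complex" by (auto simp: L2_def)
  have "weak_partial (\<lambda>x. cnj (conv (rk k) g x)) j (\<lambda>x. cnj (conv (rkd k j) g x))" for j
    unfolding weak_partial_def
  proof (intro allI impI)
    fix \<phi> :: "real^'n \<Rightarrow> real" assume \<phi>: "test_fun \<phi>"
    let ?p = "\<lambda>x. complex_of_real (\<phi> x)" and ?q = "\<lambda>x. complex_of_real (partial_ax j \<phi> x)"
    note p = L2_test_fun[OF \<phi>] and q = L2_partial_test_fun[OF \<phi>, of j]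
    have [measurable]: "?p \<in> borel_measurable borel" "?q \<in> borel_measurable borel" using p q by auto
    have "(\<integral>x. ?q x * conv (rk k) g x \<partial>lborel) = (\<integral>w. rk k w * corr ?q g w \<partial>lborel)"
      by (rule integral_mult_conv[OF integrable_rk[OF k] q Lg])
    also have "\<dots> = 1 / k * (\<integral>s. rho k s * (\<integral>w. heat (of_real s * (1 / k)) w * corr ?q g w \<partial>lborel) \<partial>lborel)"
      by (rule integral_rk_mult[OF k _ cmod_corr_le[OF q Lg]]) measurable
    also have "\<dots> = 1 / k * (\<integral>s. - (rho k s * (\<integral>w. dheat j (of_real s * (1 / k)) w * corr ?p g w \<partial>lborel)) \<partial>lborel)"
    proof -
      \<comment> \<open>Here the test function plays the role of the Sobolev function, its classical
        derivative that of the weak one.\<close>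
      have "rho k s * (\<integral>w. heat (of_real s * (1 / k)) w * corr ?q g w \<partial>lborel) = - (rho k s * (\<integral>w. dheat j (of_real s * (1 / k)) w * corr ?p g w \<partial>lborel))" for s
      proof (cases "s > 0")
        case True
        show ?thesis using heat_corr_weak(2)[OF weak_partial_test_fun[OF \<phi>] p q Lg Re_scaled_pos[OF True k]] by simp
      qed (simp add: rho_def)
      then show ?thesis by simp
    qed
    also have "\<dots> = - (1 / k * (\<integral>s. rho k s * (\<integral>w. dheat j (of_real s * (1 / k)) w * corr ?p g w \<partial>lborel) \<partial>lborel))"
      by simp
    also have "1 / k * (\<integral>s. rho k s * (\<integral>w. dheat j (of_real s * (1 / k)) w * corr ?p g w \<partial>lborel) \<partial>lborel) = (\<integral>w. rkd k j w * corr ?p g w \<partial>lborel)"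
      by (rule integral_rkd_mult[OF k _ cmod_corr_le[OF p Lg], symmetric]) measurable
    also have "\<dots> = (\<integral>x. ?p x * conv (rkd k j) g x \<partial>lborel)"
      by (rule integral_mult_conv[OF integrable_rkd[OF k] p Lg, symmetric])
    finally have "cnj (\<integral>x. ?q x * conv (rk k) g x \<partial>lborel) = cnj (- (\<integral>x. ?p x * conv (rkd k j) g x \<partial>lborel))" by simp
    then show "(\<integral>x. cnj (conv (rk k) g x) * ?q x \<partial>lborel) = - (\<integral>x. cnj (conv (rkd k j) g x) * ?p x \<partial>lborel)"
      by (simp add: mult.commute flip: Bochner_Integration.integral_cnj)
  qed
  then show ?thesis unfolding H1_grad_def Lp_2_iff using Lc L by blast
qed

section \<open>Continuity of correlations at the origin\<close>

lemma L2_indicator: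
  fixes A :: "'a::euclidean_space set"
  assumes [measurable]: "A \<in> sets borel" and "emeasure lborel A < \<infinity>"
  shows "L2 (\<lambda>x. complex_of_real (indicator A x))"
proof -
  have "integrable lborel (\<lambda>x. complex_of_real (indicator A x))"
    unfolding complex_of_real_integrable_eq using assms by (intro integrable_real_indicator) auto
  then show ?thesis by (rule L2_of_bounded_integrable[of _ 1]) (simp add: indicator_def)
qed

text \<open>If x lies in an open set, so does x - X n eventually; hence the part of U lost under the
  translation has measure tending to 0. As U and its translate have equal measure, the symmetric
  difference is twice that part.\<close>

lemma corr_open_continuous:
  fixes u :: "'a::euclidean_space \<Rightarrow> complex"
  assumes u: "L2 u" and U: "open U" "emeasure lborel U < \<infinity>" and X: "X \<longlonglongrightarrow> 0"
  shows "(\<lambda>n. corr u (\<lambda>x. of_real (indicator U x)) (X n)) \<longlonglongrightarrow> corr u (\<lambda>x. of_real (indicator U x)) 0"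
proof -
  have [measurable]: "U \<in> sets borel" using U by auto
  let ?g = "\<lambda>x. complex_of_real (indicator U x)"
  have Lg: "L2 ?g" by (rule L2_indicator[OF _ U(2)]) measurable
  have iU: "integrable lborel (indicat_real U)" using U by (intro integrable_real_indicator) auto
  have iUt: "integrable lborel (\<lambda>x. indicat_real U (x - w))" for w
    using integrable_translate_iff[of "indicat_real U" "- w"] iU by simp
  define D where "D n = (\<integral>x. \<bar>indicat_real U (x - X n) - indicator U x\<bar> \<partial>lborel)" for n
  define M where "M n x = max 0 (indicat_real U x - indicator U (x - X n))" for n x
  have iM: "integrable lborel (M n)" for n
    by (rule Bochner_Integration.integrable_bound[OF iU]) (auto simp: M_def[abs_def] indicator_def)
  have "(\<lambda>n. \<integral>x. M n x \<partial>lborel) \<longlonglongrightarrow> (\<integral>x. 0 \<partial>(lborel::'a measure))"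
  proof (rule integral_dominated_convergence[where w="indicat_real U"])
    show "AE x in lborel. (\<lambda>n. M n x) \<longlonglongrightarrow> 0"
    proof (rule AE_I2)
      fix x
      show "(\<lambda>n. M n x) \<longlonglongrightarrow> 0"
      proof (cases "x \<in> U")
        case True
        have "(\<lambda>n. x - X n) \<longlonglongrightarrow> x - 0" by (intro tendsto_intros X)
        then have "\<forall>\<^sub>F n in sequentially. x - X n \<in> U" using U(1) True by (auto intro: topological_tendstoD)
        then have "\<forall>\<^sub>F n in sequentially. M n x = 0" by eventually_elim (auto simp: M_def)
        then show ?thesis by (rule tendsto_eventually)
      qed (simp add: M_def)
    qed
    show "AE x in lborel. norm (M n x) \<le> indicat_real U x" for n by (auto simp: M_def indicator_def)
  qed (use iU iM in auto)
  moreover have "D n = 2 * (\<integral>x. M n x \<partial>lborel)" for n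
  proof -
    have "D n = (\<integral>x. 2 * M n x - (indicat_real U x - indicator U (x - X n)) \<partial>lborel)"
      unfolding D_def M_def by (intro Bochner_Integration.integral_cong) (auto simp: indicator_def)
    also have "\<dots> = (\<integral>x. 2 * M n x \<partial>lborel) - ((\<integral>x. indicat_real U x \<partial>lborel) - (\<integral>x. indicat_real U (x - X n) \<partial>lborel))"
      using iM iU iUt by (simp add: Bochner_Integration.integral_diff del: integral_indicator)
    also have "(\<integral>x. indicat_real U (x - X n) \<partial>lborel) = (\<integral>x. indicat_real U x \<partial>lborel)"
      using integral_translate[of "indicat_real U" "- X n"] by simp
    finally show ?thesis by simp
  qed
  ultimately have "(\<lambda>n. D n) \<longlonglongrightarrow> 2 * 0" by (auto intro!: tendsto_intros)
  then have "(\<lambda>n. norm2 u * sqrt (D n)) \<longlonglongrightarrow> norm2 u * sqrt 0" by (intro tendsto_intros) simp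
  then have lim: "(\<lambda>n. norm2 u * sqrt (D n)) \<longlonglongrightarrow> 0" by simp
  have "cmod (corr u ?g (X n) - corr u ?g 0) \<le> norm2 u * sqrt (D n)" for n
  proof -
    let ?h = "\<lambda>x. ?g (x - X n) - ?g x"
    have sq: "(cmod (?h x))\<^sup>2 = \<bar>indicat_real U (x - X n) - indicator U x\<bar>" for x
      by (auto simp: indicator_def)
    have ih: "integrable lborel (\<lambda>x. \<bar>indicat_real U (x - X n) - indicator U x\<bar>)"
      using iU iUt by auto
    have Lh: "L2 ?h" unfolding L2_def sq using ih by auto
    have "corr u ?g (X n) - corr u ?g 0 = (\<integral>x. u x * ?g (x - X n) - u x * ?g x \<partial>lborel)"
      unfolding corr_def using integrable_L2_mult[OF u L2_translate[OF Lg]] integrable_L2_mult[OF u Lg]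
      by (subst Bochner_Integration.integral_diff) auto
    also have "\<dots> = (\<integral>x. u x * ?h x \<partial>lborel)" by (simp add: right_diff_distrib)
    finally have "cmod (corr u ?g (X n) - corr u ?g 0) \<le> norm2 u * norm2 ?h"
      using cmod_integral_L2_le[OF u Lh] by simp
    also have "norm2 ?h = sqrt (D n)" unfolding norm2_def sq D_def ..
    finally show ?thesis .
  qed
  then have "(\<lambda>n. corr u ?g (X n) - corr u ?g 0) \<longlonglongrightarrow> 0"
    by (intro Lim_null_comparison[OF _ lim] always_eventually allI)
  then show ?thesis by (simp add: LIM_zero_iff)
qed

text \<open>Outer regularity replaces the set by an open one, with an error that Cauchy-Schwarz
  makes uniform in the translation.\<close>

lemma corr_indicator_continuous:
  fixes u :: "'a::euclidean_space \<Rightarrow> complex"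
  assumes u: "L2 u" and A: "A \<in> sets borel" "emeasure lborel A < \<infinity>" and X: "X \<longlonglongrightarrow> 0"
  shows "(\<lambda>n. corr u (\<lambda>x. of_real (indicator A x)) (X n)) \<longlonglongrightarrow> corr u (\<lambda>x. of_real (indicator A x)) 0"
proof (rule LIMSEQ_I)
  fix e :: real assume e: "e > 0"
  let ?g = "\<lambda>A x. complex_of_real (indicator A x)"
  \<comment> \<open>Cauchy-Schwarz gives the error norm2 u times sqrt \<epsilon>, which this choice
    keeps below e/4; the 1 avoids division by zero.\<close>
  define \<epsilon> where "\<epsilon> = (e / (4 * (norm2 u + 1)))\<^sup>2"
  have nu: "norm2 u + 1 > 0" using norm2_nonneg[of u] by linarith
  have \<epsilon>: "\<epsilon> > 0" using e nu by (simp add: \<epsilon>_def)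
  obtain U where U: "open U" "A \<subseteq> U" "emeasure lborel (U - A) < ennreal \<epsilon>"
    using outer_regular_lborel[OF A(1) \<epsilon>] by blast
  have [measurable]: "U \<in> sets borel" "A \<in> sets borel" using U A by auto
  have fUA: "emeasure lborel (U - A) < \<infinity>" using order.strict_trans[OF U(3) ennreal_less_top] by simp
  have "emeasure lborel U = emeasure lborel A + emeasure lborel (U - A)"
    using U(2) by (subst plus_emeasure) (auto simp: Un_absorb1)
  then have fU: "emeasure lborel U < \<infinity>" using A(2) fUA by simp
  have close: "cmod (corr u (?g U) w - corr u (?g A) w) \<le> e / 4" for w
  proof -
    have LU: "L2 (?g U)" "L2 (?g A)" "L2 (?g (U - A))" using fU A fUA by (auto intro!: L2_indicator)
    have "?g U x - ?g A x = ?g (U - A) x" for x using U(2) by (auto simp: indicator_def)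
    then have "corr u (?g U) w - corr u (?g A) w = corr u (?g (U - A)) w"
      unfolding corr_def using integrable_L2_mult[OF u L2_translate[OF LU(1)], of w] integrable_L2_mult[OF u L2_translate[OF LU(2)], of w]
      by (subst Bochner_Integration.integral_diff[symmetric]) (auto simp flip: right_diff_distrib)
    also have "cmod \<dots> \<le> norm2 u * norm2 (?g (U - A))" by (rule cmod_corr_le[OF u LU(3)])
    also have "norm2 (?g (U - A)) = sqrt (measure lborel (U - A))"
    proof -
      have "(cmod (?g (U - A) x))\<^sup>2 = indicator (U - A) x" for x by (auto simp: indicator_def)
      then show ?thesis unfolding norm2_def by simp
    qed
    also have "\<dots> \<le> sqrt \<epsilon>"
    proof -
      have "ennreal (measure lborel (U - A)) < ennreal \<epsilon>"
        using U(3) fUA by (simp add: emeasure_eq_ennreal_measure less_top)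
      then show ?thesis using \<epsilon> by (simp add: ennreal_less_iff)
    qed
    also have "sqrt \<epsilon> = e / (4 * (norm2 u + 1))" using e nu by (simp add: \<epsilon>_def)
    also have "norm2 u * (e / (4 * (norm2 u + 1))) \<le> (norm2 u + 1) * (e / (4 * (norm2 u + 1)))"
      using e nu by (intro mult_right_mono) auto
    also have "\<dots> = e / 4"
      using nu nonzero_mult_divide_mult_cancel_left[of "norm2 u + 1" e 4] by (simp add: mult.commute)
    finally show ?thesis by (simp add: mult_left_mono)
  qed
  have "(\<lambda>n. corr u (?g U) (X n)) \<longlonglongrightarrow> corr u (?g U) 0" by (rule corr_open_continuous[OF u U(1) fU X])
  then obtain N where N: "\<And>n. n \<ge> N \<Longrightarrow> cmod (corr u (?g U) (X n) - corr u (?g U) 0) < e / 4"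
    using e by (meson LIMSEQ_D divide_pos_pos zero_less_numeral)
  have "cmod (corr u (?g A) (X n) - corr u (?g A) 0) < e" if "n \<ge> N" for n
  proof -
    have "corr u (?g A) (X n) - corr u (?g A) 0 = (corr u (?g U) (X n) - corr u (?g U) 0)
        - (corr u (?g U) (X n) - corr u (?g A) (X n)) + (corr u (?g U) 0 - corr u (?g A) 0)" by simp
    then have "cmod (corr u (?g A) (X n) - corr u (?g A) 0) \<le> cmod (corr u (?g U) (X n) - corr u (?g U) 0)
        + cmod (corr u (?g U) (X n) - corr u (?g A) (X n)) + cmod (corr u (?g U) 0 - corr u (?g A) 0)"
      using norm_triangle_ineq norm_triangle_ineq4 by (smt (verit, best))
    then show ?thesis using N[OF that] close[of "X n"] close[of 0] e by linarith
  qed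
  then show "\<exists>no. \<forall>n\<ge>no. norm (corr u (?g A) (X n) - corr u (?g A) 0) < e" by blast
qed

text \<open>A simple function is a finite combination of indicators of its level sets; integrability
  makes those of nonzero value have finite measure.\<close>

lemma isCont_corr_simple:
  fixes u g :: "'a::euclidean_space \<Rightarrow> complex"
  assumes u: "L2 u" and g: "simple_function lborel g" "integrable lborel g"
  shows "isCont (corr u g) 0"
  unfolding continuous_at_sequentially comp_def
proof (intro allI impI)
  fix X assume X: "X \<longlonglongrightarrow> (0::'a)"
  have [measurable]: "g \<in> borel_measurable borel" using g by auto
  define A where "A y = {x. g x = y}" for y
  have A [measurable]: "A y \<in> sets borel" for y unfolding A_def by measurable
  have fin: "finite (range g - {0})" using g(1) by (simp add: simple_function_def)
  have mA: "emeasure lborel (A y) < \<infinity>" if "y \<noteq> 0" for y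
  proof -
    have "integrable lborel (indicat_real (A y))"
      by (rule Bochner_Integration.integrable_bound[of lborel "\<lambda>x. cmod (g x) / cmod y"])
        (use g(2) that in \<open>auto simp: A_def indicator_def\<close>)
    then show ?thesis by (simp add: integrable_indicator_iff)
  qed
  have LA: "L2 (\<lambda>x. complex_of_real (indicator (A y) x))" if "y \<noteq> 0" for y
    using mA[OF that] by (intro L2_indicator) auto
  have geq: "g x = (\<Sum>y\<in>range g - {0}. y * of_real (indicator (A y) x))" for x
  proof (cases "g x = 0")
    case True
    then have "(\<Sum>y\<in>range g - {0}. y * complex_of_real (indicator (A y) x)) = 0"
      by (intro sum.neutral ballI) (auto simp: A_def)
    then show ?thesis using True by simp
  next
    case False
    have "(\<Sum>y\<in>range g - {0}. y * of_real (indicator (A y) x)) = (\<Sum>y\<in>{g x}. y * of_real (indicator (A y) x))"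
      using False fin by (intro sum.mono_neutral_right) (auto simp: A_def indicator_def)
    then show ?thesis by (simp add: A_def)
  qed
  have ceq: "corr u g w = (\<Sum>y\<in>range g - {0}. y * corr u (\<lambda>x. of_real (indicator (A y) x)) w)" for w
  proof -
    have "corr u g w = (\<integral>x. (\<Sum>y\<in>range g - {0}. y * (u x * of_real (indicator (A y) (x - w)))) \<partial>lborel)"
      unfolding corr_def by (subst geq) (simp add: sum_distrib_left mult_ac)
    also have "\<dots> = (\<Sum>y\<in>range g - {0}. y * corr u (\<lambda>x. of_real (indicator (A y) x)) w)"
      unfolding corr_def using integrable_L2_mult[OF u L2_translate[OF LA]]
      by (subst Bochner_Integration.integral_sum) auto
    finally show ?thesis .
  qed
  show "(\<lambda>n. corr u g (X n)) \<longlonglongrightarrow> corr u g 0"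
    unfolding ceq by (intro tendsto_intros corr_indicator_continuous u A X mA) auto
qed

section \<open>The resolvent identity in weak form\<close>

lemma sum_d2heat:
  fixes w :: "real^'n::finite"
  shows "(\<Sum>j\<in>UNIV. d2heat j t w) = (of_real ((norm w)\<^sup>2) / (4 * t\<^sup>2) - of_nat CARD('n) / (2 * t)) * heat t w"
proof -
  have "(\<Sum>j\<in>UNIV. d2heat j t w) = (\<Sum>j\<in>UNIV. (of_real (w $ j))\<^sup>2 / (4 * t\<^sup>2) - 1 / (2 * t)) * heat t w"
    unfolding d2heat_def by (rule sum_distrib_right[symmetric])
  also have "(\<Sum>j\<in>UNIV. (complex_of_real (w $ j))\<^sup>2 / (4 * t\<^sup>2) - 1 / (2 * t)) = of_real ((norm w)\<^sup>2) / (4 * t\<^sup>2) - of_nat CARD('n) / (2 * t)"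
    unfolding norm_vec_power2 by (simp add: sum_subtractf sum_divide_distrib)
  finally show ?thesis .
qed

text \<open>The heat equation along the ray of times s/k, where the chain rule contributes 1/k,
  combined with the decay factor exp(-s k). The explicit kernel form makes it a one-variable
  computation.\<close>

lemma heat_time_deriv:
  fixes w :: "real^'n::finite"
  assumes s: "s > 0" and k: "k \<noteq> 0"
  shows "((\<lambda>s. exp (- (of_real s * k)) * heat (of_real s * (1 / k)) w) has_vector_derivative
    exp (- (of_real s * k)) * (- k * heat (of_real s * (1 / k)) w + 1 / k * (\<Sum>j\<in>UNIV. d2heat j (of_real s * (1 / k)) w))) (at s)"
proof -
  define H where "H = (1 / (2 * of_real (sqrt pi) * csqrt (1 / k))) ^ CARD('n)"
  define c where "c = complex_of_real (- (CARD('n) / 2))"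
  define a where "a = (norm w / 2)\<^sup>2"
  have eq: "exp (- (of_real s * k)) * heat (of_real s * (1 / k)) w = H * (cpw s c * exp (- (k * of_real (s + a / s))))" if "s > 0" for s
  proof -
    have "exp (- (of_real s * k)) * exp (- (k * of_real (a / s))) = exp (- (k * of_real (s + a / s)))"
      by (simp add: exp_add[symmetric] ring_distribs mult.commute)
    then show ?thesis unfolding heat_kernel_scaled[OF that k, of w] H_def c_def a_def by (simp add: mult_ac)
  qed
  have d: "((\<lambda>s. H * (cpw s c * exp (- (k * of_real (s + a / s))))) has_vector_derivative
      H * (cpw s c * (- (k * of_real (1 - a / s\<^sup>2)) * exp (- (k * of_real (s + a / s)))) + c / of_real s * cpw s c * exp (- (k * of_real (s + a / s))))) (at s)"
    by (intro has_vector_derivative_mult_right has_vector_derivative_mult has_vector_derivative_cpw has_vector_derivative_exp_phase s)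
  have val: "H * (cpw s c * (- (k * of_real (1 - a / s\<^sup>2)) * exp (- (k * of_real (s + a / s)))) + c / of_real s * cpw s c * exp (- (k * of_real (s + a / s))))
     = exp (- (of_real s * k)) * (- k * heat (of_real s * (1 / k)) w + 1 / k * (\<Sum>j\<in>UNIV. d2heat j (of_real s * (1 / k)) w))"
  proof -
    have gen: "(- k + 1 / k * X) * (e * h) = e * (- k * h + 1 / k * (X * h))" for X e h :: complex
      by (simp only: distrib_left distrib_right mult_ac)
    let ?\<Phi> = "H * (cpw s c * exp (- (k * of_real (s + a / s))))"
    have "H * (cpw s c * (- (k * of_real (1 - a / s\<^sup>2)) * exp (- (k * of_real (s + a / s)))) + c / of_real s * cpw s c * exp (- (k * of_real (s + a / s))))
      = (- k + (k * of_real (a / s\<^sup>2) + c / of_real s)) * ?\<Phi>"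
      by (simp add: algebra_simps)
    also have "k * of_real (a / s\<^sup>2) + c / of_real s = 1 / k * (of_real ((norm w)\<^sup>2) / (4 * (of_real s * (1 / k))\<^sup>2) - of_nat CARD('n) / (2 * (of_real s * (1 / k))))"
      using s k by (simp add: a_def c_def field_simps power2_eq_square)
    finally show ?thesis unfolding sum_d2heat eq[OF s, symmetric] by (simp only: gen)
  qed
  show ?thesis
  proof (rule has_vector_derivative_transform_within_open[OF d[unfolded val], of "{0<..}"])
    fix x :: real assume "x \<in> {0<..}"
    then show "H * (cpw x c * exp (- (k * of_real (x + a / x)))) = exp (- (of_real x * k)) * heat (of_real x * (1 / k)) w"
      using eq[of x] by simp
  qed (use s in auto)
qed

lemma integrable_Icc_continuous:
  fixes f :: "real \<Rightarrow> complex"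
  assumes "continuous_on {a..b} f"
  shows "integrable lborel (\<lambda>s. indicator {a..b} s *\<^sub>R f s)"
  using borel_integrable_atLeastAtMost'[OF assms] by (simp add: set_integrable_def)

text \<open>This is (-\<Delta> + k^2) R g = g tested against \<open>u\<close>. With P(s) the pairing
  of the heat kernel with the correlation of \<open>u\<close> and \<open>g\<close>, the function
  exp(-s k) P(s) has derivative -R(s), tends to the integral of u g as s tends to 0, and vanishes at
  infinity.\<close>

lemma resolvent_identity:
  fixes u g :: "real^'n::finite \<Rightarrow> complex"
  assumes H1: "H1_grad u G" and k: "Re k > 0" and g: "simple_function lborel g" "integrable lborel g"
  shows "(\<Sum>j\<in>UNIV. \<integral>x. G j x * conv (rkd k j) g x \<partial>lborel) + k\<^sup>2 * (\<integral>x. u x * conv (rk k) g x \<partial>lborel)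
    = (\<integral>x. u x * g x \<partial>lborel)"
proof -
  have Lu: "L2 u" and LG: "\<And>j. L2 (G j)" and wk: "\<And>j. weak_partial u j (G j)"
    using H1 by (auto simp: H1_grad_def Lp_2_iff)
  obtain B where B: "\<And>x. norm (g x) \<le> B" using simple_function_lborel_bounded[OF g(1)] by blast
  have Lg: "L2 g" by (rule L2_of_bounded_integrable[OF g(2) B])
  have k0: "k \<noteq> 0" using k by auto
  have [measurable]: "u \<in> borel_measurable borel" "g \<in> borel_measurable borel" "G j \<in> borel_measurable borel" for j
    using L2_measurable[OF Lu] L2_measurable[OF Lg] L2_measurable[OF LG[of j]] by simp_all
  define c where "c = corr u g"
  define cj where "cj j = corr (G j) g" for j
  have mc [measurable]: "c \<in> borel_measurable borel" "cj j \<in> borel_measurable borel" for j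
    unfolding c_def cj_def by measurable
  have bc: "cmod (c w) \<le> norm2 u * norm2 g" "cmod (cj j w) \<le> norm2 (G j) * norm2 g" for w j
    unfolding c_def cj_def by (rule cmod_corr_le[OF Lu Lg], rule cmod_corr_le[OF LG Lg])
  let ?h = "\<lambda>s. heat (of_real s * (1 / k)) :: real^'n \<Rightarrow> complex"
  let ?d = "\<lambda>j s. dheat j (of_real s * (1 / k)) :: real^'n \<Rightarrow> complex"
  let ?dd = "\<lambda>j s. d2heat j (of_real s * (1 / k)) :: real^'n \<Rightarrow> complex"
  define P where "P s = (\<integral>w. ?h s w * c w \<partial>lborel)" for s
  define Q where "Q j s = (\<integral>w. ?d j s w * cj j w \<partial>lborel)" for j s
  \<comment> \<open>\<open>R\<close> contains only first derivatives of the kernel, paired with the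
    gradient of \<open>u\<close>; unlike \<open>d2heat\<close> these are integrable down to time
    0.\<close>
  define R where "R s = exp (- (of_real s * k)) * (k * P s + 1 / k * (\<Sum>j\<in>UNIV. Q j s))" for s
  have Q: "(\<integral>w. ?dd j s w * c w \<partial>lborel) = - Q j s" if "s > 0" for j s
    unfolding Q_def c_def cj_def using heat_corr_weak(1)[OF wk Lu LG Lg Re_scaled_pos[OF that k]] by simp
  have ic: "integrable lborel (\<lambda>w. f w * c w)" if "integrable lborel f" for f
    unfolding c_def by (rule integrable_mult_corr[OF that Lu Lg])
  \<comment> \<open>The fundamental theorem of calculus is applied for each fixed w on compact time
    intervals, then integrated against \<open>c\<close>.\<close>
  have step: "(\<integral>s. indicator {\<epsilon>..N} s *\<^sub>R R s \<partial>lborel) = exp (- (of_real \<epsilon> * k)) * P \<epsilon> - exp (- (of_real N * k)) * P N"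
    if \<epsilon>: "0 < \<epsilon>" "\<epsilon> < N" for \<epsilon> N
  proof -
    define \<phi> where "\<phi> s w = exp (- (of_real s * k)) * (- k * ?h s w + 1 / k * (\<Sum>j\<in>UNIV. ?dd j s w))" for s w
    define F where "F s w = indicator {\<epsilon>..N} s *\<^sub>R \<phi> s w" for s w
    define \<rho>0 where "\<rho>0 s = indicator {\<epsilon>..N} s *\<^sub>R (exp (- (of_real s * k)) * (- k))" for s
    define \<rho>1 where "\<rho>1 s = indicator {\<epsilon>..N} s *\<^sub>R (exp (- (of_real s * k)) * (1 / k))" for s
    have [measurable]: "\<rho>0 \<in> borel_measurable borel" "\<rho>1 \<in> borel_measurable borel"
      unfolding \<rho>0_def[abs_def] \<rho>1_def[abs_def] by measurable
    have F: "F s w = \<rho>0 s * ?h s w + (\<Sum>j\<in>UNIV. \<rho>1 s * ?dd j s w)" for s w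
      unfolding F_def \<phi>_def \<rho>0_def \<rho>1_def by (simp add: indicator_def algebra_simps sum_distrib_left)
    have i0: "integrable (lborel \<Otimes>\<^sub>M lborel) (\<lambda>(s, w). \<rho>0 s * ?h s w)"
    proof (rule integrable_pair_scaled[of \<rho>0, OF _ _ integrable_heat[OF Re_inverse_pos[OF k]]])
      show "integrable lborel \<rho>0" unfolding \<rho>0_def[abs_def] by (intro integrable_Icc_continuous continuous_intros)
      show "(\<lambda>(s, w). \<rho>0 s * ?h s w) \<in> borel_measurable (lborel \<Otimes>\<^sub>M lborel)"
        using heat_measurable_2[of "1 / k"] unfolding case_prod_beta' by measurable
      show "\<rho>0 s = 0" if "s \<le> 0" for s using that \<epsilon> by (simp add: \<rho>0_def)
      then show "\<rho>0 s * ?h s w = 0" if "s \<le> 0" for s w using that by simp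
    qed (simp only: heat_scale_1)
    have i1: "integrable (lborel \<Otimes>\<^sub>M lborel) (\<lambda>(s, w). \<rho>1 s * ?dd j s w)" for j
    proof (rule integrable_pair_scaled[of "\<lambda>s. \<rho>1 s * of_real (1 / s)", OF _ _ integrable_d2heat[OF Re_inverse_pos[OF k], of j]])
      have "integrable lborel (\<lambda>s. indicator {\<epsilon>..N} s *\<^sub>R (exp (- (of_real s * k)) * (1 / k) * of_real (1 / s)))"
        using \<epsilon> by (intro integrable_Icc_continuous continuous_intros) auto
      then show "integrable lborel (\<lambda>s. \<rho>1 s * of_real (1 / s))" unfolding \<rho>1_def by (simp only: mult_scaleR_left)
      show "(\<lambda>(s, w). \<rho>1 s * ?dd j s w) \<in> borel_measurable (lborel \<Otimes>\<^sub>M lborel)"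
        using d2heat_measurable_2[of j "1 / k"] unfolding case_prod_beta' by measurable
      show "\<rho>1 s * of_real (1 / s) = 0" if "s \<le> 0" for s using that \<epsilon> by (simp add: \<rho>1_def)
      show "\<rho>1 s * ?dd j s w = 0" if "s \<le> 0" for s w using that \<epsilon> by (simp add: \<rho>1_def)
    qed (simp only: d2heat_scale mult.assoc)
    have iF: "integrable (lborel \<Otimes>\<^sub>M lborel) (\<lambda>(s, w). F s w)"
      unfolding F using i0 i1 unfolding case_prod_beta'
      by (intro Bochner_Integration.integrable_add Bochner_Integration.integrable_sum) auto
    note Fc = integrable_pair_bounded_mult[OF iF mc(1) bc(1)]
    have "(\<integral>w. \<integral>s. F s w * c w \<partial>lborel \<partial>lborel) = (\<integral>s. \<integral>w. F s w * c w \<partial>lborel \<partial>lborel)"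
      by (rule lborel_pair.Fubini_integral[OF Fc])
    moreover have "(\<integral>w. F s w * c w \<partial>lborel) = - (indicator {\<epsilon>..N} s *\<^sub>R R s)" for s
    proof (cases "s \<in> {\<epsilon>..N}")
      case True
      then have s: "s > 0" using \<epsilon> by auto
      have t: "Re (of_real s * (1 / k)) > 0" by (rule Re_scaled_pos[OF s k])
      have "(\<integral>w. F s w * c w \<partial>lborel) = (\<integral>w. \<rho>0 s * (?h s w * c w) + (\<Sum>j\<in>UNIV. \<rho>1 s * (?dd j s w * c w)) \<partial>lborel)"
        unfolding F by (simp add: distrib_right sum_distrib_right mult.assoc)
      also have "\<dots> = \<rho>0 s * P s + (\<Sum>j\<in>UNIV. \<rho>1 s * (\<integral>w. ?dd j s w * c w \<partial>lborel))"
        unfolding P_def using ic[OF integrable_heat[OF t]] ic[OF integrable_d2heat[OF t]]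
        by (subst Bochner_Integration.integral_add) (auto simp: Bochner_Integration.integral_sum)
      also have "\<dots> = - R s"
        unfolding Q[OF s] R_def \<rho>0_def \<rho>1_def using True by (simp add: sum_negf sum_distrib_left algebra_simps)
      finally show ?thesis using True by simp
    qed (simp add: F_def)
    moreover have "(\<integral>s. F s w * c w \<partial>lborel) = exp (- (of_real N * k)) * (?h N w * c w) - exp (- (of_real \<epsilon> * k)) * (?h \<epsilon> w * c w)" for w
    proof -
      have der: "((\<lambda>s. exp (- (of_real s * k)) * ?h s w) has_vector_derivative \<phi> s w) (at s)" if "s > 0" for s
        unfolding \<phi>_def by (rule heat_time_deriv[OF that k0])
      have co: "continuous_on {\<epsilon>..N} (\<lambda>s. exp (- (of_real s * k)) * ?h s w)"
        by (intro continuous_at_imp_continuous_on ballI has_vector_derivative_continuous[OF der]) (use \<epsilon> in auto)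
      have pe: "\<phi> s w = (- k + 1 / k * (of_real ((norm w)\<^sup>2) / (4 * (of_real s * (1 / k))\<^sup>2) - of_nat CARD('n) / (2 * (of_real s * (1 / k))))) * (exp (- (of_real s * k)) * ?h s w)" for s
        unfolding \<phi>_def sum_d2heat by (simp add: algebra_simps)
      have cc: "continuous_on {\<epsilon>..N} (\<lambda>s. (- k + 1 / k * (of_real ((norm w)\<^sup>2) / (4 * (of_real s * (1 / k))\<^sup>2) - of_nat CARD('n) / (2 * (of_real s * (1 / k))))))"
        using \<epsilon> k0 by (intro continuous_intros) simp_all
      have "continuous_on {\<epsilon>..N} (\<lambda>s. \<phi> s w)"
        unfolding pe by (rule continuous_on_mult[OF cc co])
      then have "(\<integral>s. F s w \<partial>lborel) = exp (- (of_real N * k)) * ?h N w - exp (- (of_real \<epsilon> * k)) * ?h \<epsilon> w"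
        unfolding F_def using \<epsilon> by (intro integral_FTC_Icc has_vector_derivative_at_within[OF der]) auto
      then show ?thesis by (simp add: left_diff_distrib mult.assoc)
    qed
    ultimately have "(\<integral>w. exp (- (of_real N * k)) * (?h N w * c w) - exp (- (of_real \<epsilon> * k)) * (?h \<epsilon> w * c w) \<partial>lborel) = - (\<integral>s. indicator {\<epsilon>..N} s *\<^sub>R R s \<partial>lborel)"
      by simp
    also have "(\<integral>w. exp (- (of_real N * k)) * (?h N w * c w) - exp (- (of_real \<epsilon> * k)) * (?h \<epsilon> w * c w) \<partial>lborel)
       = exp (- (of_real N * k)) * P N - exp (- (of_real \<epsilon> * k)) * P \<epsilon>"
      unfolding P_def using ic[OF integrable_heat[OF Re_scaled_pos[of N k]]] ic[OF integrable_heat[OF Re_scaled_pos[of \<epsilon> k]]] \<epsilon> k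
      by (subst Bochner_Integration.integral_diff) auto
    finally show ?thesis by (simp add: algebra_simps)
  qed
  have iP: "integrable lborel (\<lambda>s. rho k s * P s)" unfolding P_def by (rule integrable_time_pairing[OF pair_rk[OF k] mc(1) bc(1)])
  have iQ: "integrable lborel (\<lambda>s. rho k s * Q j s)" for j unfolding Q_def by (rule integrable_time_pairing[OF pair_rkd[OF k] mc(2) bc(2)])
  have Req: "indicator {0<..} s *\<^sub>R R s = k * (rho k s * P s) + 1 / k * (\<Sum>j\<in>UNIV. rho k s * Q j s)" for s
    unfolding R_def rho_def by (simp add: indicator_def algebra_simps sum_distrib_left)
  have iR: "integrable lborel (\<lambda>s. indicator {0<..} s *\<^sub>R R s)"
    unfolding Req by (intro Bochner_Integration.integrable_add integrable_mult_right Bochner_Integration.integrable_sum iP iQ)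
  \<comment> \<open>The truncation [1/(n + 1), n + 2] exhausts the positive half line; the shift to
    n + 2 keeps the interval nondegenerate for n = 0.\<close>
  define e where "e n = 1 / real (Suc n)" for n
  define N where "N n = real (Suc (Suc n))" for n
  have eN: "0 < e n" "e n < N n" for n
  proof -
    show "0 < e n" by (simp add: e_def)
    have "e n \<le> 1" by (simp add: e_def)
    then show "e n < N n" by (simp add: N_def)
  qed
  have [measurable]: "(\<lambda>s. indicator {0<..} s *\<^sub>R R s) \<in> borel_measurable borel" using iR by auto
  have elim: "e \<longlonglongrightarrow> 0" unfolding e_def by (rule LIMSEQ_Suc[OF lim_1_over_n])
  have "(\<lambda>n. \<integral>s. indicator {e n..N n} s *\<^sub>R (indicator {0<..} s *\<^sub>R R s) \<partial>lborel) \<longlonglongrightarrow> (\<integral>s. indicator {0<..} s *\<^sub>R R s \<partial>lborel)"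
  proof (rule integral_dominated_convergence[where w="\<lambda>s. norm (indicator {0<..} s *\<^sub>R R s)"])
    show "AE s in lborel. (\<lambda>n. indicator {e n..N n} s *\<^sub>R (indicator {0<..} s *\<^sub>R R s)) \<longlonglongrightarrow> indicator {0<..} s *\<^sub>R R s"
    proof (rule AE_I2)
      fix s :: real
      show "(\<lambda>n. indicator {e n..N n} s *\<^sub>R (indicator {0<..} s *\<^sub>R R s)) \<longlonglongrightarrow> indicator {0<..} s *\<^sub>R R s"
      proof (cases "s > 0")
        case True
        have "\<forall>\<^sub>F n in sequentially. e n < s" using elim True by (auto intro: order_tendstoD)
        moreover have "\<forall>\<^sub>F n in sequentially. s \<le> N n"
          unfolding N_def by (rule eventually_sequentiallyI[of "nat \<lceil>s\<rceil>"]) linarith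
        ultimately have "\<forall>\<^sub>F n in sequentially. indicator {e n..N n} s *\<^sub>R (indicator {0<..} s *\<^sub>R R s) = indicator {0<..} s *\<^sub>R R s"
          by eventually_elim auto
        then show ?thesis by (rule tendsto_eventually)
      qed auto
    qed
    show "AE s in lborel. norm (indicator {e n..N n} s *\<^sub>R (indicator {0<..} s *\<^sub>R R s)) \<le> norm (indicator {0<..} s *\<^sub>R R s)" for n
      by (auto simp: indicator_def)
    show "integrable lborel (\<lambda>s. norm (indicator {0<..} s *\<^sub>R R s))" using iR by (rule integrable_norm)
  qed measurable
  moreover have "(\<integral>s. indicator {e n..N n} s *\<^sub>R (indicator {0<..} s *\<^sub>R R s) \<partial>lborel)
      = exp (- (of_real (e n) * k)) * P (e n) - exp (- (of_real (N n) * k)) * P (N n)" for n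
  proof -
    have "indicator {e n..N n} s *\<^sub>R (indicator {0<..} s *\<^sub>R R s) = indicator {e n..N n} s *\<^sub>R R s" for s
      using eN(1)[of n] by (auto simp: indicator_def)
    then show ?thesis using step[OF eN] by (simp only:)
  qed
  moreover have "(\<lambda>n. exp (- (of_real (e n) * k)) * P (e n) - exp (- (of_real (N n) * k)) * P (N n)) \<longlonglongrightarrow> exp (- (of_real 0 * k)) * c 0 - 0"
  proof (intro tendsto_diff tendsto_mult)
    show "(\<lambda>n. exp (- (of_real (e n) * k))) \<longlonglongrightarrow> exp (- (of_real 0 * k))" by (intro tendsto_intros elim)
    have "isCont c 0" unfolding c_def by (rule isCont_corr_simple[OF Lu g])
    then have "((\<lambda>s. P s) \<longlongrightarrow> c 0) (at_right 0)"
      unfolding P_def by (rule heat_approximate_identity[OF Re_inverse_pos[OF k] mc(1) bc(1)])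
    moreover have "filterlim e (at_right 0) sequentially"
      unfolding filterlim_at using elim eN(1) by (auto simp: less_imp_neq[symmetric])
    ultimately show "(\<lambda>n. P (e n)) \<longlonglongrightarrow> c 0" by (rule filterlim_compose)
    \<comment> \<open>By parabolic scaling the L^1 norm of the heat kernel does not depend on s, so
      P is bounded and exp(-N k) sends the upper boundary term to 0.\<close>
    define K where "K = (norm2 u * norm2 g) * (\<integral>w. cmod (heat (1 / k) (w :: real^'n)) \<partial>lborel)"
    have Pb: "cmod (P s) \<le> K" if s: "s > 0" for s
    proof -
      have t: "Re (of_real s * (1 / k)) > 0" by (rule Re_scaled_pos[OF s k])
      have "cmod (P s) \<le> (\<integral>w. (norm2 u * norm2 g) * cmod (?h s w) \<partial>lborel)"
        unfolding P_def
      proof (rule order_trans[OF integral_norm_bound integral_mono])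
        show "integrable lborel (\<lambda>w. cmod (?h s w * c w))" by (rule integrable_norm[OF ic[OF integrable_heat[OF t]]])
        show "integrable lborel (\<lambda>w. (norm2 u * norm2 g) * cmod (?h s w))" by (intro integrable_mult_right integrable_norm integrable_heat t)
        show "cmod (?h s w * c w) \<le> (norm2 u * norm2 g) * cmod (?h s w)" for w
          unfolding norm_mult using mult_right_mono[OF bc(1)[of w] norm_ge_zero[of "?h s w"]] by (simp add: mult.commute)
      qed
      also have "\<dots> = (norm2 u * norm2 g) * (\<integral>w. cmod (?h s w) \<partial>lborel)" by simp
      also have "(\<integral>w. cmod (?h s w) \<partial>lborel) = (\<integral>w. cmod (heat (1 / k) (w :: real^'n)) \<partial>lborel)"
        using integral_norm_scaled[OF s heat_measurable[of "1 / k"]] unfolding heat_scale_1[OF s] .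
      finally show ?thesis unfolding K_def .
    qed
    have "(\<lambda>n. exp (- Re k * real (Suc (Suc n))) * K) \<longlonglongrightarrow> 0 * K"
    proof (intro tendsto_mult tendsto_const)
      have "filterlim (\<lambda>n. Re k * real (Suc (Suc n))) at_top sequentially"
        using k by (intro filterlim_tendsto_pos_mult_at_top[OF tendsto_const] filterlim_compose[OF filterlim_real_sequentially] filterlim_compose[OF filterlim_Suc filterlim_Suc])
      then have "filterlim (\<lambda>n. - Re k * real (Suc (Suc n))) at_bot sequentially"
        by (simp add: filterlim_uminus_at_top)
      then show "(\<lambda>n. exp (- Re k * real (Suc (Suc n)))) \<longlonglongrightarrow> 0" by (rule filterlim_compose[OF exp_at_bot])
    qed
    then have "(\<lambda>n. exp (- Re k * N n) * K) \<longlonglongrightarrow> 0" by (simp add: N_def)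
    then show "(\<lambda>n. exp (- (of_real (N n) * k)) * P (N n)) \<longlonglongrightarrow> 0"
    proof (rule Lim_null_comparison[rotated], intro always_eventually allI)
      fix n
      have "N n > 0" using eN[of n] by linarith
      from Pb[OF this] show "norm (exp (- (of_real (N n) * k)) * P (N n)) \<le> exp (- Re k * N n) * K"
        by (simp add: norm_mult mult.commute[of "Re k"] mult_left_mono)
    qed
  qed
  ultimately have "(\<integral>s. indicator {0<..} s *\<^sub>R R s \<partial>lborel) = c 0"
    using LIMSEQ_unique by fastforce
  moreover have "(\<integral>s. indicator {0<..} s *\<^sub>R R s \<partial>lborel) = k * (\<integral>s. rho k s * P s \<partial>lborel) + 1 / k * (\<Sum>j\<in>UNIV. \<integral>s. rho k s * Q j s \<partial>lborel)"
    unfolding Req using iP iQ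
    by (subst Bochner_Integration.integral_add) (auto simp: Bochner_Integration.integral_sum)
  moreover have "(\<integral>s. rho k s * P s \<partial>lborel) = k * (\<integral>x. u x * conv (rk k) g x \<partial>lborel)"
  proof -
    have "(\<integral>x. u x * conv (rk k) g x \<partial>lborel) = (\<integral>w. rk k w * c w \<partial>lborel)"
      unfolding c_def by (rule integral_mult_conv[OF integrable_rk[OF k] Lu Lg])
    also have "\<dots> = 1 / k * (\<integral>s. rho k s * P s \<partial>lborel)"
      unfolding P_def by (rule integral_rk_mult[OF k mc(1) bc(1)])
    finally show ?thesis using k0 by simp
  qed
  moreover have "1 / k * (\<integral>s. rho k s * Q j s \<partial>lborel) = (\<integral>x. G j x * conv (rkd k j) g x \<partial>lborel)" for j
  proof -
    have "(\<integral>x. G j x * conv (rkd k j) g x \<partial>lborel) = (\<integral>w. rkd k j w * cj j w \<partial>lborel)"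
      unfolding cj_def by (rule integral_mult_conv[OF integrable_rkd[OF k] LG Lg])
    also have "\<dots> = 1 / k * (\<integral>s. rho k s * Q j s \<partial>lborel)"
      unfolding Q_def by (rule integral_rkd_mult[OF k mc(2) bc(2)])
    finally show ?thesis by simp
  qed
  moreover have "c 0 = (\<integral>x. u x * g x \<partial>lborel)" by (simp add: c_def corr_def)
  ultimately show ?thesis by (simp add: sum_distrib_left power2_eq_square mult.assoc add.commute)
qed

text \<open>The subordination formula at \<zeta> = 1. It is the bridge between the kernel used with
  Sobolev functions and the multiplier bounded by interpolation.\<close>

lemma integral_mult_resolvent:
  fixes f g :: "real^'n::finite \<Rightarrow> complex"
  assumes k: "Re k > 0" and f: "integrable lborel f" "L2 f" and g: "integrable lborel g" "L2 g"
  shows "(2 * of_real pi) ^ CARD('n) * (\<integral>x. f x * conv (rk k) g x \<partial>lborel) = 1 / k * bint k (pairing f g) 1"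
proof -
  have [measurable]: "f \<in> borel_measurable borel" "g \<in> borel_measurable borel" using f g by auto
  have "(\<integral>x. f x * conv (rk k) g x \<partial>lborel) = (\<integral>w. rk k w * corr f g w \<partial>lborel)"
    by (rule integral_mult_conv[OF integrable_rk[OF k] f(2) g(2)])
  also have "\<dots> = 1 / k * (\<integral>s. rho k s * (\<integral>w. heat (of_real s * (1 / k)) w * corr f g w \<partial>lborel) \<partial>lborel)"
    by (rule integral_rk_mult[OF k _ cmod_corr_le[OF f(2) g(2)]]) measurable
  finally have 1: "(\<integral>x. f x * conv (rk k) g x \<partial>lborel) = 1 / k * (\<integral>s. rho k s * (\<integral>w. heat (of_real s * (1 / k)) w * corr f g w \<partial>lborel) \<partial>lborel)" .
  have pe: "pairing f g = ft (corr f g)" by (rule pairing_eq_ft_corr[OF f(1) g(1)])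
  have "integrable lborel (ft (corr f g))" unfolding pe[symmetric] by (rule integrable_pairing[OF f g])
  from Gamma_bint_eq[OF k _ integrable_corr[OF f(1) g(1)] this, of 1]
  have "bint k (pairing f g) 1 = (2 * of_real pi) ^ CARD('n) * (\<integral>s. rho k s * (\<integral>w. heat (of_real s * (1 / k)) w * corr f g w \<partial>lborel) \<partial>lborel)"
    by (simp add: pe rho_def cpw_def)
  then show ?thesis unfolding 1 by simp
qed

section \<open>Approximation by simple functions\<close>

lemma L2_bound:
  assumes f: "L2 f" and g: "g \<in> borel_measurable lborel" and le: "\<And>x. cmod (g x) \<le> B * cmod (f x)"
  shows "L2 g"
  unfolding L2_def
proof
  show "integrable lborel (\<lambda>x. (cmod (g x))\<^sup>2)"
  proof (rule Bochner_Integration.integrable_bound[OF integrable_mult_right[OF L2_integrable[OF f], of "B\<^sup>2"]])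
    show "AE x in lborel. norm ((cmod (g x))\<^sup>2) \<le> norm (B\<^sup>2 * (cmod (f x))\<^sup>2)"
    proof (rule AE_I2)
      fix x
      have "(cmod (g x))\<^sup>2 \<le> (B * cmod (f x))\<^sup>2" using le by (intro power_mono) auto
      then show "norm ((cmod (g x))\<^sup>2) \<le> norm (B\<^sup>2 * (cmod (f x))\<^sup>2)" by (simp add: power_mult_distrib)
    qed
  qed (use g in measurable)
qed (rule g)

lemma norm2_cmult: "norm2 (\<lambda>x. c * f x) = cmod c * norm2 f"
  unfolding norm2_def norm_mult power_mult_distrib by (simp add: real_sqrt_mult)

lemma L2_cnj: "L2 f \<Longrightarrow> L2 (\<lambda>x. cnj (f x))" and norm2_cnj: "norm2 (\<lambda>x. cnj (f x)) = norm2 f"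
  by (auto simp: L2_def norm2_def)

lemma integral_cnj_self: "(\<integral>x. cnj (f x) * f x \<partial>lborel) = of_real ((norm2 f)\<^sup>2)"
proof -
  have "cnj (f x) * f x = of_real ((cmod (f x))\<^sup>2)" for x
    by (simp only: complex_norm_square mult.commute)
  then show ?thesis unfolding norm2_power2 by (simp only: integral_complex_of_real)
qed

lemma norm2_eq_0D:
  assumes "L2 f" and "norm2 f = 0"
  shows "AE x in lborel. f x = 0"
proof -
  have "(\<integral>x. (cmod (f x))\<^sup>2 \<partial>lborel) = 0" using norm2_power2[of f] assms(2) by simp
  then show ?thesis using assms(1) by (subst (asm) integral_nonneg_eq_0_iff_AE) auto
qed

text \<open>The finitely many nonzero values are bounded away from 0, so the modulus is at most a
  constant times its square. The convention 1/0 = 0 lets the value 0 take part in the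
  maximum.\<close>

lemma simple_L2_integrable:
  assumes s: "simple_function lborel s" and L: "L2 s"
  shows "integrable lborel s"
proof -
  have fin: "finite ((\<lambda>y. 1 / cmod y) ` range s)" using s by (simp add: simple_function_def)
  define K where "K = Max (insert 0 ((\<lambda>y. 1 / cmod y) ` range s))"
  have K: "1 / cmod (s x) \<le> K" for x unfolding K_def using fin by (intro Max_ge) auto
  show ?thesis
  proof (rule Bochner_Integration.integrable_bound[OF integrable_mult_right[OF L2_integrable[OF L], of K]])
    show "AE x in lborel. norm (s x) \<le> norm (K * (cmod (s x))\<^sup>2)"
    proof (rule AE_I2)
      fix x
      have "cmod (s x) = 1 / cmod (s x) * (cmod (s x))\<^sup>2" by (simp add: power2_eq_square)
      also have "\<dots> \<le> K * (cmod (s x))\<^sup>2" using K by (intro mult_right_mono) auto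
      finally show "norm (s x) \<le> norm (K * (cmod (s x))\<^sup>2)" by simp
    qed
  qed (use L in auto)
qed

text \<open>The factor 2 comes from the pointwise approximation of measurable functions and provides
  the dominating function for the convergence of the norms.\<close>

lemma L2_simple_approx:
  assumes f: "L2 f"
  obtains s where "\<And>i. simple_function lborel (s i)" "\<And>i. integrable lborel (s i)"
    "\<And>i x. cmod (s i x) \<le> 2 * cmod (f x)" "\<And>x. (\<lambda>i. s i x) \<longlonglongrightarrow> f x" "(\<lambda>i. norm2 (s i)) \<longlonglongrightarrow> norm2 f"
proof -
  have [measurable]: "f \<in> borel_measurable borel" using f by auto
  obtain s where s: "\<And>i. simple_function lborel (s i)" "\<And>x. (\<lambda>i. s i x) \<longlonglongrightarrow> f x"
      "\<And>i x. cmod (s i x) \<le> 2 * cmod (f x)"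
    using borel_measurable_implies_sequence_metric[of f lborel 0] by (auto simp: dist_norm)
  have [measurable]: "s i \<in> borel_measurable borel" for i
    using borel_measurable_simple_function[OF s(1)[of i]] by simp
  have L: "L2 (s i)" for i by (rule L2_bound[OF f _ s(3)]) simp
  have "(\<lambda>i. \<integral>x. (cmod (s i x))\<^sup>2 \<partial>lborel) \<longlonglongrightarrow> (\<integral>x. (cmod (f x))\<^sup>2 \<partial>lborel)"
  proof (rule integral_dominated_convergence[where w="\<lambda>x. 4 * (cmod (f x))\<^sup>2"])
    show "integrable lborel (\<lambda>x. 4 * (cmod (f x))\<^sup>2)" using f by auto
    show "AE x in lborel. (\<lambda>i. (cmod (s i x))\<^sup>2) \<longlonglongrightarrow> (cmod (f x))\<^sup>2"
      by (intro AE_I2 tendsto_intros s(2))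
    show "AE x in lborel. norm ((cmod (s i x))\<^sup>2) \<le> 4 * (cmod (f x))\<^sup>2" for i
    proof (rule AE_I2)
      fix x
      have "(cmod (s i x))\<^sup>2 \<le> (2 * cmod (f x))\<^sup>2" using s(3) by (intro power_mono) auto
      then show "norm ((cmod (s i x))\<^sup>2) \<le> 4 * (cmod (f x))\<^sup>2" by (simp add: power_mult_distrib)
    qed
  qed measurable
  then have "(\<lambda>i. norm2 (s i)) \<longlonglongrightarrow> norm2 f" unfolding norm2_def by (rule tendsto_real_sqrt)
  with s simple_L2_integrable[OF s(1) L] show thesis by (intro that)
qed

lemma weight_simple_approx:
  fixes q :: "'a::euclidean_space \<Rightarrow> real"
  assumes "q \<in> borel_measurable lborel" and "\<And>x. q x \<ge> 0"
  obtains W where "\<And>i. simple_function lborel (W i)" "\<And>i x. 0 \<le> W i x" "\<And>i x. W i x \<le> q x" "\<And>x. (\<lambda>i. W i x) \<longlonglongrightarrow> q x"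
proof -
  obtain W where W: "incseq W" "\<And>i. simple_function lborel (W i)" "\<And>x. bdd_above (range (\<lambda>i. W i x))"
      "\<And>i x. 0 \<le> W i x" "q = (SUP i. W i)"
    using borel_measurable_implies_simple_function_sequence_real[of q lborel] assms by auto
  have q: "q x = (SUP i. W i x)" for x unfolding W(5) by (simp add: image_image)
  have "W i x \<le> q x" for i x unfolding q by (rule cSUP_upper[OF UNIV_I W(3)])
  moreover have "(\<lambda>i. W i x) \<longlonglongrightarrow> q x" for x
    unfolding q using W(1) by (intro LIMSEQ_incseq_SUP W(3)) (auto simp: incseq_def le_fun_def)
  ultimately show thesis using W by (intro that)
qed

lemma L2_dominated_convergence:
  assumes A: "L2 A" and B: "L2 B" and m: "\<And>i. F i \<in> borel_measurable lborel"
    and le: "\<And>i x. cmod (F i x) \<le> c * cmod (A x * B x)" and lim: "\<And>x. (\<lambda>i. F i x) \<longlonglongrightarrow> A x * B x"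
  shows "(\<lambda>i. \<integral>x. F i x \<partial>lborel) \<longlonglongrightarrow> (\<integral>x. A x * B x \<partial>lborel)"
proof (rule integral_dominated_convergence[where w="\<lambda>x. c * cmod (A x * B x)"])
  show "(\<lambda>x. A x * B x) \<in> borel_measurable lborel" using integrable_L2_mult[OF A B] by auto
  show "integrable lborel (\<lambda>x. c * cmod (A x * B x))"
    by (intro integrable_mult_right integrable_norm integrable_L2_mult A B)
qed (use m le lim in auto)

lemma weighted_simple:
  fixes b :: "'a::euclidean_space \<Rightarrow> complex"
  assumes W: "simple_function lborel W" and b: "simple_function lborel b" "integrable lborel b"
  shows "simple_function lborel (\<lambda>x. of_real (W x) * b x)" and "integrable lborel (\<lambda>x. of_real (W x) * b x)"
proof -
  show "simple_function lborel (\<lambda>x. of_real (W x) * b x)"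
    by (rule simple_function_compose2[OF W b(1), of "\<lambda>w b. of_real w * b"])
  obtain B where B: "B \<ge> 0" "\<And>x. norm (W x) \<le> B" using simple_function_lborel_bounded[OF W] by blast
  have [measurable]: "W \<in> borel_measurable borel" "b \<in> borel_measurable borel"
    using borel_measurable_simple_function[OF W] b by auto
  show "integrable lborel (\<lambda>x. of_real (W x) * b x)"
    by (rule Bochner_Integration.integrable_bound[OF integrable_mult_right[OF integrable_norm[OF b(2)], of B]])
      (use B in \<open>auto simp: norm_mult intro!: mult_right_mono\<close>)
qed

section \<open>Finiteness of the potential energy\<close>

text \<open>The norm bound \<open>K\<close> for the Birman-Schwinger operator, stated through
  bounded simple weights below sqrt |V|. No product with an unbounded potential has to make sense
  before its finiteness is known.\<close>

definition resolvent_bounded :: "(real^'n::finite \<Rightarrow> complex) \<Rightarrow> complex \<Rightarrow> real \<Rightarrow> bool" where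
  "resolvent_bounded V k K \<longleftrightarrow> (\<forall>W W' a b.
     simple_function lborel W \<longrightarrow> (\<forall>x. 0 \<le> W x \<and> W x \<le> sqrt (cmod (V x))) \<longrightarrow>
     simple_function lborel W' \<longrightarrow> (\<forall>x. 0 \<le> W' x \<and> W' x \<le> sqrt (cmod (V x))) \<longrightarrow>
     simple_function lborel a \<longrightarrow> integrable lborel a \<longrightarrow> simple_function lborel b \<longrightarrow> integrable lborel b \<longrightarrow>
     cmod (\<integral>x. of_real (W x) * a x * conv (rk k) (\<lambda>x. of_real (W' x) * b x) x \<partial>lborel) \<le> K * (norm2 a * norm2 b))"

lemma resolvent_boundedD:
  fixes V :: "real^'n::finite \<Rightarrow> complex"
  assumes "resolvent_bounded V k K"
    "simple_function lborel W" "\<And>x. 0 \<le> W x" "\<And>x. W x \<le> sqrt (cmod (V x))"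
    "simple_function lborel W'" "\<And>x. 0 \<le> W' x" "\<And>x. W' x \<le> sqrt (cmod (V x))"
    "simple_function lborel a" "integrable lborel a" "simple_function lborel b" "integrable lborel b"
  shows "cmod (\<integral>x. of_real (W x) * a x * conv (rk k) (\<lambda>x. of_real (W' x) * b x) x \<partial>lborel) \<le> K * (norm2 a * norm2 b)"
  by (rule assms(1)[unfolded resolvent_bounded_def, rule_format]) (use assms(2-) in simp_all)

text \<open>A duality argument at k = 1. With w the resolvent of g = W b, the identity for
  \<open>u\<close> expresses the integral of u g as the H^1 pairing of u and w, and the identity for
  w itself bounds its H^1 norm by K and the norm of b.\<close>

lemma form_bound_aux:
  fixes u V :: "real^'n::finite \<Rightarrow> complex"
  assumes H1: "H1_grad u G" and RB: "resolvent_bounded V 1 K"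
    and W: "simple_function lborel W" "\<And>x. 0 \<le> W x" "\<And>x. W x \<le> sqrt (cmod (V x))"
    and b: "simple_function lborel b" "integrable lborel b"
  shows "cmod (\<integral>x. u x * (of_real (W x) * b x) \<partial>lborel) \<le> ((\<Sum>j\<in>UNIV. (norm2 (G j))\<^sup>2) + (norm2 u)\<^sup>2 + K * (norm2 b)\<^sup>2) / 2"
proof -
  have Lu: "L2 u" and LG: "\<And>j. L2 (G j)" using H1 by (auto simp: H1_grad_def Lp_2_iff)
  let ?g = "\<lambda>x. of_real (W x) * b x"
  let ?w = "conv (rk 1) ?g" and ?wj = "\<lambda>j. conv (rkd 1 j) ?g"
  note g = weighted_simple[OF W(1) b]
  have k: "Re (1::complex) > 0" by simp
  obtain B where B: "\<And>x. cmod (?g x) \<le> B" using simple_function_lborel_bounded[OF g(1)] by blast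
  have Lw: "L2 ?w" "L2 (?wj j)" for j
    by (rule L2_conv[OF integrable_rk[OF k] g(2) B], rule L2_conv[OF integrable_rkd[OF k] g(2) B])
  have id: "(\<integral>x. u x * ?g x \<partial>lborel) = (\<Sum>j\<in>UNIV. \<integral>x. G j x * ?wj j x \<partial>lborel) + (\<integral>x. u x * ?w x \<partial>lborel)"
    using resolvent_identity[OF H1 k g] by simp
  define T where "T = (\<Sum>j\<in>UNIV. (norm2 (?wj j))\<^sup>2) + (norm2 ?w)\<^sup>2"
  \<comment> \<open>The identity is applied to the conjugate of w, whose gradient is the conjugate
    of \<open>?wj\<close>; the left side becomes a sum of squared norms.\<close>
  have "complex_of_real T = (\<integral>x. cnj (?w x) * ?g x \<partial>lborel)"
    using resolvent_identity[OF H1_grad_resolvent[OF k g(2) B] k g] unfolding integral_cnj_self T_def by simp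
  also have "\<dots> = cnj (\<integral>x. of_real (W x) * cnj (b x) * ?w x \<partial>lborel)"
    unfolding Bochner_Integration.integral_cnj[symmetric] by (simp add: mult_ac)
  finally have "cmod (complex_of_real T) = cmod (\<integral>x. of_real (W x) * cnj (b x) * ?w x \<partial>lborel)" by simp
  also have "\<dots> \<le> K * (norm2 (\<lambda>x. cnj (b x)) * norm2 b)"
    using b by (intro resolvent_boundedD[OF RB] W simple_function_compose1[where g=cnj]) auto
  finally have T: "T \<le> K * (norm2 b)\<^sup>2" unfolding norm2_cnj by (simp add: power2_eq_square)
  have am: "x * y \<le> (x\<^sup>2 + y\<^sup>2) / 2" for x y :: real using sum_squares_bound[of x y] by simp
  have "cmod (\<integral>x. u x * ?g x \<partial>lborel) \<le> (\<Sum>j\<in>UNIV. cmod (\<integral>x. G j x * ?wj j x \<partial>lborel)) + cmod (\<integral>x. u x * ?w x \<partial>lborel)"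
    unfolding id by (intro norm_triangle_le add_mono norm_sum order_refl)
  also have "\<dots> \<le> (\<Sum>j\<in>UNIV. norm2 (G j) * norm2 (?wj j)) + norm2 u * norm2 ?w"
    by (intro add_mono sum_mono cmod_integral_L2_le Lu LG Lw)
  also have "\<dots> \<le> (\<Sum>j\<in>UNIV. ((norm2 (G j))\<^sup>2 + (norm2 (?wj j))\<^sup>2) / 2) + ((norm2 u)\<^sup>2 + (norm2 ?w)\<^sup>2) / 2"
    by (intro add_mono sum_mono am)
  also have "\<dots> = ((\<Sum>j\<in>UNIV. (norm2 (G j))\<^sup>2) + (norm2 u)\<^sup>2 + T) / 2"
    unfolding T_def by (simp add: sum.distrib add_divide_distrib sum_divide_distrib[symmetric])
  finally show ?thesis using T by simp
qed

text \<open>The resolvent at energy \<open>-1\<close> controls the potential energy: this replaces the Sobolev embedding.\<close>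

lemma form_bound:
  fixes u V :: "real^'n::finite \<Rightarrow> complex"
  assumes H1: "H1_grad u G" and RB: "resolvent_bounded V 1 K" and K: "K \<ge> 0" and V: "V \<in> borel_measurable lborel"
  shows "L2 (\<lambda>x. of_real (sqrt (cmod (V x))) * u x)"
proof -
  have Lu: "L2 u" using H1 by (auto simp: H1_grad_def Lp_2_iff)
  have [measurable]: "u \<in> borel_measurable borel" "V \<in> borel_measurable borel" using Lu V by auto
  define A where "A = (\<Sum>j\<in>UNIV. (norm2 (G j))\<^sup>2) + (norm2 u)\<^sup>2"
  \<comment> \<open>Testing with b = \<mu> cnj(W u) gives \<mu> N^2 \<le> (A + K \<mu>^2 N^2)/2. As
    K \<mu> \<le> 1, the last term is absorbed on the left and N^2 \<le> A/\<mu>, uniformly in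
    \<open>W\<close>.\<close>
  define \<mu> where "\<mu> = 1 / (K + 1)"
  have \<mu>: "\<mu> > 0" "K * \<mu> \<le> 1" using K by (auto simp: \<mu>_def)
  have bound: "L2 (\<lambda>x. of_real (W x) * u x)" "(norm2 (\<lambda>x. of_real (W x) * u x))\<^sup>2 \<le> A / \<mu>"
    if W: "simple_function lborel W" "\<And>x. 0 \<le> W x" "\<And>x. W x \<le> sqrt (cmod (V x))" for W
  proof -
    have [measurable]: "W \<in> borel_measurable borel" using borel_measurable_simple_function[OF W(1)] by simp
    obtain B where B: "\<And>x. norm (W x) \<le> B" using simple_function_lborel_bounded[OF W(1)] by blast
    show L: "L2 (\<lambda>x. of_real (W x) * u x)"
      by (rule L2_bound[OF Lu, of _ B]) (use B in \<open>auto simp: norm_mult intro!: mult_right_mono\<close>)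
    define N where "N = norm2 (\<lambda>x. of_real (W x) * u x)"
    let ?\<phi> = "\<lambda>x. of_real \<mu> * cnj (of_real (W x) * u x)"
    have n\<phi>: "norm2 ?\<phi> = \<mu> * N"
      unfolding norm2_cmult N_def using \<mu> norm2_cnj[of "\<lambda>x. of_real (W x) * u x"] by simp
    have L\<phi>: "L2 ?\<phi>" by (rule L2_bound[OF L, of _ \<mu>]) (use \<mu> in \<open>auto simp: norm_mult\<close>)
    obtain s where s: "\<And>i. simple_function lborel (s i)" "\<And>i. integrable lborel (s i)"
        "\<And>i x. cmod (s i x) \<le> 2 * cmod (?\<phi> x)" "\<And>x. (\<lambda>i. s i x) \<longlonglongrightarrow> ?\<phi> x" "(\<lambda>i. norm2 (s i)) \<longlonglongrightarrow> norm2 ?\<phi>"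
      using L2_simple_approx[OF L\<phi>] by blast
    have [measurable]: "s i \<in> borel_measurable borel" for i using s(2)[of i] by auto
    have "(\<lambda>i. \<integral>x. u x * (of_real (W x) * s i x) \<partial>lborel) \<longlonglongrightarrow> (\<integral>x. (of_real (W x) * u x) * ?\<phi> x \<partial>lborel)"
    proof (rule L2_dominated_convergence[OF L L\<phi>, where c=2])
      show "cmod (u x * (of_real (W x) * s i x)) \<le> 2 * cmod (of_real (W x) * u x * ?\<phi> x)" for i x
        using mult_left_mono[OF s(3)[of i x] norm_ge_zero[of "of_real (W x) * u x"]] unfolding norm_mult by (simp add: mult_ac)
      have "(\<lambda>i. (of_real (W x) * u x) * s i x) \<longlonglongrightarrow> (of_real (W x) * u x) * ?\<phi> x" for x
        by (intro tendsto_mult tendsto_const s(4))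
      then show "(\<lambda>i. u x * (of_real (W x) * s i x)) \<longlonglongrightarrow> (of_real (W x) * u x) * ?\<phi> x" for x
        by (simp only: mult_ac)
    qed measurable
    then have l1: "(\<lambda>i. cmod (\<integral>x. u x * (of_real (W x) * s i x) \<partial>lborel)) \<longlonglongrightarrow> cmod (\<integral>x. (of_real (W x) * u x) * ?\<phi> x \<partial>lborel)"
      by (rule tendsto_norm)
    have "(\<integral>x. (of_real (W x) * u x) * ?\<phi> x \<partial>lborel) = (\<integral>x. of_real \<mu> * (cnj (of_real (W x) * u x) * (of_real (W x) * u x)) \<partial>lborel)"
      by (simp only: mult_ac)
    also have "\<dots> = of_real (\<mu> * N\<^sup>2)"
      by (simp only: integral_mult_right_zero integral_cnj_self N_def of_real_mult)
    finally have val: "cmod (\<integral>x. (of_real (W x) * u x) * ?\<phi> x \<partial>lborel) = \<mu> * N\<^sup>2"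
      using \<mu> by (simp only: norm_of_real) simp
    have l2: "(\<lambda>i. (A + K * (norm2 (s i))\<^sup>2) / 2) \<longlonglongrightarrow> (A + K * (\<mu> * N)\<^sup>2) / 2"
      using s(5) unfolding n\<phi> by (intro tendsto_intros) auto
    have "\<mu> * N\<^sup>2 \<le> (A + K * (\<mu> * N)\<^sup>2) / 2"
      unfolding val[symmetric] using form_bound_aux[OF H1 RB W s(1,2)] unfolding A_def[symmetric]
      by (intro LIMSEQ_le[OF l1 l2]) auto
    moreover have "K * (\<mu> * N)\<^sup>2 \<le> \<mu> * N\<^sup>2"
    proof -
      have "K * (\<mu> * N)\<^sup>2 = (K * \<mu>) * (\<mu> * N\<^sup>2)" by (simp add: power2_eq_square)
      also have "\<dots> \<le> 1 * (\<mu> * N\<^sup>2)" using \<mu> by (intro mult_right_mono) auto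
      finally show ?thesis by simp
    qed
    moreover have "x \<le> (A + y) / 2 \<Longrightarrow> y \<le> x \<Longrightarrow> x \<le> A" for x y :: real by simp
    ultimately have "\<mu> * N\<^sup>2 \<le> A" by blast
    then show "(norm2 (\<lambda>x. of_real (W x) * u x))\<^sup>2 \<le> A / \<mu>"
      using \<mu> unfolding N_def by (simp add: pos_le_divide_eq mult.commute)
  qed
  have A0: "A \<ge> 0" by (simp add: A_def sum_nonneg)
  obtain W where W: "\<And>i. simple_function lborel (W i)" "\<And>i x. 0 \<le> W i x" "\<And>i x. W i x \<le> sqrt (cmod (V x))"
      "\<And>x. (\<lambda>i. W i x) \<longlonglongrightarrow> sqrt (cmod (V x))"
    using weight_simple_approx[of "\<lambda>x. sqrt (cmod (V x))"] by auto
  have [measurable]: "W i \<in> borel_measurable borel" for i using borel_measurable_simple_function[OF W(1)[of i]] by simp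
  let ?f = "\<lambda>x. of_real (sqrt (cmod (V x))) * u x"
  \<comment> \<open>Fatou's lemma carries the uniform bound from the simple weights to sqrt
    |V|.\<close>
  have "(\<integral>\<^sup>+x. ennreal ((cmod (?f x))\<^sup>2) \<partial>lborel) = (\<integral>\<^sup>+x. liminf (\<lambda>i. ennreal ((cmod (of_real (W i x) * u x))\<^sup>2)) \<partial>lborel)"
  proof (rule nn_integral_cong)
    fix x
    have "(\<lambda>i. ennreal ((cmod (of_real (W i x) * u x))\<^sup>2)) \<longlonglongrightarrow> ennreal ((cmod (?f x))\<^sup>2)"
      by (intro tendsto_intros W(4))
    then show "ennreal ((cmod (?f x))\<^sup>2) = liminf (\<lambda>i. ennreal ((cmod (of_real (W i x) * u x))\<^sup>2))"
      by (rule lim_imp_Liminf[OF trivial_limit_sequentially, symmetric])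
  qed
  also have "\<dots> \<le> liminf (\<lambda>i. \<integral>\<^sup>+x. ennreal ((cmod (of_real (W i x) * u x))\<^sup>2) \<partial>lborel)"
    by (rule nn_integral_liminf) measurable
  also have "\<dots> \<le> limsup (\<lambda>i. \<integral>\<^sup>+x. ennreal ((cmod (of_real (W i x) * u x))\<^sup>2) \<partial>lborel)"
    by (rule Liminf_le_Limsup) simp
  also have "\<dots> \<le> ennreal (A / \<mu>)"
  proof (rule Limsup_bounded, intro always_eventually allI)
    fix i
    have "(\<integral>\<^sup>+x. ennreal ((cmod (of_real (W i x) * u x))\<^sup>2) \<partial>lborel) = ennreal ((norm2 (\<lambda>x. of_real (W i x) * u x))\<^sup>2)"
      unfolding norm2_power2 by (rule nn_integral_eq_integral) (use bound(1)[OF W(1-3)] in auto)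
    then show "(\<integral>\<^sup>+x. ennreal ((cmod (of_real (W i x) * u x))\<^sup>2) \<partial>lborel) \<le> ennreal (A / \<mu>)"
      using bound(2)[OF W(1-3)] by (simp add: ennreal_leI)
  qed
  finally have le: "(\<integral>\<^sup>+x. ennreal ((cmod (?f x))\<^sup>2) \<partial>lborel) \<le> ennreal (A / \<mu>)" .
  have "(\<integral>\<^sup>+x. ennreal (norm ((cmod (?f x))\<^sup>2)) \<partial>lborel) < \<infinity>"
    using order.strict_trans1[OF le ennreal_less_top] by simp
  then have "integrable lborel (\<lambda>x. (cmod (?f x))\<^sup>2)" by (intro integrableI_bounded) simp_all
  then show ?thesis unfolding L2_def by auto
qed

section \<open>The Birman-Schwinger principle\<close>

text \<open>The function \<psi> = sqrt |V| u is in effect an eigenvector of the Birman-Schwinger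
  operator for the eigenvalue -1, up to the phase sgn V. Pairing with its conjugate bounds the
  squared norm of \<psi> by \<open>K\<close> times itself. Simple approximants stand in for both
  weights and both vectors.\<close>

lemma birman_schwinger:
  fixes V :: "real^'n::finite \<Rightarrow> complex"
  assumes ev: "is_eigenvalue V E" and k: "Re k > 0" "E = - k\<^sup>2" and V: "V \<in> borel_measurable lborel"
    and RB1: "resolvent_bounded V 1 K1" "K1 \<ge> 0" and RB: "resolvent_bounded V k K"
  shows "K \<ge> 1"
proof -
  obtain u G where H1: "H1_grad u G" and nz: "\<not> (AE x in lborel. u x = 0)"
    and eq: "\<And>v H. H1_grad v H \<Longrightarrow> (\<Sum>j\<in>UNIV. \<integral>x. G j x * cnj (H j x) \<partial>lborel) + (\<integral>x. V x * u x * cnj (v x) \<partial>lborel)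
           = E * (\<integral>x. u x * cnj (v x) \<partial>lborel)"
    using ev unfolding is_eigenvalue_def by blast
  have Lu: "L2 u" using H1 by (auto simp: H1_grad_def Lp_2_iff)
  have [measurable]: "u \<in> borel_measurable borel" "V \<in> borel_measurable borel" using Lu V by auto
  define q where "q x = sqrt (cmod (V x))" for x
  have [measurable]: "q \<in> borel_measurable borel" unfolding q_def[abs_def] by measurable
  have q0: "q x \<ge> 0" for x by (simp add: q_def)
  have Vq: "V x = sgn (V x) * of_real (q x) * of_real (q x)" for x
  proof -
    have "complex_of_real (q x) * of_real (q x) = of_real (cmod (V x))" unfolding of_real_mult[symmetric] by (simp add: q_def)
    then show ?thesis by (simp add: mult.assoc sgn_eq)
  qed
  obtain W where W: "\<And>i. simple_function lborel (W i)" "\<And>i x. 0 \<le> W i x" "\<And>i x. W i x \<le> q x" "\<And>x. (\<lambda>i. W i x) \<longlonglongrightarrow> q x"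
    using weight_simple_approx[of q] q0 by auto
  note W' = W(1,2) W(3)[unfolded q_def]
  have [measurable]: "W i \<in> borel_measurable borel" for i using borel_measurable_simple_function[OF W(1)[of i]] by simp
  have Wa: "cmod (of_real (W i x)) \<le> q x" for i x using W(2,3)[of i x] by simp
  define \<psi> where "\<psi> x = of_real (q x) * u x" for x
  have L\<psi>: "L2 \<psi>" unfolding \<psi>_def[abs_def] q_def by (rule form_bound[OF H1 RB1 V])
  have [measurable]: "\<psi> \<in> borel_measurable borel" using L\<psi> by auto
  have lin: "G = - T" if "S + T = - c * U" "S + c * U = G" for S T U G c :: complex
  proof -
    have "G + T = (S + T) + c * U" using that(2) by (simp add: algebra_simps)
    then show ?thesis using that(1) by (simp add: eq_neg_iff_add_eq_0)
  qed
  \<comment> \<open>The eigenvalue equation is tested with the resolvent of \<open>g\<close>.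
    Comparison with the resolvent identity cancels the gradient terms and the terms with
    k^2.\<close>
  have test: "(\<integral>x. u x * g x \<partial>lborel) = - (\<integral>x. V x * u x * conv (rk k) g x \<partial>lborel)"
    and H1g: "H1_grad (\<lambda>x. cnj (conv (rk k) g x)) (\<lambda>j x. cnj (conv (rkd k j) g x))"
    if g: "simple_function lborel g" "integrable lborel g" for g
  proof -
    obtain B where B: "\<And>x. cmod (g x) \<le> B" using simple_function_lborel_bounded[OF g(1)] by blast
    show H: "H1_grad (\<lambda>x. cnj (conv (rk k) g x)) (\<lambda>j x. cnj (conv (rkd k j) g x))"
      by (rule H1_grad_resolvent[OF k(1) g(2) B])
    have "(\<Sum>j\<in>UNIV. \<integral>x. G j x * conv (rkd k j) g x \<partial>lborel) + (\<integral>x. V x * u x * conv (rk k) g x \<partial>lborel)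
       = - k\<^sup>2 * (\<integral>x. u x * conv (rk k) g x \<partial>lborel)"
      using eq[OF H] k(2) by (simp only: complex_cnj_cnj)
    then show "(\<integral>x. u x * g x \<partial>lborel) = - (\<integral>x. V x * u x * conv (rk k) g x \<partial>lborel)"
      using resolvent_identity[OF H1 k(1) g] by (rule lin)
  qed
  \<comment> \<open>Factorising V as sgn V times the square of q puts the phase into the left
    vector; it does not increase the norm.\<close>
  define a where "a x = sgn (V x) * \<psi> x" for x
  have an: "cmod (a x) \<le> 1 * cmod (\<psi> x)" for x by (simp add: a_def norm_mult norm_sgn)
  have [measurable]: "a \<in> borel_measurable borel" unfolding a_def[abs_def] sgn_eq by measurable
  have La: "L2 a" by (rule L2_bound[OF L\<psi> _ an]) simp
  have na: "norm2 a \<le> norm2 \<psi>"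
    unfolding norm2_def using L2_integrable[OF La] L2_integrable[OF L\<psi>] an
    by (intro real_sqrt_le_mono integral_mono power_mono) auto
  obtain s where s: "\<And>i. simple_function lborel (s i)" "\<And>i. integrable lborel (s i)"
      "\<And>i x. cmod (s i x) \<le> 2 * cmod (a x)" "\<And>x. (\<lambda>i. s i x) \<longlonglongrightarrow> a x" "(\<lambda>i. norm2 (s i)) \<longlonglongrightarrow> norm2 a"
    using L2_simple_approx[OF La] by blast
  have [measurable]: "s i \<in> borel_measurable borel" for i using s(2)[of i] by auto
  \<comment> \<open>The right weight \<open>W n\<close> stays fixed while the left one tends to q.
    By \<open>form_bound\<close> for the resolvent function, q times \<open>?R\<close> is
    square-integrable, which supplies the dominating function.\<close>
  have key: "cmod (\<integral>x. u x * (of_real (W n x) * b x) \<partial>lborel) \<le> K * (norm2 a * norm2 b)"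
    if b: "simple_function lborel b" "integrable lborel b" for n b
  proof -
    let ?g = "\<lambda>x. of_real (W n x) * b x"
    note g = weighted_simple[OF W(1)[of n] b]
    let ?R = "conv (rk k) ?g"
    have "L2 (\<lambda>x. of_real (sqrt (cmod (V x))) * cnj (?R x))" by (rule form_bound[OF H1g[OF g] RB1 V])
    from L2_cnj[OF this] have LR: "L2 (\<lambda>x. of_real (q x) * ?R x)" by (simp add: q_def)
    have [measurable]: "?R \<in> borel_measurable borel"
      using H1g[OF g] L2_cnj[of "\<lambda>x. cnj (?R x)"] L2_measurable[of ?R] by (simp add: H1_grad_def Lp_2_iff)
    have "(\<lambda>i. \<integral>x. of_real (W i x) * s i x * ?R x \<partial>lborel) \<longlonglongrightarrow> (\<integral>x. a x * (of_real (q x) * ?R x) \<partial>lborel)"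
    proof (rule L2_dominated_convergence[OF La LR, where c=2])
      show "cmod (of_real (W i x) * s i x * ?R x) \<le> 2 * cmod (a x * (of_real (q x) * ?R x))" for i x
      proof -
        have "cmod (of_real (W i x) * s i x * ?R x) \<le> q x * (2 * cmod (a x)) * cmod (?R x)"
          unfolding norm_mult using Wa[of i x] s(3)[of i x] q0[of x] by (intro mult_right_mono mult_mono) auto
        then show ?thesis using q0[of x] by (simp add: norm_mult mult_ac)
      qed
      show "(\<lambda>i. of_real (W i x) * s i x * ?R x) \<longlonglongrightarrow> a x * (of_real (q x) * ?R x)" for x
      proof -
        have "(\<lambda>i. of_real (W i x) * s i x * ?R x) \<longlonglongrightarrow> of_real (q x) * a x * ?R x"
          by (intro tendsto_intros W(4) s(4))
        then show ?thesis by (simp only: mult_ac)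
      qed
    qed measurable
    then have l1: "(\<lambda>i. cmod (\<integral>x. of_real (W i x) * s i x * ?R x \<partial>lborel)) \<longlonglongrightarrow> cmod (\<integral>x. a x * (of_real (q x) * ?R x) \<partial>lborel)"
      by (rule tendsto_norm)
    have l2: "(\<lambda>i. K * (norm2 (s i) * norm2 b)) \<longlonglongrightarrow> K * (norm2 a * norm2 b)" by (intro tendsto_intros s(5))
    have "cmod (\<integral>x. a x * (of_real (q x) * ?R x) \<partial>lborel) \<le> K * (norm2 a * norm2 b)"
      using resolvent_boundedD[OF RB W' W' s(1,2) b] by (intro LIMSEQ_le[OF l1 l2]) auto
    moreover have "V x * u x * ?R x = a x * (of_real (q x) * ?R x)" for x
      by (subst Vq) (simp add: a_def \<psi>_def mult_ac)
    ultimately show ?thesis unfolding test[OF g] norm_minus_cancel by (simp only:)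
  qed
  let ?\<psi> = "\<lambda>x. cnj (\<psi> x)"
  \<comment> \<open>If \<psi> vanished, so would V u almost everywhere; by \<open>test\<close> the
    function u would annihilate all integrable simple functions, hence its own conjugate,
    contradicting u \<noteq> 0.\<close>
  have "norm2 \<psi> \<noteq> 0"
  proof
    assume "norm2 \<psi> = 0"
    from norm2_eq_0D[OF L\<psi> this] have "AE x in lborel. V x * u x = 0"
      by eventually_elim (subst Vq, auto simp: \<psi>_def)
    then have "AE x in lborel. V x * u x * R x = 0" for R :: "real^'n \<Rightarrow> complex"
      by eventually_elim simp
    then have "(\<integral>x. V x * u x * R x \<partial>lborel) = 0" for R :: "real^'n \<Rightarrow> complex"
      by (rule integral_eq_zero_AE)
    then have z: "(\<integral>x. u x * g x \<partial>lborel) = 0" if "simple_function lborel g" "integrable lborel g" for g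
      using test[OF that] by simp
    obtain t where t: "\<And>i. simple_function lborel (t i)" "\<And>i. integrable lborel (t i)"
        "\<And>i x. cmod (t i x) \<le> 2 * cmod (cnj (u x))" "\<And>x. (\<lambda>i. t i x) \<longlonglongrightarrow> cnj (u x)"
        "(\<lambda>i. norm2 (t i)) \<longlonglongrightarrow> norm2 (\<lambda>x. cnj (u x))"
      using L2_simple_approx[OF L2_cnj[OF Lu]] by blast
    have [measurable]: "t i \<in> borel_measurable borel" for i using t(2)[of i] by auto
    have "(\<lambda>i. \<integral>x. u x * t i x \<partial>lborel) \<longlonglongrightarrow> (\<integral>x. cnj (u x) * u x \<partial>lborel)"
    proof (rule L2_dominated_convergence[OF L2_cnj[OF Lu] Lu, where c=2])
      show "cmod (u x * t i x) \<le> 2 * cmod (cnj (u x) * u x)" for i x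
        using mult_left_mono[OF t(3)[of i x] norm_ge_zero[of "u x"]] unfolding norm_mult by (simp add: mult_ac)
      have "(\<lambda>i. u x * t i x) \<longlonglongrightarrow> u x * cnj (u x)" for x by (intro tendsto_intros t(4))
      then show "(\<lambda>i. u x * t i x) \<longlonglongrightarrow> cnj (u x) * u x" for x by (simp only: mult.commute)
    qed measurable
    then have "complex_of_real ((norm2 u)\<^sup>2) = 0" unfolding integral_cnj_self z[OF t(1,2)] by (simp add: LIMSEQ_const_iff)
    then show False using norm2_eq_0D[OF Lu] nz by simp
  qed
  then have pos: "(norm2 \<psi>)\<^sup>2 > 0" by simp
  obtain t where t: "\<And>i. simple_function lborel (t i)" "\<And>i. integrable lborel (t i)"
      "\<And>i x. cmod (t i x) \<le> 2 * cmod (?\<psi> x)" "\<And>x. (\<lambda>i. t i x) \<longlonglongrightarrow> ?\<psi> x" "(\<lambda>i. norm2 (t i)) \<longlonglongrightarrow> norm2 ?\<psi>"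
    using L2_simple_approx[OF L2_cnj[OF L\<psi>]] by blast
  have [measurable]: "t i \<in> borel_measurable borel" for i using t(2)[of i] by auto
  \<comment> \<open>Now the right weight and the right vector converge together, which is possible
    because \<open>key\<close> holds for all indices and all simple vectors.\<close>
  have "(\<lambda>i. \<integral>x. u x * (of_real (W i x) * t i x) \<partial>lborel) \<longlonglongrightarrow> (\<integral>x. ?\<psi> x * \<psi> x \<partial>lborel)"
  proof (rule L2_dominated_convergence[OF L2_cnj[OF L\<psi>] L\<psi>, where c=2])
    show "cmod (u x * (of_real (W i x) * t i x)) \<le> 2 * cmod (?\<psi> x * \<psi> x)" for i x
    proof -
      have "cmod (u x * (of_real (W i x) * t i x)) \<le> cmod (u x) * (q x * (2 * cmod (?\<psi> x)))"
        unfolding norm_mult using Wa[of i x] t(3)[of i x] q0[of x] by (intro mult_left_mono mult_mono) auto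
      also have "\<dots> = 2 * (cmod (?\<psi> x) * (q x * cmod (u x)))" by (simp only: mult_ac)
      also have "q x * cmod (u x) = cmod (\<psi> x)" using q0[of x] by (simp add: \<psi>_def norm_mult)
      finally show ?thesis unfolding norm_mult .
    qed
    show "(\<lambda>i. u x * (of_real (W i x) * t i x)) \<longlonglongrightarrow> ?\<psi> x * \<psi> x" for x
    proof -
      have "(\<lambda>i. u x * (of_real (W i x) * t i x)) \<longlonglongrightarrow> u x * (of_real (q x) * ?\<psi> x)"
        by (intro tendsto_intros W(4) t(4))
      then show ?thesis by (simp add: \<psi>_def mult_ac)
    qed
  qed measurable
  then have l1: "(\<lambda>i. cmod (\<integral>x. u x * (of_real (W i x) * t i x) \<partial>lborel)) \<longlonglongrightarrow> cmod (\<integral>x. ?\<psi> x * \<psi> x \<partial>lborel)"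
    by (rule tendsto_norm)
  have l2: "(\<lambda>i. K * (norm2 a * norm2 (t i))) \<longlonglongrightarrow> K * (norm2 a * norm2 \<psi>)"
    using t(5) unfolding norm2_cnj by (intro tendsto_intros)
  have "cmod (\<integral>x. ?\<psi> x * \<psi> x \<partial>lborel) \<le> K * (norm2 a * norm2 \<psi>)"
    using key[OF t(1,2)] by (intro LIMSEQ_le[OF l1 l2]) auto
  then have *: "(norm2 \<psi>)\<^sup>2 \<le> K * (norm2 a * norm2 \<psi>)" unfolding integral_cnj_self norm_of_real by simp
  \<comment> \<open>Positivity of \<open>K\<close> is deduced here, because the norm of
    \<open>a\<close> is about to be replaced by the larger norm of \<psi>.\<close>
  have "K > 0"
  proof (rule ccontr)
    assume "\<not> K > 0"
    then have "K * (norm2 a * norm2 \<psi>) \<le> 0" by (intro mult_nonpos_nonneg) auto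
    with * pos show False by linarith
  qed
  then have "K * (norm2 a * norm2 \<psi>) \<le> K * (norm2 \<psi> * norm2 \<psi>)"
    using na by (intro mult_left_mono mult_right_mono) auto
  with * have "1 * (norm2 \<psi>)\<^sup>2 \<le> K * (norm2 \<psi>)\<^sup>2" by (simp add: power2_eq_square)
  then show ?thesis using pos by (rule mult_right_le_imp_le)
qed

section \<open>Exponents and conclusion\<close>

text \<open>Bookkeeping by logarithms: with p = \<gamma> - 1/2 and q = (d - 1)/2, the total power of
  x = |k| is (p + q - r)/r = -1/r.\<close>

lemma scaling_exponents:
  fixes x \<delta> X p q r :: real
  assumes "x > 0" "\<delta> > 0" "X > 0" "r > 0" and pq: "p + q = r - 1"
  shows "1 / x * ((\<delta> / x) powr (- (p / r)) * (x powr q * X) powr (1 / r)) = (\<delta> powr (- p) / x * X) powr (1 / r)"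
proof -
  have "ln (1 / x * ((\<delta> / x) powr (- (p / r)) * (x powr q * X) powr (1 / r)))
      = - ln x + (- (p / r) * (ln \<delta> - ln x) + 1 / r * (q * ln x + ln X))"
    using assms by (simp add: ln_mult ln_div ln_powr)
  also have "\<dots> = 1 / r * (- p * ln \<delta> + (p + q - r) * ln x + ln X)"
    using assms(4) by (simp add: field_simps)
  also have "\<dots> = ln ((\<delta> powr (- p) / x * X) powr (1 / r))"
    using assms by (simp add: ln_mult ln_div ln_powr)
  finally show ?thesis using assms by (subst (asm) ln_inj_iff) auto
qed

text \<open>Interpolation with the exponents adapted to \<gamma>. The constant depends on \<gamma>
  and d only, since k, V and the simple functions enter through the explicit factors.\<close>

lemma resolvent_bound:
  fixes \<gamma> :: real
  assumes \<gamma>: "\<gamma> \<ge> 1 / 2"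
  defines "r \<equiv> \<gamma> + real CARD('n::finite) / 2"
  obtains C where "C > 0" and "\<And>(V :: real^'n \<Rightarrow> complex) k X. Re k > 0 \<Longrightarrow> delta (- k\<^sup>2) > 0 \<Longrightarrow> X > 0 \<Longrightarrow> Lp r V \<Longrightarrow>
    (\<integral>x. cmod (V x) powr r \<partial>lborel) \<le> X \<Longrightarrow> resolvent_bounded V k (C * (delta (- k\<^sup>2) powr (1 / 2 - \<gamma>) / cmod k * X) powr (1 / r))"
proof -
  define d where "d = real CARD('n)"
  have d: "d \<ge> 1" unfolding d_def using zero_less_card_finite[where 'a='n] by linarith
  have rd: "r = \<gamma> + d / 2" by (simp add: r_def d_def)
  have r: "r \<ge> 1" using \<gamma> d by (simp add: rd)
  define p where "p = \<gamma> - 1 / 2"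
  \<comment> \<open>Forced by s (1 - 1/r) = p/r, which is equivalent to the condition \<zeta>(1/r) =
    1. The case r = 1 occurs only for d = 1 and \<gamma> = 1/2, where p = 0 and s = 0 works.\<close>
  define s where "s = (if r = 1 then 0 else p / (r - 1))"
  have s: "0 \<le> s" "s \<le> 1" using r \<gamma> d by (auto simp: s_def p_def rd divide_le_eq)
  have sp: "s * (1 - 1 / r) = p / r"
  proof (cases "r = 1")
    case True
    then show ?thesis using \<gamma> d by (simp add: p_def rd)
  next
    case False
    then have "1 - 1 / r = (r - 1) / r" "r - 1 \<noteq> 0" using r by (auto simp: diff_divide_distrib)
    then show ?thesis using False by (simp add: s_def)
  qed
  have s1: "s * (1 - 1 / r) + (d + 1) / (2 * r) = 1"
  proof -
    have "p / r + (d + 1) / (2 * r) = (p + (d + 1) / 2) / r" by (simp add: add_divide_distrib)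
    also have "p + (d + 1) / 2 = r" by (simp add: p_def rd field_simps)
    finally show ?thesis unfolding sp using r by simp
  qed
  define C where "C = Gamma (1 + s) * exp ((pi * (d + 1) / 2)\<^sup>2 / 4) + (20 + 4 * (d + 1))\<^sup>2 * exp 2"
  have C: "C > 0"
  proof -
    have "Gamma (1 + s) > 0" by (rule Gamma_real_pos) (use s in linarith)
    then show ?thesis unfolding C_def by (intro add_pos_nonneg mult_pos_pos) auto
  qed
  show thesis
  proof (rule that[OF C])
    fix V :: "real^'n \<Rightarrow> complex" and k :: complex and X :: real
    assume k: "Re k > 0" and \<delta>: "delta (- k\<^sup>2) > 0" and X: "X > 0" and V: "Lp r V" "(\<integral>x. cmod (V x) powr r \<partial>lborel) \<le> X"
    let ?\<delta> = "delta (- k\<^sup>2)"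
    have k0: "cmod k > 0" using k by auto
    have [measurable]: "V \<in> borel_measurable borel" using V(1) by (simp add: Lp_def)
    have iV: "integrable lborel (\<lambda>x. cmod (V x) powr r)" using V(1) by (simp add: Lp_def)
    \<comment> \<open>The modulus of k times the symbol is | |\<xi>|^2 - E |, which is at least
      \<open>delta E\<close>; division by |k| gives the lower bound on the left edge.\<close>
    define m where "m = ?\<delta> / cmod k"
    have m0: "m > 0" using \<delta> k0 by (simp add: m_def)
    have m: "m \<le> cmod (bsym k \<xi>)" for \<xi> :: "real^'n"
    proof -
      have "?\<delta> \<le> dist (- k\<^sup>2) (complex_of_real ((norm \<xi>)\<^sup>2))"
        unfolding delta_def by (intro infdist_le imageI) simp
      also have "\<dots> = cmod (k\<^sup>2 + of_real ((norm \<xi>)\<^sup>2))"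
        unfolding dist_norm by (subst norm_minus_cancel[symmetric]) simp
      also have "k\<^sup>2 + of_real ((norm \<xi>)\<^sup>2) = k * bsym k \<xi>"
        using k0 by (simp add: bsym_def distrib_left power2_eq_square)
      finally show ?thesis using k0 by (simp add: m_def norm_mult pos_divide_le_eq mult.commute)
    qed
    have wt: "integrable lborel (\<lambda>x. W x powr (2 * r)) \<and> (\<integral>x. W x powr (2 * r) \<partial>lborel) \<le> X"
      if W: "simple_function lborel W" "\<forall>x. 0 \<le> W x \<and> W x \<le> sqrt (cmod (V x))" for W
    proof -
      have [measurable]: "W \<in> borel_measurable borel" using borel_measurable_simple_function[OF W(1)] by simp
      have le: "W x powr (2 * r) \<le> cmod (V x) powr r" for x
      proof -
        have "W x powr (2 * r) \<le> sqrt (cmod (V x)) powr (2 * r)" using W(2) r by (intro powr_mono2) auto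
        also have "\<dots> = cmod (V x) powr r" by (simp add: powr_half_sqrt[symmetric] powr_powr)
        finally show ?thesis .
      qed
      have i: "integrable lborel (\<lambda>x. W x powr (2 * r))"
        by (rule Bochner_Integration.integrable_bound[OF iV]) (use le in auto)
      moreover have "(\<integral>x. W x powr (2 * r) \<partial>lborel) \<le> (\<integral>x. cmod (V x) powr r \<partial>lborel)"
        by (rule integral_mono[OF i iV le])
      ultimately show ?thesis using V(2) by simp
    qed
    define Q where "Q = C * (?\<delta> powr (1 / 2 - \<gamma>) / cmod k * X) powr (1 / r)"
    have Q: "Q > 0" using C \<delta> k0 X by (simp add: Q_def)
    show "resolvent_bounded V k (C * (?\<delta> powr (1 / 2 - \<gamma>) / cmod k * X) powr (1 / r))"
      unfolding resolvent_bounded_def Q_def[symmetric]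
    proof (intro allI impI)
      fix W W' :: "real^'n \<Rightarrow> real" and a b :: "real^'n \<Rightarrow> complex"
      assume W: "simple_function lborel W" "\<forall>x. 0 \<le> W x \<and> W x \<le> sqrt (cmod (V x))"
        and W': "simple_function lborel W'" "\<forall>x. 0 \<le> W' x \<and> W' x \<le> sqrt (cmod (V x))"
        and a: "simple_function lborel a" "integrable lborel a" and b: "simple_function lborel b" "integrable lborel b"
      let ?f = "\<lambda>x. of_real (W x) * a x" and ?g = "\<lambda>x. of_real (W' x) * b x"
      let ?I = "\<integral>x. ?f x * conv (rk k) ?g x \<partial>lborel"
      have A: "weighted r W a" and B: "weighted r W' b" using r W W' a b by (auto simp: weighted_def)
      have Lh: "L2 h" if "simple_function lborel h" "integrable lborel h" for h :: "real^'n \<Rightarrow> complex"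
        using simple_function_lborel_bounded[OF that(1)] L2_of_bounded_integrable[OF that(2)] by blast
      note f = weighted_simple(2)[OF W(1) a] Lh[OF weighted_simple[OF W(1) a]]
      note g = weighted_simple(2)[OF W'(1) b] Lh[OF weighted_simple[OF W'(1) b]]
      \<comment> \<open>Interpolation takes logarithms of the edge bounds and needs N > 0. The bound
        with norm2 a times norm2 b follows by letting \<epsilon> tend to 0, also when a norm
        vanishes.\<close>
      have claim: "cmod ?I \<le> Q * N" if N: "norm2 a * norm2 b \<le> N" "N > 0" for N
      proof -
        have "(2 * pi) ^ CARD('n) * cmod ?I = cmod ((2 * of_real pi) ^ CARD('n) * ?I)"
          by (simp add: norm_mult norm_power)
        also have "\<dots> = 1 / cmod k * cmod (bint k (pairing ?f ?g) 1)"
          unfolding integral_mult_resolvent[OF k f g] by (simp add: norm_mult norm_divide)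
        also have "\<dots> \<le> 1 / cmod k * (C * ((2 * pi) ^ CARD('n) * N * m powr (- s * (1 - 1 / r)) * (cmod k powr ((d - 1) / 2) * X) powr (1 / r)))"
        proof (rule mult_left_mono)
          note * = stein_interpolation_bound[where 'a="real^'n", unfolded DIM_cart DIM_real mult_1_right, folded d_def]
          show "cmod (bint k (pairing ?f ?g) 1) \<le> C * ((2 * pi) ^ CARD('n) * N * m powr (- s * (1 - 1 / r)) * (cmod k powr ((d - 1) / 2) * X) powr (1 / r))"
            unfolding C_def by (rule *[OF r s s1 k m0 m A B X _ _ _ _ N]) (use wt[OF W] wt[OF W'] in blast)+
        qed simp
        also have "\<dots> = (2 * pi) ^ CARD('n) * (C * N * (1 / cmod k * (m powr (- (p / r)) * (cmod k powr ((d - 1) / 2) * X) powr (1 / r))))"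
          using sp by (simp only: mult_minus_left mult_ac)
        also have "1 / cmod k * (m powr (- (p / r)) * (cmod k powr ((d - 1) / 2) * X) powr (1 / r)) = (?\<delta> powr (- p) / cmod k * X) powr (1 / r)"
          unfolding m_def by (rule scaling_exponents) (use k0 \<delta> X r in \<open>auto simp: p_def rd field_simps\<close>)
        finally have "cmod ?I \<le> C * N * (?\<delta> powr (- p) / cmod k * X) powr (1 / r)"
          by (simp only: mult_le_cancel_left_pos zero_less_power mult_pos_pos pi_gt_zero zero_less_numeral)
        then show ?thesis by (simp add: Q_def p_def mult_ac)
      qed
      have "cmod ?I / Q \<le> norm2 a * norm2 b + \<epsilon>" if "\<epsilon> > 0" for \<epsilon>
      proof -
        have "cmod ?I \<le> Q * (norm2 a * norm2 b + \<epsilon>)"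
          by (rule claim) (use that in \<open>auto intro: add_nonneg_pos\<close>)
        then show ?thesis using Q by (simp only: pos_divide_le_eq mult.commute)
      qed
      then have "cmod ?I / Q \<le> norm2 a * norm2 b" by (rule field_le_epsilon)
      then show "cmod ?I \<le> Q * (norm2 a * norm2 b)" using Q by (simp only: pos_divide_le_eq mult.commute)
    qed
  qed
qed

lemma delta_pos:
  assumes "E \<notin> complex_of_real ` {0..}"
  shows "delta E > 0"
proof -
  have "complex_of_real ` {0..} = {z. 0 \<le> Re z} \<inter> {z. Im z = 0}" by (auto simp: complex_eq_iff image_iff)
  then have "closed (complex_of_real ` {0..})"
    by (simp add: closed_Int closed_halfspace_Re_ge closed_Collect_eq continuous_on_Im)
  then show ?thesis unfolding delta_def using assms by (intro infdist_pos_not_in_closed) auto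
qed

text \<open>The principal root has nonnegative real part; a purely imaginary root of -E would make E
  a nonnegative real.\<close>

lemma Re_csqrt_uminus_pos:
  assumes "E \<notin> complex_of_real ` {0..}"
  shows "Re (csqrt (- E)) > 0"
proof (rule ccontr)
  assume "\<not> Re (csqrt (- E)) > 0"
  then have "Re (csqrt (- E)) = 0" using Re_csqrt[of "- E"] by linarith
  then have "csqrt (- E) = \<i> * of_real (Im (csqrt (- E)))" by (simp add: complex_eq_iff)
  then have "- E = (\<i> * of_real (Im (csqrt (- E))))\<^sup>2" by (metis power2_csqrt)
  then have "E = of_real ((Im (csqrt (- E)))\<^sup>2)" by (simp add: power_mult_distrib minus_equation_iff)
  then show False using assms by (metis atLeast_iff imageI zero_le_power2)
qed

text \<open>With k the principal root of -E, the Birman-Schwinger principle turns the resolvent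
  bound into 1 \<le> C Y^(1/r). The r-th power of this inequality is the claim with the constant
  C^r.\<close>

theorem theorem1p1:
  fixes \<gamma> :: real
  assumes "\<gamma> \<ge> 1/2"
  shows "\<exists>D>0. \<forall>(V :: real^'n::finite \<Rightarrow> complex) E.
           Lp (\<gamma> + real CARD('n) / 2) V \<longrightarrow>
           E \<notin> complex_of_real ` {0..} \<longrightarrow>
           is_eigenvalue V E \<longrightarrow>
           delta E powr (\<gamma> - 1/2) * sqrt (cmod E)
             \<le> D * (\<integral>x. cmod (V x) powr (\<gamma> + real CARD('n) / 2) \<partial>lborel)"
proof -
  define r where "r = \<gamma> + real CARD('n) / 2"
  have r: "r > 0" using assms by (simp add: r_def add_pos_nonneg)
  obtain C where C: "C > 0" and RB: "\<And>(V :: real^'n \<Rightarrow> complex) k X. Re k > 0 \<Longrightarrow> delta (- k\<^sup>2) > 0 \<Longrightarrow> X > 0 \<Longrightarrow> Lp r V \<Longrightarrow>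
      (\<integral>x. cmod (V x) powr r \<partial>lborel) \<le> X \<Longrightarrow> resolvent_bounded V k (C * (delta (- k\<^sup>2) powr (1 / 2 - \<gamma>) / cmod k * X) powr (1 / r))"
    using resolvent_bound[OF assms, where 'n='n] unfolding r_def by blast
  have "delta E powr (\<gamma> - 1/2) * sqrt (cmod E) \<le> C powr r * (\<integral>x. cmod (V x) powr r \<partial>lborel)"
    if V: "Lp r V" and E: "E \<notin> complex_of_real ` {0..}" and ev: "is_eigenvalue V E" for V :: "real^'n \<Rightarrow> complex" and E
  proof -
    define k where "k = csqrt (- E)"
    have k: "Re k > 0" "E = - k\<^sup>2" using Re_csqrt_uminus_pos[OF E] by (auto simp: k_def)
    have k0: "cmod k > 0" using k by auto
    have \<delta>: "delta E > 0" by (rule delta_pos[OF E])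
    have "sqrt (cmod E) = cmod k" unfolding k(2) by (simp add: norm_power)
    define I where "I = (\<integral>x. cmod (V x) powr r \<partial>lborel)"
    have I: "I \<ge> 0" by (simp add: I_def)
    have mV: "V \<in> borel_measurable lborel" using V by (simp add: Lp_def)
    \<comment> \<open>The energy -1, that is k = 1, supplies the auxiliary bound that makes the
      potential energy finite.\<close>
    have d1: "delta (- 1\<^sup>2) > 0" by (rule delta_pos) (auto simp: complex_eq_iff)
    \<comment> \<open>The resolvent bound asks for a positive upper bound X of the integral. Using I
      + \<epsilon> covers I = 0 as well.\<close>
    have "delta E powr (\<gamma> - 1/2) * cmod k / C powr r \<le> I + \<epsilon>" if \<epsilon>: "\<epsilon> > 0" for \<epsilon>
    proof -
      define X where "X = I + \<epsilon>"
      have X: "X > 0" "(\<integral>x. cmod (V x) powr r \<partial>lborel) \<le> X"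
        using I \<epsilon> unfolding X_def I_def[symmetric] by auto
      define Y where "Y = delta E powr (1 / 2 - \<gamma>) / cmod k * X"
      have Y: "Y > 0" using \<delta> k0 X by (simp add: Y_def)
      have "resolvent_bounded V k (C * Y powr (1 / r))"
        using RB[OF k(1) _ X(1) V X(2)] \<delta> unfolding k(2)[symmetric] Y_def by blast
      then have "1 \<le> C * Y powr (1 / r)"
        by (rule birman_schwinger[OF ev k mV RB[OF _ d1 X(1) V X(2)], rotated 2]) (use C in auto)
      then have "1 powr r \<le> (C * Y powr (1 / r)) powr r" using r by (intro powr_mono2) auto
      also have "\<dots> = C powr r * Y" using C Y r by (simp add: powr_mult powr_powr)
      finally have "1 \<le> C powr r * (1 / (delta E powr (\<gamma> - 1 / 2)) / cmod k * X)"
        using powr_minus_divide[of "delta E" "\<gamma> - 1 / 2"] by (simp add: Y_def)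
      then show ?thesis using \<delta> k0 C unfolding X_def[symmetric] by (simp add: field_simps)
    qed
    then have "delta E powr (\<gamma> - 1/2) * cmod k / C powr r \<le> I" by (rule field_le_epsilon)
    then show ?thesis using C unfolding \<open>sqrt (cmod E) = cmod k\<close> I_def[symmetric] by (simp add: pos_divide_le_eq mult.commute)
  qed
  then show ?thesis using C unfolding r_def by (intro exI[of _ "C powr (\<gamma> + real CARD('n) / 2)"]) auto
qed

end
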